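(* Let $u$ be the mild solution of the stochastic heat equation with piecewise constant coefficients described in the context, with $\sigma:\mathbb{R}\to\mathbb{R}$ globally Lipschitz (and known). Fix $0<T_1<T_2$ and $x\in\mathbb R\setminus\{0\}$, and suppose that $$\mathbb P\left(\int_{T_1}^{T_2}\sigma^4(u(r,x))\,dr>0\right)=1.$$ For $n\ge1$ put $t_i=T_1+i\frac{T_2-T_1}{n}$, $i=0,\dots,n$, $V_{n,x}(u)=\sum_{i=1}^n\bigl(u(t_i,x)-u(t_{i-1},x)\bigr)^4$, and define $$\widehat A_n(x)=\begin{cases}\dfrac{6(T_2-T_1)\sum_{i=1}^n\sigma^4(u(t_i,x))}{n\pi\sum_{i=1}^n\bigl(u(t_i,x)-u(t_{i-1},x)\bigr)^4},& V_{n,x}(u)>0,\\[3mm] 0,& V_{n,x}(u)=0.\end{cases}$$ Then $\widehat A_n(x)\to A(x)$ in probability as $n\to\infty$. In particular, $\widehat A_n(x)$ is a consistent estimator of $a_1$ when $x<0$ and of $a_2$ when $x>0$.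
   Context: Fix positive constants $a_1,a_2,\rho_1,\rho_2$ and set $A(x)=a_1\mathbf 1_{\{x\le 0\}}+a_2\mathbf 1_{\{x>0\}}$, $\rho(x)=\rho_1\mathbf 1_{\{x\le 0\}}+\rho_2\mathbf 1_{\{x>0\}}$, $\mathcal L=\frac{1}{2\rho(x)}\frac{d}{dx}\bigl(\rho(x)A(x)\frac{d}{dx}\bigr)$. Set $f(y)=\frac{y}{\sqrt{a_1}}\mathbf 1_{\{y\le0\}}+\frac{y}{\sqrt{a_2}}\mathbf 1_{\{y>0\}}$, $\alpha=1-\frac{\rho_1a_1}{\rho_2a_2}$, $\beta=\frac{\sqrt{a_1}+\sqrt{a_2}(\alpha-1)}{\sqrt{a_1}-\sqrt{a_2}(\alpha-1)}$. The fundamental solution of $\partial_t u=\mathcal L u$ is, for $t>0$ and $x,y\in\mathbb R$, $$G(t,x,y)=\frac{1}{\sqrt{2\pi t}}\left(\frac{\mathbf 1_{\{y\le0\}}}{\sqrt{a_1}}+\frac{\mathbf 1_{\{y>0\}}}{\sqrt{a_2}}\right)\left\{\exp\left(-\frac{(f(x)-f(y))^2}{2t}\right)+\beta\,\mathrm{sign}(y)\exp\left(-\frac{(|f(x)|+|f(y)|)^2}{2t}\right)\right\},$$ and $G(t,x,y)=0$ for $t\le0$. On a probability space $(\Omega,\mathcal F,\mathbb P)$, $W$ is a space-time white noise: a centered Gaussian family $\{W(t,B)\}$, indexed by $t\ge0$ and Borel sets $B\subset\mathbb R$ of finite Lebesgue measure, with $\mathbb E[W(t,B)W(s,C)]=(t\wedge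 s)\lambda(B\cap C)$, $\lambda$ being Lebesgue measure. $\mathcal F_t$ is the sigma-algebra generated by $\{W(s,B):0\le s\le t\}$ (augmented in the usual way). Integrals $\int\int X(s,y)\,W(ds,dy)$ are Walsh stochastic integrals of predictable, square-integrable random fields $X$; all random fields are jointly measurable and adapted. $\sigma:\mathbb R\to\mathbb R$ satisfies $|\sigma(x)-\sigma(y)|\le M|x-y|$ for all $x,y$ and some $M>0$. The mild solution $u$ of $\partial_t u=\mathcal L u+\sigma(u)\dot W$, $u(0,x)=0$, is the random field (unique up to modification) satisfying $\sup_{(t,x)\in[0,T]\times\mathbb R}\mathbb E|u(t,x)|^p<\infty$ for all $T>0$, $p\ge2$, and, for all $t\ge 0$, $x\in\mathbb R$, almost surely $$u(t,x)=\int_0^t\int_{\mathbb R}\sigma(u(s,y))G(t-s,x,y)\,W(ds,dy).$$ *)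

theory Defs
  imports "HOL-Probability.Probability"
begin

text \<open>Centered Gaussian variables may be degenerate, i.e. almost surely zero.\<close>

definition centered_gaussian :: "'a measure \<Rightarrow> ('a \<Rightarrow> real) \<Rightarrow> bool" where
  "centered_gaussian M X \<longleftrightarrow> X \<in> borel_measurable M \<and>
     ((AE \<omega> in M. X \<omega> = 0) \<or> (\<exists>s>0. distributed M lborel X (normal_density 0 s)))"

definition centered_gaussian_family ::
  "'a measure \<Rightarrow> 'i set \<Rightarrow> ('i \<Rightarrow> 'a \<Rightarrow> real) \<Rightarrow> bool" where
  "centered_gaussian_family M I Z \<longleftrightarrow>
     (\<forall>J c. finite J \<and> J \<subseteq> I \<longrightarrow> centered_gaussian M (\<lambda>\<omega>. \<Sum>j\<in>J. c j * Z j \<omega>))"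

definition finite_borel :: "real set set" where
  "finite_borel = {B \<in> sets borel. emeasure lborel B < \<infinity>}"

definition space_time_white_noise ::
  "'a measure \<Rightarrow> (real \<Rightarrow> real set \<Rightarrow> 'a \<Rightarrow> real) \<Rightarrow> bool" where
  "space_time_white_noise M W \<longleftrightarrow>
     centered_gaussian_family M ({0..} \<times> finite_borel) (\<lambda>(t, B). W t B) \<and>
     (\<forall>t\<ge>0. \<forall>s\<ge>0. \<forall>B\<in>finite_borel. \<forall>C\<in>finite_borel.
        integral\<^sup>L M (\<lambda>\<omega>. W t B \<omega> * W s C \<omega>) = min t s * measure lborel (B \<inter> C))"

definition noise_events ::
  "'a measure \<Rightarrow> (real \<Rightarrow> real set \<Rightarrow> 'a \<Rightarrow> real) \<Rightarrow> real \<Rightarrow> 'a set set" where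
  "noise_events M W t =
     {W s B -` C \<inter> space M | s B C. 0 \<le> s \<and> s \<le> t \<and> B \<in> finite_borel \<and> C \<in> sets borel}"

text \<open>The usual augmentation: the null events of \<open>M\<close> are added and the filtration is made
  right-continuous. \<open>M\<close> itself need not be complete.\<close>

definition noise_filtration ::
  "'a measure \<Rightarrow> (real \<Rightarrow> real set \<Rightarrow> 'a \<Rightarrow> real) \<Rightarrow> real \<Rightarrow> 'a measure" where
  "noise_filtration M W t =
     sigma (space M) (\<Inter>s\<in>{t<..}. sigma_sets (space M) (noise_events M W s \<union> null_sets M))"

text \<open>Random fields are curried functions of time, space and chance; only times \<open>s \<ge> 0\<close> matter.\<close>

definition field_measure :: "'a measure \<Rightarrow> (real \<times> real \<times> 'a) measure" where
  "field_measure M = restrict_space lborel {0..} \<Otimes>\<^sub>M (lborel \<Otimes>\<^sub>M M)"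

text \<open>The events at time zero belong to the predictable sigma-algebra as well; they do not
  affect the integral.\<close>

definition predictable_algebra ::
  "'a measure \<Rightarrow> (real \<Rightarrow> real set \<Rightarrow> 'a \<Rightarrow> real) \<Rightarrow> (real \<times> real \<times> 'a) measure" where
  "predictable_algebra M W = sigma (space (field_measure M))
     ({{a<..b} \<times> B \<times> A | a b B A.
         0 \<le> a \<and> a \<le> b \<and> B \<in> sets borel \<and> A \<in> sets (noise_filtration M W a)} \<union>
      {{0} \<times> B \<times> A | B A. B \<in> sets borel \<and> A \<in> sets (noise_filtration M W 0)})"

definition predictable ::
  "'a measure \<Rightarrow> (real \<Rightarrow> real set \<Rightarrow> 'a \<Rightarrow> real) \<Rightarrow> (real \<Rightarrow> real \<Rightarrow> 'a \<Rightarrow> real) \<Rightarrow> bool" where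
  "predictable M W X \<longleftrightarrow>
     (\<lambda>(s, y, \<omega>). X s y \<omega>) \<in> borel_measurable (predictable_algebra M W)"

definition field_sq_norm :: "'a measure \<Rightarrow> (real \<Rightarrow> real \<Rightarrow> 'a \<Rightarrow> real) \<Rightarrow> ennreal" where
  "field_sq_norm M X = (\<integral>\<^sup>+ (s, y, \<omega>). ennreal ((X s y \<omega>)\<^sup>2) \<partial>field_measure M)"

text \<open>A list of tuples \<open>(\<xi>, a, b, B)\<close> stands for the simple field
  \<open>\<Sum> \<xi>(\<omega>) 1\<^bsub>(a,b]\<^esub>(s) 1\<^bsub>B\<^esub>(y)\<close>.\<close>

type_synonym 'a simple_field = "(('a \<Rightarrow> real) \<times> real \<times> real \<times> real set) list"

definition is_simple_field ::
  "'a measure \<Rightarrow> (real \<Rightarrow> real set \<Rightarrow> 'a \<Rightarrow> real) \<Rightarrow> 'a simple_field \<Rightarrow> bool" where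
  "is_simple_field M W S \<longleftrightarrow>
     (\<forall>(\<xi>, a, b, B) \<in> set S. 0 \<le> a \<and> a \<le> b \<and> B \<in> finite_borel \<and>
        \<xi> \<in> borel_measurable (noise_filtration M W a) \<and>
        (\<exists>K. \<forall>\<omega>\<in>space M. \<bar>\<xi> \<omega>\<bar> \<le> K))"

definition simple_field_value :: "'a simple_field \<Rightarrow> real \<Rightarrow> real \<Rightarrow> 'a \<Rightarrow> real" where
  "simple_field_value S s y \<omega> =
     (\<Sum>(\<xi>, a, b, B)\<leftarrow>S. \<xi> \<omega> * indicator {a<..b} s * indicator B y)"

definition simple_field_integral ::
  "(real \<Rightarrow> real set \<Rightarrow> 'a \<Rightarrow> real) \<Rightarrow> 'a simple_field \<Rightarrow> 'a \<Rightarrow> real" where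
  "simple_field_integral W S \<omega> = (\<Sum>(\<xi>, a, b, B)\<leftarrow>S. \<xi> \<omega> * (W b B \<omega> - W a B \<omega>))"

text \<open>\<open>I\<close> is a version of the Walsh integral of \<open>X\<close> over \<open>[0,\<infinity>) \<times> \<real>\<close>; it is determined up to
  almost sure equality.\<close>

definition has_walsh_integral ::
  "'a measure \<Rightarrow> (real \<Rightarrow> real set \<Rightarrow> 'a \<Rightarrow> real) \<Rightarrow> (real \<Rightarrow> real \<Rightarrow> 'a \<Rightarrow> real) \<Rightarrow>
   ('a \<Rightarrow> real) \<Rightarrow> bool" where
  "has_walsh_integral M W X I \<longleftrightarrow>
     predictable M W X \<and> field_sq_norm M X < \<infinity> \<and> I \<in> borel_measurable M \<and>
     (\<exists>S. (\<forall>n. is_simple_field M W (S n)) \<and>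
        (\<lambda>n. field_sq_norm M (\<lambda>s y \<omega>. simple_field_value (S n) s y \<omega> - X s y \<omega>))
          \<longlonglongrightarrow> 0 \<and>
        (\<lambda>n. \<integral>\<^sup>+ \<omega>. ennreal ((simple_field_integral W (S n) \<omega> - I \<omega>)\<^sup>2) \<partial>M)
          \<longlonglongrightarrow> 0)"

definition coeff_A :: "real \<Rightarrow> real \<Rightarrow> real \<Rightarrow> real" where
  "coeff_A a1 a2 x = (if x \<le> 0 then a1 else a2)"

definition scale_f :: "real \<Rightarrow> real \<Rightarrow> real \<Rightarrow> real" where
  "scale_f a1 a2 y = (if y \<le> 0 then y / sqrt a1 else y / sqrt a2)"

definition coeff_alpha :: "real \<Rightarrow> real \<Rightarrow> real \<Rightarrow> real \<Rightarrow> real" where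
  "coeff_alpha a1 a2 \<rho>1 \<rho>2 = 1 - (\<rho>1 * a1) / (\<rho>2 * a2)"

definition coeff_beta :: "real \<Rightarrow> real \<Rightarrow> real \<Rightarrow> real \<Rightarrow> real" where
  "coeff_beta a1 a2 \<rho>1 \<rho>2 =
     (sqrt a1 + sqrt a2 * (coeff_alpha a1 a2 \<rho>1 \<rho>2 - 1)) /
     (sqrt a1 - sqrt a2 * (coeff_alpha a1 a2 \<rho>1 \<rho>2 - 1))"

definition heat_kernel ::
  "real \<Rightarrow> real \<Rightarrow> real \<Rightarrow> real \<Rightarrow> real \<Rightarrow> real \<Rightarrow> real \<Rightarrow> real" where
  "heat_kernel a1 a2 \<rho>1 \<rho>2 t x y =
     (if t \<le> 0 then 0 else
       1 / sqrt (2 * pi * t) *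
       (indicator {..0} y / sqrt a1 + indicator {0<..} y / sqrt a2) *
       (exp (- ((scale_f a1 a2 x - scale_f a1 a2 y)\<^sup>2 / (2 * t))) +
        coeff_beta a1 a2 \<rho>1 \<rho>2 * sgn y *
        exp (- ((\<bar>scale_f a1 a2 x\<bar> + \<bar>scale_f a1 a2 y\<bar>)\<^sup>2 / (2 * t)))))"

definition mild_solution ::
  "'a measure \<Rightarrow> (real \<Rightarrow> real set \<Rightarrow> 'a \<Rightarrow> real) \<Rightarrow> real \<Rightarrow> real \<Rightarrow> real \<Rightarrow> real \<Rightarrow>
   (real \<Rightarrow> real) \<Rightarrow> (real \<Rightarrow> real \<Rightarrow> 'a \<Rightarrow> real) \<Rightarrow> bool" where
  "mild_solution M W a1 a2 \<rho>1 \<rho>2 \<sigma> u \<longleftrightarrow>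
     (\<lambda>(t, x, \<omega>). u t x \<omega>) \<in> borel_measurable (field_measure M) \<and>
     (\<forall>t\<ge>0. \<forall>x. u t x \<in> borel_measurable (noise_filtration M W t)) \<and>
     (\<forall>T>0. \<forall>p\<ge>2. (SUP (t, x)\<in>{0..T} \<times> UNIV.
        \<integral>\<^sup>+ \<omega>. ennreal (\<bar>u t x \<omega>\<bar> powr p) \<partial>M) < \<infinity>) \<and>
     (\<forall>t\<ge>0. \<forall>x. \<exists>I.
        has_walsh_integral M W
          (\<lambda>s y \<omega>. indicator {0..t} s * (\<sigma> (u s y \<omega>) * heat_kernel a1 a2 \<rho>1 \<rho>2 (t - s) x y)) I \<and>
        (AE \<omega> in M. u t x \<omega> = I \<omega>))"

definition grid_point :: "real \<Rightarrow> real \<Rightarrow> nat \<Rightarrow> nat \<Rightarrow> real" where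
  "grid_point T1 T2 n i = T1 + real i * ((T2 - T1) / real n)"

definition quartic_variation ::
  "real \<Rightarrow> real \<Rightarrow> (real \<Rightarrow> real \<Rightarrow> 'a \<Rightarrow> real) \<Rightarrow> nat \<Rightarrow> real \<Rightarrow> 'a \<Rightarrow> real" where
  "quartic_variation T1 T2 u n x \<omega> =
     (\<Sum>i=1..n. (u (grid_point T1 T2 n i) x \<omega> - u (grid_point T1 T2 n (i - 1)) x \<omega>) ^ 4)"

definition A_estimator ::
  "(real \<Rightarrow> real) \<Rightarrow> real \<Rightarrow> real \<Rightarrow> (real \<Rightarrow> real \<Rightarrow> 'a \<Rightarrow> real) \<Rightarrow> nat \<Rightarrow> real \<Rightarrow> 'a \<Rightarrow> real" where
  "A_estimator \<sigma> T1 T2 u n x \<omega> =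
     (if quartic_variation T1 T2 u n x \<omega> > 0
      then (6 * (T2 - T1) * (\<Sum>i=1..n. \<sigma> (u (grid_point T1 T2 n i) x \<omega>) ^ 4)) /
           (real n * pi * quartic_variation T1 T2 u n x \<omega>)
      else 0)"

definition converges_in_probability ::
  "'a measure \<Rightarrow> (nat \<Rightarrow> 'a \<Rightarrow> real) \<Rightarrow> real \<Rightarrow> bool" where
  "converges_in_probability M X c \<longleftrightarrow>
     (\<forall>\<epsilon>>0. (\<lambda>n. measure M {\<omega> \<in> space M. \<bar>X n \<omega> - c\<bar> > \<epsilon>}) \<longlonglongrightarrow> 0)"

end

theory Submission
  imports Defs
begin

text \<open>Over a short time step, the increment of \<open>u\<close> at \<open>x \<noteq> 0\<close> is in \<open>L\<^sup>4\<close> close to the coefficient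
  \<open>\<sigma>(u(t - L eps, x))\<close> times a Gaussian variable \<open>Z\<close>: a Wiener integral, over the time window
  \<open>(t - L eps, t]\<close>, of a step function near the time increment of the kernel of the homogeneous medium with
  coefficient \<open>A(x)\<close>. The interface contributes little near \<open>x\<close>, noise older than \<open>L eps\<close> contributes
  little for large \<open>L\<close>, and \<open>\<sigma>(u)\<close> is \<open>L\<^sup>4\<close> continuous; a Burkholder inequality for fourth moments turns these
  estimates of the integrand into estimates of the integral.

  The variance of \<open>Z\<close> is asymptotically \<open>sqrt (2 eps / (pi A(x)))\<close>, and \<open>Z\<close> is independent of the past at
  time \<open>t - L eps\<close>. Hence \<open>Z\<^sup>4\<close> may be replaced by \<open>3 (E Z\<^sup>2)\<^sup>2\<close> in the quartic variation, because the
  fluctuations are uncorrelated at lag \<open>L\<close>. So \<open>V\<^sub>n\<close> is in \<open>L\<^sup>1\<close> asymptotically \<open>6 / (pi A(x))\<close> times the Riemann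
  sum of \<open>\<sigma>\<^sup>4(u)\<close>, which converges to a positive limit. Letting \<open>L\<close> grow slowly with \<open>n\<close> makes all errors
  vanish at once.\<close>

section \<open>Uniqueness of weighted laws\<close>

text \<open>The noise is known only through its Gaussian law and covariance, and the Walsh integral
  only as an \<open>L\<^sup>2\<close> limit of simple fields. So independence of later increments
  from the past has to come from characteristic functions, and since the filtration is
  right-continuous, increments that start exactly at the present are reached as limits of increments
  that start slightly later. The fourth moment bound adds one rectangle at a time, which needs
  rectangles ordered in time and disjoint in space; an approximating simple field has neither this
  order nor controlled fourth moments, so it is rewritten on a grid and truncated.

  The space modulus of \<open>u\<close> carries a free parameter \<rho> that keeps it quadratic in
  the distance: integrated against the kernel it then costs only a second moment. In
  \<open>6 / (pi * coeff_A a1 a2 x)\<close>, the value of \<open>3 * (\<kappa>0 x)\<^sup>2\<close>,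
  the 3 is the Gaussian fourth moment and \<open>\<kappa>0 x\<close> the variance divided by
  \<open>sqrt eps\<close>. The limit of the Riemann sums is random and positive but not bounded away
  from 0, so the quotient is estimated only after an event of small probability is excluded.\<close>

lemma abs_mult_le_bound:
  fixes wt f b :: real
  assumes "\<bar>wt\<bar> \<le> b" "\<bar>f\<bar> \<le> 1"
  shows "\<bar>wt * f\<bar> \<le> b"
  using mult_mono[OF assms] assms by (simp add: abs_mult)

lemma real_distribution_distr_density:
  fixes X wt :: "'a \<Rightarrow> real"
  assumes "prob_space M" and [measurable]: "X \<in> borel_measurable M" "wt \<in> borel_measurable M"
    and wt: "\<And>w. 0 \<le> wt w" and int: "integrable M wt" and m: "integral\<^sup>L M wt = 1"
  shows "real_distribution (distr (density M (\<lambda>w. ennreal (wt w))) borel X)"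
proof -
  interpret prob_space M by fact
  have "emeasure (density M (\<lambda>w. ennreal (wt w))) (space (density M (\<lambda>w. ennreal (wt w)))) = 1"
    using nn_integral_eq_integral[OF int] wt m by (simp add: emeasure_density cong: nn_integral_cong)
  then interpret D: prob_space "density M (\<lambda>w. ennreal (wt w))" by (rule prob_spaceI)
  show ?thesis
    by (rule D.real_distribution_distr) simp
qed

lemma char_distr_density:
  fixes X wt :: "'a \<Rightarrow> real"
  assumes "prob_space M" and [measurable]: "X \<in> borel_measurable M" "wt \<in> borel_measurable M"
    and wt: "\<And>w. 0 \<le> wt w" and int: "integrable M wt"
  shows "char (distr (density M (\<lambda>w. ennreal (wt w))) borel X) t =
    Complex (\<integral>w. wt w * cos (t * X w) \<partial>M) (\<integral>w. wt w * sin (t * X w) \<partial>M)"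
proof -
  have "char (distr (density M (\<lambda>w. ennreal (wt w))) borel X) t = (\<integral>w. wt w *\<^sub>R iexp (t * X w) \<partial>M)"
    unfolding char_def using wt by (simp add: integral_distr integral_density)
  moreover have "integrable M (\<lambda>w. wt w *\<^sub>R iexp (t * X w))"
    by (rule Bochner_Integration.integrable_bound[OF int]) auto
  then have "Re (\<integral>w. wt w *\<^sub>R iexp (t * X w) \<partial>M) = (\<integral>w. wt w * cos (t * X w) \<partial>M)"
    "Im (\<integral>w. wt w *\<^sub>R iexp (t * X w) \<partial>M) = (\<integral>w. wt w * sin (t * X w) \<partial>M)"
    by (simp_all flip: integral_Re integral_Im add: Re_exp Im_exp)
  ultimately show ?thesis by (simp add: complex_eq_iff)
qed

text \<open>Weights that are at least 1 have positive total mass, so they can be normalised to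
  densities. The cosine and sine integrals are the real and imaginary parts of the characteristic
  functions of \<open>X\<close> under these densities, and Levy's uniqueness theorem applies; the
  case \<open>t = 0\<close> shows that both masses agree.\<close>

lemma weighted_law_unique_pos:
  fixes X w1 w2 :: "'a \<Rightarrow> real"
  assumes M: "prob_space M" and [measurable]: "X \<in> borel_measurable M" "w1 \<in> borel_measurable M" "w2 \<in> borel_measurable M"
    and pos: "\<And>w. 1 \<le> w1 w" "\<And>w. 1 \<le> w2 w" and int: "integrable M w1" "integrable M w2"
    and c: "\<And>t. (\<integral>w. w1 w * cos (t * X w) \<partial>M) = (\<integral>w. w2 w * cos (t * X w) \<partial>M)"
    and s: "\<And>t. (\<integral>w. w1 w * sin (t * X w) \<partial>M) = (\<integral>w. w2 w * sin (t * X w) \<partial>M)"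
    and [measurable]: "C \<in> sets borel"
  shows "(\<integral>w. w1 w * indicator C (X w) \<partial>M) = (\<integral>w. w2 w * indicator C (X w) \<partial>M)"
proof -
  interpret prob_space M by fact
  define m where "m = integral\<^sup>L M w1"
  have m: "integral\<^sup>L M w1 = m" "integral\<^sup>L M w2 = m" using c[of 0] by (auto simp: m_def)
  have "integral\<^sup>L M (\<lambda>_. 1::real) \<le> m"
    unfolding m_def by (rule integral_mono[OF _ int(1)]) (auto simp: pos)
  then have m1: "m \<ge> 1" by (simp add: prob_space)
  define D where "D wt = distr (density M (\<lambda>w. ennreal (wt w / m))) borel X" for wt
  have nn: "\<And>w. 0 \<le> w1 w / m" "\<And>w. 0 \<le> w2 w / m"
    using pos m1 order.trans[OF zero_le_one] by (auto intro!: divide_nonneg_nonneg)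
  have D: "real_distribution (D w1)" "real_distribution (D w2)"
    unfolding D_def using int m m1 nn
    by (auto intro!: real_distribution_distr_density[OF M])
  have *: "char (D w1) = char (D w2)"
  proof
    fix t
    show "char (D w1) t = char (D w2) t"
      unfolding D_def using int nn c[of t] s[of t]
      by (subst (1 2) char_distr_density[OF M]) (auto)
  qed
  have eq: "D w1 = D w2" by (rule Levy_uniqueness[OF D *])
  have I: "measure (D wt) C = (\<integral>w. wt w * indicator C (X w) \<partial>M) / m"
    if [measurable]: "wt \<in> borel_measurable M" and i: "integrable M wt" and nn: "\<And>w. 0 \<le> wt w / m" for wt
  proof -
    have "measure (D wt) C = (\<integral>x. indicator C x \<partial>D wt)" unfolding D_def by simp
    also have "\<dots> = (\<integral>w. (wt w / m) * indicator C (X w) \<partial>M)"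
      unfolding D_def using nn by (subst integral_distr, simp, simp, subst integral_density) simp_all
    also have "\<dots> = (\<integral>w. wt w * indicator C (X w) \<partial>M) / m" by simp
    finally show ?thesis .
  qed
  have "(\<integral>w. w1 w * indicator C (X w) \<partial>M) / m = measure (D w1) C"
    by (rule I[OF _ int(1) nn(1), symmetric]) simp
  also have "\<dots> = (\<integral>w. w2 w * indicator C (X w) \<partial>M) / m"
    unfolding eq by (rule I[OF _ int(2) nn(2)]) simp
  finally show ?thesis using m1 by simp
qed

text \<open>Adding \<open>b + 1\<close> to both weights makes them at least 1 and adds the same
  integral to both sides. Signed weights are needed because trigonometric factors are later absorbed
  into them.\<close>

lemma weighted_law_unique:
  fixes X w1 w2 :: "'a \<Rightarrow> real"
  assumes M: "prob_space M" and [measurable]: "X \<in> borel_measurable M" "w1 \<in> borel_measurable M" "w2 \<in> borel_measurable M"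
    and bd: "\<And>w. \<bar>w1 w\<bar> \<le> b" "\<And>w. \<bar>w2 w\<bar> \<le> b"
    and c: "\<And>t. (\<integral>w. w1 w * cos (t * X w) \<partial>M) = (\<integral>w. w2 w * cos (t * X w) \<partial>M)"
    and s: "\<And>t. (\<integral>w. w1 w * sin (t * X w) \<partial>M) = (\<integral>w. w2 w * sin (t * X w) \<partial>M)"
    and [measurable]: "C \<in> sets borel"
  shows "(\<integral>w. w1 w * indicator C (X w) \<partial>M) = (\<integral>w. w2 w * indicator C (X w) \<partial>M)"
proof -
  interpret prob_space M by fact
  have b0: "b \<ge> 0" using bd(1)[of undefined] by linarith
  have i: "integrable M (\<lambda>w. wt w * f w)"
    if "wt \<in> borel_measurable M" "\<And>w. \<bar>wt w\<bar> \<le> b" "f \<in> borel_measurable M" "\<And>w. \<bar>f w\<bar> \<le> 1" for wt f :: "'a \<Rightarrow> real"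
    using that by (intro integrable_const_bound[where B=b]) (auto intro!: abs_mult_le_bound simp del: abs_mult)
  have i1: "integrable M f" if "f \<in> borel_measurable M" "\<And>w. \<bar>f w\<bar> \<le> 1" for f :: "'a \<Rightarrow> real"
    using that by (intro integrable_const_bound[where B=1]) auto
  have int: "integrable M w1" "integrable M w2"
    using bd by (auto intro!: integrable_const_bound[where B=b])
  have split: "(\<integral>w. (wt w + (b+1)) * f w \<partial>M) = (\<integral>w. wt w * f w \<partial>M) + (b+1) * (\<integral>w. f w \<partial>M)"
    if "wt \<in> borel_measurable M" "\<And>w. \<bar>wt w\<bar> \<le> b" "f \<in> borel_measurable M" "\<And>w. \<bar>f w\<bar> \<le> 1" for wt f :: "'a \<Rightarrow> real"
    using i[OF that] i1[OF that(3,4)] by (simp add: distrib_right)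
  have ind: "\<bar>indicator C (X w)\<bar> \<le> (1::real)" for w by (simp add: indicator_def)
  have "(\<integral>w. (w1 w + (b+1)) * indicator C (X w) \<partial>M) = (\<integral>w. (w2 w + (b+1)) * indicator C (X w) \<partial>M)"
  proof (rule weighted_law_unique_pos[OF M])
    show "\<And>w. 1 \<le> w1 w + (b + 1)" "\<And>w. 1 \<le> w2 w + (b + 1)"
      subgoal for w using bd(1)[of w] by linarith
      subgoal for w using bd(2)[of w] by linarith
      done
  qed (use int bd c s in \<open>auto simp: split\<close>)
  then show ?thesis
    using bd ind by (simp add: split)
qed

text \<open>A version of the Cramer-Wold device by induction on the variables. Product-to-sum
  formulas split the factor with the new variable from the linear combination of the others; this
  factor is absorbed into the weight for the induction hypothesis, and the roles are then
  exchanged.\<close>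

lemma weighted_joint_law_unique:
  fixes Y :: "'i \<Rightarrow> 'a \<Rightarrow> real" and w1 w2 :: "'a \<Rightarrow> real"
  assumes M: "prob_space M" and "finite J" and Y: "\<And>j. j \<in> J \<Longrightarrow> Y j \<in> borel_measurable M"
    and [measurable]: "w1 \<in> borel_measurable M" "w2 \<in> borel_measurable M"
    and bd: "\<And>w. \<bar>w1 w\<bar> \<le> b" "\<And>w. \<bar>w2 w\<bar> \<le> b"
    and c: "\<And>l. (\<integral>w. w1 w * cos (\<Sum>j\<in>J. l j * Y j w) \<partial>M) = (\<integral>w. w2 w * cos (\<Sum>j\<in>J. l j * Y j w) \<partial>M)"
    and s: "\<And>l. (\<integral>w. w1 w * sin (\<Sum>j\<in>J. l j * Y j w) \<partial>M) = (\<integral>w. w2 w * sin (\<Sum>j\<in>J. l j * Y j w) \<partial>M)"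
    and C: "\<And>j. C j \<in> sets borel"
  shows "(\<integral>w. w1 w * (\<Prod>j\<in>J. indicator (C j) (Y j w)) \<partial>M) = (\<integral>w. w2 w * (\<Prod>j\<in>J. indicator (C j) (Y j w)) \<partial>M)"
  using \<open>finite J\<close> assms(3-9)
proof (induction J arbitrary: w1 w2 rule: finite_induct)
  case empty
  then show ?case by simp
next
  case (insert k J)
  interpret prob_space M by fact
  have [measurable]: "Y k \<in> borel_measurable M" "w1 \<in> borel_measurable M" "w2 \<in> borel_measurable M"
    using insert.prems by auto
  have YJ[measurable]: "(\<lambda>w. \<Sum>j\<in>J. l j * Y j w) \<in> borel_measurable M" for l
    using insert.prems by (intro borel_measurable_sum) auto
  have b0: "b \<ge> 0" using insert.prems(4)[of undefined] by linarith
  have i: "integrable M (\<lambda>w. wt w * f w)"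
    if "wt \<in> borel_measurable M" "\<And>w. \<bar>wt w\<bar> \<le> b" "f \<in> borel_measurable M" "\<And>w. \<bar>f w\<bar> \<le> 1" for wt f :: "'a \<Rightarrow> real"
    using that by (intro integrable_const_bound[where B=b]) (auto intro!: abs_mult_le_bound simp del: abs_mult)
  define L where "L l w = (\<Sum>j\<in>J. l j * Y j w)" for l w
  have [measurable]: "L l \<in> borel_measurable M" for l unfolding L_def[abs_def] by simp
  have upd: "(\<Sum>j\<in>insert k J. (l(k:=t)) j * Y j w) = t * Y k w + L l w" for l t w
    using insert.hyps unfolding L_def by (auto simp: fun_upd_def intro!: sum.cong)
  have ec: "(\<integral>w. w1 w * cos (t * Y k w + L l w) \<partial>M) = (\<integral>w. w2 w * cos (t * Y k w + L l w) \<partial>M)" for t l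
    using insert.prems(6)[of "l(k:=t)"] unfolding upd .
  have es: "(\<integral>w. w1 w * sin (t * Y k w + L l w) \<partial>M) = (\<integral>w. w2 w * sin (t * Y k w + L l w) \<partial>M)" for t l
    using insert.prems(7)[of "l(k:=t)"] unfolding upd .
  \<comment> \<open>The sign is put on \<open>p\<close>, not on \<open>q\<close>, because
    \<open>- p\<close> is obtained from another instance of the hypothesis, with coefficient
    \<open>- t\<close> for \<open>Y k\<close>.\<close>
  have tr: "wt * cos p * cos q = (wt * cos (p + q) + wt * cos (- p + q)) / 2"
       "wt * cos p * sin q = (wt * sin (p + q) + wt * sin (- p + q)) / 2"
       "wt * sin p * cos q = (wt * sin (p + q) - wt * sin (- p + q)) / 2"
       "wt * sin p * sin q = (wt * cos (- p + q) - wt * cos (p + q)) / 2"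
    for wt p q :: real
    unfolding cos_add sin_add cos_minus sin_minus by (simp_all add: algebra_simps)
  have I1: "(\<integral>w. wt w * cos (t * Y k w) * cos (L l w) \<partial>M) =
      ((\<integral>w. wt w * cos (t * Y k w + L l w) \<partial>M) + (\<integral>w. wt w * cos (- t * Y k w + L l w) \<partial>M)) / 2"
    and I2: "(\<integral>w. wt w * cos (t * Y k w) * sin (L l w) \<partial>M) =
      ((\<integral>w. wt w * sin (t * Y k w + L l w) \<partial>M) + (\<integral>w. wt w * sin (- t * Y k w + L l w) \<partial>M)) / 2"
    and I3: "(\<integral>w. wt w * sin (t * Y k w) * cos (L l w) \<partial>M) =
      ((\<integral>w. wt w * sin (t * Y k w + L l w) \<partial>M) - (\<integral>w. wt w * sin (- t * Y k w + L l w) \<partial>M)) / 2"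
    and I4: "(\<integral>w. wt w * sin (t * Y k w) * sin (L l w) \<partial>M) =
      ((\<integral>w. wt w * cos (- t * Y k w + L l w) \<partial>M) - (\<integral>w. wt w * cos (t * Y k w + L l w) \<partial>M)) / 2"
    if [measurable]: "wt \<in> borel_measurable M" and "\<And>w. \<bar>wt w\<bar> \<le> b" for t l wt
    unfolding tr using that by (simp_all add: i)
  \<comment> \<open>Induction hypothesis for the weights multiplied by the cosine of the new
    variable; they remain bounded by \<open>b\<close>.\<close>
  have 1: "(\<integral>w. (w1 w * cos (t * Y k w)) * (\<Prod>j\<in>J. indicator (C j) (Y j w)) \<partial>M) =
        (\<integral>w. (w2 w * cos (t * Y k w)) * (\<Prod>j\<in>J. indicator (C j) (Y j w)) \<partial>M)" for t
  proof (rule insert.IH)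
    fix l
    show "(\<integral>w. w1 w * cos (t * Y k w) * cos (\<Sum>j\<in>J. l j * Y j w) \<partial>M) = (\<integral>w. w2 w * cos (t * Y k w) * cos (\<Sum>j\<in>J. l j * Y j w) \<partial>M)"
      using insert.prems(4,5) ec[of t l] ec[of "-t" l] by (simp flip: L_def add: I1)
    show "(\<integral>w. w1 w * cos (t * Y k w) * sin (\<Sum>j\<in>J. l j * Y j w) \<partial>M) = (\<integral>w. w2 w * cos (t * Y k w) * sin (\<Sum>j\<in>J. l j * Y j w) \<partial>M)"
      using insert.prems(4,5) es[of t l] es[of "-t" l] by (simp flip: L_def add: I2)
  qed (use insert.prems in \<open>auto intro!: abs_mult_le_bound\<close>)
  have 2: "(\<integral>w. (w1 w * sin (t * Y k w)) * (\<Prod>j\<in>J. indicator (C j) (Y j w)) \<partial>M) =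
        (\<integral>w. (w2 w * sin (t * Y k w)) * (\<Prod>j\<in>J. indicator (C j) (Y j w)) \<partial>M)" for t
  proof (rule insert.IH)
    fix l
    show "(\<integral>w. w1 w * sin (t * Y k w) * cos (\<Sum>j\<in>J. l j * Y j w) \<partial>M) = (\<integral>w. w2 w * sin (t * Y k w) * cos (\<Sum>j\<in>J. l j * Y j w) \<partial>M)"
      using insert.prems(4,5) es[of t l] es[of "-t" l] by (simp flip: L_def add: I3)
    show "(\<integral>w. w1 w * sin (t * Y k w) * sin (\<Sum>j\<in>J. l j * Y j w) \<partial>M) = (\<integral>w. w2 w * sin (t * Y k w) * sin (\<Sum>j\<in>J. l j * Y j w) \<partial>M)"
      using insert.prems(4,5) ec[of t l] ec[of "-t" l] by (simp flip: L_def add: I4)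
  qed (use insert.prems in \<open>auto intro!: abs_mult_le_bound\<close>)
  define P where "P w = (\<Prod>j\<in>J. indicator (C j) (Y j w) :: real)" for w
  have [measurable]: "P \<in> borel_measurable M"
    unfolding P_def[abs_def]
  proof (rule borel_measurable_prod)
    show "(\<lambda>w. indicator (C j) (Y j w) :: real) \<in> borel_measurable M" if "j \<in> J" for j
      by (rule measurable_compose[OF _ borel_measurable_indicator]) (use that insert.prems(1) C in auto)
  qed
  have Pb: "\<bar>P w\<bar> \<le> 1" for w
    unfolding P_def by (subst abs_prod, rule prod_le_1) (auto simp: indicator_def)
  \<comment> \<open>Now the product of indicators is part of the weight, and the facts just proved
    are the hypotheses of the one-dimensional statement for \<open>Y k\<close>.\<close>
  have "(\<integral>w. (w1 w * P w) * indicator (C k) (Y k w) \<partial>M) = (\<integral>w. (w2 w * P w) * indicator (C k) (Y k w) \<partial>M)"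
  proof (rule weighted_law_unique[OF M, where b=b])
    show "(\<integral>w. w1 w * P w * cos (t * Y k w) \<partial>M) = (\<integral>w. w2 w * P w * cos (t * Y k w) \<partial>M)" for t
      using 1[of t] unfolding P_def[symmetric] by (simp only: mult.assoc mult.commute[of "P _"])
    show "(\<integral>w. w1 w * P w * sin (t * Y k w) \<partial>M) = (\<integral>w. w2 w * P w * sin (t * Y k w) \<partial>M)" for t
      using 2[of t] unfolding P_def[symmetric] by (simp only: mult.assoc mult.commute[of "P _"])
  qed (use insert.prems(4,5) C Pb in \<open>auto intro!: abs_mult_le_bound simp del: abs_mult\<close>)
  moreover have "(\<Prod>j\<in>insert k J. indicator (C j) (Y j w)) = P w * indicator (C k) (Y k w)" for w
    using insert.hyps by (simp add: P_def mult.commute)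
  ultimately show ?case by (simp add: mult.assoc)
qed

section \<open>Gaussian variables\<close>

context prob_space
begin

abbreviation nnE :: "('a \<Rightarrow> real) \<Rightarrow> ennreal" where
  "nnE X \<equiv> \<integral>\<^sup>+w. ennreal (X w) \<partial>M"

lemma centered_gaussian_measurable: "centered_gaussian M X \<Longrightarrow> X \<in> borel_measurable M"
  by (simp add: centered_gaussian_def)

text \<open>The factor is the double factorial of \<open>2 k - 1\<close>. Expressing the moments by
  the variance instead of the parameter \<open>s\<close> lets the same formula cover the degenerate
  variable.\<close>

lemma centered_gaussian_even_moment:
  assumes "centered_gaussian M X"
  shows "integrable M (\<lambda>w. X w ^ k)"
    and "expectation (\<lambda>w. X w ^ (2 * k)) = fact (2 * k) / (2 ^ k * fact k) * expectation (\<lambda>w. (X w)\<^sup>2) ^ k" (is "?S1")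
    and "odd k \<Longrightarrow> expectation (\<lambda>w. X w ^ k) = 0"
proof -
  have [measurable]: "X \<in> borel_measurable M" using assms by (simp add: centered_gaussian_def)
  have "integrable M (\<lambda>w. X w ^ k) \<and>
    expectation (\<lambda>w. X w ^ (2 * k)) = fact (2 * k) / (2 ^ k * fact k) * expectation (\<lambda>w. (X w)\<^sup>2) ^ k \<and>
    (odd k \<longrightarrow> expectation (\<lambda>w. X w ^ k) = 0)"
  proof (cases "AE w in M. X w = 0")
    case True
    have e: "integrable M (\<lambda>w. X w ^ n) \<and> expectation (\<lambda>w. X w ^ n) = 0 ^ n" for n
    proof -
      have *: "AE w in M. X w ^ n = 0 ^ n" using True by eventually_elim simp
      then have "expectation (\<lambda>w. X w ^ n) = expectation (\<lambda>w. 0 ^ n)"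
        by (intro integral_cong_AE) auto
      moreover have "integrable M (\<lambda>w. X w ^ n) = integrable M (\<lambda>w. (0::real) ^ n)"
        using * by (intro integrable_cong_AE) auto
      ultimately show ?thesis by (simp add: prob_space)
    qed
    show ?thesis using e[of k] e[of "2 * k"] e[of 2] by (cases k) auto
  next
    case False
    then obtain s where s: "s > 0" "distributed M lborel X (normal_density 0 s)"
      using assms unfolding centered_gaussian_def by auto
    have 1: "expectation (\<lambda>w. X w ^ n) = (\<integral>x. normal_density 0 s x * (x - 0) ^ n \<partial>lborel)" for n
      using distributed_integral[OF s(2), of "\<lambda>x. x ^ n"] by simp
    have 2: "integrable M (\<lambda>w. X w ^ n)" for n
      using distributed_integrable[OF s(2), of "\<lambda>x. x ^ n"] integrable_normal_moment[OF s(1), of 0 n] by simp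
    have 3: "expectation (\<lambda>w. X w ^ (2 * n)) = fact (2 * n) / ((2 / s\<^sup>2) ^ n * fact n)" for n
      unfolding 1 by (rule integral_normal_moment_even[OF s(1)])
    have "expectation (\<lambda>w. (X w)\<^sup>2) = s\<^sup>2" using 3[of 1] by simp
    moreover have "odd k \<longrightarrow> expectation (\<lambda>w. X w ^ k) = 0"
      using integral_normal_moment_odd[OF s(1), of 0] unfolding 1 by (auto elim!: oddE)
    ultimately show ?thesis using 2 3[of k] by (auto simp: power_divide)
  qed
  then show "integrable M (\<lambda>w. X w ^ k)"
    ?S1
    "odd k \<Longrightarrow> expectation (\<lambda>w. X w ^ k) = 0"
    by auto
qed

lemma centered_gaussian_moments:
  assumes "centered_gaussian M X"
  shows "expectation X = 0"
    and "expectation (\<lambda>w. X w ^ 3) = 0"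
    and "expectation (\<lambda>w. X w ^ 4) = 3 * (expectation (\<lambda>w. (X w)\<^sup>2))\<^sup>2"
    and "expectation (\<lambda>w. X w ^ 8) = 105 * (expectation (\<lambda>w. (X w)\<^sup>2)) ^ 4"
  using centered_gaussian_even_moment(3)[OF assms, of 1] centered_gaussian_even_moment(3)[OF assms, of 3]
    centered_gaussian_even_moment(2)[OF assms, of 2] centered_gaussian_even_moment(2)[OF assms, of 4]
  by (auto simp: fact_numeral)

text \<open>Real and imaginary parts of the Gaussian characteristic function at 1, obtained from the
  standard normal law by scaling; a degenerate variable has variance 0 and fits the formula.\<close>

lemma centered_gaussian_trig:
  assumes "centered_gaussian M X"
  shows "expectation (\<lambda>w. cos (X w)) = exp (- expectation (\<lambda>w. (X w)\<^sup>2) / 2)" (is "?S1")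
    and "expectation (\<lambda>w. sin (X w)) = 0"
proof -
  have [measurable]: "X \<in> borel_measurable M" using assms by (simp add: centered_gaussian_def)
  have "expectation (\<lambda>w. cos (X w)) = exp (- expectation (\<lambda>w. (X w)\<^sup>2) / 2) \<and> expectation (\<lambda>w. sin (X w)) = 0"
  proof (cases "AE w in M. X w = 0")
    case True
    have "expectation (\<lambda>w. f (X w)) = f 0" if [measurable]: "f \<in> borel_measurable borel" for f :: "real \<Rightarrow> real"
    proof -
      have "expectation (\<lambda>w. f (X w)) = expectation (\<lambda>w. f 0)"
        using True by (intro integral_cong_AE) auto
      then show ?thesis by (simp add: prob_space)
    qed
    from this[of cos] this[of sin] this[of "\<lambda>x. x\<^sup>2"] show ?thesis by simp
  next
    case False
    then obtain s where s: "s > 0" "distributed M lborel X (normal_density 0 s)"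
      using assms unfolding centered_gaussian_def by auto
    have v: "expectation (\<lambda>w. (X w)\<^sup>2) = s\<^sup>2"
      using distributed_integral[OF s(2), of "\<lambda>x. x\<^sup>2"] integral_normal_moment_even[OF s(1), of 0 1] by simp
    have d: "distributed M lborel (\<lambda>w. X w / s) std_normal_density"
      using normal_standard_normal_convert[OF s(1), of X 0] s(2) by simp
    have D: "distr M borel (\<lambda>w. X w / s) = std_normal_distribution"
    proof -
      have "distr M borel (\<lambda>w. X w / s) = distr M lborel (\<lambda>w. X w / s)"
        by (rule distr_cong) auto
      then show ?thesis using distributed_distr_eq_density[OF d] by simp
    qed
    have "char (distr M borel (\<lambda>w. X w / s)) s = complex_of_real (exp (- (s\<^sup>2) / 2))"
      unfolding D char_std_normal_distribution by simp
    moreover have "char (distr (density M (\<lambda>w. ennreal 1)) borel (\<lambda>w. X w / s)) s =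
        Complex (\<integral>w. 1 * cos (s * (X w / s)) \<partial>M) (\<integral>w. 1 * sin (s * (X w / s)) \<partial>M)"
      by (rule char_distr_density) (auto simp: prob_space_axioms)
    moreover have "density M (\<lambda>w. ennreal 1) = M"
      by (simp add: density_1)
    ultimately show ?thesis using s(1) by (simp add: v complex_eq_iff)
  qed
  then show ?S1
    "expectation (\<lambda>w. sin (X w)) = 0" by auto
qed

text \<open>Intersections of a set from \<open>\<N>\<close> with finitely many constraints on
  variables from \<open>\<Y>\<close> form a generator that is stable under intersection. On it the
  joint law is determined, with the indicator of the \<open>\<N>\<close>-set absorbed into the
  weight, and Dynkin's theorem extends the equality. \<open>\<N>\<close> holds events that Gaussian
  variables do not describe: first the null sets, later a whole sigma-algebra of the past.\<close>

lemma weighted_sigma_unique: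
  fixes w1 w2 :: "'a \<Rightarrow> real"
  assumes N: "Int_stable \<N>" "\<N> \<subseteq> events" "space M \<in> \<N>"
    and Y: "\<Y> \<subseteq> borel_measurable M"
    and [measurable]: "w1 \<in> borel_measurable M" "w2 \<in> borel_measurable M"
    and bd: "\<And>w. \<bar>w1 w\<bar> \<le> b" "\<And>w. \<bar>w2 w\<bar> \<le> b"
    and c: "\<And>A J l. A \<in> \<N> \<Longrightarrow> finite J \<Longrightarrow> J \<subseteq> \<Y> \<Longrightarrow>
      (\<integral>w. indicator A w * w1 w * cos (\<Sum>Y\<in>J. l Y * Y w) \<partial>M) =
      (\<integral>w. indicator A w * w2 w * cos (\<Sum>Y\<in>J. l Y * Y w) \<partial>M)"
    and s: "\<And>A J l. A \<in> \<N> \<Longrightarrow> finite J \<Longrightarrow> J \<subseteq> \<Y> \<Longrightarrow>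
      (\<integral>w. indicator A w * w1 w * sin (\<Sum>Y\<in>J. l Y * Y w) \<partial>M) =
      (\<integral>w. indicator A w * w2 w * sin (\<Sum>Y\<in>J. l Y * Y w) \<partial>M)"
    and B: "B \<in> sigma_sets (space M) (\<N> \<union> {Y -` C \<inter> space M | Y C. Y \<in> \<Y> \<and> C \<in> sets borel})"
  shows "(\<integral>w. indicator B w * w1 w \<partial>M) = (\<integral>w. indicator B w * w2 w \<partial>M)"
proof -
  define G where "G = {A \<inter> {w\<in>space M. \<forall>Y\<in>J. Y w \<in> C Y} | A J C. A \<in> \<N> \<and> finite J \<and> J \<subseteq> \<Y> \<and> (\<forall>Y. C Y \<in> sets borel)}"
  have GI: "A \<inter> {w\<in>space M. \<forall>Y\<in>J. Y w \<in> C Y} \<in> G" if "A \<in> \<N>" "finite J" "J \<subseteq> \<Y>" "\<And>Y. C Y \<in> sets borel" for A J C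
    using that unfolding G_def by blast
  have Gev: "G \<subseteq> events"
  proof
    fix X assume "X \<in> G"
    then obtain A J C where X: "X = A \<inter> {w\<in>space M. \<forall>Y\<in>J. Y w \<in> C Y}" "A \<in> \<N>" "finite J" "J \<subseteq> \<Y>" "\<forall>Y. C Y \<in> sets borel"
      unfolding G_def by blast
    have "{w\<in>space M. \<forall>Y\<in>J. Y w \<in> C Y} \<in> events"
    proof (rule sets.sets_Collect_finite_All[OF _ X(3)])
      fix Y assume "Y \<in> J"
      then show "{w\<in>space M. Y w \<in> C Y} \<in> events"
        using measurable_sets[of Y M borel "C Y"] X Y by (auto simp: vimage_def Int_def conj_commute)
    qed
    then show "X \<in> events" using X N by auto
  qed
  have Gst: "Int_stable G"
  proof (rule Int_stableI)
    fix X X' assume "X \<in> G" "X' \<in> G"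
    obtain A J C where X: "X = A \<inter> {w\<in>space M. \<forall>Y\<in>J. Y w \<in> C Y}" "A \<in> \<N>" "finite J" "J \<subseteq> \<Y>" "\<forall>Y. C Y \<in> sets borel"
      using \<open>X \<in> G\<close> unfolding G_def by blast
    obtain A' J' C' where X': "X' = A' \<inter> {w\<in>space M. \<forall>Y\<in>J'. Y w \<in> C' Y}" "A' \<in> \<N>" "finite J'" "J' \<subseteq> \<Y>" "\<forall>Y. C' Y \<in> sets borel"
      using \<open>X' \<in> G\<close> unfolding G_def by blast
    have "X \<inter> X' = (A \<inter> A') \<inter> {w\<in>space M. \<forall>Y\<in>J \<union> J'. Y w \<in> (if Y \<in> J then C Y else UNIV) \<inter> (if Y \<in> J' then C' Y else UNIV)}"
      unfolding X X' by auto
    also have "\<dots> \<in> G"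
      using X X' N(1) by (intro GI) (auto simp: Int_stable_def)
    finally show "X \<inter> X' \<in> G" .
  qed
  have "B \<in> sigma_sets (space M) G"
  proof -
    have "\<N> \<subseteq> G"
      using GI[of _ "{}" "\<lambda>_. UNIV"] N(2) sets.sets_into_space by fastforce
    moreover have "{Y -` C \<inter> space M | Y C. Y \<in> \<Y> \<and> C \<in> sets borel} \<subseteq> G"
    proof clarify
      fix Y and C :: "real set" assume "Y \<in> \<Y>" "C \<in> sets borel"
      then have "space M \<inter> {w\<in>space M. \<forall>Y\<in>{Y}. Y w \<in> (\<lambda>_. C) Y} \<in> G" using N(3) by (intro GI) auto
      moreover have "space M \<inter> {w\<in>space M. \<forall>Y\<in>{Y}. Y w \<in> (\<lambda>_. C) Y} = Y -` C \<inter> space M" by auto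
      ultimately show "Y -` C \<inter> space M \<in> G" by simp
    qed
    ultimately show ?thesis using B sigma_sets_mono'[of "\<N> \<union> {Y -` C \<inter> space M | Y C. Y \<in> \<Y> \<and> C \<in> sets borel}" G "space M"] by blast
  qed
  have i: "integrable M (\<lambda>w. indicator A w * wt w)"
    if "wt \<in> borel_measurable M" "\<And>w. \<bar>wt w\<bar> \<le> b" "A \<in> events" for wt :: "'a \<Rightarrow> real" and A
    using that bd(1)[of undefined] by (intro integrable_const_bound[where B=b]) (auto simp: indicator_def)
  have sG: "sigma_sets (space M) G \<subseteq> events" using Gev sets.sigma_sets_subset by blast
  have "G \<subseteq> Pow (space M)" using Gev sets.sets_into_space by blast
  from Gst this \<open>B \<in> sigma_sets (space M) G\<close> show ?thesis
  proof (induction rule: sigma_sets_induct_disjoint)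
    fix X assume "X \<in> G"
    then obtain A J C where X: "X = A \<inter> {w\<in>space M. \<forall>Y\<in>J. Y w \<in> C Y}" "A \<in> \<N>" "finite J" "J \<subseteq> \<Y>" "\<forall>Y. C Y \<in> sets borel"
      unfolding G_def by blast
    have [measurable]: "A \<in> events" using X N by auto
    have e: "indicator X w * wt w = indicator A w * wt w * (\<Prod>Y\<in>J. indicator (C Y) (Y w))" if "w \<in> space M" for wt :: "'a \<Rightarrow> real" and w
    proof -
      have "(\<Prod>Y\<in>J. indicator (C Y) (Y w)) = (if \<forall>Y\<in>J. Y w \<in> C Y then 1 else 0 :: real)"
        using X(3) by (auto simp: indicator_def intro!: prod.neutral)
      then show ?thesis using that unfolding X(1) by (auto simp: indicator_def)
    qed
    have "(\<integral>w. indicator A w * w1 w * (\<Prod>Y\<in>J. indicator (C Y) (Y w)) \<partial>M) =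
        (\<integral>w. indicator A w * w2 w * (\<Prod>Y\<in>J. indicator (C Y) (Y w)) \<partial>M)"
    proof (rule weighted_joint_law_unique[OF prob_space_axioms X(3), where b=b])
      show "\<bar>indicator A w * w1 w\<bar> \<le> b" "\<bar>indicator A w * w2 w\<bar> \<le> b" for w
        using bd[of w] by (auto simp: indicator_def)
    qed (use X Y c s in auto)
    moreover have "(\<integral>w. indicator X w * wt w \<partial>M) =
        (\<integral>w. indicator A w * wt w * (\<Prod>Y\<in>J. indicator (C Y) (Y w)) \<partial>M)" for wt :: "'a \<Rightarrow> real"
      by (rule Bochner_Integration.integral_cong[OF refl e])
    ultimately show "(\<integral>w. indicator X w * w1 w \<partial>M) = (\<integral>w. indicator X w * w2 w \<partial>M)"
      by simp
  next
    show "(\<integral>w. indicator {} w * w1 w \<partial>M) = (\<integral>w. indicator {} w * w2 w \<partial>M)" by simp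
  next
    fix X assume X: "X \<in> sigma_sets (space M) G" "(\<integral>w. indicator X w * w1 w \<partial>M) = (\<integral>w. indicator X w * w2 w \<partial>M)"
    have [measurable]: "X \<in> events" using X sG by auto
    have *: "(\<integral>w. indicator (space M - X) w * wt w \<partial>M) = (\<integral>w. indicator (space M) w * wt w \<partial>M) - (\<integral>w. indicator X w * wt w \<partial>M)"
      if "wt \<in> borel_measurable M" "\<And>w. \<bar>wt w\<bar> \<le> b" for wt
    proof -
      have "(\<integral>w. indicator (space M - X) w * wt w \<partial>M) = (\<integral>w. indicator (space M) w * wt w - indicator X w * wt w \<partial>M)"
        by (intro Bochner_Integration.integral_cong) (auto simp: indicator_def)
      then show ?thesis using i[OF that, of X] i[OF that, of "space M"] by simp
    qed
    \<comment> \<open>The total masses agree by the hypothesis for \<open>J = {}\<close> and the set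
      \<open>space M\<close>, where the cosine is 1.\<close>
    show "(\<integral>w. indicator (space M - X) w * w1 w \<partial>M) = (\<integral>w. indicator (space M - X) w * w2 w \<partial>M)"
      using X(2) c[OF N(3), of "{}"] bd by (simp add: *)
  next
    fix A :: "nat \<Rightarrow> 'a set"
    assume A: "disjoint_family A" "range A \<subseteq> sigma_sets (space M) G"
      "\<And>i. (\<integral>w. indicator (A i) w * w1 w \<partial>M) = (\<integral>w. indicator (A i) w * w2 w \<partial>M)"
    have Aev: "A i \<in> events" for i using A sG by auto
    have "(\<integral>w. indicator (\<Union>i. A i) w * wt w \<partial>M) = (\<Sum>n. (\<integral>w. indicator (A n) w * wt w \<partial>M))"
      if "wt \<in> borel_measurable M" "\<And>w. \<bar>wt w\<bar> \<le> b" for wt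
      using lebesgue_integral_countable_add[of A M wt] A Aev i[OF that, of "\<Union>i. A i"]
      by (auto simp: set_lebesgue_integral_def set_integrable_def disjoint_family_on_def)
    then show "(\<integral>w. indicator (\<Union>i. A i) w * w1 w \<partial>M) = (\<integral>w. indicator (\<Union>i. A i) w * w2 w \<partial>M)"
      using A(3) bd by simp
  qed
qed

end

section \<open>White noise\<close>

locale white_noise = prob_space M for M :: "'a measure" +
  fixes W :: "real \<Rightarrow> real set \<Rightarrow> 'a \<Rightarrow> real"
  assumes noise: "space_time_white_noise M W"
begin

abbreviation "dW s t B w \<equiv> W t B w - W s B w"

lemma noise_gaussian_family:
  assumes "finite J" "J \<subseteq> {0..} \<times> finite_borel"
  shows "centered_gaussian M (\<lambda>w. \<Sum>(t, B)\<in>J. c (t, B) * W t B w)"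
  using noise assms unfolding space_time_white_noise_def centered_gaussian_family_def
  by (auto simp: case_prod_beta)

lemma noise_cov:
  "0 \<le> t \<Longrightarrow> 0 \<le> s \<Longrightarrow> B \<in> finite_borel \<Longrightarrow> C \<in> finite_borel \<Longrightarrow>
    expectation (\<lambda>w. W t B w * W s C w) = min t s * measure lborel (B \<inter> C)"
  using noise unfolding space_time_white_noise_def by blast

text \<open>The Gaussian space of the noise. In inductive form, closure under linear operations is a
  rule induction; the representation over distinct indices, which the Gaussian family asks for, is
  produced only once.\<close>

inductive_set noise_span :: "('a \<Rightarrow> real) set" where
  zero: "(\<lambda>_. 0) \<in> noise_span"
| step: "Z \<in> noise_span \<Longrightarrow> 0 \<le> t \<Longrightarrow> B \<in> finite_borel \<Longrightarrow> (\<lambda>w. Z w + c * W t B w) \<in> noise_span"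

lemma noise_span_gaussian:
  assumes "Z \<in> noise_span"
  shows "centered_gaussian M Z"
proof -
  have "\<exists>J c. finite J \<and> J \<subseteq> {0..} \<times> finite_borel \<and> Z = (\<lambda>w. \<Sum>(t, B)\<in>J. c (t, B) * W t B w)"
    using assms
  proof induction
    case zero
    show ?case by (intro exI[of _ "{}"]) auto
  next
    case (step Z t B c)
    then obtain J d where J: "finite J" "J \<subseteq> {0..} \<times> finite_borel" "Z = (\<lambda>w. \<Sum>(t, B)\<in>J. d (t, B) * W t B w)"
      by auto
    \<comment> \<open>The index \<open>(t, B)\<close> may already occur in \<open>J\<close>; then
      the old and the new coefficient have to be added.\<close>
    define e where "e k = (if k \<in> J then d k else 0) + (if k = (t, B) then c else 0)" for k
    have "(\<Sum>(s, C)\<in>insert (t, B) J. e (s, C) * W s C w) = Z w + c * W t B w" for w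
    proof -
      have "(\<Sum>(s, C)\<in>insert (t, B) J. e (s, C) * W s C w) =
          (\<Sum>k\<in>insert (t, B) J. (if k \<in> J then d k else 0) * W (fst k) (snd k) w) +
          (\<Sum>k\<in>insert (t, B) J. (if k = (t, B) then c * W (fst k) (snd k) w else 0))"
        unfolding sum.distrib[symmetric] e_def by (rule sum.cong) (auto simp: distrib_right split: if_splits)
      also have "(\<Sum>k\<in>insert (t, B) J. (if k = (t, B) then c * W (fst k) (snd k) w else 0)) = c * W t B w"
        using J(1) by (subst sum.delta) auto
      also have "(\<Sum>k\<in>insert (t, B) J. (if k \<in> J then d k else 0) * W (fst k) (snd k) w) =
          (\<Sum>k\<in>J. d k * W (fst k) (snd k) w)"
        using J(1) by (intro sum.mono_neutral_cong_right) auto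
      finally show ?thesis unfolding J(3) by (simp add: case_prod_beta)
    qed
    then show ?case using J step by (intro exI[of _ "insert (t, B) J"] exI[of _ e]) auto
  qed
  then show ?thesis using noise_gaussian_family by auto
qed

lemma noise_span_W: "0 \<le> t \<Longrightarrow> B \<in> finite_borel \<Longrightarrow> W t B \<in> noise_span"
  using noise_span.step[OF noise_span.zero, of t B 1] by simp

lemma noise_span_add:
  assumes Z: "Z \<in> noise_span" and "Y \<in> noise_span"
  shows "(\<lambda>w. Z w + Y w) \<in> noise_span"
  using assms(2)
proof induction
  case zero
  then show ?case using Z by simp
next
  case (step Y t B c)
  from noise_span.step[OF step.IH step.hyps(2,3), of c] show ?case by (simp add: add.assoc)
qed

lemma noise_span_scale:
  assumes "Z \<in> noise_span"
  shows "(\<lambda>w. d * Z w) \<in> noise_span"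
  using assms
proof induction
  case zero
  then show ?case using noise_span.zero by simp
next
  case (step Y t B c)
  from noise_span.step[OF step.IH step.hyps(2,3), of "d * c"] show ?case by (simp add: algebra_simps)
qed

lemma noise_span_diff: "Z \<in> noise_span \<Longrightarrow> Y \<in> noise_span \<Longrightarrow> (\<lambda>w. Z w - Y w) \<in> noise_span"
  using noise_span_add[OF _ noise_span_scale[of Y "-1"]] by simp

lemma noise_span_sum:
  "finite J \<Longrightarrow> (\<And>j. j \<in> J \<Longrightarrow> Z j \<in> noise_span) \<Longrightarrow> (\<lambda>w. \<Sum>j\<in>J. Z j w) \<in> noise_span"
  by (induction J rule: finite_induct) (auto intro: noise_span.zero noise_span_add)

lemma noise_span_measurable: "Z \<in> noise_span \<Longrightarrow> Z \<in> borel_measurable M"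
  using noise_span_gaussian centered_gaussian_measurable by blast

lemma noise_span_integrable_mult:
  assumes "Z \<in> noise_span" "Y \<in> noise_span"
  shows "integrable M (\<lambda>w. Z w * Y w)"
proof -
  note [measurable] = assms[THEN noise_span_measurable]
  note G = assms[THEN noise_span_gaussian]
  show ?thesis
  proof (rule Bochner_Integration.integrable_bound)
    show "integrable M (\<lambda>w. (Z w)\<^sup>2 + (Y w)\<^sup>2)"
      using G[THEN centered_gaussian_even_moment(1), of 2] by simp
    have "\<bar>a * b\<bar> \<le> \<bar>a\<^sup>2 + b\<^sup>2\<bar>" for a b :: real
      using sum_squares_bound[of "\<bar>a\<bar>" "\<bar>b\<bar>"] abs_ge_zero[of "a * b"] unfolding abs_mult power2_abs by linarith
    then show "AE w in M. norm (Z w * Y w) \<le> norm ((Z w)\<^sup>2 + (Y w)\<^sup>2)" by auto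
  qed measurable
qed

text \<open>Uncorrelated elements of a Gaussian space: \<open>Z + L\<close> and \<open>Z - L\<close>
  are Gaussian with the same variance, the sum of the two variances, so the product-to-sum formulas
  give products of exponentials or cancel.\<close>

lemma noise_span_trig_factor:
  assumes Z: "Z \<in> noise_span" and L: "L \<in> noise_span" and ZL: "expectation (\<lambda>w. Z w * L w) = 0"
  shows "expectation (\<lambda>w. cos (Z w) * cos (L w)) = expectation (\<lambda>w. cos (Z w)) * expectation (\<lambda>w. cos (L w))" (is "?S1")
    and "expectation (\<lambda>w. cos (Z w) * sin (L w)) = 0"
    and "expectation (\<lambda>w. sin (Z w) * cos (L w)) = 0"
    and "expectation (\<lambda>w. sin (Z w) * sin (L w)) = 0"
proof -
  note [measurable] = Z[THEN noise_span_measurable] L[THEN noise_span_measurable]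
  define v where "v = expectation (\<lambda>w. (Z w)\<^sup>2)"
  define wt where "wt = expectation (\<lambda>w. (L w)\<^sup>2)"
  have i[simp]: "integrable M (\<lambda>w. (Z w)\<^sup>2)" "integrable M (\<lambda>w. (L w)\<^sup>2)" "integrable M (\<lambda>w. Z w * L w)"
    using Z L noise_span_integrable_mult centered_gaussian_even_moment(1)[OF noise_span_gaussian] by auto
  have a: "(\<lambda>w. Z w + L w) \<in> noise_span" "(\<lambda>w. Z w - L w) \<in> noise_span"
    using Z L noise_span_add noise_span_diff by auto
  have va: "expectation (\<lambda>w. (Z w + L w)\<^sup>2) = v + wt" "expectation (\<lambda>w. (Z w - L w)\<^sup>2) = v + wt"
    using ZL by (simp_all add: power2_sum power2_diff v_def wt_def mult.assoc)
  have c: "expectation (\<lambda>w. cos (Z w + L w)) = exp (-(v+wt)/2)" "expectation (\<lambda>w. sin (Z w + L w)) = 0"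
     "expectation (\<lambda>w. cos (Z w - L w)) = exp (-(v+wt)/2)" "expectation (\<lambda>w. sin (Z w - L w)) = 0"
    using a[THEN noise_span_gaussian, THEN centered_gaussian_trig(1)] a[THEN noise_span_gaussian, THEN centered_gaussian_trig(2)] va
    by simp_all
  have d: "expectation (\<lambda>w. cos (Z w)) = exp (-v/2)" "expectation (\<lambda>w. cos (L w)) = exp (-wt/2)"
    unfolding v_def wt_def using Z L noise_span_gaussian centered_gaussian_trig(1) by blast+
  have ib: "integrable M f" if "f \<in> borel_measurable M" "\<And>w. \<bar>f w\<bar> \<le> 1" for f :: "'a \<Rightarrow> real"
    using that by (intro integrable_const_bound[where B=1]) auto
  have tr: "cos p * cos q = (cos (p + q) + cos (p - q)) / 2"
       "cos p * sin q = (sin (p + q) - sin (p - q)) / 2"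
       "sin p * cos q = (sin (p + q) + sin (p - q)) / 2"
       "sin p * sin q = (cos (p - q) - cos (p + q)) / 2" for p q :: real
    unfolding cos_add sin_add cos_diff sin_diff by (simp_all add: algebra_simps)
  show ?S1
    unfolding tr d by (simp add: ib c flip: exp_add add_divide_distrib)
  show "expectation (\<lambda>w. cos (Z w) * sin (L w)) = 0" "expectation (\<lambda>w. sin (Z w) * cos (L w)) = 0"
    "expectation (\<lambda>w. sin (Z w) * sin (L w)) = 0"
    unfolding tr by (simp_all add: ib c)
qed

text \<open>Increments, not values of \<open>W\<close>, generate this span: they are uncorrelated
  with every value of \<open>W\<close> up to time \<open>a\<close>.\<close>

inductive_set future :: "real \<Rightarrow> ('a \<Rightarrow> real) set" for a where
  zero: "(\<lambda>_. 0) \<in> future a"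
| step: "Z \<in> future a \<Longrightarrow> 0 \<le> s \<Longrightarrow> a \<le> s \<Longrightarrow> s \<le> t \<Longrightarrow> B \<in> finite_borel \<Longrightarrow>
    (\<lambda>w. Z w + c * dW s t B w) \<in> future a"

lemma future_noise_span: "Z \<in> future a \<Longrightarrow> Z \<in> noise_span"
proof (induction rule: future.induct)
  case zero
  then show ?case by (rule noise_span.zero)
next
  case (step Z s t B c)
  then show ?case
    by (intro noise_span_add noise_span_scale noise_span_diff noise_span_W) auto
qed

lemma future_increment: "0 \<le> s \<Longrightarrow> a \<le> s \<Longrightarrow> s \<le> t \<Longrightarrow> B \<in> finite_borel \<Longrightarrow> (dW s t B) \<in> future a"
  using future.step[OF future.zero, of s a t B 1] by simp

lemma future_add:
  assumes Z: "Z \<in> future a" and "Y \<in> future a"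
  shows "(\<lambda>w. Z w + Y w) \<in> future a"
  using assms(2)
proof induction
  case zero
  then show ?case using Z by simp
next
  case (step Y s t B c)
  from future.step[OF step.IH step.hyps(2-5), of c] show ?case by (simp add: add.assoc)
qed

lemma future_scale:
  assumes "Z \<in> future a"
  shows "(\<lambda>w. d * Z w) \<in> future a"
  using assms
proof induction
  case zero
  then show ?case using future.zero by simp
next
  case (step Y s t B c)
  from future.step[OF step.IH step.hyps(2-5), of "d * c"] show ?case by (simp add: algebra_simps)
qed

lemma future_diff: "Z \<in> future a \<Longrightarrow> Y \<in> future a \<Longrightarrow> (\<lambda>w. Z w - Y w) \<in> future a"
  using future_add[OF _ future_scale[of Y a "-1"]] by simp

lemma future_sum:
  "finite J \<Longrightarrow> (\<And>j. j \<in> J \<Longrightarrow> Z j \<in> future a) \<Longrightarrow> (\<lambda>w. \<Sum>j\<in>J. Z j w) \<in> future a"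
  by (induction J rule: finite_induct) (auto intro: future.zero future_add)

lemmas future_measurable = noise_span_measurable[OF future_noise_span]
lemmas future_gaussian = noise_span_gaussian[OF future_noise_span]

lemma noise_increment_past_cov:
  assumes "0 \<le> r" "r \<le> s" "s \<le> t" "B \<in> finite_borel" "C \<in> finite_borel"
  shows "expectation (\<lambda>w. dW s t B w * W r C w) = 0"
proof -
  have "expectation (\<lambda>w. dW s t B w * W r C w) =
     expectation (\<lambda>w. W t B w * W r C w) - expectation (\<lambda>w. W s B w * W r C w)"
    using assms noise_span_integrable_mult noise_span_W by (simp add: left_diff_distrib)
  then show ?thesis using assms by (simp add: noise_cov)
qed

lemma noise_increment_cov:
  assumes "0 \<le> s" "s \<le> t" "0 \<le> s'" "s' \<le> t'" "B \<in> finite_borel" "C \<in> finite_borel"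
  shows "expectation (\<lambda>w. dW s t B w * dW s' t' C w) =
    measure lborel ({s<..t} \<inter> {s'<..t'}) * measure lborel (B \<inter> C)"
proof -
  have "expectation (\<lambda>w. dW s t B w * dW s' t' C w) =
     expectation (\<lambda>w. W t B w * W t' C w) - expectation (\<lambda>w. W s B w * W t' C w)
     - (expectation (\<lambda>w. W t B w * W s' C w) - expectation (\<lambda>w. W s B w * W s' C w))"
    using assms noise_span_integrable_mult noise_span_W by (simp add: left_diff_distrib right_diff_distrib)
  also have "\<dots> = (min t t' - min s t' - (min t s' - min s s')) * measure lborel (B \<inter> C)"
    using assms by (simp add: noise_cov) (simp add: algebra_simps)
  also have "min t t' - min s t' - (min t s' - min s s') = max 0 (min t t' - max s s')"
    using assms by (auto simp: min_def max_def)
  also have "\<dots> = measure lborel ({s<..t} \<inter> {s'<..t'})"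
    by (auto simp: greaterThanAtMost_def[symmetric] Int_greaterThanAtMost max_def)
  finally show ?thesis .
qed

lemma future_past_cov:
  assumes "Z \<in> future s" "0 \<le> r" "r \<le> s" "C \<in> finite_borel"
  shows "expectation (\<lambda>w. Z w * W r C w) = 0"
  using assms(1)
proof induction
  case (step Z s' t B c)
  have "expectation (\<lambda>w. (Z w + c * dW s' t B w) * W r C w) =
     expectation (\<lambda>w. Z w * W r C w) + c * expectation (\<lambda>w. dW s' t B w * W r C w)"
    using noise_span_integrable_mult[OF future_noise_span[OF step.hyps(1)] noise_span_W[of r C]]
      noise_span_integrable_mult[OF noise_span_diff[OF noise_span_W[of t B] noise_span_W[of s' B]] noise_span_W[of r C]]
      step.hyps assms by (simp add: distrib_right mult.assoc)
  then show ?case using step noise_increment_past_cov[of r s' t B C] assms by simp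
qed simp

end

section \<open>Independence of later noise from the augmented past\<close>

context white_noise
begin

lemma noise_events_subset: "noise_events M W s \<subseteq> events"
  unfolding noise_events_def
  using noise_span_measurable[OF noise_span_W] by (auto intro: measurable_sets)

abbreviation "\<F> \<equiv> noise_filtration M W"

definition raw_events :: "real \<Rightarrow> 'a set set" where
  "raw_events s = sigma_sets (space M) (noise_events M W s \<union> null_sets M)"

lemma raw_events_subset: "raw_events s \<subseteq> events"
  unfolding raw_events_def
  using noise_events_subset by (intro sets.sigma_sets_subset) (auto simp: null_sets_def)

lemma sets_filtration: "sets (\<F> t) = sigma_sets (space M) (\<Inter>s\<in>{t<..}. raw_events s)"
  and space_filtration [simp]: "space (\<F> t) = space M"
proof -
  have "(\<Inter>s\<in>{t<..}. raw_events s) \<subseteq> Pow (space M)"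
    using order_trans[OF raw_events_subset[of "t + 1"] sets.space_closed[of M]] by (intro INF_lower2[of "t + 1"]) auto
  then show "sets (\<F> t) = sigma_sets (space M) (\<Inter>s\<in>{t<..}. raw_events s)"
    "space (\<F> t) = space M"
    unfolding noise_filtration_def raw_events_def by simp_all
qed

text \<open>\<open>raw_events s\<close> is a sigma-algebra containing the whole intersection once
  \<open>t < s\<close>. Events of the right-continuous filtration thus become plain noise events, at
  the price of a strictly later time.\<close>

lemma filtration_raw:
  assumes "A \<in> sets (\<F> t)" "t < s"
  shows "A \<in> raw_events s"
proof -
  have "A \<in> sigma_sets (space M) (raw_events s)"
    using assms(1) sigma_sets_mono'[of "\<Inter>s\<in>{t<..}. raw_events s" "raw_events s" "space M"]
    unfolding sets_filtration using assms(2) by (meson INF_lower greaterThan_iff subsetD)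
  also have "sigma_sets (space M) (raw_events s) = raw_events s"
    unfolding raw_events_def using order_trans[OF noise_events_subset[of s] sets.space_closed[of M]]
    by (intro sigma_sets_sigma_sets_eq) (auto simp: null_sets_def dest: sets.sets_into_space)
  finally show ?thesis .
qed

lemma filtration_subset: "sets (\<F> t) \<subseteq> events"
  using filtration_raw[of _ t "t + 1"] raw_events_subset[of "t + 1"] by auto

lemma filtration_measurable: "f \<in> measurable (\<F> t) N \<Longrightarrow> f \<in> measurable M N"
  by (rule measurable_from_subalg[of M "\<F> t"]) (auto simp: subalgebra_def filtration_subset)

lemma filtration_mono: "s \<le> t \<Longrightarrow> sets (\<F> s) \<subseteq> sets (\<F> t)"
  unfolding sets_filtration by (rule sigma_sets_mono') auto

lemma filtration_measurable_mono: "f \<in> measurable (\<F> s) N \<Longrightarrow> s \<le> t \<Longrightarrow> f \<in> measurable (\<F> t) N"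
  by (rule measurable_from_subalg[of "\<F> t" "\<F> s"]) (auto simp: subalgebra_def filtration_mono)

lemma filtration_W:
  assumes "0 \<le> s" "s \<le> t" "B \<in> finite_borel"
  shows "W s B \<in> borel_measurable (\<F> t)"
proof (rule measurableI)
  fix C :: "real set" assume C: "C \<in> sets borel"
  have "W s B -` C \<inter> space M \<in> noise_events M W r" if "r > t" for r
    using assms C that unfolding noise_events_def by force
  then have "W s B -` C \<inter> space M \<in> (\<Inter>s\<in>{t<..}. raw_events s)"
    by (auto simp: raw_events_def)
  then show "W s B -` C \<inter> space (\<F> t) \<in> sets (\<F> t)"
    by (auto simp: sets_filtration)
qed simp

text \<open>An instance of \<open>weighted_sigma_unique\<close> with the trigonometric function of
  \<open>Z\<close> and its mean as weights. The past is generated by null sets, on which all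
  integrals vanish, and by values of \<open>W\<close> up to \<open>s\<close>, whose linear
  combinations are uncorrelated with \<open>Z\<close> and therefore factor.\<close>

lemma future_raw_trig:
  assumes Z: "Z \<in> future s" and A: "A \<in> raw_events s"
  shows "expectation (\<lambda>w. indicator A w * cos (Z w)) = prob A * expectation (\<lambda>w. cos (Z w))" (is "?S1")
    and "expectation (\<lambda>w. indicator A w * sin (Z w)) = 0"
proof -
  note Zm[measurable] = future_measurable[OF Z]
  define \<N> where "\<N> = insert (space M) (null_sets M)"
  define \<Y> where "\<Y> = {W r B | r B. 0 \<le> r \<and> r \<le> s \<and> B \<in> finite_borel}"
  have Aev[measurable]: "A \<in> events" using A raw_events_subset by auto
  have N: "Int_stable \<N>" "\<N> \<subseteq> events" "space M \<in> \<N>"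
    by (auto simp: \<N>_def Int_stable_def dest: sets.sets_into_space intro: null_set_Int1 null_set_Int2)
  have Ysp: "\<Y> \<subseteq> noise_span" unfolding \<Y>_def using noise_span_W by auto
  then have Y: "\<Y> \<subseteq> borel_measurable M" using noise_span_measurable by auto
  have L: "(\<lambda>w. \<Sum>Y\<in>J. l Y * Y w) \<in> noise_span" "expectation (\<lambda>w. Z w * (\<Sum>Y\<in>J. l Y * Y w)) = 0"
    if J: "finite J" "J \<subseteq> \<Y>" for J l
  proof -
    show "(\<lambda>w. \<Sum>Y\<in>J. l Y * Y w) \<in> noise_span"
      using J Ysp by (intro noise_span_sum noise_span_scale) auto
    have i: "integrable M (\<lambda>w. Z w * Y w)" if "Y \<in> J" for Y
      using that J Ysp noise_span_integrable_mult[OF future_noise_span[OF Z]] by auto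
    have "expectation (\<lambda>w. Z w * (\<Sum>Y\<in>J. l Y * Y w)) = (\<Sum>Y\<in>J. l Y * expectation (\<lambda>w. Z w * Y w))"
    proof -
      have "(\<lambda>w. Z w * (\<Sum>Y\<in>J. l Y * Y w)) = (\<lambda>w. \<Sum>Y\<in>J. l Y * (Z w * Y w))"
        by (simp add: sum_distrib_left mult.left_commute)
      then show ?thesis using i by simp
    qed
    also have "\<dots> = 0"
      using J future_past_cov[OF Z] unfolding \<Y>_def by (intro sum.neutral) auto
    finally show "expectation (\<lambda>w. Z w * (\<Sum>Y\<in>J. l Y * Y w)) = 0" .
  qed
  have z: "(\<integral>w. indicator N w * f w * g w \<partial>M) = 0" if N: "N \<in> null_sets M" for N and f g :: "'a \<Rightarrow> real"
  proof -
    have "AE w in M. indicator N w * f w * g w = 0"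
      using AE_not_in[OF N] by eventually_elim simp
    then show ?thesis by (rule integral_eq_zero_AE)
  qed
  have sp: "(\<integral>w. indicator (space M) w * f w * g w \<partial>M) = (\<integral>w. f w * g w \<partial>M)" for f g :: "'a \<Rightarrow> real"
    by (rule Bochner_Integration.integral_cong) auto
  have sub: "A \<in> sigma_sets (space M) (\<N> \<union> {Y -` C \<inter> space M | Y C. Y \<in> \<Y> \<and> C \<in> sets borel})"
    using A sigma_sets_mono'[of "noise_events M W s \<union> null_sets M" "\<N> \<union> {Y -` C \<inter> space M | Y C. Y \<in> \<Y> \<and> C \<in> sets borel}" "space M"]
    unfolding raw_events_def noise_events_def \<N>_def \<Y>_def by blast
  have "expectation (\<lambda>w. indicator A w * cos (Z w)) = expectation (\<lambda>w. indicator A w * expectation (\<lambda>w. cos (Z w)))"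
  proof (rule weighted_sigma_unique[OF N Y, where b=1])
    show "\<bar>expectation (\<lambda>w. cos (Z w))\<bar> \<le> 1"
      using centered_gaussian_trig(1)[OF future_gaussian[OF Z]] by simp
  qed (use sub noise_span_trig_factor[OF future_noise_span[OF Z] L] centered_gaussian_trig(2)[OF noise_span_gaussian[OF L(1)]]
      in \<open>auto simp: \<N>_def z sp\<close>)
  then show ?S1
    by simp
  have "expectation (\<lambda>w. indicator A w * sin (Z w)) = expectation (\<lambda>w. indicator A w * 0)"
    by (rule weighted_sigma_unique[OF N Y, where b=1])
       (use sub noise_span_trig_factor[OF future_noise_span[OF Z] L] in \<open>auto simp: \<N>_def z sp\<close>)
  then show "expectation (\<lambda>w. indicator A w * sin (Z w)) = 0" by simp
qed

lemma expectation_abs_le_sqrt: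
  assumes [measurable]: "X \<in> borel_measurable M" and i: "integrable M (\<lambda>w. (X w)\<^sup>2)"
  shows "integrable M X" "expectation (\<lambda>w. \<bar>X w\<bar>) \<le> sqrt (expectation (\<lambda>w. (X w)\<^sup>2))" (is "?S1")
proof -
  show iX: "integrable M X"
    by (rule square_integrable_imp_integrable) (use i in auto)
  have "0 \<le> variance (\<lambda>w. \<bar>X w\<bar>)" by simp
  also have "\<dots> = expectation (\<lambda>w. (X w)\<^sup>2) - (expectation (\<lambda>w. \<bar>X w\<bar>))\<^sup>2"
    by (subst variance_eq) (use i iX in auto)
  finally show ?S1
    by (intro real_le_rsqrt) simp
qed

lemma noise_increment_abs:
  assumes "0 \<le> s" "s \<le> t" "B \<in> finite_borel"
  shows "integrable M (\<lambda>w. \<bar>W t B w - W s B w\<bar>)"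
    "expectation (\<lambda>w. \<bar>W t B w - W s B w\<bar>) \<le> sqrt ((t - s) * measure lborel B)" (is "?S1")
proof -
  have D: "dW s t B \<in> noise_span"
    using assms noise_span_diff noise_span_W by auto
  have "expectation (\<lambda>w. (dW s t B w)\<^sup>2) = (t - s) * measure lborel B"
    using noise_increment_cov[of s t s t B B] assms by (simp add: power2_eq_square)
  then show ?S1
    using expectation_abs_le_sqrt(2)[OF noise_span_measurable[OF D] centered_gaussian_even_moment(1)[OF noise_span_gaussian[OF D]]] by simp
  show "integrable M (\<lambda>w. \<bar>W t B w - W s B w\<bar>)"
    using expectation_abs_le_sqrt(1)[OF noise_span_measurable[OF D] centered_gaussian_even_moment(1)[OF noise_span_gaussian[OF D]]] by simp
qed

text \<open>Events of \<open>\<F> a\<close> are noise events only after \<open>a\<close>, so an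
  increment that starts at \<open>a\<close> itself is out of reach of
  \<open>future_raw_trig\<close>. Delaying its start costs, in \<open>L\<^sup>1\<close>, at most the
  square root of the delay times the measure of the set.\<close>

lemma future_right_approx:
  assumes "Z \<in> future a" "0 \<le> a"
  shows "\<exists>Y. (\<forall>n. Y n \<in> future (a + 1 / real (Suc n))) \<and> (\<lambda>n. expectation (\<lambda>w. \<bar>Y n w - Z w\<bar>)) \<longlonglongrightarrow> 0"
  using assms(1)
proof induction
  case zero
  show ?case by (intro exI[of _ "\<lambda>_ _. 0"]) (auto intro: future.zero)
next
  case (step Z s t B c)
  then obtain Y where Y: "\<And>n. Y n \<in> future (a + 1 / real (Suc n))"
    "(\<lambda>n. expectation (\<lambda>w. \<bar>Y n w - Z w\<bar>)) \<longlonglongrightarrow> 0" by auto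
  define r where "r n = a + 1 / real (Suc n)" for n
  have r: "a \<le> r n" for n by (simp add: r_def)
  \<comment> \<open>Both endpoints are raised to at least \<open>r n\<close>, so that an increment
    which ends before \<open>r n\<close> becomes zero instead of changing sign.\<close>
  define V where "V n w = Y n w + c * (W (max t (r n)) B w - W (max s (r n)) B w)" for n w
  have V: "V n \<in> future (r n)" for n
    unfolding V_def[abs_def] using Y(1)[of n, folded r_def] step.hyps r[of n] \<open>0 \<le> a\<close>
    by (intro future.step) auto
  define b where "b n = expectation (\<lambda>w. \<bar>Y n w - Z w\<bar>) + \<bar>c\<bar> * (2 * sqrt (1 / real (Suc n) * measure lborel B))" for n
  have m: "expectation (\<lambda>w. \<bar>V n w - (Z w + c * dW s t B w)\<bar>) \<le> b n" for n
  proof -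
    have q: "expectation (\<lambda>w. \<bar>W (max q (r n)) B w - W q B w\<bar>) \<le> sqrt (1 / real (Suc n) * measure lborel B)"
        "integrable M (\<lambda>w. \<bar>W (max q (r n)) B w - W q B w\<bar>)" if "q \<ge> a" for q
    proof -
      have le: "sqrt ((max q (r n) - q) * measure lborel B) \<le> sqrt (1 / real (Suc n) * measure lborel B)"
        using that by (intro real_sqrt_le_mono mult_right_mono) (auto simp: r_def max_def)
      then show "expectation (\<lambda>w. \<bar>W (max q (r n)) B w - W q B w\<bar>) \<le> sqrt (1 / real (Suc n) * measure lborel B)"
        "integrable M (\<lambda>w. \<bar>W (max q (r n)) B w - W q B w\<bar>)"
        using order_trans[OF noise_increment_abs(2)[of q "max q (r n)" B] le] noise_increment_abs(1)[of q "max q (r n)" B]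
          that \<open>0 \<le> a\<close> step.hyps by (simp_all only: max.cobounded1)
    qed
    have D: "(\<lambda>w. Y n w - Z w) \<in> noise_span"
      using future_noise_span[OF Y(1)] future_noise_span[OF step.hyps(1)] noise_span_diff by blast
    have i: "integrable M (\<lambda>w. \<bar>Y n w - Z w\<bar>)"
      using expectation_abs_le_sqrt(1)[OF noise_span_measurable[OF D] centered_gaussian_even_moment(1)[OF noise_span_gaussian[OF D]]] by simp
    note [measurable] = V[THEN future_measurable] future_measurable[OF step.hyps(1)]
    have [measurable]: "W t B \<in> borel_measurable M" "W s B \<in> borel_measurable M"
      using step.hyps by (auto intro!: noise_span_measurable noise_span_W)
    have "expectation (\<lambda>w. \<bar>V n w - (Z w + c * dW s t B w)\<bar>) \<le>
      expectation (\<lambda>w. \<bar>Y n w - Z w\<bar> + \<bar>c\<bar> * (\<bar>W (max t (r n)) B w - W t B w\<bar> + \<bar>W (max s (r n)) B w - W s B w\<bar>))"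
    proof (rule integral_mono')
      show "integrable M (\<lambda>w. \<bar>Y n w - Z w\<bar> + \<bar>c\<bar> * (\<bar>W (max t (r n)) B w - W t B w\<bar> + \<bar>W (max s (r n)) B w - W s B w\<bar>))"
        using i q(2)[of t] q(2)[of s] step.hyps by simp
      fix w
      have "V n w - (Z w + c * dW s t B w) = (Y n w - Z w) +
          c * ((W (max t (r n)) B w - W t B w) - (W (max s (r n)) B w - W s B w))"
        by (simp add: V_def algebra_simps)
      also have "\<bar>\<dots>\<bar> \<le> \<bar>Y n w - Z w\<bar> + \<bar>c\<bar> * \<bar>(W (max t (r n)) B w - W t B w) - (W (max s (r n)) B w - W s B w)\<bar>"
        by (metis abs_mult abs_triangle_ineq)
      also have "\<dots> \<le> \<bar>Y n w - Z w\<bar> + \<bar>c\<bar> * (\<bar>W (max t (r n)) B w - W t B w\<bar> + \<bar>W (max s (r n)) B w - W s B w\<bar>)"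
        by (intro add_left_mono mult_left_mono abs_triangle_ineq4) simp
      finally show "\<bar>V n w - (Z w + c * dW s t B w)\<bar> \<le> \<bar>Y n w - Z w\<bar> + \<bar>c\<bar> * (\<bar>W (max t (r n)) B w - W t B w\<bar> + \<bar>W (max s (r n)) B w - W s B w\<bar>)" .
    qed simp
    also have "\<dots> \<le> b n"
      unfolding b_def using i q(2)[of t] q(2)[of s] step.hyps q(1)[of t] q(1)[of s] mult_left_mono[of _ _ "\<bar>c\<bar>"]
      by (simp add: mult_left_mono)
    finally show ?thesis .
  qed
  have "b \<longlonglongrightarrow> 0 + \<bar>c\<bar> * (2 * sqrt (0 * measure lborel B))"
    unfolding b_def by (intro tendsto_intros Y(2) LIMSEQ_inverse_real_of_nat[unfolded inverse_eq_divide])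
  then have "b \<longlonglongrightarrow> 0" by simp
  then have "(\<lambda>n. expectation (\<lambda>w. \<bar>V n w - (Z w + c * dW s t B w)\<bar>)) \<longlonglongrightarrow> 0"
    by (rule Lim_null_comparison[rotated]) (use m in simp)
  then show ?case using V unfolding r_def by (intro exI[of _ V]) auto
qed

text \<open>The factorisation holds for the delayed variables at the times
  \<open>a + 1 / Suc n\<close>, where \<open>A\<close> is a noise event. Sine and cosine are
  1-Lipschitz, so convergence in \<open>L\<^sup>1\<close> suffices to pass to the limit.\<close>

lemma future_filtration_trig:
  assumes Z: "Z \<in> future a" and a: "0 \<le> a" and A: "A \<in> sets (\<F> a)"
  shows "expectation (\<lambda>w. indicator A w * cos (Z w)) = prob A * expectation (\<lambda>w. cos (Z w))" (is "?S1")
    and "expectation (\<lambda>w. indicator A w * sin (Z w)) = 0"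
proof -
  obtain Y where Y: "\<And>n. Y n \<in> future (a + 1 / real (Suc n))"
    "(\<lambda>n. expectation (\<lambda>w. \<bar>Y n w - Z w\<bar>)) \<longlonglongrightarrow> 0"
    using future_right_approx[OF Z a] by auto
  have [measurable]: "A \<in> events" using A filtration_subset by auto
  note [measurable] = Y(1)[THEN future_measurable] future_measurable[OF Z]
  have ib: "integrable M f" if "f \<in> borel_measurable M" "\<And>w. \<bar>f w\<bar> \<le> 1" for f :: "'a \<Rightarrow> real"
    using that by (intro integrable_const_bound[where B=1]) auto
  have iY: "integrable M (\<lambda>w. Y n w - Z w)" for n
  proof -
    have D: "(\<lambda>w. Y n w - Z w) \<in> noise_span"
      using future_noise_span[OF Y(1)] future_noise_span[OF Z] noise_span_diff by blast
    show ?thesis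
      using expectation_abs_le_sqrt(1)[OF noise_span_measurable[OF D] centered_gaussian_even_moment(1)[OF noise_span_gaussian[OF D]]] .
  qed
  have lim: "(\<lambda>n. expectation (\<lambda>w. indicator B w * f (Y n w))) \<longlonglongrightarrow> expectation (\<lambda>w. indicator B w * f (Z w))"
    if [measurable]: "B \<in> events" "f \<in> borel_measurable borel" and f: "\<And>x. \<bar>f x\<bar> \<le> 1" "\<And>x y. \<bar>f x - f y\<bar> \<le> \<bar>x - y\<bar>" for B and f :: "real \<Rightarrow> real"
  proof (rule LIM_zero_cancel, rule Lim_null_comparison[OF _ Y(2)], rule always_eventually, rule allI)
    fix n
    have 1: "\<bar>indicator B w * f x\<bar> \<le> 1" for x w using f(1)[of x] by (simp add: indicator_def)
    have "expectation (\<lambda>w. indicator B w * f (Y n w)) - expectation (\<lambda>w. indicator B w * f (Z w)) =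
       expectation (\<lambda>w. indicator B w * f (Y n w) - indicator B w * f (Z w))"
      by (rule Bochner_Integration.integral_diff[symmetric]) (auto intro!: ib simp: 1)
    also have "norm \<dots> \<le> expectation (\<lambda>w. norm (indicator B w * f (Y n w) - indicator B w * f (Z w)))"
      by (rule integral_norm_bound)
    also have "\<dots> \<le> expectation (\<lambda>w. \<bar>Y n w - Z w\<bar>)"
      by (rule integral_mono') (use iY f(2) in \<open>auto simp: indicator_def\<close>)
    finally show "norm (expectation (\<lambda>w. indicator B w * f (Y n w)) - expectation (\<lambda>w. indicator B w * f (Z w))) \<le> expectation (\<lambda>w. \<bar>Y n w - Z w\<bar>)" .
  qed
  have Lip: "\<bar>cos x - cos y\<bar> \<le> \<bar>x - y\<bar>" "\<bar>sin x - sin y\<bar> \<le> \<bar>x - y\<bar>" for x y :: real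
  proof -
    have h: "\<bar>sin ((x - y) / 2)\<bar> \<le> \<bar>x - y\<bar> / 2" "\<bar>sin ((y - x) / 2)\<bar> \<le> \<bar>x - y\<bar> / 2"
      using abs_sin_x_le_abs_x[of "(x-y)/2"] abs_sin_x_le_abs_x[of "(y-x)/2"] by (simp_all add: abs_minus_commute)
    have "\<bar>cos x - cos y\<bar> = 2 * (\<bar>sin ((x + y) / 2)\<bar> * \<bar>sin ((y - x) / 2)\<bar>)"
      by (simp add: cos_diff_cos abs_mult)
    also have "\<dots> \<le> 2 * (1 * (\<bar>x - y\<bar> / 2))" by (intro mult_left_mono mult_mono h) auto
    finally show "\<bar>cos x - cos y\<bar> \<le> \<bar>x - y\<bar>" by simp
    have "\<bar>sin x - sin y\<bar> = 2 * (\<bar>sin ((x - y) / 2)\<bar> * \<bar>cos ((x + y) / 2)\<bar>)"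
      by (simp add: sin_diff_sin abs_mult)
    also have "\<dots> \<le> 2 * ((\<bar>x - y\<bar> / 2) * 1)" by (intro mult_left_mono mult_mono h) auto
    finally show "\<bar>sin x - sin y\<bar> \<le> \<bar>x - y\<bar>" by simp
  qed
  have raw: "A \<in> raw_events (a + 1 / real (Suc n))" for n
    using A by (rule filtration_raw) simp
  have sp: "expectation (\<lambda>w. indicator (space M) w * f w) = expectation f" for f :: "'a \<Rightarrow> real"
    by (rule Bochner_Integration.integral_cong) auto
  have "(\<lambda>n. expectation (\<lambda>w. indicator A w * cos (Y n w))) \<longlonglongrightarrow> prob A * expectation (\<lambda>w. cos (Z w))"
    unfolding future_raw_trig(1)[OF Y(1) raw]
    using lim[of "space M" cos] Lip by (intro tendsto_mult tendsto_const) (simp add: sp)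
  then show ?S1
    using lim[of A cos] Lip LIMSEQ_unique by auto
  have "(\<lambda>n. expectation (\<lambda>w. indicator A w * sin (Y n w))) \<longlonglongrightarrow> 0"
    unfolding future_raw_trig(2)[OF Y(1) raw] by simp
  then show "expectation (\<lambda>w. indicator A w * sin (Z w)) = 0"
    using lim[of A sin] Lip LIMSEQ_unique by auto
qed

text \<open>Later increments are included because the rectangles of one time slab are treated one after the
  other: the increments over disjoint sets are uncorrelated with \<open>Z\<close> but not in the past.\<close>

definition past_and_uncorrelated :: "real \<Rightarrow> ('a \<Rightarrow> real) \<Rightarrow> 'a measure" where
  "past_and_uncorrelated a Z = sigma (space M) (sets (\<F> a) \<union>
     {Y -` C \<inter> space M | Y C. Y \<in> {Y \<in> future a. expectation (\<lambda>w. Z w * Y w) = 0} \<and> C \<in> sets borel})"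

lemma space_past_and_uncorrelated [simp]: "space (past_and_uncorrelated a Z) = space M"
  and sets_past_and_uncorrelated: "sets (past_and_uncorrelated a Z) = sigma_sets (space M) (sets (\<F> a) \<union>
     {Y -` C \<inter> space M | Y C. Y \<in> {Y \<in> future a. expectation (\<lambda>w. Z w * Y w) = 0} \<and> C \<in> sets borel})"
proof -
  have "sets (\<F> a) \<union> {Y -` C \<inter> space M | Y C. Y \<in> {Y \<in> future a. expectation (\<lambda>w. Z w * Y w) = 0} \<and> C \<in> sets borel} \<subseteq> Pow (space M)"
    using sets.sets_into_space[of _ "\<F> a"] by auto
  then show "space (past_and_uncorrelated a Z) = space M"
   "sets (past_and_uncorrelated a Z) = sigma_sets (space M) (sets (\<F> a) \<union>
     {Y -` C \<inter> space M | Y C. Y \<in> {Y \<in> future a. expectation (\<lambda>w. Z w * Y w) = 0} \<and> C \<in> sets borel})"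
    unfolding past_and_uncorrelated_def by simp_all
qed

lemma measurable_past_and_uncorrelated_past:
  "f \<in> borel_measurable (\<F> a) \<Longrightarrow> f \<in> borel_measurable (past_and_uncorrelated a Z)"
  by (rule measurable_from_subalg[of _ "\<F> a"]) (auto simp: subalgebra_def sets_past_and_uncorrelated)

lemma measurable_past_and_uncorrelated_future:
  assumes "Y \<in> future a" "expectation (\<lambda>w. Z w * Y w) = 0"
  shows "Y \<in> borel_measurable (past_and_uncorrelated a Z)"
  by (rule measurableI) (use assms in \<open>auto simp: sets_past_and_uncorrelated\<close>)

text \<open>Uniqueness of weighted laws is used twice. First the events of the past and the
  uncorrelated variables are the generator, and the weights are trigonometric functions of
  \<open>Z\<close> and their means. Then the indicator of an event from this sigma-algebra is the
  weight and the law of \<open>Z\<close> is the object.\<close>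

lemma future_indep:
  assumes Z: "Z \<in> future a" and a: "0 \<le> a" and Y: "Y \<in> borel_measurable (past_and_uncorrelated a Z)"
  shows "indep_var borel Y borel Z"
proof -
  note [measurable] = future_measurable[OF Z]
  define \<Y> where "\<Y> = {Y \<in> future a. expectation (\<lambda>w. Z w * Y w) = 0}"
  have Ym: "\<Y> \<subseteq> borel_measurable M" unfolding \<Y>_def using future_measurable by auto
  have N: "Int_stable (sets (\<F> a))" "sets (\<F> a) \<subseteq> events" "space M \<in> sets (\<F> a)"
    using filtration_subset sets.top[of "\<F> a"] by (auto simp: sets.Int_stable)
  have S: "sets (past_and_uncorrelated a Z) \<subseteq> events"
    unfolding sets_past_and_uncorrelated \<Y>_def[symmetric] using N(2) Ym
    by (intro sets.sigma_sets_subset) (auto intro: measurable_sets)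
  have ib: "integrable M f" if "f \<in> borel_measurable M" "\<And>w. \<bar>f w\<bar> \<le> 1" for f :: "'a \<Rightarrow> real"
    using that by (intro integrable_const_bound[where B=1]) auto
  have L: "(\<lambda>w. \<Sum>Y\<in>J. l Y * Y w) \<in> future a" "expectation (\<lambda>w. (\<theta> * Z w) * (\<Sum>Y\<in>J. l Y * Y w)) = 0"
    if J: "finite J" "J \<subseteq> \<Y>" for J l \<theta>
  proof -
    show "(\<lambda>w. \<Sum>Y\<in>J. l Y * Y w) \<in> future a"
      using J unfolding \<Y>_def by (intro future_sum future_scale) auto
    have i: "integrable M (\<lambda>w. Z w * Y w)" if "Y \<in> J" for Y
      using that J future_noise_span noise_span_integrable_mult[OF future_noise_span[OF Z]] unfolding \<Y>_def by auto
    have "expectation (\<lambda>w. (\<theta> * Z w) * (\<Sum>Y\<in>J. l Y * Y w)) = (\<Sum>Y\<in>J. (\<theta> * l Y) * expectation (\<lambda>w. Z w * Y w))"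
    proof -
      have "(\<lambda>w. (\<theta> * Z w) * (\<Sum>Y\<in>J. l Y * Y w)) = (\<lambda>w. \<Sum>Y\<in>J. (\<theta> * l Y) * (Z w * Y w))"
        by (simp add: sum_distrib_left mult_ac)
      then show ?thesis using i by simp
    qed
    also have "\<dots> = 0"
      using J unfolding \<Y>_def by (intro sum.neutral) auto
    finally show "expectation (\<lambda>w. (\<theta> * Z w) * (\<Sum>Y\<in>J. l Y * Y w)) = 0" .
  qed
  \<comment> \<open>\<open>\<theta> * Z + L\<close> and \<open>\<theta> * Z - L\<close> are again
    future variables, so the indicator of \<open>A\<close> separates from their sines and cosines;
    afterwards \<open>\<theta> * Z\<close> and \<open>L\<close> separate because they are
    uncorrelated.\<close>
  have T: "expectation (\<lambda>w. indicator A w * cos (\<theta> * Z w) * cos (L w)) =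
       expectation (\<lambda>w. indicator A w * expectation (\<lambda>w. cos (\<theta> * Z w)) * cos (L w))" (is ?A)
    "expectation (\<lambda>w. indicator A w * cos (\<theta> * Z w) * sin (L w)) =
       expectation (\<lambda>w. indicator A w * expectation (\<lambda>w. cos (\<theta> * Z w)) * sin (L w))" (is ?B)
    "expectation (\<lambda>w. indicator A w * sin (\<theta> * Z w) * cos (L w)) = 0" (is ?C)
    "expectation (\<lambda>w. indicator A w * sin (\<theta> * Z w) * sin (L w)) = 0" (is ?D)
    if A: "A \<in> sets (\<F> a)" and Lf: "L \<in> future a" and c: "expectation (\<lambda>w. (\<theta> * Z w) * L w) = 0" for A L \<theta>
  proof -
    have [measurable]: "A \<in> events" using A N by auto
    note [measurable] = future_measurable[OF Lf]
    have Zt: "(\<lambda>w. \<theta> * Z w) \<in> future a" using Z future_scale by blast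
    note F = noise_span_trig_factor[OF future_noise_span[OF Zt] future_noise_span[OF Lf] c]
    note p = future_filtration_trig[OF future_add[OF Zt Lf] a A] future_filtration_trig[OF future_diff[OF Zt Lf] a A]
    note q = future_filtration_trig[OF Lf a A]
    have tr: "cos p * cos q = (cos (p + q) + cos (p - q)) / 2"
       "cos p * sin q = (sin (p + q) - sin (p - q)) / 2"
       "sin p * cos q = (sin (p + q) + sin (p - q)) / 2"
       "sin p * sin q = (cos (p - q) - cos (p + q)) / 2" for p q :: real
      unfolding cos_add sin_add cos_diff sin_diff by (simp_all add: algebra_simps)
    have jb: "integrable M (\<lambda>w. indicator A w * f w)" if "f \<in> borel_measurable M" "\<And>w. \<bar>f w\<bar> \<le> 1" for f :: "'a \<Rightarrow> real"
      using that by (intro ib) (auto simp: indicator_def)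
    have 1: "expectation (\<lambda>w. indicator A w * (cos (\<theta> * Z w) * cos (L w))) = prob A * expectation (\<lambda>w. cos (\<theta> * Z w) * cos (L w))"
      "expectation (\<lambda>w. indicator A w * (cos (\<theta> * Z w) * sin (L w))) = 0"
      "expectation (\<lambda>w. indicator A w * (sin (\<theta> * Z w) * cos (L w))) = 0"
      "expectation (\<lambda>w. indicator A w * (sin (\<theta> * Z w) * sin (L w))) = prob A * expectation (\<lambda>w. sin (\<theta> * Z w) * sin (L w))"
      unfolding tr using p by (simp_all add: jb ib distrib_left right_diff_distrib)
    have k: "expectation (\<lambda>w. indicator A w * k * f w) = k * expectation (\<lambda>w. indicator A w * f w)" for k and f :: "'a \<Rightarrow> real"
      by (subst integral_mult_right_zero[symmetric]) (simp add: mult_ac)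
    show ?A using 1(1) q(1) unfolding F k by (simp add: mult_ac)
    show ?B using 1(2) q(2) unfolding k by (simp add: mult_ac)
    show ?C using 1(3) by (simp add: mult_ac)
    show ?D using 1(4) unfolding F by (simp add: mult_ac)
  qed
  have P: "prob (B \<inter> (Z -` C \<inter> space M)) = prob B * prob (Z -` C \<inter> space M)"
    if B: "B \<in> sets (past_and_uncorrelated a Z)" and [measurable]: "C \<in> sets borel" for B C
  proof -
    have [measurable]: "B \<in> events" using B S by auto
    have Bs: "B \<in> sigma_sets (space M) (sets (\<F> a) \<union> {Y -` C \<inter> space M | Y C. Y \<in> \<Y> \<and> C \<in> sets borel})"
      using B unfolding sets_past_and_uncorrelated \<Y>_def .
    have 1: "expectation (\<lambda>w. indicator B w * cos (\<theta> * Z w)) = expectation (\<lambda>w. indicator B w * expectation (\<lambda>w. cos (\<theta> * Z w)))" for \<theta>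
    proof (rule weighted_sigma_unique[OF N Ym _ _ _ _ _ _ Bs, where b=1])
      show "\<bar>expectation (\<lambda>w. cos (\<theta> * Z w))\<bar> \<le> 1"
        using centered_gaussian_trig(1)[OF future_gaussian[OF future_scale[OF Z, of \<theta>]]] by simp
    qed (auto intro!: T L)
    have 2: "expectation (\<lambda>w. indicator B w * sin (\<theta> * Z w)) = expectation (\<lambda>w. indicator B w * 0)" for \<theta>
      by (rule weighted_sigma_unique[OF N Ym _ _ _ _ _ _ Bs, where b=1])
         (use T L in \<open>auto\<close>)
    have 3: "expectation (\<lambda>w. sin (\<theta> * Z w)) = 0" for \<theta>
      using centered_gaussian_trig(2)[OF future_gaussian[OF future_scale[OF Z, of \<theta>]]] by simp
    \<comment> \<open>Second use: the characteristic function of \<open>Z\<close> weighted by the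
      indicator of \<open>B\<close> is that of \<open>Z\<close> times \<open>prob B\<close>.\<close>
    have "expectation (\<lambda>w. indicator B w * indicator C (Z w)) = expectation (\<lambda>w. prob B * indicator C (Z w))"
    proof (rule weighted_law_unique[OF prob_space_axioms, where b=1])
      show "\<bar>indicator B w :: real\<bar> \<le> 1" for w by (simp add: indicator_def)
    qed (use 1 2 3 in auto)
    moreover have "expectation (\<lambda>w. indicator B w * indicator C (Z w)) = prob (B \<inter> (Z -` C \<inter> space M))"
      by (subst Bochner_Integration.integral_cong[OF refl, of M _ "indicator (B \<inter> (Z -` C \<inter> space M))"]) (auto simp: indicator_def)
    moreover have "expectation (\<lambda>w. indicator C (Z w)) = prob (Z -` C \<inter> space M)"
      by (subst Bochner_Integration.integral_cong[OF refl, of M _ "indicator (Z -` C \<inter> space M)"]) (auto simp: indicator_def)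
    ultimately show ?thesis by simp
  qed
  have Yev: "Y -` A \<inter> space M \<in> sets (past_and_uncorrelated a Z)" if "A \<in> sets borel" for A
    using measurable_sets[OF Y that] by simp
  have Ymeas: "Y \<in> borel_measurable M"
    by (rule measurable_from_subalg[OF _ Y]) (auto simp: subalgebra_def S)
  have "indep_set {Y -` A \<inter> space M | A. A \<in> sets borel} {Z -` A \<inter> space M | A. A \<in> sets borel}"
    unfolding indep_sets2_eq using Yev S P by auto
  moreover have "Int_stable {X -` A \<inter> space M | A. A \<in> sets (borel :: real measure)}" for X :: "'a \<Rightarrow> real"
  proof (rule Int_stableI, clarify)
    fix A B :: "real set" assume "A \<in> sets borel" "B \<in> sets borel"
    then show "\<exists>C. X -` A \<inter> space M \<inter> (X -` B \<inter> space M) = X -` C \<inter> space M \<and> C \<in> sets borel"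
      by (intro exI[of _ "A \<inter> B"]) auto
  qed
  ultimately show ?thesis
    unfolding indep_var_eq using Ymeas indep_set_sigma_sets by simp
qed

text \<open>All later uses of independence go through this product formula, with \<open>g\<close> a
  power or a centred power.\<close>

lemma future_expectation_mult:
  fixes Y :: "'a \<Rightarrow> real" and g :: "real \<Rightarrow> real"
  assumes Z: "Z \<in> future a" and a: "0 \<le> a" and Y: "Y \<in> borel_measurable (past_and_uncorrelated a Z)"
    and [measurable]: "g \<in> borel_measurable borel" and i: "integrable M Y" "integrable M (\<lambda>w. g (Z w))"
  shows "integrable M (\<lambda>w. Y w * g (Z w))"
    and "expectation (\<lambda>w. Y w * g (Z w)) = expectation Y * expectation (\<lambda>w. g (Z w))" (is "?S1")
proof -
  have "indep_var borel ((\<lambda>x. x) \<circ> Y) borel (g \<circ> Z)"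
    by (rule indep_var_compose[OF future_indep[OF Z a Y]]) simp_all
  then have *: "indep_var borel Y borel (\<lambda>w. g (Z w))" by (simp add: comp_def)
  show "integrable M (\<lambda>w. Y w * g (Z w))" by (rule indep_var_integrable[OF * i])
  show ?S1
    by (rule indep_var_lebesgue_integral[OF * i])
qed

end

section \<open>Simple Walsh integrals\<close>

lemma field_measure_projections [measurable]:
  "fst \<in> borel_measurable (field_measure M)"
  "(\<lambda>z. fst (snd z)) \<in> borel_measurable (field_measure M)"
  "(\<lambda>z. snd (snd z)) \<in> measurable (field_measure M) M"
proof -
  have "(\<lambda>x. x) \<in> measurable (restrict_space lborel {0..}) borel"
    by (rule measurable_restrict_space1) simp
  then show "fst \<in> borel_measurable (field_measure M)"
    unfolding field_measure_def using measurable_compose[OF measurable_fst] by blast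
  show "(\<lambda>z. fst (snd z)) \<in> borel_measurable (field_measure M)" "(\<lambda>z. snd (snd z)) \<in> measurable (field_measure M) M"
    unfolding field_measure_def by measurable
qed

lemma nn_integral_field_measure:
  assumes "prob_space M" and f: "f \<in> borel_measurable (field_measure M)"
  shows "(\<integral>\<^sup>+z. f z \<partial>field_measure M) = (\<integral>\<^sup>+s\<in>{0..}. (\<integral>\<^sup>+y. (\<integral>\<^sup>+w. f (s, y, w) \<partial>M) \<partial>lborel) \<partial>lborel)"
proof -
  interpret prob_space M by fact
  interpret P: pair_sigma_finite lborel M ..
  have Q: "sigma_finite_measure (lborel \<Otimes>\<^sub>M M)"
    by (rule sigma_finite_pair_measure) unfold_locales
  have f': "f \<in> borel_measurable (restrict_space lborel {0..} \<Otimes>\<^sub>M (lborel \<Otimes>\<^sub>M M))"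
    using f by (simp add: field_measure_def)
  have "(\<integral>\<^sup>+z. f z \<partial>field_measure M) = (\<integral>\<^sup>+s. (\<integral>\<^sup>+p. f (s, p) \<partial>(lborel \<Otimes>\<^sub>M M)) \<partial>restrict_space lborel {0..})"
    unfolding field_measure_def by (rule sigma_finite_measure.nn_integral_fst[OF Q f', symmetric])
  also have "\<dots> = (\<integral>\<^sup>+s\<in>{0..}. (\<integral>\<^sup>+p. f (s, p) \<partial>(lborel \<Otimes>\<^sub>M M)) \<partial>lborel)"
    by (subst nn_integral_restrict_space) auto
  also have "\<dots> = (\<integral>\<^sup>+s\<in>{0..}. (\<integral>\<^sup>+y. (\<integral>\<^sup>+w. f (s, y, w) \<partial>M) \<partial>lborel) \<partial>lborel)"
  proof (intro nn_integral_cong, goal_cases)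
    case (1 s)
    have "(\<integral>\<^sup>+p. f (s, p) \<partial>(lborel \<Otimes>\<^sub>M M)) = (\<integral>\<^sup>+y. (\<integral>\<^sup>+w. f (s, y, w) \<partial>M) \<partial>lborel)" if "s \<in> {0..}"
    proof -
      have "(\<lambda>p. f (s, p)) \<in> borel_measurable (lborel \<Otimes>\<^sub>M M)"
        by (rule measurable_compose[OF _ f'], rule measurable_Pair1') (use that in \<open>simp add: space_restrict_space\<close>)
      then show ?thesis by (rule nn_integral_fst[symmetric])
    qed
    then show ?case by (cases "s \<in> {0..}") auto
  qed
  finally show ?thesis .
qed

text \<open>The second moment of \<open>t X - Y\<close> is nonnegative for all \<open>t\<close>; its
  minimum is at \<open>t = z / x\<close>. If \<open>x = 0\<close> it is affine in \<open>t\<close>,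
  and for \<open>z \<noteq> 0\<close> the value at \<open>(y + 1) / (2 z)\<close> would be
  -1.\<close>

lemma (in prob_space) expectation_Cauchy_Schwarz:
  fixes X Y :: "'a \<Rightarrow> real"
  assumes [measurable]: "X \<in> borel_measurable M" "Y \<in> borel_measurable M"
    and i: "integrable M (\<lambda>w. (X w)\<^sup>2)" "integrable M (\<lambda>w. (Y w)\<^sup>2)"
  shows "integrable M (\<lambda>w. X w * Y w)"
    and "expectation (\<lambda>w. X w * Y w) \<le> sqrt (expectation (\<lambda>w. (X w)\<^sup>2)) * sqrt (expectation (\<lambda>w. (Y w)\<^sup>2))"
proof -
  have ab: "\<bar>a * b\<bar> \<le> \<bar>a\<^sup>2 + b\<^sup>2\<bar>" for a b :: real
    using sum_squares_bound[of "\<bar>a\<bar>" "\<bar>b\<bar>"] abs_ge_zero[of "a * b"] unfolding abs_mult power2_abs by linarith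
  show XY: "integrable M (\<lambda>w. X w * Y w)"
    by (rule Bochner_Integration.integrable_bound[of M "\<lambda>w. (X w)\<^sup>2 + (Y w)\<^sup>2"]) (use i ab in auto)
  define x y z where "x = expectation (\<lambda>w. (X w)\<^sup>2)" and "y = expectation (\<lambda>w. (Y w)\<^sup>2)"
    and "z = expectation (\<lambda>w. X w * Y w)"
  have "0 \<le> expectation (\<lambda>w. (t * X w - Y w)\<^sup>2)" for t by simp
  also have "expectation (\<lambda>w. (t * X w - Y w)\<^sup>2) = t\<^sup>2 * x + y - 2 * t * z" for t
    unfolding power2_diff using i XY by (simp add: power_mult_distrib mult.assoc x_def y_def z_def)
  finally have q: "0 \<le> t\<^sup>2 * x + y - 2 * t * z" for t .
  have xy: "x \<ge> 0" "y \<ge> 0" by (simp_all add: x_def y_def)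
  have "z\<^sup>2 \<le> x * y"
  proof (cases "x = 0")
    case True
    have "z = 0"
    proof (rule ccontr)
      assume "z \<noteq> 0"
      then show False using q[of "(y + 1) / (2 * z)"] True by (simp add: field_simps)
    qed
    then show ?thesis using xy by simp
  next
    case False
    then have x0: "x > 0" using xy by simp
    have "0 \<le> x * ((z/x)\<^sup>2 * x + y - 2 * (z/x) * z)" using q[of "z/x"] xy by (intro mult_nonneg_nonneg)
    also have "\<dots> = x * y - z\<^sup>2" using x0 by (simp add: field_simps power2_eq_square)
    finally show ?thesis by simp
  qed
  then have "\<bar>z\<bar> \<le> sqrt (x * y)" by (metis real_sqrt_abs real_sqrt_le_mono)
  then show "z \<le> sqrt x * sqrt y" by (simp add: real_sqrt_mult)
qed

context white_noise
begin

declare Int_greaterThanAtMost [simp del]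

text \<open>Polarisation: the product formula handles a function of a single Gaussian variable, and
  \<open>Z Z'\<close> is a difference of squares of \<open>Z + Z'\<close> and
  \<open>Z - Z'\<close>.\<close>

lemma future_product_expectation:
  assumes Y: "Y \<in> borel_measurable (\<F> c)" and iY: "integrable M Y" and c: "0 \<le> c"
    and Z: "Z \<in> future c" and Z': "Z' \<in> future c"
  shows "integrable M (\<lambda>w. Y w * (Z w * Z' w))"
    and "expectation (\<lambda>w. Y w * (Z w * Z' w)) = expectation Y * expectation (\<lambda>w. Z w * Z' w)" (is "?S1")
proof -
  note g = centered_gaussian_even_moment(1)[OF future_gaussian]
  have 1: "integrable M (\<lambda>w. Y w * (V w)\<^sup>2) \<and> expectation (\<lambda>w. Y w * (V w)\<^sup>2) = expectation Y * expectation (\<lambda>w. (V w)\<^sup>2)"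
    if V: "V \<in> future c" for V
    using future_expectation_mult[OF V c measurable_past_and_uncorrelated_past[OF Y], of "\<lambda>x. x\<^sup>2"] iY g[OF V, of 2] by simp
  note p = 1[OF future_add[OF Z Z']] 1[OF future_diff[OF Z Z']]
  have e: "Z w * Z' w = ((Z w + Z' w)\<^sup>2 - (Z w - Z' w)\<^sup>2) / 4" for w
    by (simp add: power2_eq_square algebra_simps)
  show "integrable M (\<lambda>w. Y w * (Z w * Z' w))"
    unfolding e using p by (simp add: right_diff_distrib)
  show ?S1
    unfolding e using p g[OF future_add[OF Z Z'], of 2] g[OF future_diff[OF Z Z'], of 2]
    by (simp add: right_diff_distrib diff_divide_distrib)
qed

lemma future_mean_zero:
  assumes Y: "Y \<in> borel_measurable (\<F> c)" and iY: "integrable M Y" and c: "0 \<le> c" and Z: "Z \<in> future c"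
  shows "integrable M (\<lambda>w. Y w * Z w)" and "expectation (\<lambda>w. Y w * Z w) = 0"
  using future_expectation_mult[OF Z c measurable_past_and_uncorrelated_past[OF Y], of "\<lambda>x. x"] iY
    centered_gaussian_even_moment(1)[OF future_gaussian[OF Z], of 1] centered_gaussian_moments(1)[OF future_gaussian[OF Z]]
  by simp_all

text \<open>The increment that starts first is cut at \<open>c = min b a'\<close>. Its part before
  \<open>c\<close> is known at time \<open>a'\<close>, so its product with the other increment has
  mean zero. The rest is zero or starts at \<open>a'\<close>; there both increments are independent
  of the coefficients, and their covariance is the area of the overlap.\<close>

lemma simple_pair_expectation_le:
  assumes \<xi>: "\<xi> \<in> borel_measurable (\<F> a)" "\<And>w. w \<in> space M \<Longrightarrow> \<bar>\<xi> w\<bar> \<le> K" and \<xi>': "\<xi>' \<in> borel_measurable (\<F> a')" "\<And>w. w \<in> space M \<Longrightarrow> \<bar>\<xi>' w\<bar> \<le> K'"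
    and a: "0 \<le> a" "a \<le> b" "a' \<le> b'" and B: "B \<in> finite_borel" "B' \<in> finite_borel" and le: "a \<le> a'"
  shows "integrable M (\<lambda>w. (\<xi> w * dW a b B w) * (\<xi>' w * dW a' b' B' w))" (is "?S1")
    and "expectation (\<lambda>w. (\<xi> w * dW a b B w) * (\<xi>' w * dW a' b' B' w)) =
      expectation (\<lambda>w. \<xi> w * \<xi>' w) * (measure lborel ({a<..b} \<inter> {a'<..b'}) * measure lborel (B \<inter> B'))" (is "?S2")
proof -
  define c where "c = min b a'"
  have c: "a \<le> c" "c \<le> a'" "c \<le> b" using a le by (auto simp: c_def)
  note [measurable] = \<xi>'(1) filtration_measurable_mono[OF \<xi>(1) le]
  have [measurable]: "W c B \<in> borel_measurable (\<F> a')" "W a B \<in> borel_measurable (\<F> a')"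
    using c a le B by (auto intro!: filtration_W)
  have "(\<lambda>w. \<xi> w * \<xi>' w) \<in> borel_measurable (\<F> a')" by simp
  note X = filtration_measurable[OF this]
  have iX: "integrable M (\<lambda>w. \<xi> w * \<xi>' w)"
    by (intro integrable_const_bound[where B="K * K'"] AE_I2 X)
       (use \<xi>(2) \<xi>'(2) in \<open>auto simp: abs_mult intro!: mult_mono intro: order.trans[OF abs_ge_zero]\<close>)
  have inc: "dW a c B \<in> noise_span"
    using a c B le by (intro noise_span_diff noise_span_W) auto
  have D: "dW a' b' B' \<in> future a'"
    using a le B by (intro future_increment) auto
  let ?Y = "\<lambda>w. \<xi> w * \<xi>' w * dW a c B w"
  have iY: "integrable M ?Y"
  proof (rule Bochner_Integration.integrable_bound)
    show "integrable M (\<lambda>w. (K * K') * dW a c B w)"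
      using centered_gaussian_even_moment(1)[OF noise_span_gaussian[OF inc], of 1] by simp
    show "?Y \<in> borel_measurable M"
      by (rule borel_measurable_times[OF X noise_span_measurable[OF inc]])
    show "AE w in M. norm (?Y w) \<le> norm ((K * K') * dW a c B w)"
    proof (intro AE_I2)
      fix w assume "w \<in> space M"
      then have "\<bar>\<xi> w\<bar> * \<bar>\<xi>' w\<bar> \<le> \<bar>K\<bar> * \<bar>K'\<bar>"
        using \<xi>(2)[of w] \<xi>'(2)[of w] by (intro mult_mono) auto
      then show "norm (?Y w) \<le> norm ((K * K') * dW a c B w)"
        by (simp add: abs_mult mult_right_mono)
    qed
  qed
  have Ym: "?Y \<in> borel_measurable (\<F> a')" by measurable
  have a'0: "0 \<le> a'" using a le by simp
  note one = future_mean_zero[OF Ym iY a'0 D]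
  have E: "dW c b B \<in> future a' \<and>
     expectation (\<lambda>w. dW c b B w * dW a' b' B' w) = measure lborel ({a<..b} \<inter> {a'<..b'}) * measure lborel (B \<inter> B')"
  proof (cases "b \<le> a'")
    case True
    then have "c = b" by (simp add: c_def)
    moreover have "{a<..b} \<inter> {a'<..b'} = {}" using True by auto
    ultimately show ?thesis by (simp add: future.zero)
  next
    case False
    then have [simp]: "c = a'" by (simp add: c_def)
    have "{a<..b} \<inter> {a'<..b'} = {a'<..b} \<inter> {a'<..b'}" using le by auto
    then show ?thesis using noise_increment_cov[of a' b a' b' B B'] False a le B
      by (simp add: future_increment)
  qed
  have XF: "(\<lambda>w. \<xi> w * \<xi>' w) \<in> borel_measurable (\<F> a')" by simp
  note two = future_product_expectation[OF XF iX a'0 conjunct1[OF E] D]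
  have e: "(\<xi> w * dW a b B w) * (\<xi>' w * dW a' b' B' w) =
      ?Y w * dW a' b' B' w + \<xi> w * \<xi>' w * (dW c b B w * dW a' b' B' w)" for w
    by (simp add: algebra_simps)
  show ?S1
    unfolding e using one two by simp
  show ?S2
    unfolding e using one two E by simp
qed

lemma simple_pair_expectation:
  assumes \<xi>: "\<xi> \<in> borel_measurable (\<F> a)" "\<And>w. w \<in> space M \<Longrightarrow> \<bar>\<xi> w\<bar> \<le> K" and \<xi>': "\<xi>' \<in> borel_measurable (\<F> a')" "\<And>w. w \<in> space M \<Longrightarrow> \<bar>\<xi>' w\<bar> \<le> K'"
    and a: "0 \<le> a" "a \<le> b" "0 \<le> a'" "a' \<le> b'" and B: "B \<in> finite_borel" "B' \<in> finite_borel"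
  shows "integrable M (\<lambda>w. (\<xi> w * dW a b B w) * (\<xi>' w * dW a' b' B' w))" (is "?S1")
    and "expectation (\<lambda>w. (\<xi> w * dW a b B w) * (\<xi>' w * dW a' b' B' w)) =
      expectation (\<lambda>w. \<xi> w * \<xi>' w) * (measure lborel ({a<..b} \<inter> {a'<..b'}) * measure lborel (B \<inter> B'))" (is "?S2")
proof -
  have "integrable M (\<lambda>w. (\<xi> w * dW a b B w) * (\<xi>' w * dW a' b' B' w)) \<and>
    expectation (\<lambda>w. (\<xi> w * dW a b B w) * (\<xi>' w * dW a' b' B' w)) =
      expectation (\<lambda>w. \<xi> w * \<xi>' w) * (measure lborel ({a<..b} \<inter> {a'<..b'}) * measure lborel (B \<inter> B'))"
  proof (cases "a \<le> a'")
    case True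
    show ?thesis using simple_pair_expectation_le[OF \<xi> \<xi>' a(1,2,4) B True] by blast
  next
    case False
    then have "a' \<le> a" by simp
    from simple_pair_expectation_le[OF \<xi>' \<xi> a(3,4,2) B(2,1) this] show ?thesis
      by (simp add: mult.commute[of "\<xi>' _"] mult.commute[of "\<xi>' _ * _"] Int_commute)
         (simp add: mult_ac)
  qed
  then show ?S1
    ?S2
    by auto
qed

abbreviation simple :: "'a simple_field \<Rightarrow> bool" where "simple \<equiv> is_simple_field M W"
abbreviation "sval \<equiv> simple_field_value"
abbreviation "sint \<equiv> simple_field_integral W"

lemma simple_field_value_nth:
  "sval S s y w = (\<Sum>i<length S. fst (S ! i) w * indicator {fst (snd (S ! i))<..fst (snd (snd (S ! i)))} s *
    indicator (snd (snd (snd (S ! i)))) y)"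
  unfolding simple_field_value_def by (subst sum_list_sum_nth) (auto simp: case_prod_beta atLeast0LessThan)

lemma simple_field_integral_nth:
  "sint S w = (\<Sum>i<length S. fst (S ! i) w *
    (W (fst (snd (snd (S ! i)))) (snd (snd (snd (S ! i)))) w - W (fst (snd (S ! i))) (snd (snd (snd (S ! i)))) w))"
  unfolding simple_field_integral_def by (subst sum_list_sum_nth) (auto simp: case_prod_beta atLeast0LessThan)

lemma simple_nth:
  assumes "simple S" "i \<in> {..<length S}"
  shows "\<exists>\<xi> a b B K. S ! i = (\<xi>, a, b, B) \<and> 0 \<le> a \<and> a \<le> b \<and> B \<in> finite_borel \<and>
    \<xi> \<in> borel_measurable (\<F> a) \<and> (\<forall>w\<in>space M. \<bar>\<xi> w\<bar> \<le> K)"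
proof -
  obtain \<xi> a b B where e: "S ! i = (\<xi>, a, b, B)" by (cases "S ! i") auto
  then have "(\<xi>, a, b, B) \<in> set S" using assms(2) nth_mem by force
  then show ?thesis using assms(1) e unfolding is_simple_field_def by blast
qed

lemma finite_borelD: "B \<in> finite_borel \<Longrightarrow> B \<in> sets borel" "B \<in> finite_borel \<Longrightarrow> emeasure lborel B < \<infinity>"
  by (auto simp: finite_borel_def)

lemma simple_append: "simple S \<Longrightarrow> simple T \<Longrightarrow> simple (S @ T)"
  unfolding is_simple_field_def by auto

lemma simple_field_value_append:
  "sval (S @ T) s y w = sval S s y w + sval T s y w"
  by (simp add: simple_field_value_def)

lemma simple_field_integral_append:
  "sint (S @ T) w = sint S w + sint T w"
  by (simp add: simple_field_integral_def)

definition simple_uminus :: "'a simple_field \<Rightarrow> 'a simple_field" where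
  "simple_uminus = map (\<lambda>(\<xi>, r). (\<lambda>w. - \<xi> w, r))"

lemma simple_simple_uminus: "simple S \<Longrightarrow> simple (simple_uminus S)"
  unfolding is_simple_field_def simple_uminus_def by fastforce

lemma simple_field_value_uminus: "sval (simple_uminus S) s y w = - sval S s y w"
  by (induction S) (auto simp: simple_field_value_def simple_uminus_def)

lemma simple_field_integral_uminus: "sint (simple_uminus S) w = - sint S w"
  by (induction S) (auto simp: simple_field_integral_def simple_uminus_def)

lemma simple_field_value_measurable:
  assumes "simple S"
  shows "(\<lambda>(s, y, w). sval S s y w) \<in> borel_measurable (field_measure M)"
  unfolding simple_field_value_nth case_prod_beta'
proof (intro borel_measurable_sum)
  fix i assume "i \<in> {..<length S}"
  then obtain \<xi> a b B where S: "S ! i = (\<xi>, a, b, B)" "B \<in> finite_borel" "\<xi> \<in> borel_measurable (\<F> a)"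
    using simple_nth[OF assms] by blast
  have [measurable]: "\<xi> \<in> borel_measurable M" "B \<in> sets borel" using S filtration_measurable finite_borelD by auto
  show "(\<lambda>x. fst (S ! i) (snd (snd x)) * indicator {fst (snd (S ! i))<..fst (snd (snd (S ! i)))} (fst x) *
      indicator (snd (snd (snd (S ! i)))) (fst (snd x)) :: real) \<in> borel_measurable (field_measure M)"
    unfolding S fst_conv snd_conv by measurable
qed

lemma simple_field_integral_measurable:
  assumes "simple S"
  shows "sint S \<in> borel_measurable M"
  unfolding simple_field_integral_nth[abs_def]
proof (intro borel_measurable_sum)
  fix i assume "i \<in> {..<length S}"
  then obtain \<xi> a b B where S: "S ! i = (\<xi>, a, b, B)" "0 \<le> a" "a \<le> b" "B \<in> finite_borel" "\<xi> \<in> borel_measurable (\<F> a)"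
    using simple_nth[OF assms] by blast
  have [measurable]: "\<xi> \<in> borel_measurable M" "W a B \<in> borel_measurable M" "W b B \<in> borel_measurable M"
    using S filtration_measurable[OF S(5)] noise_span_measurable[OF noise_span_W] by auto
  show "(\<lambda>w. fst (S ! i) w * (W (fst (snd (snd (S ! i)))) (snd (snd (snd (S ! i)))) w - W (fst (snd (S ! i))) (snd (snd (snd (S ! i)))) w)) \<in> borel_measurable M"
    unfolding S by simp
qed

text \<open>The elements of the list may overlap, so both sides are expanded into double sums.\<close>

lemma simple_isometry:
  assumes S: "simple S"
  shows "integrable M (\<lambda>w. (sint S w)\<^sup>2)"
    and "nnE (\<lambda>w. (sint S w)\<^sup>2) = field_sq_norm M (sval S)" (is "?S1")
    and "field_sq_norm M (sval S) < \<infinity>"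
proof -
  define \<xi> a b B where "\<xi> i = fst (S ! i)" and "a i = fst (snd (S ! i))" and "b i = fst (snd (snd (S ! i)))"
     and "B i = snd (snd (snd (S ! i)))" for i
  let ?I = "{..<length S}"
  have ab: "0 \<le> a i" "a i \<le> b i" "B i \<in> finite_borel" "\<xi> i \<in> borel_measurable (\<F> (a i))" "\<exists>K. \<forall>w\<in>space M. \<bar>\<xi> i w\<bar> \<le> K" if i: "i \<in> ?I" for i
  proof -
    obtain x y z C K where "S ! i = (x, y, z, C)" "0 \<le> y" "y \<le> z" "C \<in> finite_borel" "x \<in> borel_measurable (\<F> y)"
      and K: "\<forall>w\<in>space M. \<bar>x w\<bar> \<le> K"
      using simple_nth[OF S i] by blast
    then show "0 \<le> a i" "a i \<le> b i" "B i \<in> finite_borel" "\<xi> i \<in> borel_measurable (\<F> (a i))" "\<exists>K. \<forall>w\<in>space M. \<bar>\<xi> i w\<bar> \<le> K"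
      using exI[of "\<lambda>K. \<forall>w\<in>space M. \<bar>x w\<bar> \<le> K", OF K] unfolding \<xi>_def a_def b_def B_def by simp_all
  qed
  define e where "e i j = expectation (\<lambda>w. \<xi> i w * \<xi> j w)" for i j
  define l where "l i j = measure lborel ({a i<..b i} \<inter> {a j<..b j})" for i j
  define m where "m i j = measure lborel (B i \<inter> B j)" for i j
  have pr: "integrable M (\<lambda>w. (\<xi> i w * dW (a i) (b i) (B i) w) * (\<xi> j w * dW (a j) (b j) (B j) w)) \<and>
     expectation (\<lambda>w. (\<xi> i w * dW (a i) (b i) (B i) w) * (\<xi> j w * dW (a j) (b j) (B j) w)) =
     e i j * (l i j * m i j)" if ij: "i \<in> ?I" "j \<in> ?I" for i j
  proof -
    obtain K K' where "\<And>w. w \<in> space M \<Longrightarrow> \<bar>\<xi> i w\<bar> \<le> K" "\<And>w. w \<in> space M \<Longrightarrow> \<bar>\<xi> j w\<bar> \<le> K'"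
      using ab(5)[OF ij(1)] ab(5)[OF ij(2)] by blast
    from simple_pair_expectation[OF ab(4)[OF ij(1)] this(1) ab(4)[OF ij(2)] this(2) ab(1,2)[OF ij(1)] ab(1,2)[OF ij(2)] ab(3)[OF ij(1)] ab(3)[OF ij(2)]]
    show ?thesis unfolding e_def l_def m_def by blast
  qed
  have sq: "(sint S w)\<^sup>2 = (\<Sum>i\<in>?I. \<Sum>j\<in>?I. (\<xi> i w * dW (a i) (b i) (B i) w) * (\<xi> j w * dW (a j) (b j) (B j) w))" for w
    unfolding simple_field_integral_nth power2_eq_square sum_product \<xi>_def a_def b_def B_def ..
  show I: "integrable M (\<lambda>w. (sint S w)\<^sup>2)"
    unfolding sq using pr by (intro Bochner_Integration.integrable_sum) auto
  define T where "T = (\<Sum>i\<in>?I. \<Sum>j\<in>?I. e i j * (l i j * m i j))"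
  have "expectation (\<lambda>w. (sint S w)\<^sup>2) = T"
    unfolding sq T_def using pr by (subst Bochner_Integration.integral_sum; intro Bochner_Integration.integrable_sum sum.cong refl)+ auto
  then have L: "nnE (\<lambda>w. (sint S w)\<^sup>2) = ennreal T"
    by (subst nn_integral_eq_integral[OF I]) auto
  have vsq: "(sval S s y w)\<^sup>2 = (\<Sum>i\<in>?I. \<Sum>j\<in>?I. (indicator ({a i<..b i} \<inter> {a j<..b j}) s * indicator (B i \<inter> B j) y) * (\<xi> i w * \<xi> j w))" for s y w
    unfolding simple_field_value_nth power2_eq_square sum_product \<xi>_def[symmetric] a_def[symmetric] b_def[symmetric] B_def[symmetric]
    by (intro sum.cong refl) (simp add: indicator_inter_arith)
  have ie: "integrable M (\<lambda>w. \<xi> i w * \<xi> j w)" if ij: "i \<in> ?I" "j \<in> ?I" for i j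
  proof -
    obtain K K' where K: "\<And>w. w \<in> space M \<Longrightarrow> \<bar>\<xi> i w\<bar> \<le> K" "\<And>w. w \<in> space M \<Longrightarrow> \<bar>\<xi> j w\<bar> \<le> K'"
      using ab(5)[OF ij(1)] ab(5)[OF ij(2)] by blast
    show ?thesis
      by (intro integrable_const_bound[where B="K * K'"] AE_I2 borel_measurable_times filtration_measurable[OF ab(4)] ij)
         (use K in \<open>auto simp: abs_mult intro!: mult_mono intro: order.trans[OF abs_ge_zero]\<close>)
  qed
  \<comment> \<open>Used three times, for chance, space and time in turn. The individual summands
    have no sign, so the nonnegativity of the integrated double sum is recorded for the next
    integration.\<close>
  have step: "(\<integral>\<^sup>+x. ennreal (\<Sum>i\<in>?I. \<Sum>j\<in>?I. c i j * f i j x) \<partial>N) = ennreal (\<Sum>i\<in>?I. \<Sum>j\<in>?I. c i j * integral\<^sup>L N (f i j)) \<and>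
     (0 \<le> (\<Sum>i\<in>?I. \<Sum>j\<in>?I. c i j * integral\<^sup>L N (f i j)))"
    if "\<And>i j. i \<in> ?I \<Longrightarrow> j \<in> ?I \<Longrightarrow> integrable N (f i j)" "\<And>x. x \<in> space N \<Longrightarrow> 0 \<le> (\<Sum>i\<in>?I. \<Sum>j\<in>?I. c i j * f i j x)"
    for N :: "'b measure" and f c
  proof -
    have i: "integrable N (\<lambda>x. \<Sum>i\<in>?I. \<Sum>j\<in>?I. c i j * f i j x)"
      using that by (intro Bochner_Integration.integrable_sum) auto
    have v: "integral\<^sup>L N (\<lambda>x. \<Sum>i\<in>?I. \<Sum>j\<in>?I. c i j * f i j x) = (\<Sum>i\<in>?I. \<Sum>j\<in>?I. c i j * integral\<^sup>L N (f i j))"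
      using that by (subst Bochner_Integration.integral_sum; intro Bochner_Integration.integrable_sum sum.cong refl)+ auto
    have "0 \<le> integral\<^sup>L N (\<lambda>x. \<Sum>i\<in>?I. \<Sum>j\<in>?I. c i j * f i j x)"
      by (intro Bochner_Integration.integral_nonneg_AE AE_I2 that)
    then show ?thesis using i v that by (subst nn_integral_eq_integral) auto
  qed
  define c1 where "c1 s y i j = (indicator ({a i<..b i} \<inter> {a j<..b j}) s * indicator (B i \<inter> B j) y :: real)" for s y i j
  have 1: "nnE (\<lambda>w. (sval S s y w)\<^sup>2) = ennreal (\<Sum>i\<in>?I. \<Sum>j\<in>?I. c1 s y i j * e i j) \<and>
     0 \<le> (\<Sum>i\<in>?I. \<Sum>j\<in>?I. c1 s y i j * e i j)" for s y
    unfolding vsq c1_def[symmetric] e_def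
    by (rule step) (use ie in \<open>auto simp: vsq[folded c1_def, symmetric]\<close>)
  define c2 where "c2 s i j = (indicator ({a i<..b i} \<inter> {a j<..b j}) s * e i j :: real)" for s i j
  have c12: "(\<Sum>i\<in>?I. \<Sum>j\<in>?I. c1 s y i j * e i j) = (\<Sum>i\<in>?I. \<Sum>j\<in>?I. c2 s i j * indicator (B i \<inter> B j) y)" for s y
    unfolding c1_def c2_def by (intro sum.cong refl) (simp add: mult_ac)
  have fb: "B i \<inter> B j \<in> sets borel" "emeasure lborel (B i \<inter> B j) < \<infinity>" if "i \<in> ?I" "j \<in> ?I" for i j
    using ab(3)[OF that(1)] ab(3)[OF that(2)] finite_borelD[of "B i"] finite_borelD(1)[of "B j"]
    by (auto intro!: le_less_trans[OF emeasure_mono[of "B i \<inter> B j" "B i" lborel]])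
  have 2: "(\<integral>\<^sup>+y. ennreal (\<Sum>i\<in>?I. \<Sum>j\<in>?I. c1 s y i j * e i j) \<partial>lborel) = ennreal (\<Sum>i\<in>?I. \<Sum>j\<in>?I. c2 s i j * m i j) \<and>
     0 \<le> (\<Sum>i\<in>?I. \<Sum>j\<in>?I. c2 s i j * m i j)" for s
  proof -
    have "m i j = integral\<^sup>L lborel (indicator (B i \<inter> B j))" if "i \<in> ?I" "j \<in> ?I" for i j
      using fb[OF that] by (simp add: m_def)
    then have *: "(\<Sum>i\<in>?I. \<Sum>j\<in>?I. c2 s i j * m i j) = (\<Sum>i\<in>?I. \<Sum>j\<in>?I. c2 s i j * integral\<^sup>L lborel (indicator (B i \<inter> B j)))"
      by (intro sum.cong refl) simp
    show ?thesis
      unfolding * c12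
    proof (rule step)
      show "0 \<le> (\<Sum>i\<in>?I. \<Sum>j\<in>?I. c2 s i j * indicator (B i \<inter> B j) y)" for y
        unfolding c12[symmetric] using 1 by blast
    qed (use fb in auto)
  qed
  define c3 where "c3 i j = e i j * m i j" for i j
  have c23: "(\<Sum>i\<in>?I. \<Sum>j\<in>?I. c2 s i j * m i j) = (\<Sum>i\<in>?I. \<Sum>j\<in>?I. c3 i j * indicator ({a i<..b i} \<inter> {a j<..b j}) s)" for s
    unfolding c3_def c2_def by (intro sum.cong refl) (simp add: mult_ac)
  have fc: "emeasure lborel ({a i<..b i} \<inter> {a j<..b j}) < \<infinity>" for i j
    by (rule le_less_trans[OF emeasure_mono[of _ "{a i..b i}"]]) (auto simp: emeasure_lborel_Icc_eq)
  have 3: "(\<integral>\<^sup>+s. ennreal (\<Sum>i\<in>?I. \<Sum>j\<in>?I. c2 s i j * m i j) \<partial>lborel) = ennreal (\<Sum>i\<in>?I. \<Sum>j\<in>?I. c3 i j * l i j)"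
  proof -
    have *: "l i j = integral\<^sup>L lborel (indicator ({a i<..b i} \<inter> {a j<..b j}))" for i j
      using fc by (simp add: l_def)
    show ?thesis
      unfolding * c23
    proof (rule step[THEN conjunct1])
      show "0 \<le> (\<Sum>i\<in>?I. \<Sum>j\<in>?I. c3 i j * indicator ({a i<..b i} \<inter> {a j<..b j}) s)" for s
        unfolding c23[symmetric] using 2 by blast
      show "integrable lborel (indicator ({a i<..b i} \<inter> {a j<..b j}) :: real \<Rightarrow> real)" for i j
        using fc by (simp)
    qed
  qed
  have "field_sq_norm M (sval S) = (\<integral>\<^sup>+s\<in>{0..}. (\<integral>\<^sup>+y. (nnE (\<lambda>w. (sval S s y w)\<^sup>2)) \<partial>lborel) \<partial>lborel)"
    unfolding field_sq_norm_def
    using simple_field_value_measurable[OF S]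
    by (subst nn_integral_field_measure[OF prob_space_axioms]) (auto simp: case_prod_beta')
  also have "\<dots> = (\<integral>\<^sup>+s. ennreal (\<Sum>i\<in>?I. \<Sum>j\<in>?I. c2 s i j * m i j) \<partial>lborel)"
  proof (intro nn_integral_cong, goal_cases)
    case (1 s)
    have "c2 s i j = 0" if "s < 0" "i \<in> ?I" for i j using ab(1)[OF that(2)] that by (auto simp: c2_def indicator_def)
    then have "(\<Sum>i\<in>?I. \<Sum>j\<in>?I. c2 s i j * m i j) = 0" if "s < 0" using that by simp
    then show ?case using 2 \<open>\<And>s y. (nnE (\<lambda>w. (sval S s y w)\<^sup>2)) = _ \<and> _\<close>
      by (cases "s < 0") (simp_all add: indicator_def)
  qed
  also have "\<dots> = ennreal T"
    unfolding 3 T_def c3_def by (simp add: mult_ac)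
  finally have R: "field_sq_norm M (sval S) = ennreal T" .
  show ?S1
    "field_sq_norm M (sval S) < \<infinity>"
    using L R by simp_all
qed

text \<open>The condition under which the increment of the last entry is independent of the partial
  sum before it: earlier entries are finished by then, or share the time interval and live over a
  disjoint set.\<close>

definition ordered_field :: "'a simple_field \<Rightarrow> bool" where
  "ordered_field = sorted_wrt (\<lambda>(\<xi>, a, b, B) (\<xi>', a', b', B'). b \<le> a' \<or> (a = a' \<and> b = b' \<and> B \<inter> B' = {}))"

text \<open>With \<open>\<phi>\<^sub>k\<close> the fourth moment of the partial sums, adding a rectangle \<open>(\<xi>, a, b, B)\<close> of volume \<open>v\<close> gives
  \<open>\<phi>\<^sub>k\<^sub>+\<^sub>1 = \<phi>\<^sub>k + 6 v E(M\<^sup>2 \<xi>\<^sup>2) + 3 v\<^sup>2 E \<xi>\<^sup>4 \<le> (\<surd>\<phi>\<^sub>k + 3 v \<surd>E \<xi>\<^sup>4)\<^sup>2\<close>, because the odd moments vanish.\<close>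

lemma ordered_fourth_moment:
  assumes "simple S" "ordered_field S"
  shows "integrable M (\<lambda>w. sint S w ^ 4) \<and>
    sqrt (expectation (\<lambda>w. sint S w ^ 4)) \<le>
      3 * (\<Sum>(\<xi>, a, b, B)\<leftarrow>S. (b - a) * measure lborel B * sqrt (expectation (\<lambda>w. \<xi> w ^ 4)))"
  using assms
proof (induction S rule: rev_induct)
  case Nil
  then show ?case by (simp add: simple_field_integral_def)
next
  case (snoc x S)
  obtain \<xi> a b B where x: "x = (\<xi>, a, b, B)" by (cases x) auto
  define X where "X = sint S"
  define Z where "Z w = W b B w - W a B w" for w
  define q where "q = (\<Sum>(\<xi>, a, b, B)\<leftarrow>S. (b - a) * measure lborel B * sqrt (expectation (\<lambda>w. \<xi> w ^ 4)))"
  have sS: "simple S" and oS: "ordered_field S" using snoc.prems by (auto simp: is_simple_field_def ordered_field_def sorted_wrt_append)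
  have ab: "0 \<le> a" "a \<le> b" "B \<in> finite_borel" "\<xi> \<in> borel_measurable (\<F> a)" and "\<exists>K. \<forall>w\<in>space M. \<bar>\<xi> w\<bar> \<le> K"
    using snoc.prems(1) unfolding is_simple_field_def x by auto
  then obtain K where K: "\<And>w. w \<in> space M \<Longrightarrow> \<bar>\<xi> w\<bar> \<le> K" by blast
  have K0: "0 \<le> K" using K not_empty by (meson abs_ge_zero ex_in_conv order_trans)
  have IH: "integrable M (\<lambda>w. X w ^ 4)" "sqrt (expectation (\<lambda>w. X w ^ 4)) \<le> 3 * q"
    using snoc.IH[OF sS oS] unfolding X_def q_def by auto
  have Z: "Z \<in> future a" unfolding Z_def[abs_def] using ab by (intro future_increment) auto
  define v where "v = (b - a) * measure lborel B"
  have v: "expectation (\<lambda>w. (Z w)\<^sup>2) = v" "0 \<le> v"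
    unfolding Z_def v_def using noise_increment_cov[of a b a b B B] ab by (auto simp: power2_eq_square)
  let ?N = "past_and_uncorrelated a Z"
  have XN: "X \<in> borel_measurable ?N"
    unfolding X_def simple_field_integral_nth[abs_def]
  proof (intro borel_measurable_sum)
    fix i assume i: "i \<in> {..<length S}"
    then obtain \<xi>' a' b' B' where S: "S ! i = (\<xi>', a', b', B')" "0 \<le> a'" "a' \<le> b'" "B' \<in> finite_borel" "\<xi>' \<in> borel_measurable (\<F> a')"
      using simple_nth[OF sS] by blast
    have "b' \<le> a \<or> (a' = a \<and> b' = b \<and> B' \<inter> B = {})"
      using snoc.prems(2) i S(1) nth_mem[of i S] unfolding ordered_field_def sorted_wrt_append x by fastforce
    then show "(\<lambda>w. fst (S ! i) w * (W (fst (snd (snd (S ! i)))) (snd (snd (snd (S ! i)))) w - W (fst (snd (S ! i))) (snd (snd (snd (S ! i)))) w)) \<in> borel_measurable ?N"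
    proof
      assume "b' \<le> a"
      then have "\<xi>' \<in> borel_measurable (\<F> a)" "W a' B' \<in> borel_measurable (\<F> a)" "W b' B' \<in> borel_measurable (\<F> a)"
        using S by (auto intro!: filtration_W intro: filtration_measurable_mono)
      then show ?thesis unfolding S by (intro measurable_past_and_uncorrelated_past) simp
    next
      assume *: "a' = a \<and> b' = b \<and> B' \<inter> B = {}"
      have "\<xi>' \<in> borel_measurable ?N" using S * by (intro measurable_past_and_uncorrelated_past) auto
      moreover have "dW a' b' B' \<in> borel_measurable ?N"
        using S * ab noise_increment_cov[of a b a b B B']
        by (intro measurable_past_and_uncorrelated_future future_increment) (auto simp: Z_def Int_commute)
      ultimately show ?thesis unfolding S by simp
    qed
  qed
  have \<xi>N: "\<xi> \<in> borel_measurable ?N" using ab(4) by (rule measurable_past_and_uncorrelated_past)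
  have Xm[measurable]: "X \<in> borel_measurable M" unfolding X_def by (rule simple_field_integral_measurable[OF sS])
  have \<xi>m[measurable]: "\<xi> \<in> borel_measurable M" using ab filtration_measurable by auto
  have pw: "\<bar>x ^ k\<bar> \<le> 1 + x ^ 4" if "k \<le> 4" for x :: real and k
  proof (cases "\<bar>x\<bar> \<le> 1")
    case True
    have "\<bar>x ^ k\<bar> \<le> 1" using True by (simp add: power_abs power_le_one)
    then show ?thesis by (smt (verit) zero_le_even_power even_numeral)
  next
    case False
    then have "\<bar>x\<bar> ^ k \<le> \<bar>x\<bar> ^ 4" using that by (intro power_increasing) auto
    then show ?thesis by (simp add: power_abs)
  qed
  \<comment> \<open>Powers of the bounded coefficient cost a constant, and powers of
    \<open>X\<close> up to the fourth are dominated by \<open>1 + X ^ 4\<close>.\<close>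
  have im: "integrable M (\<lambda>w. X w ^ k * \<xi> w ^ j)" if "k \<le> 4" for k j
  proof (rule Bochner_Integration.integrable_bound)
    show "integrable M (\<lambda>w. (1 + X w ^ 4) * K ^ j)" using IH by simp
    show "AE w in M. norm (X w ^ k * \<xi> w ^ j) \<le> norm ((1 + X w ^ 4) * K ^ j)"
    proof (rule AE_I2)
      fix w assume "w \<in> space M"
      then have "\<bar>\<xi> w ^ j\<bar> \<le> K ^ j" using K by (simp add: power_abs power_mono)
      then have "\<bar>X w ^ k\<bar> * \<bar>\<xi> w ^ j\<bar> \<le> (1 + X w ^ 4) * K ^ j"
        using pw[OF that, of "X w"] by (intro mult_mono) auto
      then show "norm (X w ^ k * \<xi> w ^ j) \<le> norm ((1 + X w ^ 4) * K ^ j)"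
        using K0 by (simp add: abs_mult)
    qed
  qed simp
  have f: "integrable M (\<lambda>w. X w ^ k * \<xi> w ^ j * Z w ^ j) \<and>
      expectation (\<lambda>w. X w ^ k * \<xi> w ^ j * Z w ^ j) = expectation (\<lambda>w. X w ^ k * \<xi> w ^ j) * expectation (\<lambda>w. Z w ^ j)" if "k \<le> 4" for k j
  proof -
    have "(\<lambda>w. X w ^ k * \<xi> w ^ j) \<in> borel_measurable ?N" using XN \<xi>N by simp
    from future_expectation_mult[OF Z ab(1) this, of "\<lambda>x. x ^ j"] im[OF that]
      centered_gaussian_even_moment(1)[OF future_gaussian[OF Z]] show ?thesis by simp
  qed
  note G = centered_gaussian_moments[OF future_gaussian[OF Z]]
  have e: "(X w + \<xi> w * Z w) ^ 4 = X w ^ 4 * \<xi> w ^ 0 * Z w ^ 0 + 4 * (X w ^ 3 * \<xi> w ^ 1 * Z w ^ 1) + 6 * (X w ^ 2 * \<xi> w ^ 2 * Z w ^ 2)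
     + 4 * (X w ^ 1 * \<xi> w ^ 3 * Z w ^ 3) + X w ^ 0 * \<xi> w ^ 4 * Z w ^ 4" for w
    by (simp add: power4_eq_xxxx power3_eq_cube power2_eq_square algebra_simps)
  have I: "integrable M (\<lambda>w. (X w + \<xi> w * Z w) ^ 4)"
    unfolding e using f[of 4 0] f[of 3 1] f[of 2 2] f[of 1 3] f[of 0 4]
    by (intro Bochner_Integration.integrable_add integrable_mult_right) auto
  define \<phi> where "\<phi> = expectation (\<lambda>w. X w ^ 4)"
  define p where "p = sqrt (expectation (\<lambda>w. \<xi> w ^ 4))"
  have p0: "0 \<le> p" "p\<^sup>2 = expectation (\<lambda>w. \<xi> w ^ 4)" "0 \<le> \<phi>"
    unfolding p_def \<phi>_def by auto
  have "expectation (\<lambda>w. (X w + \<xi> w * Z w) ^ 4) = \<phi> + 6 * (expectation (\<lambda>w. X w ^ 2 * \<xi> w ^ 2) * v) + 3 * v\<^sup>2 * p\<^sup>2"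
    unfolding e using f[of 4 0] f[of 3 1] f[of 2 2] f[of 1 3] f[of 0 4] G v
    by (simp add: \<phi>_def p0(2) prob_space)
  also have "\<dots> \<le> \<phi> + 6 * ((sqrt \<phi> * p) * v) + 3 * v\<^sup>2 * p\<^sup>2"
  proof -
    have "expectation (\<lambda>w. X w ^ 2 * \<xi> w ^ 2) \<le> sqrt \<phi> * p"
      unfolding \<phi>_def p_def using expectation_Cauchy_Schwarz(2)[of "\<lambda>w. X w ^ 2" "\<lambda>w. \<xi> w ^ 2"] im[of 4 0] im[of 0 4]
      by simp
    then show ?thesis using v(2) by (simp add: mult_right_mono)
  qed
  \<comment> \<open>Only the last coefficient is enlarged, from 3 to 9, to complete a square. The
    square root of the fourth moment then grows additively, which is what makes the induction
    close.\<close>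
  also have "\<dots> \<le> (sqrt \<phi> + 3 * (v * p))\<^sup>2"
  proof -
    have "(sqrt \<phi> + 3 * (v * p))\<^sup>2 = \<phi> + 6 * ((sqrt \<phi> * p) * v) + 9 * (v\<^sup>2 * p\<^sup>2)"
      using p0 by (simp add: power2_sum power_mult_distrib algebra_simps)
    then show ?thesis using zero_le_square[of "v * p"] by (simp add: power2_eq_square algebra_simps)
  qed
  finally have "sqrt (expectation (\<lambda>w. (X w + \<xi> w * Z w) ^ 4)) \<le> sqrt \<phi> + 3 * (v * p)"
    using p0 v by (intro real_le_lsqrt) auto
  also have "\<dots> \<le> 3 * (q + v * p)" using IH(2) by (simp add: \<phi>_def)
  finally have *: "sqrt (expectation (\<lambda>w. (X w + \<xi> w * Z w) ^ 4)) \<le> 3 * (q + v * p)" .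
  have "sint (S @ [x]) = (\<lambda>w. X w + \<xi> w * Z w)"
    by (auto simp: fun_eq_iff simple_field_integral_append X_def Z_def x simple_field_integral_def)
  then show ?case using I * by (simp add: q_def v_def p_def x)
qed

end

section \<open>Truncated simple fields on a grid of disjoint rectangles\<close>

fun slabs :: "real list \<Rightarrow> (real \<times> real) list" where
  "slabs (x # y # zs) = (x, y) # slabs (y # zs)"
| "slabs _ = []"

lemma slabs_bounds:
  "sorted_wrt (<) xs \<Longrightarrow> (p, q) \<in> set (slabs xs) \<Longrightarrow>
    p \<in> set xs \<and> q \<in> set xs \<and> p < q \<and> (\<forall>z\<in>set xs. z \<le> p \<or> q \<le> z)"
  by (induction xs rule: slabs.induct) (auto intro: order.strict_implies_order)

lemma slabs_ordered: "sorted_wrt (<) xs \<Longrightarrow> sorted_wrt (\<lambda>(p, q) (p', q'). q \<le> p') (slabs xs)"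
proof (induction xs rule: slabs.induct)
  case (1 x y zs)
  have "y \<le> p" if "(p, q) \<in> set (slabs (y # zs))" for p q
    using slabs_bounds[of "y # zs" p q] that 1 by auto
  then show ?case using 1 by auto
qed auto

lemma sum_list_zero: "(\<And>x. x \<in> set xs \<Longrightarrow> f x = (0::real)) \<Longrightarrow> (\<Sum>x\<leftarrow>xs. f x) = 0"
  by (induction xs) auto

lemma distinct_sorted_wrt_neq: "distinct xs \<Longrightarrow> sorted_wrt (\<lambda>x y. x \<noteq> y) xs"
  by (induction xs) auto

text \<open>The slab is fixed before \<open>g\<close>, so the same slab can be used for every
  coefficient function; half-open slabs make the choice unique at grid times.\<close>

lemma slabs_select:
  assumes "sorted_wrt (<) xs" "xs \<noteq> []" "hd xs < s" "s \<le> last xs"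
  shows "\<exists>p q. (p, q) \<in> set (slabs xs) \<and> p < s \<and> s \<le> q \<and>
    (\<forall>g. (\<Sum>(p, q)\<leftarrow>slabs xs. g p q * indicator {p<..q} s) = (g p q :: real))"
  using assms
proof (induction xs rule: slabs.induct)
  case (1 x y zs)
  show ?case
  proof (cases "s \<le> y")
    case True
    have "(\<Sum>(p, q)\<leftarrow>slabs (y # zs). g p q * indicator {p<..q} s) = (0::real)" for g
    proof (rule sum_list_zero, clarify)
      fix p q assume "(p, q) \<in> set (slabs (y # zs))"
      then have "y \<le> p" using slabs_bounds[of "y # zs" p q] 1 by auto
      then show "g p q * indicator {p<..q} s = 0" using True by simp
    qed
    then show ?thesis using True 1 by (intro exI[of _ x] exI[of _ y]) auto
  next
    case False
    then obtain p q where pq: "(p, q) \<in> set (slabs (y # zs))" "p < s" "s \<le> q"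
      "\<forall>g. (\<Sum>(p, q)\<leftarrow>slabs (y # zs). g p q * indicator {p<..q} s) = (g p q :: real)"
      using 1 by auto
    then show ?thesis using False by (intro exI[of _ p] exI[of _ q]) auto
  qed
qed auto

text \<open>For \<open>K \<ge> 0\<close> truncation is a contraction that fixes 0: it increases
  neither the distance of two fields nor a fourth moment, and it bounds the coefficients.\<close>

definition clip :: "real \<Rightarrow> real \<Rightarrow> real" where "clip K v = max (-K) (min K v)"

lemma clip_measurable [measurable]: "clip K \<in> borel_measurable borel"
  unfolding clip_def by measurable

lemma clip_bound: "0 \<le> K \<Longrightarrow> \<bar>clip K v\<bar> \<le> K"
  and clip_abs: "0 \<le> K \<Longrightarrow> \<bar>clip K v\<bar> \<le> \<bar>v\<bar>"
  and clip_diff: "\<bar>clip K v - clip K wt\<bar> \<le> \<bar>v - wt\<bar>"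
  and clip_eq: "\<bar>v\<bar> \<le> K \<Longrightarrow> clip K v = v"
  and clip_error: "0 \<le> K \<Longrightarrow> \<bar>clip K v - v\<bar> \<le> \<bar>v\<bar>"
  by (auto simp: clip_def max_def min_def)

context white_noise
begin

text \<open>Entry \<open>i\<close> of \<open>sig\<close> prescribes whether the point lies in the
  set of the \<open>i\<close>-th rectangle. Different lists of full length therefore give disjoint
  sets, and together these exhaust \<open>{-K..K}\<close>.\<close>

definition atom :: "real \<Rightarrow> 'a simple_field \<Rightarrow> bool list \<Rightarrow> real set" where
  "atom K S sig = {y\<in>{-K..K}. \<forall>i<length S. (y \<in> snd (snd (snd (S ! i)))) = sig ! i}"

text \<open>0 and \<open>K\<close> are adjoined so that the slabs exhaust the times after 0 up to
  \<open>K\<close>.\<close>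

definition clip_times :: "real \<Rightarrow> 'a simple_field \<Rightarrow> real list" where
  "clip_times K S = sorted_list_of_set ({0, K} \<union> ((\<Union>(\<xi>, a, b, B)\<in>set S. {a, b}) \<inter> {0..K}))"

text \<open>On a slab times an atom the field \<open>S\<close> has a value that does not depend on
  the point, so the truncation can be applied to this random coefficient; summands count if their
  rectangle covers the whole slab and the atom.\<close>

definition clip_coeff :: "real \<Rightarrow> 'a simple_field \<Rightarrow> real \<Rightarrow> real \<Rightarrow> bool list \<Rightarrow> 'a \<Rightarrow> real" where
  "clip_coeff K S p q sig w = clip K (\<Sum>i<length S. if sig ! i \<and> fst (snd (S ! i)) \<le> p \<and> q \<le> fst (snd (snd (S ! i)))
     then fst (S ! i) w else 0)"

definition clip_row :: "real \<Rightarrow> 'a simple_field \<Rightarrow> real \<Rightarrow> real \<Rightarrow> 'a simple_field" where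
  "clip_row K S p q = map (\<lambda>sig. (clip_coeff K S p q sig, p, q, atom K S sig)) (List.n_lists (length S) [True, False])"

text \<open>The simple field \<open>clip K (S s y w)\<close> on \<open>0 < s \<le> K\<close>, \<open>\<bar>y\<bar> \<le> K\<close>, written over time slabs and the
  atoms generated by the sets of \<open>S\<close>.\<close>

definition clip_field :: "real \<Rightarrow> 'a simple_field \<Rightarrow> 'a simple_field" where
  "clip_field K S = concat (map (\<lambda>(p, q). clip_row K S p q) (slabs (clip_times K S)))"

lemma clip_times:
  assumes "K > 0"
  shows "sorted_wrt (<) (clip_times K S)" "set (clip_times K S) = {0, K} \<union> ((\<Union>(\<xi>, a, b, B)\<in>set S. {a, b}) \<inter> {0..K})"
    "clip_times K S \<noteq> []" "hd (clip_times K S) = 0" "last (clip_times K S) = K"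
proof -
  let ?A = "{0, K} \<union> ((\<Union>(\<xi>, a, b, B)\<in>set S. {a, b}) \<inter> {0..K})"
  have f: "finite ?A" by auto
  then show s: "set (clip_times K S) = ?A" and st: "sorted_wrt (<) (clip_times K S)"
    unfolding clip_times_def using strict_sorted_list_of_set set_sorted_list_of_set[OF f] by blast+
  show ne: "clip_times K S \<noteq> []" using s by auto
  have srt: "sorted (clip_times K S)" unfolding clip_times_def by simp
  have "clip_times K S ! 0 \<le> 0"
  proof -
    have "0 \<in> set (clip_times K S)" using s by simp
    then obtain i where "i < length (clip_times K S)" "clip_times K S ! i = 0" by (auto simp: in_set_conv_nth)
    then show ?thesis using sorted_nth_mono[OF srt, of 0 i] by simp
  qed
  moreover have "hd (clip_times K S) \<in> ?A" using ne s hd_in_set by blast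
  ultimately show "hd (clip_times K S) = 0" using assms ne by (auto simp: hd_conv_nth)
  have "K \<le> last (clip_times K S)"
  proof -
    have "K \<in> set (clip_times K S)" using s by simp
    then obtain i where "i < length (clip_times K S)" "clip_times K S ! i = K" by (auto simp: in_set_conv_nth)
    then show ?thesis using sorted_nth_mono[OF srt, of i "length (clip_times K S) - 1"] by (simp add: last_conv_nth ne)
  qed
  moreover have "last (clip_times K S) \<in> ?A" using ne s last_in_set by blast
  ultimately show "last (clip_times K S) = K" using assms by auto
qed

lemma clip_slab:
  assumes "K > 0" "(p, q) \<in> set (slabs (clip_times K S))"
  shows "0 \<le> p" "p < q" "q \<le> K"
  using slabs_bounds[OF clip_times(1) assms(2)] clip_times(2)[of K S] assms(1) by auto

lemma atom_finite_borel:
  assumes "simple S"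
  shows "atom K S sig \<in> finite_borel"
proof -
  have m: "{y. (y \<in> snd (snd (snd (S ! i)))) = sig ! i} \<in> sets borel" if "i < length S" for i
  proof -
    have B: "snd (snd (snd (S ! i))) \<in> sets borel" using simple_nth[OF assms, of i] that finite_borelD(1) by auto
    then show ?thesis by (cases "sig ! i") (auto simp: Compl_eq[symmetric] intro: borel_comp)
  qed
  have "atom K S sig = {-K..K} - (\<Union>i<length S. - {y. (y \<in> snd (snd (snd (S ! i)))) = sig ! i})"
    unfolding atom_def by auto
  also have "\<dots> \<in> sets borel" using m by (intro sets.Diff sets.finite_UN borel_comp) auto
  finally have b: "atom K S sig \<in> sets borel" .
  have "emeasure lborel (atom K S sig) \<le> emeasure lborel {-K..K}"
    by (rule emeasure_mono) (auto simp: atom_def)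
  then have "emeasure lborel (atom K S sig) < \<infinity>"
    by (rule le_less_trans) (auto simp: emeasure_lborel_Icc_eq)
  then show ?thesis using b by (simp add: finite_borel_def)
qed

lemma simple_clip_field:
  assumes S: "simple S" and K: "K > 0"
  shows "simple (clip_field K S)"
  unfolding is_simple_field_def
proof (clarify)
  fix \<xi> a b B assume "(\<xi>, a, b, B) \<in> set (clip_field K S)"
  then obtain sig where e: "(a, b) \<in> set (slabs (clip_times K S))" "\<xi> = clip_coeff K S a b sig" "B = atom K S sig"
    unfolding clip_field_def clip_row_def by auto
  have "(\<lambda>w. if sig ! i \<and> fst (snd (S ! i)) \<le> a \<and> b \<le> fst (snd (snd (S ! i))) then fst (S ! i) w else 0) \<in> borel_measurable (\<F> a)"
    if "i \<in> {..<length S}" for i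
  proof (cases "sig ! i \<and> fst (snd (S ! i)) \<le> a \<and> b \<le> fst (snd (snd (S ! i)))")
    case True
    then show ?thesis using simple_nth[OF S that] filtration_measurable_mono by auto
  qed auto
  then have "\<xi> \<in> borel_measurable (\<F> a)"
    unfolding e(2) clip_coeff_def[abs_def] by (intro measurable_compose[OF _ clip_measurable] borel_measurable_sum) auto
  moreover have "\<exists>C. \<forall>w\<in>space M. \<bar>\<xi> w\<bar> \<le> C"
    unfolding e(2) clip_coeff_def using clip_bound[of K] K by (intro exI[of _ K]) auto
  ultimately show "0 \<le> a \<and> a \<le> b \<and> B \<in> finite_borel \<and> \<xi> \<in> borel_measurable (\<F> a) \<and> (\<exists>C. \<forall>w\<in>space M. \<bar>\<xi> w\<bar> \<le> C)"
    using clip_slab[OF K e(1)] atom_finite_borel[OF S] e(3) by auto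
qed

lemma atom_disjoint:
  assumes "length sig = length S" "length sig' = length S" "sig \<noteq> sig'"
  shows "atom K S sig \<inter> atom K S sig' = {}"
proof -
  obtain i where "i < length S" "sig ! i \<noteq> sig' ! i" using assms nth_equalityI[of sig sig'] by auto
  then show ?thesis unfolding atom_def by auto
qed

text \<open>Within a row the time interval is common and the atoms are disjoint; different rows
  follow each other as their slabs do.\<close>

lemma ordered_clip_field:
  assumes "K > 0"
  shows "ordered_field (clip_field K S)"
proof -
  let ?P = "\<lambda>(\<xi>, a, b, B) (\<xi>', a', b', B'). b \<le> a' \<or> (a = a' \<and> b = b' \<and> B \<inter> B' = {})"
  have row: "sorted_wrt ?P (clip_row K S p q)" for p q
  proof -
    have "sorted_wrt (\<lambda>x y. x \<noteq> y) (List.n_lists (length S) [True, False])"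
      by (intro distinct_sorted_wrt_neq distinct_n_lists) simp
    then show ?thesis
      unfolding clip_row_def sorted_wrt_map
      by (rule sorted_wrt_mono_rel[rotated]) (auto simp: length_n_lists_elem atom_disjoint)
  qed
  have "sorted_wrt ?P (concat (map (\<lambda>(p, q). clip_row K S p q) zs))"
    if "sorted_wrt (\<lambda>(p, q) (p', q'). q \<le> p') zs" for zs
    using that
  proof (induction zs)
    case (Cons z zs)
    obtain p q where z: "z = (p, q)" by (cases z)
    have "?P x y" if xy: "x \<in> set (clip_row K S p q)" "y \<in> set (concat (map (\<lambda>(p, q). clip_row K S p q) zs))" for x y
    proof -
      obtain p' q' where "(p', q') \<in> set zs" "y \<in> set (clip_row K S p' q')" using xy(2) by auto
      moreover from this(1) have "q \<le> p'" using Cons.prems z by fastforce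
      ultimately show ?thesis using xy(1) unfolding clip_row_def by auto
    qed
    then show ?case using Cons z row[of p q] by (simp add: sorted_wrt_append)
  qed simp
  then show ?thesis
    unfolding ordered_field_def clip_field_def using slabs_ordered[OF clip_times(1)[OF assms]] by blast
qed

lemma clip_row_value:
  assumes "\<And>i. i < length S \<Longrightarrow> True"
  shows "sval (clip_row K S p q) s y w =
    (if y \<in> {-K..K} then clip_coeff K S p q (map (\<lambda>i. y \<in> snd (snd (snd (S ! i)))) [0..<length S]) w * indicator {p<..q} s else 0)"
proof -
  let ?L = "List.n_lists (length S) [True, False]"
  let ?s = "map (\<lambda>i. y \<in> snd (snd (snd (S ! i)))) [0..<length S]"
  have "?s \<in> set ?L" by (auto simp: set_n_lists)
  have at: "y \<in> atom K S sig \<longleftrightarrow> y \<in> {-K..K} \<and> sig = ?s" if "sig \<in> set ?L" for sig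
    using length_n_lists_elem[OF that] unfolding atom_def by (auto intro!: nth_equalityI)
  have "sval (clip_row K S p q) s y w =
     (\<Sum>sig\<leftarrow>?L. clip_coeff K S p q sig w * indicator {p<..q} s * indicator (atom K S sig) y)"
    unfolding simple_field_value_def clip_row_def by (simp add: comp_def)
  also have "\<dots> = (\<Sum>sig\<in>set ?L. clip_coeff K S p q sig w * indicator {p<..q} s * indicator (atom K S sig) y)"
    using distinct_n_lists[of "[True, False]" "length S"] by (simp add: sum_list_distinct_conv_sum_set)
  also have "\<dots> = (\<Sum>sig\<in>set ?L. if sig = ?s then (if y \<in> {-K..K} then clip_coeff K S p q sig w * indicator {p<..q} s else 0) else 0)"
    using at by (intro sum.cong refl) (auto simp: indicator_def)
  also have "\<dots> = (if y \<in> {-K..K} then clip_coeff K S p q ?s w * indicator {p<..q} s else 0)"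
    using \<open>?s \<in> set ?L\<close> by (subst sum.delta) auto
  finally show ?thesis .
qed

text \<open>Every interval endpoint of \<open>S\<close> up to \<open>K\<close> is a grid time. Hence
  an interval contains a slab or misses it, and whether it contains \<open>s\<close> is decided by
  the slab in which \<open>s\<close> lies.\<close>

lemma clip_field_value:
  assumes S: "simple S" and K: "K > 0"
  shows "sval (clip_field K S) s y w =
    (if 0 < s \<and> s \<le> K \<and> y \<in> {-K..K} then clip K (sval S s y w) else 0)"
proof -
  let ?s = "map (\<lambda>i. y \<in> snd (snd (snd (S ! i)))) [0..<length S]"
  let ?xs = "clip_times K S"
  have app: "sval (concat (map (\<lambda>(p, q). clip_row K S p q) zs)) s y w =
      (\<Sum>(p, q)\<leftarrow>zs. sval (clip_row K S p q) s y w)" for zs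
    by (induction zs) (auto simp: simple_field_value_append simple_field_value_def[of "[]"])
  have "sval (clip_field K S) s y w = (\<Sum>(p, q)\<leftarrow>slabs ?xs. (if y \<in> {-K..K} then clip_coeff K S p q ?s w else 0) * indicator {p<..q} s)"
    unfolding clip_field_def app clip_row_value[OF TrueI] by (intro arg_cong[where f=sum_list] map_cong refl) auto
  also have "\<dots> = (if 0 < s \<and> s \<le> K \<and> y \<in> {-K..K} then clip K (sval S s y w) else 0)"
  proof (cases "0 < s \<and> s \<le> K")
    case True
    then obtain p q where pq: "(p, q) \<in> set (slabs ?xs)" "p < s" "s \<le> q"
      and g: "\<And>g. (\<Sum>(p, q)\<leftarrow>slabs ?xs. g p q * indicator {p<..q} s) = (g p q :: real)"
      using slabs_select[OF clip_times(1,3)[OF K, of S], of s] clip_times(4,5)[OF K, of S] by auto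
    have "clip_coeff K S p q ?s w = clip K (sval S s y w)"
      unfolding clip_coeff_def simple_field_value_nth
    proof (intro arg_cong[where f="clip K"] sum.cong refl)
      fix i assume i: "i \<in> {..<length S}"
      obtain \<xi> a b B where Si: "S ! i = (\<xi>, a, b, B)" "0 \<le> a" "a \<le> b" using simple_nth[OF S i] by blast
      then have "(\<xi>, a, b, B) \<in> set S" using i nth_mem by force
      \<comment> \<open>Endpoints beyond \<open>K\<close> are not grid times, but they lie to the
        right of every slab and so cannot cut one.\<close>
      then have "a \<in> set ?xs \<or> a > K" "b \<in> set ?xs \<or> b > K" using Si clip_times(2)[OF K, of S] by fastforce+
      then have "s \<in> {a<..b} \<longleftrightarrow> a \<le> p \<and> q \<le> b"
        using slabs_bounds[OF clip_times(1)[OF K, of S] pq(1)] clip_slab[OF K pq(1)] pq True by fastforce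
      then show "(if ?s ! i \<and> fst (snd (S ! i)) \<le> p \<and> q \<le> fst (snd (snd (S ! i))) then fst (S ! i) w else 0) =
         fst (S ! i) w * indicator {fst (snd (S ! i))<..fst (snd (snd (S ! i)))} s * indicator (snd (snd (snd (S ! i)))) y"
        using i Si(1) by (auto simp: indicator_def)
    qed
    then show ?thesis using g True by simp
  next
    case False
    have "(\<Sum>(p, q)\<leftarrow>slabs ?xs. (if y \<in> {-K..K} then clip_coeff K S p q ?s w else 0) * indicator {p<..q} s) = 0"
    proof (rule sum_list_zero, clarify)
      fix p q assume "(p, q) \<in> set (slabs ?xs)"
      then have "s \<notin> {p<..q}"
        using clip_slab[OF K, of p q S] False by auto
      then show "(if y \<in> {-K..K} then clip_coeff K S p q ?s w else 0) * indicator {p<..q} s = 0" by simp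
    qed
    then show ?thesis using False by auto
  qed
  finally show ?thesis .
qed

text \<open>The rectangles of an ordered field are disjoint, so at most one entry is active at
  \<open>(s, y)\<close> and the square root of the fourth moment passes through the sum.\<close>

lemma ordered_value_fourth:
  assumes "ordered_field S"
  shows "sqrt (expectation (\<lambda>w. sval S s y w ^ 4)) =
    (\<Sum>(\<xi>, a, b, B)\<leftarrow>S. sqrt (expectation (\<lambda>w. \<xi> w ^ 4)) * (indicator {a<..b} s * indicator B y))"
  using assms
proof (induction S)
  case Nil
  then show ?case by (simp add: simple_field_value_def)
next
  case (Cons x S)
  obtain \<xi> a b B where x: "x = (\<xi>, a, b, B)" by (cases x) auto
  have o: "ordered_field S" using Cons.prems by (simp add: ordered_field_def)
  show ?case
  proof (cases "s \<in> {a<..b} \<and> y \<in> B")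
    case True
    have z: "(indicator {a'<..b'} s * indicator B' y) = (0::real)" if "(\<xi>', a', b', B') \<in> set S" for \<xi>' a' b' B'
      using Cons.prems that True unfolding ordered_field_def x by (auto simp: indicator_def)
    have "(\<Sum>(\<xi>, a, b, B)\<leftarrow>S. sqrt (expectation (\<lambda>w. \<xi> w ^ 4)) * (indicator {a<..b} s * indicator B y)) = 0"
      using z by (intro sum_list_zero) auto
    moreover have "sval S s y w = 0" for w
      unfolding simple_field_value_def using z by (intro sum_list_zero) (auto simp: mult.assoc)
    ultimately show ?thesis using True by (simp add: x simple_field_value_def)
  next
    case False
    then have "sval (x # S) s y w = sval S s y w" for w
      by (auto simp: x simple_field_value_def)
    then show ?thesis using Cons.IH[OF o] False by (auto simp: x)
  qed
qed

text \<open>The weighted sum over the list becomes an integral of pointwise moments over the plane.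
  In this form the bound no longer mentions the rectangles and can be compared with bounds for other
  fields.\<close>

lemma ordered_fourth_moment_integral:
  assumes S: "simple S" "ordered_field S"
  shows "nnE (\<lambda>w. sint S w ^ 4) \<le>
    9 * (\<integral>\<^sup>+s\<in>{0..}. (\<integral>\<^sup>+y. ennreal (sqrt (expectation (\<lambda>w. sval S s y w ^ 4))) \<partial>lborel) \<partial>lborel)\<^sup>2"
proof -
  define T where "T = (\<Sum>(\<xi>, a, b, B)\<leftarrow>S. (b - a) * measure lborel B * sqrt (expectation (\<lambda>w. \<xi> w ^ 4)))"
  note F = ordered_fourth_moment[OF S, folded T_def]
  have "sqrt (expectation (\<lambda>w. sint S w ^ 4)) ^ 2 \<le> (3 * T)\<^sup>2"
    using F by (intro power_mono) auto
  then have 1: "expectation (\<lambda>w. sint S w ^ 4) \<le> 9 * T\<^sup>2"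
    by (simp add: power_mult_distrib)
  have "0 \<le> expectation (\<lambda>w. sint S w ^ 4)" by simp
  from real_sqrt_ge_zero[OF this] F have T0: "0 \<le> T" by linarith
  \<comment> \<open>Measurability of the integrands and the sign of the sum belong to the induction
    statement, since splitting the integral at each new entry depends on them.\<close>
  have 2: "(\<integral>\<^sup>+s\<in>{0..}. (\<integral>\<^sup>+y. ennreal (\<Sum>(\<xi>, a, b, B)\<leftarrow>S. sqrt (expectation (\<lambda>w. \<xi> w ^ 4)) * (indicator {a<..b} s * indicator B y)) \<partial>lborel) \<partial>lborel) = ennreal T \<and>
    (\<forall>s. (\<lambda>y. ennreal (\<Sum>(\<xi>, a, b, B)\<leftarrow>S. sqrt (expectation (\<lambda>w. \<xi> w ^ 4)) * (indicator {a<..b} s * indicator B y))) \<in> borel_measurable lborel) \<and>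
    (\<lambda>s. \<integral>\<^sup>+y. ennreal (\<Sum>(\<xi>, a, b, B)\<leftarrow>S. sqrt (expectation (\<lambda>w. \<xi> w ^ 4)) * (indicator {a<..b} s * indicator B y)) \<partial>lborel) \<in> borel_measurable lborel \<and> 0 \<le> T"
    using S(1) unfolding T_def
  proof (induction S)
    case (Cons x S)
    obtain \<xi> a b B where x: "x = (\<xi>, a, b, B)" by (cases x) auto
    have sS: "simple S" and ab: "0 \<le> a" "a \<le> b" "B \<in> finite_borel" using Cons.prems by (auto simp: is_simple_field_def x)
    define c where "c = sqrt (expectation (\<lambda>w. \<xi> w ^ 4))"
    define f where "f s y = (\<Sum>(\<xi>, a, b, B)\<leftarrow>S. sqrt (expectation (\<lambda>w. \<xi> w ^ 4)) * (indicator {a<..b} s * indicator B y))" for s y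
    define T where "T = (\<Sum>(\<xi>, a, b, B)\<leftarrow>S. (b - a) * measure lborel B * sqrt (expectation (\<lambda>w. \<xi> w ^ 4)))"
    have c0: "c \<ge> 0" by (simp add: c_def)
    have f0: "f s y \<ge> 0" for s y
      unfolding f_def by (intro sum_list_nonneg) auto
    note IH = Cons.IH[OF sS, folded f_def T_def]
    have [measurable]: "B \<in> sets borel" using ab finite_borelD by blast
    have mf[measurable]: "(\<lambda>y. ennreal (f s y)) \<in> borel_measurable borel" for s using IH by auto
    have mf2[measurable]: "(\<lambda>s. \<integral>\<^sup>+y. ennreal (f s y) \<partial>lborel) \<in> borel_measurable borel" using IH by auto
    have s: "ennreal (\<Sum>(\<xi>, a, b, B)\<leftarrow>x # S. sqrt (expectation (\<lambda>w. \<xi> w ^ 4)) * (indicator {a<..b} s * indicator B y)) =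
          ennreal c * indicator {a<..b} s * indicator B y + ennreal (f s y)" for s y
    proof -
      have "(\<Sum>(\<xi>, a, b, B)\<leftarrow>x # S. sqrt (expectation (\<lambda>w. \<xi> w ^ 4)) * (indicator {a<..b} s * indicator B y)) =
          c * (indicator {a<..b} s * indicator B y) + f s y"
        by (simp add: x c_def f_def)
      then show ?thesis
        using c0 f0[of s y] by (simp only:) (simp add: indicator_def)
    qed
    have eB: "emeasure lborel B = ennreal (measure lborel B)"
      using finite_borelD(2)[OF ab(3)] by (simp add: emeasure_eq_ennreal_measure)
    have i: "(\<integral>\<^sup>+y. ennreal c * indicator {a<..b} s * indicator B y + ennreal (f s y) \<partial>lborel) =
       ennreal c * indicator {a<..b} s * emeasure lborel B + (\<integral>\<^sup>+y. ennreal (f s y) \<partial>lborel)" for s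
      by (subst nn_integral_add) (auto simp: nn_integral_cmult_indicator)
    have "(\<integral>\<^sup>+s\<in>{0..}. (ennreal c * indicator {a<..b} s * emeasure lborel B + (\<integral>\<^sup>+y. ennreal (f s y) \<partial>lborel)) \<partial>lborel) =
       (\<integral>\<^sup>+s. (ennreal c * emeasure lborel B) * indicator {a<..b} s + (\<integral>\<^sup>+y. ennreal (f s y) \<partial>lborel) * indicator {0..} s \<partial>lborel)"
      using ab by (intro nn_integral_cong) (auto simp: indicator_def)
    also have "\<dots> = ennreal c * emeasure lborel B * ennreal (b - a) + ennreal T"
      using ab by (subst nn_integral_add) (auto simp: nn_integral_cmult_indicator IH)
    also have "\<dots> = ennreal ((b - a) * measure lborel B * c + T)"
      unfolding eB using IH c0 ab by (simp add: ennreal_mult ennreal_plus mult_ac)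
    finally show ?case
      unfolding s i using IH c0 ab by (auto simp: x c_def[symmetric] T_def[symmetric])
  qed simp
  have "nnE (\<lambda>w. sint S w ^ 4) = ennreal (expectation (\<lambda>w. sint S w ^ 4))"
    using F by (intro nn_integral_eq_integral) auto
  also have "\<dots> \<le> ennreal (9 * T\<^sup>2)" using 1 by (rule ennreal_leI)
  also have "\<dots> = 9 * (ennreal T)\<^sup>2" using T0 by (simp add: ennreal_mult ennreal_power)
  finally show ?thesis unfolding ordered_value_fourth[OF S(2)] using 2 by simp
qed

end

section \<open>Fourth moments of Walsh integrals\<close>

text \<open>The inequality \<open>(x + y)\<^sup>2 \<le> (1 + t) * x\<^sup>2 + (1 + 1 / t) *
  y\<^sup>2\<close> is applied to \<open>a + b\<close> and then to the resulting sum of squares,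
  which raises both factors to the third power.\<close>

lemma fourth_power_split:
  fixes \<eta> :: real
  assumes "\<eta> > 0"
  shows "\<exists>C\<ge>1. \<forall>a b. (a + b) ^ 4 \<le> (1 + \<eta>) * a ^ 4 + C * b ^ 4"
proof -
  \<comment> \<open>For \<open>t \<le> 1\<close> the third power of \<open>1 + t\<close> is at most
    \<open>1 + 7 * t\<close>.\<close>
  define t where "t = min 1 (\<eta> / 7)"
  have t: "0 < t" "t \<le> 1" "7 * t \<le> \<eta>" using assms by (auto simp: t_def)
  have "t * t \<le> t * 1" using t by (intro mult_left_mono) auto
  moreover from this have "t * (t * t) \<le> 1 * t" using t by (intro mult_mono) auto
  moreover have "(1 + t) ^ 3 = 1 + 3 * t + 3 * (t * t) + t * (t * t)"
    by (simp add: power3_eq_cube algebra_simps)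
  ultimately have t3: "(1 + t) ^ 3 \<le> 1 + \<eta>" using t by linarith
  define C where "C = (1 + 1 / t) ^ 3"
  have C: "C \<ge> 1" unfolding C_def using t by (intro one_le_power) auto
  have "(a + b) ^ 4 \<le> (1 + \<eta>) * a ^ 4 + C * b ^ 4" for a b :: real
  proof -
    have conv: "(x + y)\<^sup>2 \<le> (1 + t) * x\<^sup>2 + (1 + 1 / t) * y\<^sup>2" for x y :: real
    proof -
      have "0 \<le> (t * x - y)\<^sup>2 / t" using t by simp
      also have "\<dots> = t * x\<^sup>2 + y\<^sup>2 / t - 2 * x * y"
        using t by (simp add: field_simps power2_eq_square)
      finally show ?thesis by (simp add: power2_sum algebra_simps)
    qed
    have "(a + b) ^ 4 = ((a + b)\<^sup>2)\<^sup>2" by (simp flip: power_mult)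
    also have "\<dots> \<le> ((1 + t) * a\<^sup>2 + (1 + 1 / t) * b\<^sup>2)\<^sup>2" by (intro power_mono conv) auto
    also have "\<dots> \<le> (1 + t) * ((1 + t) * a\<^sup>2)\<^sup>2 + (1 + 1 / t) * ((1 + 1 / t) * b\<^sup>2)\<^sup>2" by (rule conv)
    also have "\<dots> = (1 + t) ^ 3 * a ^ 4 + C * b ^ 4"
      unfolding C_def by (simp add: power_mult_distrib power3_eq_cube power2_eq_square power4_eq_xxxx)
    also have "\<dots> \<le> (1 + \<eta>) * a ^ 4 + C * b ^ 4" using t3 by (intro add_right_mono mult_right_mono) auto
    finally show ?thesis .
  qed
  then show ?thesis using C by blast
qed

lemma ennreal_two_sum: "0 \<le> r \<Longrightarrow> 0 \<le> q \<Longrightarrow> 2 * ennreal r + 2 * ennreal q = ennreal (2 * r + 2 * q)"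
  by (simp add: ennreal_plus ennreal_mult)

lemma ennreal_linear: "0 \<le> a \<Longrightarrow> 0 \<le> x \<Longrightarrow> 0 \<le> b \<Longrightarrow> 0 \<le> y \<Longrightarrow>
    ennreal a * ennreal x + ennreal b * ennreal y = ennreal (a * x + b * y)"
  by (simp add: ennreal_plus ennreal_mult)

lemma nn_integral_sq_add:
  fixes f g :: "'b \<Rightarrow> real"
  assumes [measurable]: "f \<in> borel_measurable N" "g \<in> borel_measurable N"
  shows "(\<integral>\<^sup>+x. ennreal ((f x + g x)\<^sup>2) \<partial>N) \<le> 2 * (\<integral>\<^sup>+x. ennreal ((f x)\<^sup>2) \<partial>N) + 2 * (\<integral>\<^sup>+x. ennreal ((g x)\<^sup>2) \<partial>N)"
proof -
  have le: "(a + b)\<^sup>2 \<le> 2 * a\<^sup>2 + 2 * b\<^sup>2" for a b :: real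
    using zero_le_power2[of "a - b"] by (simp add: power2_sum power2_diff)
  have "(\<integral>\<^sup>+x. ennreal ((f x + g x)\<^sup>2) \<partial>N) \<le> (\<integral>\<^sup>+x. 2 * ennreal ((f x)\<^sup>2) + 2 * ennreal ((g x)\<^sup>2) \<partial>N)"
  proof (rule nn_integral_mono)
    fix x
    have "ennreal ((f x + g x)\<^sup>2) \<le> ennreal (2 * (f x)\<^sup>2 + 2 * (g x)\<^sup>2)" by (rule ennreal_leI[OF le])
    then show "ennreal ((f x + g x)\<^sup>2) \<le> 2 * ennreal ((f x)\<^sup>2) + 2 * ennreal ((g x)\<^sup>2)"
      by (simp add: ennreal_mult)
  qed
  also have "\<dots> = 2 * (\<integral>\<^sup>+x. ennreal ((f x)\<^sup>2) \<partial>N) + 2 * (\<integral>\<^sup>+x. ennreal ((g x)\<^sup>2) \<partial>N)"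
    by (subst nn_integral_add) (auto simp: nn_integral_cmult)
  finally show ?thesis .
qed

lemma field_inner_measurable:
  assumes "prob_space M" and f: "f \<in> borel_measurable (field_measure M)"
  shows "0 \<le> s \<Longrightarrow> (\<lambda>y. \<integral>\<^sup>+w. f (s, y, w) \<partial>M) \<in> borel_measurable lborel"
    and "(\<lambda>s. \<integral>\<^sup>+y. (\<integral>\<^sup>+w. f (s, y, w) \<partial>M) \<partial>lborel) \<in> borel_measurable (restrict_space lborel {0..})" (is "?S2")
proof -
  interpret prob_space M by fact
  have Q: "sigma_finite_measure (lborel \<Otimes>\<^sub>M M)"
    by (rule sigma_finite_pair_measure) unfold_locales
  have f': "f \<in> borel_measurable (restrict_space lborel {0..} \<Otimes>\<^sub>M (lborel \<Otimes>\<^sub>M M))"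
    using f by (simp add: field_measure_def)
  have m: "(\<lambda>p. f (s, p)) \<in> borel_measurable (lborel \<Otimes>\<^sub>M M)" if "s \<in> {0..}" for s
    by (rule measurable_compose[OF _ f'], rule measurable_Pair1') (use that in \<open>simp add: space_restrict_space\<close>)
  then show "0 \<le> s \<Longrightarrow> (\<lambda>y. \<integral>\<^sup>+w. f (s, y, w) \<partial>M) \<in> borel_measurable lborel"
    using borel_measurable_nn_integral_fst[of "\<lambda>p. f (s, p)" lborel] by simp
  have "(\<lambda>s. \<integral>\<^sup>+p. f (s, p) \<partial>(lborel \<Otimes>\<^sub>M M)) \<in> borel_measurable (restrict_space lborel {0..})"
    by (rule sigma_finite_measure.borel_measurable_nn_integral_fst[OF Q f'])
  then show ?S2
    by (rule measurable_cong[THEN iffD1, rotated])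
       (simp add: space_restrict_space nn_integral_fst[OF m, symmetric])
qed

text \<open>Simple fields live on half-open time intervals and vanish at time 0, so truncated fields
  can converge to \<open>X\<close> only off that null set.\<close>

lemma AE_field_measure_pos:
  assumes "prob_space M"
  shows "AE z in field_measure M. 0 < fst z"
proof -
  have "AE s in lborel. s \<noteq> (0::real)" by (rule AE_lborel_singleton)
  then have "AE s in lborel. (indicator {0::real} s :: ennreal) * emeasure (lborel :: real measure) UNIV * emeasure M (space M) * indicator {0..} s = 0"
    by eventually_elim simp
  then have "(\<integral>\<^sup>+s\<in>{0..}. (indicator {0::real} s :: ennreal) * emeasure (lborel :: real measure) UNIV * emeasure M (space M) \<partial>lborel) = (\<integral>\<^sup>+(s::real). 0 \<partial>lborel)"
    by (rule nn_integral_cong_AE)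
  moreover have "(\<integral>\<^sup>+z. indicator {0} (fst z) \<partial>field_measure M) =
     (\<integral>\<^sup>+s\<in>{0..}. (indicator {0::real} s :: ennreal) * emeasure (lborel :: real measure) UNIV * emeasure M (space M) \<partial>lborel)"
    by (subst nn_integral_field_measure[OF assms])
       (auto intro!: nn_integral_cong simp: mult_ac)
  ultimately have "AE z in field_measure M. indicator {0} (fst z) = (0::ennreal)"
    by (subst nn_integral_0_iff_AE[symmetric]) simp_all
  moreover have "AE z in field_measure M. 0 \<le> fst z"
    by (rule AE_I2) (auto simp: field_measure_def space_pair_measure space_restrict_space)
  ultimately show ?thesis by eventually_elim (auto simp: indicator_def split: if_splits)
qed

context white_noise
begin

abbreviation field_measurable :: "(real \<Rightarrow> real \<Rightarrow> 'a \<Rightarrow> real) \<Rightarrow> bool" where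
  "field_measurable X \<equiv> (\<lambda>(s, y, w). X s y w) \<in> borel_measurable (field_measure M)"

abbreviation fsq :: "(real \<Rightarrow> real \<Rightarrow> 'a \<Rightarrow> real) \<Rightarrow> ennreal" where
  "fsq \<equiv> field_sq_norm M"

lemma field_measurable_diff: "field_measurable X \<Longrightarrow> field_measurable Y \<Longrightarrow> field_measurable (\<lambda>s y w. X s y w - Y s y w)"
  by (simp add: case_prod_beta')

lemma fsq_add:
  assumes "field_measurable X" "field_measurable Y"
  shows "fsq (\<lambda>s y w. X s y w + Y s y w) \<le> 2 * fsq X + 2 * fsq Y"
  using nn_integral_sq_add[of "\<lambda>(s, y, w). X s y w" "field_measure M" "\<lambda>(s, y, w). Y s y w"] assms
  by (simp add: field_sq_norm_def case_prod_beta')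

lemma fsq_iterated:
  assumes "field_measurable X"
  shows "fsq X = (\<integral>\<^sup>+s\<in>{0..}. (\<integral>\<^sup>+y. (nnE (\<lambda>w. (X s y w)\<^sup>2)) \<partial>lborel) \<partial>lborel)"
  unfolding field_sq_norm_def using assms
  by (subst nn_integral_field_measure[OF prob_space_axioms]) (auto simp: case_prod_beta')

text \<open>Closure of the graph of the simple integral. Predictability of \<open>X\<close> is dropped: joint measurability
  passes to the differences that occur below, and the moment bounds need no more.\<close>

definition walsh_limit :: "(real \<Rightarrow> real \<Rightarrow> 'a \<Rightarrow> real) \<Rightarrow> ('a \<Rightarrow> real) \<Rightarrow> bool" where
  "walsh_limit X I \<longleftrightarrow> field_measurable X \<and> I \<in> borel_measurable M \<and>
    (\<forall>e>0. \<exists>S. simple S \<and> fsq (\<lambda>s y w. sval S s y w - X s y w) < ennreal e \<and>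
      nnE (\<lambda>w. (sint S w - I w)\<^sup>2) < ennreal e)"

lemma has_walsh_integral_limit:
  assumes "has_walsh_integral M W X I" "field_measurable X"
  shows "walsh_limit X I"
  unfolding walsh_limit_def
proof (intro conjI allI impI)
  fix e :: real assume "e > 0"
  then have e: "0 < ennreal e" by simp
  obtain S where S: "\<And>n. simple (S n)"
     "(\<lambda>n. fsq (\<lambda>s y w. sval (S n) s y w - X s y w)) \<longlonglongrightarrow> 0"
     "(\<lambda>n. \<integral>\<^sup>+ w. ennreal ((sint (S n) w - I w)\<^sup>2) \<partial>M) \<longlonglongrightarrow> 0"
    using assms(1) unfolding has_walsh_integral_def by blast
  have "\<forall>\<^sub>F n in sequentially. fsq (\<lambda>s y w. sval (S n) s y w - X s y w) < ennreal e \<and>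
      nnE (\<lambda>w. (sint (S n) w - I w)\<^sup>2) < ennreal e"
    by (intro eventually_conj order_tendstoD(2)[OF S(2) e] order_tendstoD(2)[OF S(3) e])
  then show "\<exists>S. simple S \<and> fsq (\<lambda>s y w. sval S s y w - X s y w) < ennreal e \<and>
      nnE (\<lambda>w. (sint S w - I w)\<^sup>2) < ennreal e"
    using S(1) eventually_happens'[OF sequentially_bot] by blast
qed (use assms in \<open>auto simp: has_walsh_integral_def\<close>)

lemma walsh_limitD:
  assumes "walsh_limit X I"
  shows "field_measurable X" "I \<in> borel_measurable M"
  using assms by (auto simp: walsh_limit_def)

lemma walsh_limit_approx:
  "walsh_limit X I \<Longrightarrow> 0 < e \<Longrightarrow> \<exists>S. simple S \<and> fsq (\<lambda>s y w. sval S s y w - X s y w) < ennreal e \<and>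
    nnE (\<lambda>w. (sint S w - I w)\<^sup>2) < ennreal e"
  by (simp add: walsh_limit_def)

lemma walsh_limit_AE:
  assumes "walsh_limit X I" "AE w in M. J w = I w" "J \<in> borel_measurable M"
  shows "walsh_limit X J"
proof -
  have "nnE (\<lambda>w. (f w - J w)\<^sup>2) = nnE (\<lambda>w. (f w - I w)\<^sup>2)" for f
    using assms(2) by (intro nn_integral_cong_AE, eventually_elim) simp
  then show ?thesis using assms unfolding walsh_limit_def by simp
qed

text \<open>The factor 4 in the hypothesis leaves room for the triangle inequality with squares.\<close>

lemma walsh_limit_closure:
  assumes X: "field_measurable X" and I: "I \<in> borel_measurable M"
    and ap: "\<And>e. e > 0 \<Longrightarrow> \<exists>Y J. walsh_limit Y J \<and> fsq (\<lambda>s y w. Y s y w - X s y w) \<le> ennreal e \<and>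
      nnE (\<lambda>w. (J w - I w)\<^sup>2) \<le> ennreal e"
  shows "walsh_limit X I"
  unfolding walsh_limit_def
proof (intro conjI allI impI X I)
  fix e :: real assume e: "e > 0"
  obtain Y J where Y: "walsh_limit Y J" "fsq (\<lambda>s y w. Y s y w - X s y w) \<le> ennreal (e/4)"
      "nnE (\<lambda>w. (J w - I w)\<^sup>2) \<le> ennreal (e/4)"
    using ap[of "e/4"] e by auto
  obtain S where S: "simple S" "fsq (\<lambda>s y w. sval S s y w - Y s y w) < ennreal (e/4)"
      "nnE (\<lambda>w. (sint S w - J w)\<^sup>2) < ennreal (e/4)"
    using walsh_limit_approx[OF Y(1), of "e/4"] e by auto
  note m = walsh_limitD[OF Y(1)]
  have lt: "2 * a + 2 * b < ennreal e" if ab: "a < ennreal (e/4)" "b \<le> ennreal (e/4)" for a b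
  proof -
    obtain r where r: "a = ennreal r" "0 \<le> r" "r < e/4" using ab(1) e
      by (cases a) (auto simp: ennreal_less_iff)
    have "2 * a + 2 * b \<le> 2 * ennreal r + 2 * ennreal (e/4)" using ab(2) r(1) by (intro add_mono mult_left_mono) auto
    also have "\<dots> = ennreal (2 * r + 2 * (e/4))" using r e by (intro ennreal_two_sum) auto
    also have "\<dots> < ennreal e" using r e by (intro ennreal_lessI) auto
    finally show ?thesis .
  qed
  have "fsq (\<lambda>s y w. (sval S s y w - Y s y w) + (Y s y w - X s y w)) < ennreal e"
    by (rule le_less_trans[OF fsq_add lt[OF S(2) Y(2)]]) (intro field_measurable_diff simple_field_value_measurable S m X)+
  moreover have "nnE (\<lambda>w. ((sint S w - J w) + (J w - I w))\<^sup>2) < ennreal e"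
    by (rule le_less_trans[OF nn_integral_sq_add lt[OF S(3) Y(3)]]) (intro borel_measurable_diff simple_field_integral_measurable S m I)+
  ultimately show "\<exists>S. simple S \<and> fsq (\<lambda>s y w. sval S s y w - X s y w) < ennreal e \<and>
      nnE (\<lambda>w. (sint S w - I w)\<^sup>2) < ennreal e"
    using S(1) by auto
qed

lemma walsh_limit_simple: "simple S \<Longrightarrow> walsh_limit (sval S) (sint S)"
  unfolding walsh_limit_def using simple_field_value_measurable simple_field_integral_measurable
  by (auto simp: field_sq_norm_def case_prod_beta' intro!: exI[of _ S])

lemma walsh_limit_diff:
  assumes X: "walsh_limit X I" and Y: "walsh_limit Y J"
  shows "walsh_limit (\<lambda>s y w. X s y w - Y s y w) (\<lambda>w. I w - J w)"
proof (rule walsh_limit_closure)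
  note m = walsh_limitD[OF X] walsh_limitD[OF Y]
  show "field_measurable (\<lambda>s y w. X s y w - Y s y w)" "(\<lambda>w. I w - J w) \<in> borel_measurable M"
    using m by (auto intro: field_measurable_diff)
  fix e :: real assume e: "e > 0"
  obtain S where S: "simple S" "fsq (\<lambda>s y w. sval S s y w - X s y w) < ennreal (e/4)"
      "nnE (\<lambda>w. (sint S w - I w)\<^sup>2) < ennreal (e/4)"
    using walsh_limit_approx[OF X, of "e/4"] e by auto
  obtain T where T: "simple T" "fsq (\<lambda>s y w. sval T s y w - Y s y w) < ennreal (e/4)"
      "nnE (\<lambda>w. (sint T w - J w)\<^sup>2) < ennreal (e/4)"
    using walsh_limit_approx[OF Y, of "e/4"] e by auto
  define U where "U = S @ simple_uminus T"
  have U: "simple U" unfolding U_def by (intro simple_append simple_simple_uminus S T)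
  have le: "2 * a + 2 * b \<le> ennreal e" if "a < ennreal (e/4)" "b < ennreal (e/4)" for a b
  proof -
    have "2 * a + 2 * b \<le> 2 * ennreal (e/4) + 2 * ennreal (e/4)" using that by (intro add_mono mult_left_mono) auto
    also have "\<dots> = ennreal (2 * (e/4) + 2 * (e/4))" using e by (intro ennreal_two_sum) auto
    finally show ?thesis by simp
  qed
  have f: "fsq (\<lambda>s y w. Z s y w - V s y w) = fsq (\<lambda>s y w. V s y w - Z s y w)" for Z V
    by (simp add: field_sq_norm_def power2_commute)
  have g: "nnE (\<lambda>w. (Z w - V w)\<^sup>2) = nnE (\<lambda>w. (V w - Z w)\<^sup>2)" for Z V
    by (simp add: power2_commute)
  have "fsq (\<lambda>s y w. (sval S s y w - X s y w) + (Y s y w - sval T s y w)) \<le> ennreal e"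
    by (rule order_trans[OF fsq_add le[OF S(2)]]) (use T m S in \<open>auto intro!: field_measurable_diff simple_field_value_measurable simp: f[of Y]\<close>)
  moreover have "nnE (\<lambda>w. ((sint S w - I w) + (J w - sint T w))\<^sup>2) \<le> ennreal e"
    by (rule order_trans[OF nn_integral_sq_add le[OF S(3)]]) (use T m S in \<open>auto intro!: borel_measurable_diff simple_field_integral_measurable simp: g[of J]\<close>)
  ultimately show "\<exists>Z V. walsh_limit Z V \<and> fsq (\<lambda>s y w. Z s y w - (X s y w - Y s y w)) \<le> ennreal e \<and>
      nnE (\<lambda>w. (V w - (I w - J w))\<^sup>2) \<le> ennreal e"
    using walsh_limit_simple[OF U]
    by (intro exI[of _ "sval U"] exI[of _ "sint U"])
       (simp add: U_def simple_field_value_append simple_field_value_uminus simple_field_integral_append simple_field_integral_uminus algebra_simps)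
qed

lemma walsh_limit_fsq_finite:
  assumes "walsh_limit X I"
  shows "fsq X < \<infinity>"
proof -
  obtain S where S: "simple S" "fsq (\<lambda>s y w. sval S s y w - X s y w) < ennreal 1"
    using walsh_limit_approx[OF assms zero_less_one] by blast
  have f: "fsq (\<lambda>s y w. X s y w - sval S s y w) = fsq (\<lambda>s y w. sval S s y w - X s y w)"
    by (simp add: field_sq_norm_def power2_commute)
  have "fsq (\<lambda>s y w. (X s y w - sval S s y w) + sval S s y w) \<le>
     2 * fsq (\<lambda>s y w. X s y w - sval S s y w) + 2 * fsq (sval S)"
    using walsh_limitD[OF assms] S by (intro fsq_add field_measurable_diff simple_field_value_measurable)
  also have "\<dots> < \<infinity>"
    using S simple_isometry(3)[OF S(1)] unfolding f
    by (auto simp: ennreal_mult_less_top intro: less_trans)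
  finally show ?thesis by simp
qed

text \<open>Truncation in time, space and value at the same level; the error is at most the size of
  \<open>X\<close> itself, so dominated convergence applies, and at a fixed point with positive time
  it is zero from some level on.\<close>

lemma clip_field_convergence:
  assumes X: "field_measurable X" and fin: "fsq X < \<infinity>" and e: "e > 0"
  shows "\<exists>K>0. fsq (\<lambda>s y w. (if 0 < s \<and> s \<le> K \<and> y \<in> {-K..K} then clip K (X s y w) else 0) - X s y w) < ennreal e"
proof -
  define X' where "X' K s y w = (if 0 < s \<and> s \<le> K \<and> y \<in> {-K..K} then clip K (X s y w) else 0)" for K s y w
  have [measurable]: "(\<lambda>z. X (fst z) (fst (snd z)) (snd (snd z))) \<in> borel_measurable (field_measure M)"
    using X by (simp add: case_prod_beta')
  have m: "(\<lambda>z. X' K (fst z) (fst (snd z)) (snd (snd z))) \<in> borel_measurable (field_measure M)" for K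
    unfolding X'_def by measurable
  have "(\<lambda>n. \<integral>\<^sup>+z. ennreal ((X' (real (Suc n)) (fst z) (fst (snd z)) (snd (snd z)) - X (fst z) (fst (snd z)) (snd (snd z)))\<^sup>2) \<partial>field_measure M)
      \<longlonglongrightarrow> (\<integral>\<^sup>+z. 0 \<partial>field_measure M)"
  proof (rule nn_integral_dominated_convergence[where w="\<lambda>z. ennreal ((X (fst z) (fst (snd z)) (snd (snd z)))\<^sup>2)"])
    show "(\<integral>\<^sup>+z. ennreal ((X (fst z) (fst (snd z)) (snd (snd z)))\<^sup>2) \<partial>field_measure M) < \<infinity>"
      using fin by (simp add: field_sq_norm_def case_prod_beta')
    show "AE z in field_measure M. ennreal ((X' (real (Suc n)) (fst z) (fst (snd z)) (snd (snd z)) - X (fst z) (fst (snd z)) (snd (snd z)))\<^sup>2) \<le>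
        ennreal ((X (fst z) (fst (snd z)) (snd (snd z)))\<^sup>2)" for n
      unfolding X'_def by (intro AE_I2 ennreal_leI abs_le_square_iff[THEN iffD1]) (auto intro: clip_error)
    show "AE z in field_measure M. (\<lambda>n. ennreal ((X' (real (Suc n)) (fst z) (fst (snd z)) (snd (snd z)) - X (fst z) (fst (snd z)) (snd (snd z)))\<^sup>2)) \<longlonglongrightarrow> 0"
      using AE_field_measure_pos[OF prob_space_axioms]
    proof eventually_elim
      case (elim z)
      define r where "r = fst z + \<bar>fst (snd z)\<bar> + \<bar>X (fst z) (fst (snd z)) (snd (snd z))\<bar>"
      have "\<forall>\<^sub>F n in sequentially. r \<le> real n"
        using filterlim_real_sequentially unfolding filterlim_at_top by blast
      then have "\<forall>\<^sub>F n in sequentially. ennreal ((X' (real (Suc n)) (fst z) (fst (snd z)) (snd (snd z)) - X (fst z) (fst (snd z)) (snd (snd z)))\<^sup>2) = 0"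
      proof eventually_elim
        case (elim n)
        then have "X' (real (Suc n)) (fst z) (fst (snd z)) (snd (snd z)) = X (fst z) (fst (snd z)) (snd (snd z))"
          using \<open>0 < fst z\<close> unfolding X'_def r_def by (auto simp: clip_eq)
        then show ?case by simp
      qed
      then show ?case by (rule tendsto_eventually)
    qed
  qed (use m in auto)
  then have "(\<lambda>n. fsq (\<lambda>s y w. X' (real (Suc n)) s y w - X s y w)) \<longlonglongrightarrow> 0"
    by (simp add: field_sq_norm_def case_prod_beta')
  then have "\<forall>\<^sub>F n in sequentially. fsq (\<lambda>s y w. X' (real (Suc n)) s y w - X s y w) < ennreal e"
    using order_tendstoD(2)[of _ 0 sequentially "ennreal e"] e by simp
  then obtain n where "fsq (\<lambda>s y w. X' (real (Suc n)) s y w - X s y w) < ennreal e"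
    using eventually_happens'[OF sequentially_bot] by blast
  then show ?thesis unfolding X'_def by (intro exI[of _ "real (Suc n)"]) auto
qed

text \<open>A simple field \<open>S\<close> close to \<open>X\<close> in mean square may have large
  fourth moments. Its truncation \<open>T\<close> has a pointwise fourth moment of at most
  \<open>1 + \<eta>\<close> times that of \<open>X\<close> plus a multiple of the mean square
  distance of \<open>S\<close> and \<open>X\<close>, because differences of truncated values are
  bounded. The ordered bound then applies to \<open>T\<close>, and \<open>T\<close> is still close
  to \<open>X\<close>.\<close>

lemma walsh_fourth_moment_approx:
  assumes XI: "walsh_limit X I"
    and h: "(\<lambda>(s, y). h s y) \<in> borel_measurable (borel \<Otimes>\<^sub>M borel)" "\<And>s y. 0 \<le> h s y"
    and X4: "\<And>s y. 0 \<le> s \<Longrightarrow> nnE (\<lambda>w. X s y w ^ 4) \<le> ennreal ((h s y)\<^sup>2)"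
    and hC: "(\<integral>\<^sup>+s\<in>{0..}. (\<integral>\<^sup>+y. ennreal (h s y) \<partial>lborel) \<partial>lborel) \<le> ennreal C" and C: "0 \<le> C" and e: "0 < e"
  shows "\<exists>J. J \<in> borel_measurable M \<and> nnE (\<lambda>w. J w ^ 4) \<le> ennreal (9 * (C + e)\<^sup>2) \<and>
    nnE (\<lambda>w. (J w - I w)\<^sup>2) \<le> ennreal e"
proof -
  note Xm = walsh_limitD(1)[OF XI] and Im = walsh_limitD(2)[OF XI]
  \<comment> \<open>The level \<open>K\<close> is fixed first; the constants \<open>c\<close> and
    \<open>\<nu>\<close> depend on it, and the accuracy \<open>\<delta>\<close> of the approximation
    is chosen last.\<close>
  obtain K where K: "K > 0" and KX: "fsq (\<lambda>s y w. (if 0 < s \<and> s \<le> K \<and> y \<in> {-K..K} then clip K (X s y w) else 0) - X s y w) < ennreal (e/80)"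
    using clip_field_convergence[OF Xm walsh_limit_fsq_finite[OF XI], of "e/80"] e by auto
  define \<eta> where "\<eta> = e / (3 * (C + 1))"
  have \<eta>: "\<eta> > 0" "\<eta> * C \<le> e / 3"
    using C e by (auto simp: \<eta>_def field_simps)
  obtain c0 where c0: "c0 \<ge> 1" "\<And>a b. (a + b) ^ 4 \<le> (1 + \<eta>) * a ^ 4 + c0 * b ^ 4"
    using fourth_power_split[OF \<eta>(1)] by blast
  define c where "c = c0 * (4 * K\<^sup>2)"
  have c: "c > 0" using c0 K by (simp add: c_def)
  \<comment> \<open>Over the box of area \<open>2 * K * K\<close> the constant error
    \<open>\<nu> / 2\<close> integrates to \<open>e / 3\<close>.\<close>
  define \<nu> where "\<nu> = e / (3 * K\<^sup>2)"
  have \<nu>: "\<nu> > 0" "\<nu> / 2 * (2 * K) * K = e / 3" using K e by (auto simp: \<nu>_def field_simps power2_eq_square)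
  \<comment> \<open>The first bound serves the mean square error of the integral, the second makes
    the error proportional to \<open>D\<close> integrate to at most \<open>e / 3\<close>.\<close>
  define \<delta> where "\<delta> = min (e / 80) (e / 3 / (c / (2 * \<nu>)))"
  have \<delta>: "\<delta> > 0" "\<delta> \<le> e / 80" "c / (2 * \<nu>) * \<delta> \<le> e / 3"
  proof -
    have q: "c / (2 * \<nu>) > 0" using c \<nu> by simp
    then show "\<delta> > 0" "\<delta> \<le> e / 80" using e c \<nu>(1) by (auto simp: \<delta>_def)
    have "c / (2 * \<nu>) * \<delta> \<le> c / (2 * \<nu>) * (e / 3 / (c / (2 * \<nu>)))"
      using q by (intro mult_left_mono) (auto simp: \<delta>_def)
    also have "\<dots> = e / 3" using c \<nu>(1) by (simp add: field_simps)
    finally show "c / (2 * \<nu>) * \<delta> \<le> e / 3" .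
  qed
  obtain S where S: "simple S" "fsq (\<lambda>s y w. sval S s y w - X s y w) < ennreal \<delta>"
      "nnE (\<lambda>w. (sint S w - I w)\<^sup>2) < ennreal \<delta>"
    using walsh_limit_approx[OF XI \<delta>(1)] by blast
  define T where "T = clip_field K S"
  have T: "simple T" "ordered_field T" unfolding T_def using simple_clip_field[OF S(1) K] ordered_clip_field[OF K] by auto
  have TV: "sval T s y w = (if 0 < s \<and> s \<le> K \<and> y \<in> {-K..K} then clip K (sval S s y w) else 0)" for s y w
    unfolding T_def by (rule clip_field_value[OF S(1) K])
  note Sm = simple_field_value_measurable[OF S(1)] and Tm = simple_field_value_measurable[OF T(1)]
  define D where "D s y = nnE (\<lambda>w. (sval S s y w - X s y w)\<^sup>2)" for s y
  have Dm: "(\<lambda>y. D s y) \<in> borel_measurable lborel" if "0 \<le> s" for s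
    unfolding D_def using field_inner_measurable(1)[OF prob_space_axioms _ that, of "\<lambda>(s, y, w). ennreal ((sval S s y w - X s y w)\<^sup>2)"]
      field_measurable_diff[OF Sm Xm] by (simp add: case_prod_beta')
  have DDm: "(\<lambda>s. \<integral>\<^sup>+y. D s y \<partial>lborel) \<in> borel_measurable (restrict_space lborel {0..})"
    unfolding D_def using field_inner_measurable(2)[OF prob_space_axioms, of "\<lambda>(s, y, w). ennreal ((sval S s y w - X s y w)\<^sup>2)"]
      field_measurable_diff[OF Sm Xm] by (simp add: case_prod_beta')
  have Dint: "(\<integral>\<^sup>+s. (\<integral>\<^sup>+y. D s y \<partial>lborel) \<partial>restrict_space lborel {0..}) < ennreal \<delta>"
    using S(2) fsq_iterated[OF field_measurable_diff[OF Sm Xm]] by (simp add: D_def nn_integral_restrict_space)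
  \<comment> \<open>The estimate \<open>sqrt (c * d) \<le> \<nu> / 2 + c * d / (2 * \<nu>)\<close>
    makes the mean square distance \<open>d\<close> enter linearly; only then can it be integrated
    over the plane. Where \<open>D\<close> is infinite the right side is infinite.\<close>
  have pt: "ennreal (sqrt (expectation (\<lambda>w. sval T s y w ^ 4))) \<le>
      ennreal (1 + \<eta>) * ennreal (h s y) + (ennreal (\<nu> / 2) * indicator {0..K} s * indicator {-K..K} y + ennreal (c / (2 * \<nu>)) * D s y)"
    if s: "0 \<le> s" for s y
  proof (cases "0 < s \<and> s \<le> K \<and> y \<in> {-K..K} \<and> D s y < \<infinity>")
    case True
    then obtain d where d: "D s y = ennreal d" "0 \<le> d" by (cases "D s y") auto
    have Xsy: "X s y \<in> borel_measurable M"
    proof -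
      have "(\<lambda>w. (s, y, w)) \<in> measurable M (field_measure M)"
        unfolding field_measure_def using s by (simp add: space_restrict_space)
      from measurable_compose[OF this Xm] show ?thesis by simp
    qed
    have Ssy: "sval S s y \<in> borel_measurable M"
    proof -
      have "(\<lambda>w. (s, y, w)) \<in> measurable M (field_measure M)"
        unfolding field_measure_def using s by (simp add: space_restrict_space)
      from measurable_compose[OF this Sm] show ?thesis by simp
    qed
    have TV': "sval T s y w = clip K (sval S s y w)" for w using TV True by simp
    have i: "integrable M (\<lambda>w. sval T s y w ^ 4)"
    proof -
      have "clip K v ^ 4 \<le> K ^ 4" for v
        using power_mono[OF clip_bound[of K v], of 4] K by simp
      then show ?thesis
        unfolding TV' using Ssy by (intro integrable_const_bound[where B="K ^ 4"]) auto
    qed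
    have "ennreal (expectation (\<lambda>w. sval T s y w ^ 4)) = nnE (\<lambda>w. sval T s y w ^ 4)"
      using i by (intro nn_integral_eq_integral[symmetric]) auto
    also have "\<dots> \<le> (\<integral>\<^sup>+w. ennreal (1 + \<eta>) * ennreal (X s y w ^ 4) + ennreal c * ennreal ((sval S s y w - X s y w)\<^sup>2) \<partial>M)"
    proof (rule nn_integral_mono)
      fix w
      let ?p = "clip K (sval S s y w)" and ?q = "clip K (X s y w)"
      have "?p ^ 4 \<le> (1 + \<eta>) * ?q ^ 4 + c0 * (?p - ?q) ^ 4" using c0(2)[of ?q "?p - ?q"] by simp
      also have "\<dots> \<le> (1 + \<eta>) * X s y w ^ 4 + c * (sval S s y w - X s y w)\<^sup>2"
      proof (rule add_mono)
        have "\<bar>?q\<bar> ^ 4 \<le> \<bar>X s y w\<bar> ^ 4" using clip_abs[of K] K by (intro power_mono) auto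
        then show "(1 + \<eta>) * ?q ^ 4 \<le> (1 + \<eta>) * X s y w ^ 4" using \<eta> by simp
        \<comment> \<open>Two of the four powers are bounded by \<open>2 * K\<close>; the remaining
          square is the one controlled in mean.\<close>
        have "\<bar>?p - ?q\<bar> \<le> 2 * K" using clip_bound[of K "sval S s y w"] clip_bound[of K "X s y w"] K by linarith
        then have "\<bar>?p - ?q\<bar>\<^sup>2 * \<bar>?p - ?q\<bar>\<^sup>2 \<le> (2 * K)\<^sup>2 * \<bar>sval S s y w - X s y w\<bar>\<^sup>2"
          using clip_diff[of K "sval S s y w" "X s y w"] by (intro mult_mono power_mono) auto
        then have "(?p - ?q) ^ 4 \<le> 4 * K\<^sup>2 * (sval S s y w - X s y w)\<^sup>2"
          by (simp add: power_mult_distrib flip: power_add)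
        then show "c0 * (?p - ?q) ^ 4 \<le> c * (sval S s y w - X s y w)\<^sup>2"
          using c0(1) by (simp add: c_def mult.assoc)
      qed
      finally have "?p ^ 4 \<le> (1 + \<eta>) * X s y w ^ 4 + c * (sval S s y w - X s y w)\<^sup>2" .
      from ennreal_leI[OF this] show "ennreal (sval T s y w ^ 4) \<le>
          ennreal (1 + \<eta>) * ennreal (X s y w ^ 4) + ennreal c * ennreal ((sval S s y w - X s y w)\<^sup>2)"
        unfolding TV' using \<eta>(1) c by (subst ennreal_linear) auto
    qed
    also have "\<dots> = ennreal (1 + \<eta>) * nnE (\<lambda>w. X s y w ^ 4) + ennreal c * D s y"
      unfolding D_def using Xsy Ssy by (subst nn_integral_add) (auto simp: nn_integral_cmult)
    also have "\<dots> \<le> ennreal (1 + \<eta>) * ennreal ((h s y)\<^sup>2) + ennreal c * ennreal d"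
      using X4[OF s] d by (intro add_mono mult_left_mono) auto
    also have "\<dots> = ennreal ((1 + \<eta>) * (h s y)\<^sup>2 + c * d)"
      using \<eta>(1) c d(2) by (intro ennreal_linear) auto
    finally have "expectation (\<lambda>w. sval T s y w ^ 4) \<le> (1 + \<eta>) * (h s y)\<^sup>2 + c * d"
      using \<eta> c d by (subst (asm) ennreal_le_iff) auto
    also have "\<dots> \<le> ((1 + \<eta>) * h s y + (\<nu> / 2 + c / (2 * \<nu>) * d))\<^sup>2"
    proof -
      have "(\<nu> / 2 + c / (2 * \<nu>) * d)\<^sup>2 - c * d = (\<nu> / 2 - c / (2 * \<nu>) * d)\<^sup>2"
        using \<nu>(1) by (simp add: power2_eq_square field_simps)
      then have 1: "c * d \<le> (\<nu> / 2 + c / (2 * \<nu>) * d)\<^sup>2" by (metis diff_ge_0_iff_ge zero_le_power2)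
      have "(1 + \<eta>) * 1 \<le> (1 + \<eta>) * (1 + \<eta>)" using \<eta> by (intro mult_left_mono) auto
      then have "(1 + \<eta>) * (h s y)\<^sup>2 \<le> (1 + \<eta>)\<^sup>2 * (h s y)\<^sup>2"
        by (intro mult_right_mono) (auto simp: power2_eq_square)
      then have 2: "(1 + \<eta>) * (h s y)\<^sup>2 \<le> ((1 + \<eta>) * h s y)\<^sup>2" by (simp add: power_mult_distrib)
      have 3: "0 \<le> (1 + \<eta>) * h s y" "0 \<le> \<nu> / 2 + c / (2 * \<nu>) * d" using \<eta> h(2) \<nu> c d by auto
      show ?thesis using 1 2 mult_nonneg_nonneg[OF 3] unfolding power2_sum by linarith
    qed
    finally have "sqrt (expectation (\<lambda>w. sval T s y w ^ 4)) \<le> (1 + \<eta>) * h s y + (\<nu> / 2 + c / (2 * \<nu>) * d)"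
      using \<eta> h(2) \<nu> c d by (intro real_le_lsqrt) auto
    from ennreal_leI[OF this] show ?thesis
      using True s \<eta>(1) h(2)[of s y] \<nu>(1) c d(2) unfolding d(1)
      by (simp add: ennreal_mult[symmetric] ennreal_plus[symmetric] del: ennreal_plus)
  next
    case False
    show ?thesis
    proof (cases "D s y < \<infinity>")
      case True
      then have "\<And>w. sval T s y w = 0" using False TV by auto
      then show ?thesis by simp
    next
      case False
      then have "D s y = \<infinity>" by (cases "D s y") auto
      then show ?thesis using c \<nu> by (simp add: ennreal_mult_top)
    qed
  qed
  let ?R = "restrict_space lborel {0::real..}"
  have hm: "(\<lambda>y. h s y) \<in> borel_measurable lborel" for s
    using measurable_compose[OF measurable_Pair1' h(1), of s] by simp
  have Hm: "(\<lambda>s. \<integral>\<^sup>+y. ennreal (h s y) \<partial>lborel) \<in> borel_measurable ?R"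
  proof (rule measurable_restrict_space1)
    have "(\<lambda>z. ennreal (case z of (s, y) \<Rightarrow> h s y)) \<in> borel_measurable (lborel \<Otimes>\<^sub>M lborel)"
      using h(1) by (simp add: lborel_prod[symmetric] measurable_lborel1 cong: measurable_cong_sets)
    from lborel.borel_measurable_nn_integral_fst[OF this]
    show "(\<lambda>s. \<integral>\<^sup>+y. ennreal (h s y) \<partial>lborel) \<in> borel_measurable lborel" by simp
  qed
  have "(\<integral>\<^sup>+s\<in>{0..}. (\<integral>\<^sup>+y. ennreal (sqrt (expectation (\<lambda>w. sval T s y w ^ 4))) \<partial>lborel) \<partial>lborel) =
      (\<integral>\<^sup>+s. (\<integral>\<^sup>+y. ennreal (sqrt (expectation (\<lambda>w. sval T s y w ^ 4))) \<partial>lborel) \<partial>?R)"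
    by (simp add: nn_integral_restrict_space)
  also have "\<dots> \<le> (\<integral>\<^sup>+s. ennreal (1 + \<eta>) * (\<integral>\<^sup>+y. ennreal (h s y) \<partial>lborel) +
      (ennreal (\<nu> / 2 * (2 * K)) * indicator {0..K} s + ennreal (c / (2 * \<nu>)) * (\<integral>\<^sup>+y. D s y \<partial>lborel)) \<partial>?R)"
  proof (rule nn_integral_mono)
    fix s assume "s \<in> space ?R"
    then have s: "0 \<le> s" by (simp add: space_restrict_space)
    note [measurable] = hm[of s] Dm[OF s]
    have "(\<integral>\<^sup>+y. ennreal (sqrt (expectation (\<lambda>w. sval T s y w ^ 4))) \<partial>lborel) \<le>
       (\<integral>\<^sup>+y. ennreal (1 + \<eta>) * ennreal (h s y) + (ennreal (\<nu> / 2) * indicator {0..K} s * indicator {-K..K} y + ennreal (c / (2 * \<nu>)) * D s y) \<partial>lborel)"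
      by (intro nn_integral_mono pt s)
    also have "\<dots> = ennreal (1 + \<eta>) * (\<integral>\<^sup>+y. ennreal (h s y) \<partial>lborel) +
      (ennreal (\<nu> / 2) * indicator {0..K} s * ennreal (2 * K) + ennreal (c / (2 * \<nu>)) * (\<integral>\<^sup>+y. D s y \<partial>lborel))"
      using K by (simp add: nn_integral_add nn_integral_cmult nn_integral_cmult_indicator)
    also have "ennreal (\<nu> / 2) * indicator {0..K} s * ennreal (2 * K) = ennreal (\<nu> / 2 * (2 * K)) * indicator {0..K} s"
      using \<nu>(1) K by (subst ennreal_mult) (auto simp: mult_ac)
    finally show "(\<integral>\<^sup>+y. ennreal (sqrt (expectation (\<lambda>w. sval T s y w ^ 4))) \<partial>lborel) \<le> ennreal (1 + \<eta>) * (\<integral>\<^sup>+y. ennreal (h s y) \<partial>lborel) +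
      (ennreal (\<nu> / 2 * (2 * K)) * indicator {0..K} s + ennreal (c / (2 * \<nu>)) * (\<integral>\<^sup>+y. D s y \<partial>lborel))" .
  qed
  also have "\<dots> = ennreal (1 + \<eta>) * (\<integral>\<^sup>+s. (\<integral>\<^sup>+y. ennreal (h s y) \<partial>lborel) \<partial>?R) +
      (ennreal (\<nu> / 2 * (2 * K)) * ennreal K + ennreal (c / (2 * \<nu>)) * (\<integral>\<^sup>+s. (\<integral>\<^sup>+y. D s y \<partial>lborel) \<partial>?R))"
  proof -
    have im: "(indicator {0..K} :: real \<Rightarrow> ennreal) \<in> borel_measurable ?R" by (rule measurable_restrict_space1) simp
    have "(\<integral>\<^sup>+s. indicator {0..K} s \<partial>?R) = (\<integral>\<^sup>+s. indicator {0..K} s * indicator {0..} s \<partial>lborel)"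
      by (subst nn_integral_restrict_space) auto
    also have "\<dots> = (\<integral>\<^sup>+s. indicator {0..K} s \<partial>lborel)"
      by (rule nn_integral_cong) (simp add: indicator_def)
    also have "\<dots> = ennreal K" using K by simp
    finally show ?thesis using Hm DDm im by (simp add: nn_integral_add nn_integral_cmult)
  qed
  also have "\<dots> \<le> ennreal (1 + \<eta>) * ennreal C + (ennreal (\<nu> / 2 * (2 * K)) * ennreal K + ennreal (c / (2 * \<nu>)) * ennreal \<delta>)"
    using hC Dint by (intro add_mono mult_left_mono) (auto simp: nn_integral_restrict_space)
  also have "\<dots> = ennreal ((1 + \<eta>) * C + (\<nu> / 2 * (2 * K) * K + c / (2 * \<nu>) * \<delta>))"
    using \<eta> C \<nu>(1) K c \<delta>(1) by (simp add: ennreal_mult[symmetric] ennreal_plus[symmetric] del: ennreal_plus)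
  also have "\<dots> \<le> ennreal (C + e)"
    using \<eta>(2) \<nu>(2) \<delta>(3) by (intro ennreal_leI) (simp add: distrib_right)
  finally have N: "(\<integral>\<^sup>+s\<in>{0..}. (\<integral>\<^sup>+y. ennreal (sqrt (expectation (\<lambda>w. sval T s y w ^ 4))) \<partial>lborel) \<partial>lborel) \<le> ennreal (C + e)" .
  have 1: "nnE (\<lambda>w. sint T w ^ 4) \<le> ennreal (9 * (C + e)\<^sup>2)"
  proof -
    have "nnE (\<lambda>w. sint T w ^ 4) \<le> 9 * (ennreal (C + e))\<^sup>2"
      by (rule order_trans[OF ordered_fourth_moment_integral[OF T]]) (intro mult_left_mono power_mono N, auto)
    also have "\<dots> = ennreal (9 * (C + e)\<^sup>2)" using C e by (simp add: ennreal_mult ennreal_power del: ennreal_plus)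
    finally show ?thesis .
  qed
  let ?X' = "\<lambda>s y w. if 0 < s \<and> s \<le> K \<and> y \<in> {-K..K} then clip K (X s y w) else 0"
  have X'm: "field_measurable ?X'"
  proof -
    have [measurable]: "(\<lambda>z. X (fst z) (fst (snd z)) (snd (snd z))) \<in> borel_measurable (field_measure M)"
      using Xm by (simp add: case_prod_beta')
    show ?thesis unfolding case_prod_beta' by measurable
  qed
  have f: "fsq (\<lambda>s y w. Z s y w - V s y w) = fsq (\<lambda>s y w. V s y w - Z s y w)" for Z V
    by (simp add: field_sq_norm_def power2_commute)
  have TX': "fsq (\<lambda>s y w. sval T s y w - ?X' s y w) \<le> ennreal \<delta>"
  proof -
    have "fsq (\<lambda>s y w. sval T s y w - ?X' s y w) \<le> fsq (\<lambda>s y w. sval S s y w - X s y w)"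
      unfolding field_sq_norm_def TV
      by (intro nn_integral_mono) (auto intro!: ennreal_leI simp: abs_le_square_iff[symmetric] clip_diff)
    then show ?thesis using S(2) by simp
  qed
  have le: "2 * a + 2 * b \<le> ennreal (4 * r)" if "a \<le> ennreal r" "b \<le> ennreal r" "0 \<le> r" for a b r
  proof -
    have "2 * a + 2 * b \<le> 2 * ennreal r + 2 * ennreal r" using that by (intro add_mono mult_left_mono) auto
    also have "\<dots> = ennreal (2 * r + 2 * r)" using that by (intro ennreal_two_sum) auto
    finally show ?thesis by simp
  qed
  have \<delta>e: "ennreal \<delta> \<le> ennreal (e / 80)" using \<delta> by (intro ennreal_leI)
  \<comment> \<open>Each triangle inequality for squares multiplies the bound by 4. Three in
    succession give \<open>64 * (e / 80)\<close>, which is below \<open>e\<close>.\<close>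
  have TX: "fsq (\<lambda>s y w. (sval T s y w - ?X' s y w) + (?X' s y w - X s y w)) \<le> ennreal (4 * (e/80))"
    using order_trans[OF TX' \<delta>e] KX e by (intro order_trans[OF fsq_add le] field_measurable_diff Tm X'm Xm) auto
  have "fsq (\<lambda>s y w. (sval T s y w - X s y w) + (X s y w - sval S s y w)) \<le> ennreal (4 * (4 * (e/80)))"
  proof (intro order_trans[OF fsq_add le] field_measurable_diff Tm Xm Sm)
    show "fsq (\<lambda>s y w. sval T s y w - X s y w) \<le> ennreal (4 * (e/80))" using TX by simp
    have "fsq (\<lambda>s y w. sval S s y w - X s y w) \<le> ennreal (4 * (e/80))"
      by (rule order_trans[OF less_imp_le[OF S(2)]]) (use \<delta> e in \<open>auto intro!: ennreal_leI\<close>)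
    then show "fsq (\<lambda>s y w. X s y w - sval S s y w) \<le> ennreal (4 * (e/80))" using f[of X] by simp
  qed (use e in auto)
  then have TS: "fsq (\<lambda>s y w. sval T s y w - sval S s y w) \<le> ennreal (4 * (4 * (e/80)))" by simp
  define U where "U = T @ simple_uminus S"
  have U: "simple U" unfolding U_def by (intro simple_append simple_simple_uminus S T)
  \<comment> \<open>Both fields are simple, so the isometry of the concatenated list turns the
    distance of the fields into the distance of the integrals.\<close>
  have "nnE (\<lambda>w. (sint T w - sint S w)\<^sup>2) \<le> ennreal (4 * (4 * (e/80)))"
  proof -
    have "sval U = (\<lambda>s y w. sval T s y w - sval S s y w)"
      by (intro ext) (simp add: U_def simple_field_value_append simple_field_value_uminus)
    then show ?thesis
      using simple_isometry(2)[OF U] TS by (simp add: U_def simple_field_integral_append simple_field_integral_uminus)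
  qed
  moreover have "nnE (\<lambda>w. (sint S w - I w)\<^sup>2) \<le> ennreal (4 * (4 * (e/80)))"
    by (rule order_trans[OF less_imp_le[OF S(3)]]) (use \<delta> e in \<open>auto intro!: ennreal_leI\<close>)
  ultimately have "nnE (\<lambda>w. ((sint T w - sint S w) + (sint S w - I w))\<^sup>2) \<le> ennreal (4 * (4 * (4 * (e/80))))"
    using e by (intro order_trans[OF nn_integral_sq_add le] borel_measurable_diff simple_field_integral_measurable S T Im) auto
  also have "\<dots> \<le> ennreal e" using e by (intro ennreal_leI) simp
  finally have 2: "nnE (\<lambda>w. (sint T w - I w)\<^sup>2) \<le> ennreal e" by simp
  show ?thesis
    using 1 2 simple_field_integral_measurable[OF T(1)] by blast
qed

text \<open>Burkholder's inequality for \<open>p = 4\<close>, with the norms exchanged by Minkowski: \<open>h\<close> dominates the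
  \<open>L\<^sup>2(M)\<close> norm of the squared integrand.\<close>

lemma walsh_fourth_moment:
  assumes XI: "walsh_limit X I"
    and h: "(\<lambda>(s, y). h s y) \<in> borel_measurable (borel \<Otimes>\<^sub>M borel)" "\<And>s y. 0 \<le> h s y"
    and X4: "\<And>s y. 0 \<le> s \<Longrightarrow> nnE (\<lambda>w. X s y w ^ 4) \<le> ennreal ((h s y)\<^sup>2)"
    and hC: "(\<integral>\<^sup>+s\<in>{0..}. (\<integral>\<^sup>+y. ennreal (h s y) \<partial>lborel) \<partial>lborel) \<le> ennreal C" and C: "0 \<le> C"
  shows "nnE (\<lambda>w. I w ^ 4) \<le> ennreal (9 * C\<^sup>2)"
proof -
  note Im[measurable] = walsh_limitD(2)[OF XI]
  have "\<forall>n. \<exists>J. J \<in> borel_measurable M \<and> nnE (\<lambda>w. J w ^ 4) \<le> ennreal (9 * (C + 1 / real (Suc n))\<^sup>2) \<and>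
    nnE (\<lambda>w. (J w - I w)\<^sup>2) \<le> ennreal (1 / real (Suc n))"
    by (intro allI walsh_fourth_moment_approx[OF XI h X4 hC C]) auto
  from choice[OF this] obtain J where J0: "\<forall>n. J n \<in> borel_measurable M \<and> nnE (\<lambda>w. J n w ^ 4) \<le> ennreal (9 * (C + 1 / real (Suc n))\<^sup>2) \<and>
    nnE (\<lambda>w. (J n w - I w)\<^sup>2) \<le> ennreal (1 / real (Suc n))" by blast
  then have J: "\<And>n. J n \<in> borel_measurable M" "\<And>n. (nnE (\<lambda>w. J n w ^ 4)) \<le> ennreal (9 * (C + 1 / real (Suc n))\<^sup>2)"
    "\<And>n. (nnE (\<lambda>w. (J n w - I w)\<^sup>2)) \<le> ennreal (1 / real (Suc n))"
    by blast+
  note [measurable] = J(1)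
  have lim1: "(\<lambda>n. 1 / real (Suc n)) \<longlonglongrightarrow> 0" using LIMSEQ_inverse_real_of_nat by (simp add: inverse_eq_divide)
  have ij: "integrable M (\<lambda>w. (J n w - I w)\<^sup>2)" for n
    using J(3)[of n] by (intro integrableI_nonneg) (auto intro: le_less_trans)
  have "(\<lambda>n. \<integral>w. norm ((J n w - I w)\<^sup>2) \<partial>M) \<longlonglongrightarrow> 0"
  proof (rule Lim_null_comparison[OF _ lim1], rule always_eventually, rule allI)
    fix n
    have "ennreal (\<integral>w. (J n w - I w)\<^sup>2 \<partial>M) \<le> ennreal (1 / real (Suc n))"
      using J(3)[of n] nn_integral_eq_integral[OF ij[of n]] by simp
    then show "norm (\<integral>w. norm ((J n w - I w)\<^sup>2) \<partial>M) \<le> 1 / real (Suc n)"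
      by (subst (asm) ennreal_le_iff) auto
  qed
  \<comment> \<open>The approximants converge to \<open>I\<close> only in mean square. Along a
    subsequence they converge almost surely, and Fatou's lemma carries the fourth moment bound to
    the limit.\<close>
  from tendsto_L1_AE_subseq[OF ij this]
  obtain r where r: "strict_mono r" "AE w in M. (\<lambda>n. (J (r n) w - I w)\<^sup>2) \<longlonglongrightarrow> 0" by auto
  have "nnE (\<lambda>w. I w ^ 4) = (\<integral>\<^sup>+w. liminf (\<lambda>n. ennreal (J (r n) w ^ 4)) \<partial>M)"
    using r(2)
  proof (intro nn_integral_cong_AE, eventually_elim)
    case (elim w)
    then have "(\<lambda>n. sqrt ((J (r n) w - I w)\<^sup>2)) \<longlonglongrightarrow> sqrt 0" by (intro tendsto_real_sqrt)
    then have "(\<lambda>n. J (r n) w) \<longlonglongrightarrow> I w" by (simp add: tendsto_rabs_zero_iff LIM_zero_iff)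
    then have "(\<lambda>n. ennreal (J (r n) w ^ 4)) \<longlonglongrightarrow> ennreal (I w ^ 4)" by (intro tendsto_ennrealI tendsto_power)
    from lim_imp_Liminf[OF sequentially_bot this] show ?case by simp
  qed
  also have "\<dots> \<le> liminf (\<lambda>n. \<integral>\<^sup>+w. ennreal (J (r n) w ^ 4) \<partial>M)" by (rule nn_integral_liminf) simp
  also have "\<dots> \<le> liminf (\<lambda>n. ennreal (9 * (C + 1 / real (Suc (r n)))\<^sup>2))"
    by (intro Liminf_mono always_eventually allI J(2))
  also have "\<dots> = ennreal (9 * C\<^sup>2)"
  proof (rule lim_imp_Liminf)
    have "(\<lambda>n. 1 / real (Suc (r n))) \<longlonglongrightarrow> 0" using LIMSEQ_subseq_LIMSEQ[OF lim1 r(1)] by (simp add: comp_def)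
    then have "(\<lambda>n. ennreal (9 * (C + 1 / real (Suc (r n)))\<^sup>2)) \<longlonglongrightarrow> ennreal (9 * (C + 0)\<^sup>2)"
      by (intro tendsto_ennrealI tendsto_intros)
    then show "(\<lambda>n. ennreal (9 * (C + 1 / real (Suc (r n)))\<^sup>2)) \<longlonglongrightarrow> ennreal (9 * C\<^sup>2)" by simp
  qed simp
  finally show ?thesis .
qed

end

section \<open>Deterministic step functions and their mean square closure\<close>

type_synonym rectangles = "(real \<times> real \<times> real \<times> real set) list"

definition rect_within :: "real \<Rightarrow> real \<Rightarrow> rectangles \<Rightarrow> bool" where
  "rect_within \<tau> t P \<longleftrightarrow> (\<forall>(c, a, b, B)\<in>set P. \<tau> \<le> a \<and> a \<le> b \<and> b \<le> t \<and> B \<in> finite_borel)"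

definition rect_value :: "rectangles \<Rightarrow> real \<times> real \<Rightarrow> real" where
  "rect_value P = (\<lambda>(s, y). \<Sum>(c, a, b, B)\<leftarrow>P. c * indicator {a<..b} s * indicator B y)"

lemma rect_value_measurable:
  "rect_within \<tau> t P \<Longrightarrow> rect_value P \<in> borel_measurable (borel \<Otimes>\<^sub>M borel)"
proof (induction P)
  case (Cons x P)
  obtain c a b B where x: "x = (c, a, b, B)" by (cases x)
  have [measurable]: "B \<in> sets borel" "rect_value P \<in> borel_measurable (borel \<Otimes>\<^sub>M borel)"
    using Cons by (auto simp: rect_within_def x finite_borel_def)
  have "rect_value (x # P) = (\<lambda>z. c * indicator {a<..b} (fst z) * indicator B (snd z) + rect_value P z)"
    by (auto simp: rect_value_def x)
  then show ?case by simp
qed (simp add: rect_value_def case_prod_beta')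

lemma rect_value_outside:
  "rect_within \<tau> t P \<Longrightarrow> s \<notin> {\<tau><..t} \<Longrightarrow> rect_value P (s, y) = 0"
  by (induction P) (auto simp: rect_value_def rect_within_def indicator_def)

lemma rect_append:
  "rect_value (P @ Q) z = rect_value P z + rect_value Q z"
  "rect_within \<tau> t (P @ Q) \<longleftrightarrow> rect_within \<tau> t P \<and> rect_within \<tau> t Q"
  by (auto simp: rect_value_def rect_within_def case_prod_beta')

definition rect_scale :: "real \<Rightarrow> rectangles \<Rightarrow> rectangles" where
  "rect_scale d = map (\<lambda>(c, r). (d * c, r))"

lemma rect_scale:
  "rect_value (rect_scale d P) z = d * rect_value P z"
  "rect_within \<tau> t P \<Longrightarrow> rect_within \<tau> t (rect_scale d P)"
proof -
  show "rect_value (rect_scale d P) z = d * rect_value P z"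
    by (induction P) (auto simp: rect_value_def rect_scale_def case_prod_beta' algebra_simps)
  show "rect_within \<tau> t P \<Longrightarrow> rect_within \<tau> t (rect_scale d P)"
    unfolding rect_within_def rect_scale_def by fastforce
qed

abbreviation plane :: "(real \<times> real) measure" where "plane \<equiv> lborel \<Otimes>\<^sub>M lborel"

text \<open>The approximants are confined to the time window, so that their integrals are increments
  after \<open>\<tau>\<close> that are known at time \<open>t\<close>.\<close>

definition rect_approx :: "real \<Rightarrow> real \<Rightarrow> (real \<times> real \<Rightarrow> real) \<Rightarrow> bool" where
  "rect_approx \<tau> t f \<longleftrightarrow> f \<in> borel_measurable plane \<and>
    (\<forall>e>0. \<exists>P. rect_within \<tau> t P \<and> (\<integral>\<^sup>+z. ennreal ((rect_value P z - f z)\<^sup>2) \<partial>plane) \<le> ennreal e)"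

lemma rect_approxD:
  "rect_approx \<tau> t f \<Longrightarrow> f \<in> borel_measurable plane"
  "rect_approx \<tau> t f \<Longrightarrow> 0 < e \<Longrightarrow> \<exists>P. rect_within \<tau> t P \<and> (\<integral>\<^sup>+z. ennreal ((rect_value P z - f z)\<^sup>2) \<partial>plane) \<le> ennreal e"
  by (simp_all add: rect_approx_def)

lemma rect_value_plane: "rect_within \<tau> t P \<Longrightarrow> rect_value P \<in> borel_measurable plane"
  using rect_value_measurable by (simp cong: measurable_cong_sets)

lemma rect_approx_limit:
  assumes f: "f \<in> borel_measurable plane"
    and ap: "\<And>e. e > 0 \<Longrightarrow> \<exists>g. rect_approx \<tau> t g \<and> (\<integral>\<^sup>+z. ennreal ((g z - f z)\<^sup>2) \<partial>plane) \<le> ennreal e"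
  shows "rect_approx \<tau> t f"
  unfolding rect_approx_def
proof (intro conjI f allI impI)
  fix e :: real assume e: "e > 0"
  obtain g where g: "rect_approx \<tau> t g" "(\<integral>\<^sup>+z. ennreal ((g z - f z)\<^sup>2) \<partial>plane) \<le> ennreal (e/4)"
    using ap[of "e/4"] e by auto
  then obtain P where P: "rect_within \<tau> t P" "(\<integral>\<^sup>+z. ennreal ((rect_value P z - g z)\<^sup>2) \<partial>plane) \<le> ennreal (e/4)"
    using rect_approxD(2)[OF g(1), of "e/4"] e by auto
  have "(\<integral>\<^sup>+z. ennreal (((rect_value P z - g z) + (g z - f z))\<^sup>2) \<partial>plane) \<le> 2 * ennreal (e/4) + 2 * ennreal (e/4)"
    by (rule order_trans[OF nn_integral_sq_add add_mono])
       (use rect_value_plane[OF P(1)] g f P in \<open>auto simp: rect_approx_def intro!: mult_left_mono borel_measurable_diff\<close>)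
  also have "\<dots> = ennreal e" using e by (subst ennreal_two_sum) auto
  finally show "\<exists>P. rect_within \<tau> t P \<and> (\<integral>\<^sup>+z. ennreal ((rect_value P z - f z)\<^sup>2) \<partial>plane) \<le> ennreal e"
    using P(1) by auto
qed

lemma rect_approx_rect: "rect_within \<tau> t P \<Longrightarrow> rect_approx \<tau> t (rect_value P)"
  unfolding rect_approx_def using rect_value_plane by (auto intro!: exI[of _ P])

lemma rect_approx_add:
  assumes f: "rect_approx \<tau> t f" and g: "rect_approx \<tau> t g"
  shows "rect_approx \<tau> t (\<lambda>z. f z + g z)"
proof (rule rect_approx_limit)
  show "(\<lambda>z. f z + g z) \<in> borel_measurable plane" using f g by (auto simp: rect_approx_def)
  fix e :: real assume e: "e > 0"
  obtain P where P: "rect_within \<tau> t P" "(\<integral>\<^sup>+z. ennreal ((rect_value P z - f z)\<^sup>2) \<partial>plane) \<le> ennreal (e/4)"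
    using rect_approxD(2)[OF f, of "e/4"] e by auto
  obtain Q where Q: "rect_within \<tau> t Q" "(\<integral>\<^sup>+z. ennreal ((rect_value Q z - g z)\<^sup>2) \<partial>plane) \<le> ennreal (e/4)"
    using rect_approxD(2)[OF g, of "e/4"] e by auto
  have "(\<integral>\<^sup>+z. ennreal (((rect_value P z - f z) + (rect_value Q z - g z))\<^sup>2) \<partial>plane) \<le> 2 * ennreal (e/4) + 2 * ennreal (e/4)"
    by (rule order_trans[OF nn_integral_sq_add add_mono])
       (use rect_value_plane[OF P(1)] rect_value_plane[OF Q(1)] g f P Q in \<open>auto simp: rect_approx_def intro!: mult_left_mono borel_measurable_diff\<close>)
  also have "\<dots> = ennreal e" using e by (subst ennreal_two_sum) auto
  finally show "\<exists>h. rect_approx \<tau> t h \<and> (\<integral>\<^sup>+z. ennreal ((h z - (f z + g z))\<^sup>2) \<partial>plane) \<le> ennreal e"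
    using P(1) Q(1) rect_approx_rect[of \<tau> t "P @ Q"]
    by (intro exI[of _ "rect_value (P @ Q)"]) (auto simp: rect_append algebra_simps)
qed

lemma rect_approx_scale:
  assumes f: "rect_approx \<tau> t f"
  shows "rect_approx \<tau> t (\<lambda>z. d * f z)"
proof (rule rect_approx_limit)
  show "(\<lambda>z. d * f z) \<in> borel_measurable plane" using f by (auto simp: rect_approx_def)
  fix e :: real assume e: "e > 0"
  define r where "r = e / (d\<^sup>2 + 1)"
  have d: "0 < d\<^sup>2 + 1" by (rule add_nonneg_pos) auto
  have r: "r > 0" "d\<^sup>2 * r \<le> e"
    using e d by (auto simp: r_def pos_divide_le_eq distrib_left)
  obtain P where P: "rect_within \<tau> t P" "(\<integral>\<^sup>+z. ennreal ((rect_value P z - f z)\<^sup>2) \<partial>plane) \<le> ennreal r"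
    using rect_approxD(2)[OF f r(1)] by auto
  have m: "rect_value P \<in> borel_measurable plane" "f \<in> borel_measurable plane"
    using rect_value_plane[OF P(1)] f by (auto simp: rect_approx_def)
  have "(\<integral>\<^sup>+z. ennreal ((d * rect_value P z - d * f z)\<^sup>2) \<partial>plane) = (\<integral>\<^sup>+z. ennreal (d\<^sup>2) * ennreal ((rect_value P z - f z)\<^sup>2) \<partial>plane)"
    by (intro nn_integral_cong) (simp add: ennreal_mult[symmetric] power_mult_distrib[symmetric] right_diff_distrib)
  also have "\<dots> = ennreal (d\<^sup>2) * (\<integral>\<^sup>+z. ennreal ((rect_value P z - f z)\<^sup>2) \<partial>plane)"
    using m by (intro nn_integral_cmult) auto
  also have "\<dots> \<le> ennreal (d\<^sup>2) * ennreal r" using P(2) by (intro mult_left_mono) auto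
  also have "\<dots> \<le> ennreal e" using r by (subst ennreal_mult[symmetric]) (auto intro!: ennreal_leI)
  finally show "\<exists>h. rect_approx \<tau> t h \<and> (\<integral>\<^sup>+z. ennreal ((h z - d * f z)\<^sup>2) \<partial>plane) \<le> ennreal e"
    using P(1) rect_approx_rect rect_scale(2)
    by (intro exI[of _ "rect_value (rect_scale d P)"]) (auto simp: rect_scale)
qed

lemma rect_approx_sum:
  "finite J \<Longrightarrow> (\<And>j. j \<in> J \<Longrightarrow> rect_approx \<tau> t (f j)) \<Longrightarrow> rect_approx \<tau> t (\<lambda>z. \<Sum>j\<in>J. f j z)"
proof (induction J rule: finite_induct)
  case empty
  have "rect_value [] = (\<lambda>_. 0)" by (auto simp: rect_value_def)
  then show ?case using rect_approx_rect[of \<tau> t "[]"] by (simp add: rect_within_def)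
qed (auto intro: rect_approx_add)

lemma rect_approx_dominated:
  assumes g: "\<And>n. rect_approx \<tau> t (g n)" and f: "f \<in> borel_measurable plane"
    and lim: "\<And>z. (\<lambda>n. g n z) \<longlonglongrightarrow> f z" and bd: "\<And>n z. \<bar>g n z - f z\<bar> \<le> wt z"
    and wt: "wt \<in> borel_measurable plane" "(\<integral>\<^sup>+z. ennreal ((wt z)\<^sup>2) \<partial>plane) < \<infinity>"
  shows "rect_approx \<tau> t f"
proof (rule rect_approx_limit[OF f])
  have "(\<lambda>n. \<integral>\<^sup>+z. ennreal ((g n z - f z)\<^sup>2) \<partial>plane) \<longlonglongrightarrow> (\<integral>\<^sup>+z. 0 \<partial>plane)"
  proof (rule nn_integral_dominated_convergence[where w="\<lambda>z. ennreal ((wt z)\<^sup>2)"])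
    show "AE z in plane. ennreal ((g n z - f z)\<^sup>2) \<le> ennreal ((wt z)\<^sup>2)" for n
      by (intro AE_I2 ennreal_leI abs_le_square_iff[THEN iffD1] order_trans[OF bd abs_ge_self])
    show "AE z in plane. (\<lambda>n. ennreal ((g n z - f z)\<^sup>2)) \<longlonglongrightarrow> 0"
    proof (intro AE_I2)
      fix z
      have "(\<lambda>n. (g n z - f z)\<^sup>2) \<longlonglongrightarrow> (f z - f z)\<^sup>2" by (intro tendsto_intros lim)
      then have "(\<lambda>n. ennreal ((g n z - f z)\<^sup>2)) \<longlonglongrightarrow> ennreal 0" by (intro tendsto_ennrealI) simp
      then show "(\<lambda>n. ennreal ((g n z - f z)\<^sup>2)) \<longlonglongrightarrow> 0" by simp
    qed
    show "(\<lambda>z. ennreal ((g n z - f z)\<^sup>2)) \<in> borel_measurable plane" for n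
      using rect_approxD(1)[OF g] f by measurable
  qed (use wt in auto)
  then have lim0: "(\<lambda>n. \<integral>\<^sup>+z. ennreal ((g n z - f z)\<^sup>2) \<partial>plane) \<longlonglongrightarrow> 0" by simp
  fix e :: real assume "e > 0"
  then have "\<forall>\<^sub>F n in sequentially. (\<integral>\<^sup>+z. ennreal ((g n z - f z)\<^sup>2) \<partial>plane) < ennreal e"
    using order_tendstoD(2)[OF lim0, of "ennreal e"] by simp
  then obtain n where "(\<integral>\<^sup>+z. ennreal ((g n z - f z)\<^sup>2) \<partial>plane) < ennreal e"
    using eventually_happens'[OF sequentially_bot] by blast
  then show "\<exists>h. rect_approx \<tau> t h \<and> (\<integral>\<^sup>+z. ennreal ((h z - f z)\<^sup>2) \<partial>plane) \<le> ennreal e"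
    using g by (intro exI[of _ "g n"]) auto
qed

text \<open>Products of half-open intervals are stable under intersection and have the shape of the
  rectangles used for step functions.\<close>

lemma sets_plane_Ioc:
  "sets plane = sigma_sets UNIV {A \<times> B | A B. A \<in> range (\<lambda>(a, b). {a<..b::real}) \<and> B \<in> range (\<lambda>(a, b). {a<..b::real})}"
proof -
  have u: "\<Union> (range (\<lambda>n::nat. {- real n<..real n})) = UNIV"
  proof -
    have "x \<in> \<Union> (range (\<lambda>n::nat. {- real n<..real n}))" for x :: real
    proof -
      obtain n :: nat where "\<bar>x\<bar> < real n" using reals_Archimedean2 by blast
      then have "x \<in> {- real n<..real n}" by auto
      then show ?thesis by blast
    qed
    then show ?thesis by blast
  qed
  then have c: "\<exists>E\<subseteq>range (\<lambda>(a, b). {a<..b::real}). countable E \<and> UNIV = \<Union>E"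
    by (intro exI[of _ "range (\<lambda>n::nat. {- real n<..real n})"]) auto
  have "(borel :: real measure) \<Otimes>\<^sub>M (borel :: real measure) = sigma (UNIV \<times> UNIV)
      {A \<times> B | A B. A \<in> range (\<lambda>(a, b). {a<..b::real}) \<and> B \<in> range (\<lambda>(a, b). {a<..b::real})}"
    unfolding borel_sigma_sets_Ioc using sigma_prod[OF c _ c] by simp
  from arg_cong[where f=sets, OF this]
  have "sets ((borel :: real measure) \<Otimes>\<^sub>M (borel :: real measure)) = sets (sigma UNIV
      {A \<times> B | A B. A \<in> range (\<lambda>(a, b). {a<..b::real}) \<and> B \<in> range (\<lambda>(a, b). {a<..b::real})})"
    unfolding UNIV_Times_UNIV .
  also have "\<dots> = sigma_sets UNIV {A \<times> B | A B. A \<in> range (\<lambda>(a, b). {a<..b::real}) \<and> B \<in> range (\<lambda>(a, b). {a<..b::real})}"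
    by (rule sets_measure_of) simp
  finally show ?thesis by (simp cong: sets_pair_measure_cong)
qed

text \<open>Dynkin's argument inside a box of finite measure: complements become differences from
  the box, and countable disjoint unions are limits of finite ones, dominated by the indicator of
  the box.\<close>

lemma rect_approx_indicator:
  assumes \<tau>: "\<tau> \<le> t" and K: "0 \<le> K" and A: "A \<in> sets plane"
  shows "rect_approx \<tau> t (indicator (A \<inter> ({\<tau><..t} \<times> {-K..K})))"
proof -
  let ?G = "{A \<times> B | A B. A \<in> range (\<lambda>(a, b). {a<..b::real}) \<and> B \<in> range (\<lambda>(a, b). {a<..b::real})}"
  let ?Q = "{\<tau><..t} \<times> {-K..K}"
  have Qm: "?Q \<in> sets plane" by simp
  have Qf: "emeasure plane ?Q < \<infinity>"
    using \<tau> K by (subst lborel.emeasure_pair_measure_Times) (auto simp: ennreal_mult_less_top)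
  have base: "rect_approx \<tau> t (indicator ({a<..b} \<times> B \<inter> ?Q))" if B: "B \<in> sets borel" for a b B
  proof (cases "max a \<tau> \<le> min b t")
    case True
    have "emeasure lborel (B \<inter> {-K..K}) \<le> emeasure lborel {-K..K}" using B by (intro emeasure_mono) auto
    then have "B \<inter> {-K..K} \<in> finite_borel" using B K by (auto simp: finite_borel_def intro: le_less_trans)
    then have "rect_within \<tau> t [(1, max a \<tau>, min b t, B \<inter> {-K..K})]" using True by (auto simp: rect_within_def)
    moreover have "rect_value [(1, max a \<tau>, min b t, B \<inter> {-K..K})] = indicator ({a<..b} \<times> B \<inter> ?Q)"
      by (auto simp: rect_value_def indicator_def)
    ultimately show ?thesis using rect_approx_rect by metis
  next
    case False
    then have "indicator ({a<..b} \<times> B \<inter> ?Q) = rect_value []" by (auto simp: fun_eq_iff rect_value_def indicator_def)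
    then show ?thesis using rect_approx_rect[of \<tau> t "[]"] by (simp add: rect_within_def)
  qed
  have wt: "(\<integral>\<^sup>+z. ennreal ((indicator ?Q z)\<^sup>2) \<partial>plane) < \<infinity>"
  proof -
    have "(\<integral>\<^sup>+z. ennreal ((indicator ?Q z)\<^sup>2) \<partial>plane) = (\<integral>\<^sup>+z. indicator ?Q z \<partial>plane)"
      by (intro nn_integral_cong) (simp add: indicator_def)
    then show ?thesis using Qf by simp
  qed
  have st: "Int_stable ?G"
  proof (rule Int_stableI)
    fix a b assume "a \<in> ?G" "b \<in> ?G"
    then obtain p q r v p' q' r' v' where e: "a = {p<..q} \<times> {r<..v}" "b = {p'<..q'} \<times> {r'<..v'}" by auto
    have "a \<inter> b = {max p p'<..min q q'} \<times> {max r r'<..min v v'}" unfolding e by auto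
    then show "a \<inter> b \<in> ?G" by auto
  qed
  have "?G \<subseteq> Pow UNIV" by simp
  from st this A[unfolded sets_plane_Ioc] show ?thesis
  proof (induction rule: sigma_sets_induct_disjoint)
    case (basic A)
    then show ?case using base by auto
  next
    case empty
    have "indicator ({} \<inter> ?Q) = rect_value []" by (auto simp: fun_eq_iff rect_value_def indicator_def)
    then show ?case using rect_approx_rect[of \<tau> t "[]"] by (simp add: rect_within_def)
  next
    case (compl A)
    have "rect_approx \<tau> t (indicator ?Q)" 
      using base[of UNIV \<tau> t] by (rule back_subst[of "rect_approx \<tau> t"]) (auto simp: indicator_def)
    from rect_approx_add[OF this rect_approx_scale[OF compl(2), of "-1"]]
    show ?case
      by (rule back_subst[of "rect_approx \<tau> t"]) (auto simp: indicator_def)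
  next
    case (union A)
    have Am: "A n \<in> sets plane" for n using union(2) unfolding sets_plane_Ioc by auto
    have uni: "(\<Sum>i<n. indicator (A i \<inter> ?Q) z) = (indicator ((\<Union>i<n. A i) \<inter> ?Q) z :: real)" for n z
    proof (induction n)
      case (Suc n)
      have "A i \<inter> A n = {}" if "i < n" for i
        using disjoint_family_onD[OF union(1), of i n] that by simp
      then have "z \<in> A n \<Longrightarrow> z \<notin> (\<Union>i<n. A i)" by blast
      moreover have "(\<Union>i<Suc n. A i) = A n \<union> (\<Union>i<n. A i)" by (simp add: lessThan_Suc)
      ultimately show ?case using Suc by (simp add: indicator_def)
    qed simp
    have g: "rect_approx \<tau> t (indicator ((\<Union>i<n. A i) \<inter> ?Q))" for n
    proof -
      have "rect_approx \<tau> t (\<lambda>z. \<Sum>i<n. indicator (A i \<inter> ?Q) z)" by (intro rect_approx_sum union(3)) auto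
      then show ?thesis unfolding uni by simp
    qed
    show ?case
    proof (rule rect_approx_dominated[OF g, where wt="indicator ?Q"])
      show "(\<lambda>n. indicator ((\<Union>i<n. A i) \<inter> ?Q) z :: real) \<longlonglongrightarrow> indicator ((\<Union>i. A i) \<inter> ?Q) z" for z
      proof (cases "z \<in> (\<Union>i. A i)")
        case True
        then obtain k where k: "z \<in> A k" by auto
        have "\<forall>\<^sub>F n in sequentially. n > k" by (rule eventually_gt_at_top)
        then have "\<forall>\<^sub>F n in sequentially. (indicator ((\<Union>i<n. A i) \<inter> ?Q) z :: real) = indicator ((\<Union>i. A i) \<inter> ?Q) z"
          by eventually_elim (use k in \<open>auto simp: indicator_def\<close>)
        then show ?thesis by (rule tendsto_eventually)
      qed (auto simp: indicator_def)
      show "\<bar>indicator ((\<Union>i<n. A i) \<inter> ?Q) z - indicator ((\<Union>i. A i) \<inter> ?Q) z\<bar> \<le> (indicator ?Q z :: real)" for n z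
        by (auto simp: indicator_def)
    qed (use Am Qm wt in \<open>auto intro!: borel_measurable_indicator sets.Int\<close>)
  qed
qed

text \<open>Simple functions bounded by \<open>2 * \<bar>f\<bar>\<close> are cut off to
  \<open>{- real n..real n}\<close> in space; cutting in time changes nothing in the limit because
  \<open>f\<close> vanishes outside the window. The error is dominated by
  \<open>3 * \<bar>f\<bar>\<close>.\<close>

lemma rect_dense:
  fixes f :: "real \<times> real \<Rightarrow> real"
  assumes \<tau>: "\<tau> \<le> t" and f: "f \<in> borel_measurable plane" and fin: "(\<integral>\<^sup>+z. ennreal ((f z)\<^sup>2) \<partial>plane) < \<infinity>"
    and supp: "\<And>s y. s \<notin> {\<tau><..t} \<Longrightarrow> f (s, y) = 0"
  shows "rect_approx \<tau> t f"
proof -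
  have sp: "z \<in> space plane" for z by (simp add: space_pair_measure mem_Times_iff)
  obtain F where F0: "\<forall>i. simple_function plane (F i)" "\<forall>z\<in>space plane. (\<lambda>i. F i z) \<longlonglongrightarrow> f z"
    "\<forall>i. \<forall>z\<in>space plane. dist (F i z) 0 \<le> 2 * dist (f z) 0"
    using borel_measurable_implies_sequence_metric[OF f, of 0] by blast
  then have F: "\<And>i. simple_function plane (F i)" "\<And>z. (\<lambda>i. F i z) \<longlonglongrightarrow> f z" "\<And>i z. \<bar>F i z\<bar> \<le> 2 * \<bar>f z\<bar>"
    using sp by (auto simp: dist_real_def)
  define g where "g n z = F n z * indicator ({\<tau><..t} \<times> {- real n..real n}) z" for n z
  have "rect_approx \<tau> t (g n)" for n
  proof -
    have fin: "finite (range (F n))" using simple_functionD(1)[OF F(1)[of n]] by (simp add: space_pair_measure)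
    have "rect_approx \<tau> t (\<lambda>z. \<Sum>v\<in>range (F n). v * indicator (F n -` {v} \<inter> ({\<tau><..t} \<times> {- real n..real n})) z)"
      using simple_functionD(2)[OF F(1)[of n]]
      by (intro rect_approx_sum fin rect_approx_scale rect_approx_indicator \<tau>) (auto simp: space_pair_measure)
    moreover have "(\<lambda>z. \<Sum>v\<in>range (F n). v * indicator (F n -` {v} \<inter> ({\<tau><..t} \<times> {- real n..real n})) z) = g n"
    proof
      fix z
      have "(\<Sum>v\<in>range (F n). v * indicator (F n -` {v} \<inter> ({\<tau><..t} \<times> {- real n..real n})) z) =
        (\<Sum>v\<in>range (F n). if v = F n z then v * indicator ({\<tau><..t} \<times> {- real n..real n}) z else 0)"
        by (intro sum.cong refl) (auto simp: indicator_def)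
      also have "\<dots> = g n z" using fin by (subst sum.delta) (auto simp: g_def)
      finally show "(\<Sum>v\<in>range (F n). v * indicator (F n -` {v} \<inter> ({\<tau><..t} \<times> {- real n..real n})) z) = g n z" .
    qed
    ultimately show ?thesis by simp
  qed
  then show ?thesis
  proof (rule rect_approx_dominated[OF _ f, where wt="\<lambda>z. 3 * \<bar>f z\<bar>"])
    show "(\<lambda>n. g n z) \<longlonglongrightarrow> f z" for z
    proof (cases "fst z \<in> {\<tau><..t}")
      case True
      have "\<forall>\<^sub>F n in sequentially. \<bar>snd z\<bar> \<le> real n"
        using filterlim_real_sequentially unfolding filterlim_at_top by blast
      then have "\<forall>\<^sub>F n in sequentially. F n z = g n z"
        by eventually_elim (use True in \<open>auto simp: g_def indicator_def mem_Times_iff\<close>)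
      then show ?thesis using F(2)[of z] by (rule Lim_transform_eventually[rotated])
    next
      case False
      then show ?thesis using supp[of "fst z" "snd z"] by (auto simp: g_def indicator_def mem_Times_iff)
    qed
    show "\<bar>g n z - f z\<bar> \<le> 3 * \<bar>f z\<bar>" for n z
      using F(3)[of n z] by (auto simp: g_def indicator_def)
    have "(\<integral>\<^sup>+z. ennreal ((3 * \<bar>f z\<bar>)\<^sup>2) \<partial>plane) = (\<integral>\<^sup>+z. 9 * ennreal ((f z)\<^sup>2) \<partial>plane)"
      by (intro nn_integral_cong) (simp add: power_mult_distrib ennreal_mult)
    also have "\<dots> = 9 * (\<integral>\<^sup>+z. ennreal ((f z)\<^sup>2) \<partial>plane)" using f by (intro nn_integral_cmult) auto
    finally show "(\<integral>\<^sup>+z. ennreal ((3 * \<bar>f z\<bar>)\<^sup>2) \<partial>plane) < \<infinity>" using fin by (simp add: ennreal_mult_less_top)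
  qed (use f in auto)
qed

section \<open>Wiener integrals with a coefficient from the past\<close>

context white_noise
begin

definition rect_field :: "('a \<Rightarrow> real) \<Rightarrow> rectangles \<Rightarrow> 'a simple_field" where
  "rect_field \<xi> P = map (\<lambda>(c, r). (\<lambda>w. \<xi> w * c, r)) P"

definition rect_integral :: "rectangles \<Rightarrow> 'a \<Rightarrow> real" where
  "rect_integral P w = (\<Sum>(c, a, b, B)\<leftarrow>P. c * dW a b B w)"

lemma rect_field_value: "sval (rect_field \<xi> P) s y w = \<xi> w * rect_value P (s, y)"
  by (induction P) (auto simp: simple_field_value_def rect_field_def rect_value_def algebra_simps)

lemma rect_field_integral: "sint (rect_field \<xi> P) w = \<xi> w * rect_integral P w"
  by (induction P) (auto simp: simple_field_integral_def rect_field_def rect_integral_def algebra_simps)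

lemma simple_rect_field:
  assumes "rect_within \<tau> t P" "0 \<le> \<tau>" "\<xi> \<in> borel_measurable (\<F> \<tau>)" "\<And>w. w \<in> space M \<Longrightarrow> \<bar>\<xi> w\<bar> \<le> K"
  shows "simple (rect_field \<xi> P)"
  unfolding is_simple_field_def
proof clarify
  fix \<zeta> a b B assume "(\<zeta>, a, b, B) \<in> set (rect_field \<xi> P)"
  then obtain c where c: "\<zeta> = (\<lambda>w. \<xi> w * c)" "(c, a, b, B) \<in> set P" unfolding rect_field_def by auto
  then have r: "\<tau> \<le> a" "a \<le> b" "B \<in> finite_borel" using assms(1) unfolding rect_within_def by auto
  have "\<forall>w\<in>space M. \<bar>\<zeta> w\<bar> \<le> K * \<bar>c\<bar>" unfolding c using assms(4) by (auto simp: abs_mult intro: mult_right_mono)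
  then show "0 \<le> a \<and> a \<le> b \<and> B \<in> finite_borel \<and> \<zeta> \<in> borel_measurable (\<F> a) \<and> (\<exists>K. \<forall>w\<in>space M. \<bar>\<zeta> w\<bar> \<le> K)"
    using r assms(2) filtration_measurable_mono[OF assms(3) r(1)] unfolding c
    by (intro conjI exI[of _ "K * \<bar>c\<bar>"]) auto
qed

lemma rect_integral_future:
  assumes "rect_within \<tau> t P" "0 \<le> \<tau>"
  shows "rect_integral P \<in> future \<tau>"
  using assms(1)
proof (induction P)
  case Nil
  then show ?case using future.zero by (simp add: rect_integral_def[abs_def])
next
  case (Cons x P)
  obtain c a b B where x: "x = (c, a, b, B)" by (cases x)
  have "rect_integral P \<in> future \<tau>" "\<tau> \<le> a" "a \<le> b" "B \<in> finite_borel"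
    using Cons by (auto simp: rect_within_def x)
  from future.step[OF this(1) _ this(2-4), of c] show ?case
    using assms(2) \<open>\<tau> \<le> a\<close> by (simp add: rect_integral_def[abs_def] x add.commute)
qed

lemma rect_integral_adapted:
  assumes "rect_within \<tau> t P" "0 \<le> \<tau>"
  shows "rect_integral P \<in> borel_measurable (\<F> t)"
  using assms(1)
proof (induction P)
  case Nil
  then show ?case by (simp add: rect_integral_def[abs_def])
next
  case (Cons x P)
  obtain c a b B where x: "x = (c, a, b, B)" by (cases x)
  have [measurable]: "rect_integral P \<in> borel_measurable (\<F> t)" "W b B \<in> borel_measurable (\<F> t)" "W a B \<in> borel_measurable (\<F> t)"
    using Cons assms(2) by (auto simp: rect_within_def x intro!: filtration_W)
  have "rect_integral (x # P) = (\<lambda>w. c * dW a b B w + rect_integral P w)"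
    by (auto simp: rect_integral_def x)
  then show ?case by simp
qed

lemma rect_field_sq:
  assumes P: "rect_within \<tau> t P" "0 \<le> \<tau>" and [measurable]: "\<xi> \<in> borel_measurable M"
  shows "field_measurable (\<lambda>s y w. \<xi> w * rect_value P (s, y))" (is "?S1")
    and "fsq (\<lambda>s y w. \<xi> w * rect_value P (s, y)) =
      (\<integral>\<^sup>+z. ennreal ((rect_value P z)\<^sup>2) \<partial>plane) * nnE (\<lambda>w. (\<xi> w)\<^sup>2)" (is "?S2")
proof -
  note Pm = rect_value_measurable[OF P(1)]
  have "(\<lambda>z. rect_value P (fst z, fst (snd z))) \<in> borel_measurable (field_measure M)"
    by (rule measurable_compose[OF _ Pm]) (auto intro!: measurable_Pair)
  then show m: ?S1
    by (simp add: case_prod_beta')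
  have "nnE (\<lambda>w. (\<xi> w * rect_value P (s, y))\<^sup>2) = ennreal ((rect_value P (s, y))\<^sup>2) * nnE (\<lambda>w. (\<xi> w)\<^sup>2)" for s y
    by (subst nn_integral_cmult[symmetric]) (auto simp: power_mult_distrib ennreal_mult mult.commute)
  moreover have "rect_value P (s, y) = 0" if "s < 0" for s y
    using rect_value_outside[OF P(1), of s y] that P(2) by auto
  moreover note [measurable] = rect_value_plane[OF P(1)]
  have "(\<lambda>y. ennreal ((rect_value P (s, y))\<^sup>2)) \<in> borel_measurable lborel" for s by measurable
  ultimately have "fsq (\<lambda>s y w. \<xi> w * rect_value P (s, y)) =
     (\<integral>\<^sup>+s. (\<integral>\<^sup>+y. ennreal ((rect_value P (s, y))\<^sup>2) \<partial>lborel) * nnE (\<lambda>w. (\<xi> w)\<^sup>2) \<partial>lborel)"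
    unfolding fsq_iterated[OF m]
    by (intro nn_integral_cong) (auto simp: nn_integral_multc indicator_def not_le)
  also have "\<dots> = (\<integral>\<^sup>+s. (\<integral>\<^sup>+y. ennreal ((rect_value P (s, y))\<^sup>2) \<partial>lborel) \<partial>lborel) * nnE (\<lambda>w. (\<xi> w)\<^sup>2)"
    by (intro nn_integral_multc lborel.borel_measurable_nn_integral) simp
  also have "(\<integral>\<^sup>+s. (\<integral>\<^sup>+y. ennreal ((rect_value P (s, y))\<^sup>2) \<partial>lborel) \<partial>lborel) = (\<integral>\<^sup>+z. ennreal ((rect_value P z)\<^sup>2) \<partial>plane)"
    by (rule lborel.nn_integral_fst) simp
  finally show ?S2 .
qed

lemma rect_integral_sq:
  assumes P: "rect_within \<tau> t P" "0 \<le> \<tau>"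
  shows "ennreal (expectation (\<lambda>w. (rect_integral P w)\<^sup>2)) = (\<integral>\<^sup>+z. ennreal ((rect_value P z)\<^sup>2) \<partial>plane)"
proof -
  have s: "simple (rect_field (\<lambda>_. 1) P)" by (rule simple_rect_field[OF P, where K=1]) auto
  have "ennreal (expectation (\<lambda>w. (rect_integral P w)\<^sup>2)) = nnE (\<lambda>w. (sint (rect_field (\<lambda>_. 1) P) w)\<^sup>2)"
    using simple_isometry(1)[OF s] by (subst nn_integral_eq_integral) (auto simp: rect_field_integral)
  also have "\<dots> = fsq (\<lambda>s y w. (\<lambda>_. 1) w * rect_value P (s, y))"
    unfolding simple_isometry(2)[OF s] rect_field_value[abs_def] ..
  also have "\<dots> = (\<integral>\<^sup>+z. ennreal ((rect_value P z)\<^sup>2) \<partial>plane)"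
    by (subst rect_field_sq(2)[OF P]) (auto simp: emeasure_space_1)
  finally show ?thesis .
qed

text \<open>Simple fields need bounded coefficients, while \<xi> is only square integrable, so it is
  truncated. The Wiener integral is independent of \<open>\<F> \<tau>\<close>, hence the error of
  the product is the error of the coefficient times the variance \<open>v\<close>, the same number
  for the field and for the integral.\<close>

lemma walsh_limit_rect:
  assumes P: "rect_within \<tau> t P" "0 \<le> \<tau>" and \<xi>: "\<xi> \<in> borel_measurable (\<F> \<tau>)" "integrable M (\<lambda>w. (\<xi> w)\<^sup>2)"
  shows "walsh_limit (\<lambda>s y w. \<xi> w * rect_value P (s, y)) (\<lambda>w. \<xi> w * rect_integral P w)"
proof (rule walsh_limit_closure)
  have \<xi>m[measurable]: "\<xi> \<in> borel_measurable M" using filtration_measurable[OF \<xi>(1)] .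
  note Zf = rect_integral_future[OF P]
  note Zm[measurable] = future_measurable[OF Zf]
  show "field_measurable (\<lambda>s y w. \<xi> w * rect_value P (s, y))" by (rule rect_field_sq(1)[OF P \<xi>m])
  show "(\<lambda>w. \<xi> w * rect_integral P w) \<in> borel_measurable M" by simp
  fix e :: real assume e: "e > 0"
  define v where "v = expectation (\<lambda>w. (rect_integral P w)\<^sup>2)"
  have v0: "0 \<le> v" by (simp add: v_def)
  have v: "(\<integral>\<^sup>+z. ennreal ((rect_value P z)\<^sup>2) \<partial>plane) = ennreal v" using rect_integral_sq[OF P] by (simp add: v_def)
  have "(\<lambda>n. expectation (\<lambda>w. (clip (real n) (\<xi> w) - \<xi> w)\<^sup>2)) \<longlonglongrightarrow> expectation (\<lambda>w. 0)"
  proof (rule integral_dominated_convergence[where w="\<lambda>w. (\<xi> w)\<^sup>2"])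
    show "AE w in M. (\<lambda>n. (clip (real n) (\<xi> w) - \<xi> w)\<^sup>2) \<longlonglongrightarrow> 0"
    proof (rule AE_I2)
      fix w
      have "\<forall>\<^sub>F n in sequentially. \<bar>\<xi> w\<bar> \<le> real n"
        using filterlim_real_sequentially unfolding filterlim_at_top by blast
      then have "\<forall>\<^sub>F n in sequentially. (clip (real n) (\<xi> w) - \<xi> w)\<^sup>2 = 0"
        by eventually_elim (simp add: clip_eq)
      then show "(\<lambda>n. (clip (real n) (\<xi> w) - \<xi> w)\<^sup>2) \<longlonglongrightarrow> 0" by (rule tendsto_eventually)
    qed
    show "AE w in M. norm ((clip (real n) (\<xi> w) - \<xi> w)\<^sup>2) \<le> (\<xi> w)\<^sup>2" for n
      using clip_error[of "real n"] by (auto simp: abs_le_square_iff[symmetric])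
  qed (use \<xi> in auto)
  then have "(\<lambda>n. v * expectation (\<lambda>w. (clip (real n) (\<xi> w) - \<xi> w)\<^sup>2)) \<longlonglongrightarrow> v * 0"
    by (intro tendsto_mult tendsto_const) simp
  then have "\<forall>\<^sub>F n in sequentially. v * expectation (\<lambda>w. (clip (real n) (\<xi> w) - \<xi> w)\<^sup>2) < e"
    using e by (intro order_tendstoD(2)[where y="v * 0"]) auto
  then obtain n where n: "v * expectation (\<lambda>w. (clip (real n) (\<xi> w) - \<xi> w)\<^sup>2) < e"
    using eventually_happens'[OF sequentially_bot] by blast
  define \<zeta> where "\<zeta> w = clip (real n) (\<xi> w)" for w
  have \<zeta>F: "\<zeta> \<in> borel_measurable (\<F> \<tau>)" unfolding \<zeta>_def[abs_def] using \<xi>(1) by simp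
  have s: "simple (rect_field \<zeta> P)"
    by (rule simple_rect_field[OF P \<zeta>F, where K="real n"]) (simp add: \<zeta>_def clip_bound)
  have \<zeta>m[measurable]: "\<zeta> \<in> borel_measurable M" using filtration_measurable[OF \<zeta>F] .
  have i: "integrable M (\<lambda>w. (\<zeta> w - \<xi> w)\<^sup>2)"
    by (rule Bochner_Integration.integrable_bound[OF \<xi>(2)])
       (auto simp: \<zeta>_def abs_le_square_iff[symmetric] clip_error)
  have "(\<lambda>w. (\<zeta> w - \<xi> w)\<^sup>2) \<in> borel_measurable (\<F> \<tau>)" using \<xi>(1) \<zeta>F by simp
  from future_expectation_mult[OF Zf P(2) measurable_past_and_uncorrelated_past[OF this], of "\<lambda>x. x\<^sup>2"]
  have ind: "integrable M (\<lambda>w. (\<zeta> w - \<xi> w)\<^sup>2 * (rect_integral P w)\<^sup>2)"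
      "expectation (\<lambda>w. (\<zeta> w - \<xi> w)\<^sup>2 * (rect_integral P w)\<^sup>2) = expectation (\<lambda>w. (\<zeta> w - \<xi> w)\<^sup>2) * v"
    using i centered_gaussian_even_moment(1)[OF future_gaussian[OF Zf], of 2] by (auto simp: v_def)
  have "fsq (\<lambda>s y w. \<zeta> w * rect_value P (s, y) - \<xi> w * rect_value P (s, y)) = fsq (\<lambda>s y w. (\<lambda>w. \<zeta> w - \<xi> w) w * rect_value P (s, y))"
    by (simp add: left_diff_distrib)
  also have "\<dots> = ennreal (v * expectation (\<lambda>w. (\<zeta> w - \<xi> w)\<^sup>2))"
    by (subst rect_field_sq(2)[OF P]) (use i v0 in \<open>auto simp: v nn_integral_eq_integral ennreal_mult\<close>)
  also have "\<dots> \<le> ennreal e" using n by (intro ennreal_leI) (simp add: \<zeta>_def)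
  finally have 1: "fsq (\<lambda>s y w. \<zeta> w * rect_value P (s, y) - \<xi> w * rect_value P (s, y)) \<le> ennreal e" .
  have "nnE (\<lambda>w. (\<zeta> w * rect_integral P w - \<xi> w * rect_integral P w)\<^sup>2) = nnE (\<lambda>w. (\<zeta> w - \<xi> w)\<^sup>2 * (rect_integral P w)\<^sup>2)"
    by (simp add: left_diff_distrib[symmetric] power_mult_distrib)
  also have "\<dots> = ennreal (v * expectation (\<lambda>w. (\<zeta> w - \<xi> w)\<^sup>2))"
    using ind by (subst nn_integral_eq_integral) (auto simp: mult.commute)
  also have "\<dots> \<le> ennreal e" using n by (intro ennreal_leI) (simp add: \<zeta>_def)
  finally have 2: "nnE (\<lambda>w. (\<zeta> w * rect_integral P w - \<xi> w * rect_integral P w)\<^sup>2) \<le> ennreal e" .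
  have "walsh_limit (\<lambda>s y w. \<zeta> w * rect_value P (s, y)) (\<lambda>w. \<zeta> w * rect_integral P w)"
    using walsh_limit_simple[OF s] by (simp add: rect_field_value[abs_def] rect_field_integral[abs_def])
  then show "\<exists>Y J. walsh_limit Y J \<and> fsq (\<lambda>s y w. Y s y w - \<xi> w * rect_value P (s, y)) \<le> ennreal e \<and>
      nnE (\<lambda>w. (J w - \<xi> w * rect_integral P w)\<^sup>2) \<le> ennreal e"
    using 1 2 by blast
qed

end

section \<open>The heat kernel\<close>

lemma nn_integral_FTC_interior:
  fixes f F :: "real \<Rightarrow> real"
  assumes "a \<le> b" "continuous_on {a..b} F"
    and "\<And>x. a < x \<Longrightarrow> x < b \<Longrightarrow> (F has_real_derivative f x) (at x)" and "\<And>x. 0 \<le> f x"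
  shows "(\<integral>\<^sup>+x\<in>{a..b}. ennreal (f x) \<partial>lborel) = ennreal (F b - F a)"
  using assms fundamental_theorem_of_calculus_interior[of a b F f]
  by (intro nn_integral_has_integral_lebesgue') (auto simp: has_real_derivative_iff_has_vector_derivative)

text \<open>Centred Gaussian density with variance \<open>t\<close>. The value 0 at nonpositive
  times lets one formula describe a kernel increment before, inside and after the step from
  \<open>t - eps\<close> to \<open>t\<close>.\<close>

definition gk :: "real \<Rightarrow> real \<Rightarrow> real" where
  "gk t z = (if t \<le> 0 then 0 else exp (- (z\<^sup>2 / (2 * t))) / sqrt (2 * pi * t))"

lemma gk_measurable [measurable (raw)]:
  assumes [measurable]: "f \<in> borel_measurable N" "g \<in> borel_measurable N"
  shows "(\<lambda>x. gk (f x) (g x)) \<in> borel_measurable N"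
  unfolding gk_def by measurable

lemma gk_nonneg [simp]: "0 \<le> gk t z"
  by (simp add: gk_def)

lemma gk_nonpos [simp]: "t \<le> 0 \<Longrightarrow> gk t z = 0"
  by (simp add: gk_def)

lemma gk_minus [simp]: "gk t (- z) = gk t z" and gk_abs [simp]: "gk t \<bar>z\<bar> = gk t z"
  by (simp_all add: gk_def)

lemma gk_normal_density: "0 < t \<Longrightarrow> gk t z = normal_density 0 (sqrt t) z"
  by (simp add: gk_def normal_density_def real_sqrt_mult)

lemma gk_antimono: "\<bar>w\<bar> \<le> \<bar>z\<bar> \<Longrightarrow> gk t z \<le> gk t w"
  by (auto simp: gk_def abs_le_square_iff intro!: divide_right_mono)

text \<open>The Chapman-Kolmogorov identity: after translation by \<open>d\<close> the integral is a
  convolution of two centred normal densities.\<close>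

lemma gk_product_integral:
  assumes "0 < t" "0 < s"
  shows "(\<integral>\<^sup>+v. ennreal (gk t (c - v) * gk s (d - v)) \<partial>lborel) = ennreal (gk (t + s) (c - d))"
proof -
  have "(\<integral>\<^sup>+v. ennreal (gk t (c - v) * gk s (d - v)) \<partial>lborel) = (\<integral>\<^sup>+y. ennreal (gk t ((c - d) - y) * gk s y) \<partial>lborel)"
    by (subst nn_integral_real_affine[where c=1 and t=d]) (auto simp: algebra_simps)
  also have "\<dots> = ennreal (normal_density 0 (sqrt ((sqrt t)\<^sup>2 + (sqrt s)\<^sup>2)) (c - d))"
    using fun_cong[OF conv_normal_density_zero_mean[of "sqrt t" "sqrt s"], of "c - d"] assms
    by (simp add: gk_normal_density)
  finally show ?thesis using assms by (simp add: gk_normal_density)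
qed

lemma gk_product_has_integral:
  assumes "0 < t" "0 < s"
  shows "has_bochner_integral lborel (\<lambda>v. gk t (c - v) * gk s (d - v)) (gk (t + s) (c - d))"
  by (rule has_bochner_integral_nn_integral) (use gk_product_integral[OF assms] in auto)

lemma gk_diff_sq_integral:
  assumes "0 < t" "0 < s"
  shows "(\<integral>\<^sup>+v. ennreal ((gk t (c - v) - gk s (d - v))\<^sup>2) \<partial>lborel) =
    ennreal (gk (2 * t) 0 + gk (2 * s) 0 - 2 * gk (t + s) (c - d))" (is "?S1")
    and "0 \<le> gk (2 * t) 0 + gk (2 * s) 0 - 2 * gk (t + s) (c - d)" (is "?S2")
proof -
  have "has_bochner_integral lborel (\<lambda>v. gk t (c - v) * gk t (c - v) + gk s (d - v) * gk s (d - v) - 2 * (gk t (c - v) * gk s (d - v)))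
      (gk (t + t) (c - c) + gk (s + s) (d - d) - 2 * gk (t + s) (c - d))"
    by (intro has_bochner_integral_add has_bochner_integral_diff has_bochner_integral_mult_right gk_product_has_integral assms)
  moreover have "gk t (c - v) * gk t (c - v) + gk s (d - v) * gk s (d - v) - 2 * (gk t (c - v) * gk s (d - v)) = (gk t (c - v) - gk s (d - v))\<^sup>2" for v
    by (simp add: power2_eq_square algebra_simps)
  ultimately have h: "has_bochner_integral lborel (\<lambda>v. (gk t (c - v) - gk s (d - v))\<^sup>2) (gk (2 * t) 0 + gk (2 * s) 0 - 2 * gk (t + s) (c - d))"
    by (simp only: diff_self mult_2[symmetric])
  then show ?S1
    by (subst nn_integral_eq_integral) (auto simp: has_bochner_integral_iff)
  show ?S2
    unfolding has_bochner_integral_integral_eq[OF h, symmetric] by simp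
qed

lemma gk_sq_integral:
  assumes "0 < t"
  shows "(\<integral>\<^sup>+v. ennreal ((gk t (c - v))\<^sup>2) \<partial>lborel) = ennreal (gk (2 * t) 0)"
  using gk_product_integral[OF assms assms, of c c] by (simp only: power2_eq_square diff_self mult_2[symmetric])

text \<open>One factor is bounded by its maximum \<open>1 / sqrt (2 * pi * t)\<close>; the other
  integrates \<open>z\<^sup>2\<close> to the variance \<open>t\<close>.\<close>

lemma gk_second_moment:
  "(\<integral>\<^sup>+z. ennreal ((gk t z)\<^sup>2 * z\<^sup>2) \<partial>lborel) \<le> ennreal (sqrt t)"
proof (cases "t \<le> 0")
  case False
  then have t: "0 < t" by simp
  have "(\<integral>\<^sup>+z. ennreal ((gk t z)\<^sup>2 * z\<^sup>2) \<partial>lborel) \<le> (\<integral>\<^sup>+z. ennreal (1 / sqrt (2 * pi * t)) * ennreal (normal_density 0 (sqrt t) z * (z - 0) ^ (2 * 1)) \<partial>lborel)"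
  proof (rule nn_integral_mono)
    fix z
    have "gk t z \<le> 1 / sqrt (2 * pi * t)" using t by (simp add: gk_def divide_right_mono)
    then have "gk t z * (gk t z * z\<^sup>2) \<le> 1 / sqrt (2 * pi * t) * (gk t z * z\<^sup>2)" by (intro mult_right_mono) auto
    then have "(gk t z)\<^sup>2 * z\<^sup>2 \<le> 1 / sqrt (2 * pi * t) * (normal_density 0 (sqrt t) z * (z - 0) ^ (2 * 1))"
      using t by (simp add: gk_normal_density power2_eq_square mult_ac)
    from ennreal_leI[OF this] show "ennreal ((gk t z)\<^sup>2 * z\<^sup>2) \<le> ennreal (1 / sqrt (2 * pi * t)) * ennreal (normal_density 0 (sqrt t) z * (z - 0) ^ (2 * 1))"
      using t by (subst ennreal_mult[symmetric]) auto
  qed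
  also have "\<dots> = ennreal (1 / sqrt (2 * pi * t)) * ennreal t"
  proof -
    have "has_bochner_integral lborel (\<lambda>z. normal_density 0 (sqrt t) z * (z - 0) ^ (2 * 1)) t"
      using normal_moment_even[of "sqrt t" 0 1] t by simp
    then show ?thesis
      by (subst nn_integral_cmult) (auto simp: has_bochner_integral_iff nn_integral_eq_integral)
  qed
  also have "\<dots> = ennreal (t / sqrt (2 * pi * t))" using t by (subst ennreal_mult[symmetric]) auto
  also have "\<dots> \<le> ennreal (sqrt t)"
  proof (rule ennreal_leI)
    have "t / sqrt (2 * pi * t) = sqrt t / sqrt (2 * pi)"
      using t by (simp add: real_sqrt_mult real_div_sqrt field_simps)
    also have "\<dots> \<le> sqrt t / 1"
      using t pi_ge_two by (intro divide_left_mono) auto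
    finally show "t / sqrt (2 * pi * t) \<le> sqrt t" by simp
  qed
  finally show ?thesis .
qed simp

text \<open>The squared spatial norm of a time increment of the Gaussian kernel at age
  \<open>r\<close>. Up to age \<open>eps\<close> the earlier kernel is zero; the cross term has
  variance \<open>r + (r - eps) = 2 * (r - eps / 2)\<close>.\<close>

definition gk_energy :: "real \<Rightarrow> real \<Rightarrow> real" where
  "gk_energy eps r = (if r \<le> 0 then 0 else if r \<le> eps then gk (2 * r) 0
     else gk (2 * r) 0 + gk (2 * (r - eps)) 0 - 2 * gk (2 * (r - eps / 2)) 0)"

lemma gk_energy:
  assumes "0 < eps"
  shows "(\<integral>\<^sup>+v. ennreal ((gk r (c - v) - gk (r - eps) (c - v))\<^sup>2) \<partial>lborel) = ennreal (gk_energy eps r)" (is "?S1")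
    and "0 \<le> gk_energy eps r"
proof -
  have e: "r + (r - eps) = 2 * (r - eps / 2)" by simp
  show ?S1
    using gk_diff_sq_integral(1)[of r "r - eps" c c] gk_sq_integral[of r c] assms e
    by (cases "r \<le> 0"; cases "r \<le> eps") (auto simp: gk_energy_def)
  show "0 \<le> gk_energy eps r"
    using gk_diff_sq_integral(2)[of r "r - eps" c c] assms e by (auto simp: gk_energy_def)
qed

lemma sqrt_pi_derivative:
  assumes "0 < x"
  shows "((\<lambda>x. sqrt x / sqrt pi) has_real_derivative gk (2 * x) 0) (at x)"
proof -
  have "((\<lambda>x. sqrt x / sqrt pi) has_real_derivative (inverse (sqrt x) / 2) / sqrt pi) (at x)"
    using assms by (intro DERIV_cdivide DERIV_real_sqrt)
  moreover have "(inverse (sqrt x) / 2) / sqrt pi = gk (2 * x) 0"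
  proof -
    have "2 * pi * (2 * x) = 4 * (pi * x)" by simp
    then show ?thesis using assms by (simp add: gk_def real_sqrt_mult field_simps)
  qed
  ultimately show ?thesis by simp
qed

text \<open>An antiderivative of the energy for ages above \<open>eps\<close>: a second difference
  of the square root with step \<open>eps / 2\<close>. It vanishes at infinity, so its negative at
  \<open>r\<close> is the energy of all ages beyond \<open>r\<close>.\<close>

definition energy_primitive :: "real \<Rightarrow> real \<Rightarrow> real" where
  "energy_primitive eps r = (sqrt r + sqrt (r - eps) - 2 * sqrt (r - eps / 2)) / sqrt pi"

lemma energy_primitive_derivative:
  assumes "0 < eps" "eps < x"
  shows "(energy_primitive eps has_real_derivative gk_energy eps x) (at x)"
proof -
  have s: "((\<lambda>x. sqrt (x - a) / sqrt pi) has_real_derivative gk (2 * (x - a)) 0) (at x)" if "a < x" for a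
  proof -
    have "((\<lambda>x. sqrt x / sqrt pi) has_real_derivative gk (2 * (x - a)) 0) (at (x - a))"
      using that by (intro sqrt_pi_derivative) simp
    moreover have "((\<lambda>x. x - a) has_real_derivative 1) (at x)" by (auto intro!: derivative_eq_intros)
    ultimately show ?thesis
      using DERIV_chain2[of "\<lambda>x. sqrt x / sqrt pi" "gk (2 * (x - a)) 0" "\<lambda>x. x - a" x 1 UNIV] by simp
  qed
  have "((\<lambda>x. sqrt (x - 0) / sqrt pi + sqrt (x - eps) / sqrt pi - 2 * (sqrt (x - eps / 2) / sqrt pi)) has_real_derivative
      gk (2 * (x - 0)) 0 + gk (2 * (x - eps)) 0 - 2 * gk (2 * (x - eps / 2)) 0) (at x)"
    using assms by (intro DERIV_add DERIV_diff DERIV_cmult s) auto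
  then show ?thesis
    using assms by (simp add: gk_energy_def energy_primitive_def[abs_def] add_divide_distrib diff_divide_distrib)
qed

lemma gk_energy_integral_late:
  assumes "0 < eps" "eps \<le> p" "p \<le> q"
  shows "(\<integral>\<^sup>+r\<in>{p..q}. ennreal (gk_energy eps r) \<partial>lborel) = ennreal (energy_primitive eps q - energy_primitive eps p)"
proof (rule nn_integral_FTC_interior)
  show "continuous_on {p..q} (energy_primitive eps)"
    unfolding energy_primitive_def by (intro continuous_intros) auto
  show "(energy_primitive eps has_real_derivative gk_energy eps x) (at x)" if "p < x" "x < q" for x
    using that assms by (intro energy_primitive_derivative) auto
qed (use assms gk_energy in auto)

lemma gk_energy_integral_early:
  assumes "0 \<le> q" "q \<le> eps"
  shows "(\<integral>\<^sup>+r\<in>{0..q}. ennreal (gk_energy eps r) \<partial>lborel) = ennreal (sqrt q / sqrt pi)"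
proof -
  have "(\<integral>\<^sup>+r\<in>{0..q}. ennreal (gk (2 * r) 0) \<partial>lborel) = ennreal (sqrt q / sqrt pi - sqrt 0 / sqrt pi)"
    using assms by (intro nn_integral_FTC_interior sqrt_pi_derivative) (auto intro!: continuous_intros)
  moreover have "(\<integral>\<^sup>+r\<in>{0..q}. ennreal (gk_energy eps r) \<partial>lborel) = (\<integral>\<^sup>+r\<in>{0..q}. ennreal (gk (2 * r) 0) \<partial>lborel)"
    using assms by (intro nn_integral_cong) (auto simp: gk_energy_def indicator_def)
  ultimately show ?thesis by simp
qed

lemma gk_energy_measurable [measurable]: "gk_energy eps \<in> borel_measurable borel"
  unfolding gk_energy_def by measurable

lemma nn_integral_split_Icc:
  fixes f :: "real \<Rightarrow> ennreal"
  assumes [measurable]: "f \<in> borel_measurable borel" and "a \<le> b" "b \<le> c"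
  shows "(\<integral>\<^sup>+x\<in>{a..c}. f x \<partial>lborel) = (\<integral>\<^sup>+x\<in>{a..b}. f x \<partial>lborel) + (\<integral>\<^sup>+x\<in>{b..c}. f x \<partial>lborel)"
proof -
  have "AE x in lborel. x \<noteq> b" by (rule AE_lborel_singleton)
  then have "(\<integral>\<^sup>+x\<in>{a..c}. f x \<partial>lborel) = (\<integral>\<^sup>+x. f x * indicator {a..b} x + f x * indicator {b..c} x \<partial>lborel)"
    using assms(2,3) by (intro nn_integral_cong_AE, elim eventually_mono) (auto simp: indicator_def)
  also have "\<dots> = (\<integral>\<^sup>+x\<in>{a..b}. f x \<partial>lborel) + (\<integral>\<^sup>+x\<in>{b..c}. f x \<partial>lborel)"
    by (rule nn_integral_add) auto
  finally show ?thesis .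
qed

text \<open>Concavity of the square root, \<open>r - eps / 2\<close> being the midpoint of
  \<open>r - eps\<close> and \<open>r\<close>.\<close>

lemma energy_primitive_nonpos:
  assumes "0 < eps" "eps \<le> r"
  shows "energy_primitive eps r \<le> 0"
proof -
  have "(sqrt r + sqrt (r - eps))\<^sup>2 \<le> 2 * (sqrt r)\<^sup>2 + 2 * (sqrt (r - eps))\<^sup>2"
    using zero_le_power2[of "sqrt r - sqrt (r - eps)"] by (simp add: power2_sum power2_diff del: real_sqrt_pow2)
  also have "\<dots> = (2 * sqrt (r - eps / 2))\<^sup>2" using assms by (simp add: power_mult_distrib)
  finally have "sqrt r + sqrt (r - eps) \<le> 2 * sqrt (r - eps / 2)"
    by (rule power2_le_imp_le) (use assms in simp)
  then show ?thesis by (simp add: energy_primitive_def divide_nonpos_pos)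
qed

lemma energy_primitive_start: "0 < eps \<Longrightarrow> energy_primitive eps eps = sqrt eps / sqrt pi * (1 - sqrt 2)"
proof -
  have "sqrt (eps - eps / 2) = sqrt eps / sqrt 2" by (simp add: real_sqrt_divide[symmetric])
  moreover have "2 * (sqrt eps / sqrt 2) = sqrt 2 * sqrt eps" by (simp add: field_simps)
  ultimately show ?thesis by (simp add: energy_primitive_def algebra_simps diff_divide_distrib)
qed

text \<open>Ages up to \<open>eps\<close> contribute \<open>sqrt eps / sqrt pi\<close>, and minus
  the primitive at \<open>eps\<close> contributes \<open>(sqrt 2 - 1) * sqrt eps / sqrt pi\<close>.
  The energy of all ages is therefore \<open>sqrt (2 * eps / pi)\<close>, the source of the constant
  in the limit theorem.\<close>

lemma gk_energy_integral:
  assumes "0 < eps" "eps \<le> q"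
  shows "(\<integral>\<^sup>+r\<in>{0..q}. ennreal (gk_energy eps r) \<partial>lborel) = ennreal (sqrt 2 * sqrt eps / sqrt pi + energy_primitive eps q)" (is "?S1")
    and "0 \<le> sqrt 2 * sqrt eps / sqrt pi + energy_primitive eps q" (is "?S2")
proof -
  note late = gk_energy_integral_late[OF assms(1) order_refl assms(2)]
  have "(gk_energy eps has_integral (energy_primitive eps q - energy_primitive eps eps)) {eps..q}"
  proof (rule fundamental_theorem_of_calculus_interior[OF assms(2)])
    show "(energy_primitive eps has_vector_derivative gk_energy eps x) (at x)" if "x \<in> {eps<..<q}" for x
      using energy_primitive_derivative[OF assms(1), of x] that by (simp add: has_real_derivative_iff_has_vector_derivative)
  qed (auto simp: energy_primitive_def[abs_def] intro!: continuous_intros)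
  then have mono: "0 \<le> energy_primitive eps q - energy_primitive eps eps"
    by (rule has_integral_nonneg) (use gk_energy(2)[OF assms(1)] in auto)
  have start: "sqrt eps / sqrt pi - energy_primitive eps eps = sqrt 2 * sqrt eps / sqrt pi"
    unfolding energy_primitive_start[OF assms(1)] by (simp add: algebra_simps)
  have "(\<integral>\<^sup>+r\<in>{0..q}. ennreal (gk_energy eps r) \<partial>lborel) = ennreal (sqrt eps / sqrt pi) + ennreal (energy_primitive eps q - energy_primitive eps eps)"
    using assms by (subst nn_integral_split_Icc[of _ 0 eps q]) (auto simp: gk_energy_integral_early late)
  also have "\<dots> = ennreal (sqrt eps / sqrt pi + (energy_primitive eps q - energy_primitive eps eps))"
    using assms mono by (intro ennreal_plus[symmetric]) auto
  also have "sqrt eps / sqrt pi + (energy_primitive eps q - energy_primitive eps eps) = sqrt 2 * sqrt eps / sqrt pi + energy_primitive eps q"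
    using start by simp
  finally show ?S1 .
  have "0 \<le> sqrt eps / sqrt pi" using assms by simp
  then show ?S2 using mono start by linarith
qed

lemma gk_energy_total:
  assumes "0 < eps"
  shows "(\<integral>\<^sup>+r\<in>{0..q}. ennreal (gk_energy eps r) \<partial>lborel) \<le> ennreal (sqrt eps)"
proof (cases "0 \<le> q")
  case True
  have p: "1 \<le> sqrt pi" "sqrt 2 \<le> sqrt pi" using pi_ge_two by auto
  show ?thesis
  proof (cases "q \<le> eps")
    case True
    have "sqrt q / sqrt pi \<le> sqrt eps / 1" using True \<open>0 \<le> q\<close> p by (intro frac_le) auto
    then show ?thesis using gk_energy_integral_early[OF \<open>0 \<le> q\<close> True] by (simp add: ennreal_leI)
  next
    case False
    have "sqrt 2 * sqrt eps / sqrt pi \<le> sqrt eps"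
      using p assms by (simp add: pos_divide_le_eq mult.commute[of "sqrt eps"] mult_right_mono)
    then show ?thesis
      using gk_energy_integral(1)[OF assms, of q] energy_primitive_nonpos[OF assms, of q] False by (simp add: ennreal_leI)
  qed
qed simp

text \<open>Ages up to \<open>\<rho>\<^sup>2\<close> are estimated without using that
  \<open>c\<close> and \<open>d\<close> are close; beyond, \<open>1 - exp (- z) \<le> z\<close>
  gains the squared distance over the age. Optimising over \<rho> would spoil the quadratic
  dependence on the distance, so it stays free.\<close>

lemma gk_space_increment:
  assumes \<rho>: "0 < \<rho>" and T: "0 \<le> T"
  shows "(\<integral>\<^sup>+r\<in>{0..T}. (\<integral>\<^sup>+v. ennreal ((gk r (c - v) - gk r (d - v))\<^sup>2) \<partial>lborel) \<partial>lborel) \<le>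
    ennreal (2 * \<rho> + (c - d)\<^sup>2 * sqrt T / \<rho>\<^sup>2)"
proof -
  define \<delta> where "\<delta> = c - d"
  have b: "(\<integral>\<^sup>+v. ennreal ((gk r (c - v) - gk r (d - v))\<^sup>2) \<partial>lborel) \<le>
     2 * ennreal (gk (2 * r) 0) * indicator {0..\<rho>\<^sup>2} r + ennreal (\<delta>\<^sup>2 / \<rho>\<^sup>2) * ennreal (gk (2 * r) 0)" if r: "0 \<le> r" for r
  proof (cases "r = 0")
    case False
    then have r: "0 < r" using r by simp
    define g where "g = gk (2 * r) 0"
    have g: "0 \<le> g" by (simp add: g_def)
    define E where "E = exp (- (\<delta>\<^sup>2 / (4 * r)))"
    have ge: "gk (2 * r) \<delta> = g * E" using r by (simp add: gk_def g_def E_def)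
    have "0 \<le> E" "1 - \<delta>\<^sup>2 / (4 * r) \<le> E" unfolding E_def using exp_ge_add_one_self[of "- (\<delta>\<^sup>2 / (4 * r))"] by auto
    then have E1: "2 * g - 2 * (g * E) \<le> 2 * g" "2 * g - 2 * (g * E) \<le> 2 * (g * (\<delta>\<^sup>2 / (4 * r)))"
      using g mult_left_mono[of "1 - E" "\<delta>\<^sup>2 / (4 * r)" g] by (auto simp: algebra_simps)
    have L: "(\<integral>\<^sup>+v. ennreal ((gk r (c - v) - gk r (d - v))\<^sup>2) \<partial>lborel) = ennreal (2 * g - 2 * (g * E))"
      using gk_diff_sq_integral(1)[OF r r, of c d] ge by (simp add: g_def \<delta>_def[symmetric] mult_2[symmetric])
    show ?thesis
    proof (cases "r \<le> \<rho>\<^sup>2")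
      case True
      have "ennreal (2 * g - 2 * (g * E)) \<le> ennreal (2 * g)" by (rule ennreal_leI[OF E1(1)])
      also have "\<dots> = 2 * ennreal g" using g by (simp add: ennreal_mult)
      also have "\<dots> \<le> 2 * ennreal g + ennreal (\<delta>\<^sup>2 / \<rho>\<^sup>2) * ennreal g" by simp
      finally show ?thesis using True r L by (simp add: g_def)
    next
      case False
      have "2 * (g * (\<delta>\<^sup>2 / (4 * r))) = g * (\<delta>\<^sup>2 / (2 * r))" by simp
      also have "\<dots> \<le> g * (\<delta>\<^sup>2 / \<rho>\<^sup>2)"
        using False \<rho> r by (intro mult_left_mono divide_left_mono g) auto
      finally have "ennreal (2 * g - 2 * (g * E)) \<le> ennreal (\<delta>\<^sup>2 / \<rho>\<^sup>2 * g)" using E1(2) by (intro ennreal_leI) (simp add: mult.commute)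
      also have "\<dots> = ennreal (\<delta>\<^sup>2 / \<rho>\<^sup>2) * ennreal g" using g by (intro ennreal_mult) auto
      finally show ?thesis using False r L by (simp add: g_def)
    qed
  qed simp
  have e: "(\<integral>\<^sup>+r\<in>{0..q}. ennreal (gk (2 * r) 0) \<partial>lborel) \<le> ennreal (sqrt q)" if "0 \<le> q" for q
  proof -
    have "(\<integral>\<^sup>+r\<in>{0..q}. ennreal (gk (2 * r) 0) \<partial>lborel) = ennreal (sqrt q / sqrt pi - sqrt 0 / sqrt pi)"
      using that by (intro nn_integral_FTC_interior sqrt_pi_derivative) (auto intro!: continuous_intros)
    also have "\<dots> \<le> ennreal (sqrt q)" using that pi_ge_two divide_left_mono[of 1 "sqrt pi" "sqrt q"] by (intro ennreal_leI) auto
    finally show ?thesis .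
  qed
  have "(\<integral>\<^sup>+r\<in>{0..T}. (\<integral>\<^sup>+v. ennreal ((gk r (c - v) - gk r (d - v))\<^sup>2) \<partial>lborel) \<partial>lborel) \<le>
      (\<integral>\<^sup>+r. 2 * (ennreal (gk (2 * r) 0) * indicator {0..\<rho>\<^sup>2} r) + ennreal (\<delta>\<^sup>2 / \<rho>\<^sup>2) * (ennreal (gk (2 * r) 0) * indicator {0..T} r) \<partial>lborel)"
    using b by (intro nn_integral_mono) (auto simp: indicator_def mult_ac)
  also have "\<dots> = 2 * (\<integral>\<^sup>+r\<in>{0..\<rho>\<^sup>2}. ennreal (gk (2 * r) 0) \<partial>lborel) + ennreal (\<delta>\<^sup>2 / \<rho>\<^sup>2) * (\<integral>\<^sup>+r\<in>{0..T}. ennreal (gk (2 * r) 0) \<partial>lborel)"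
    by (subst nn_integral_add) (auto simp: nn_integral_cmult)
  also have "\<dots> \<le> 2 * ennreal (sqrt (\<rho>\<^sup>2)) + ennreal (\<delta>\<^sup>2 / \<rho>\<^sup>2) * ennreal (sqrt T)"
    using T by (intro add_mono mult_left_mono e) auto
  also have "\<dots> = ennreal (2 * \<rho> + (c - d)\<^sup>2 * sqrt T / \<rho>\<^sup>2)"
    using \<rho> T ennreal_linear[of 2 \<rho> "\<delta>\<^sup>2 / \<rho>\<^sup>2" "sqrt T"] by (simp add: \<delta>_def)
  finally show ?thesis .
qed

lemma nn_integral_reflect:
  fixes \<phi> :: "real \<Rightarrow> ennreal"
  assumes [measurable]: "\<phi> \<in> borel_measurable borel"
  shows "(\<integral>\<^sup>+v. \<phi> (- v) \<partial>lborel) = (\<integral>\<^sup>+v. \<phi> v \<partial>lborel)"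
  by (subst (2) nn_integral_real_affine[where c="-1" and t=0]) auto

lemma nn_integral_scale:
  fixes \<phi> :: "real \<Rightarrow> ennreal"
  assumes [measurable]: "\<phi> \<in> borel_measurable borel" and c: "0 < c"
  shows "(\<integral>\<^sup>+y. \<phi> (t + y / c) \<partial>lborel) = ennreal c * (\<integral>\<^sup>+v. \<phi> v \<partial>lborel)"
proof -
  have "(\<integral>\<^sup>+v. \<phi> v \<partial>lborel) = ennreal (1 / c) * (\<integral>\<^sup>+y. \<phi> (t + y / c) \<partial>lborel)"
    using c by (subst nn_integral_real_affine[where c="1/c" and t=t]) auto
  moreover have "ennreal c * (ennreal (1 / c) * z) = z" for z
    using c by (simp add: mult.assoc[symmetric] ennreal_mult[symmetric])
  ultimately show ?thesis by simp
qed

lemma nn_integral_abs_le: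
  fixes \<phi> :: "real \<Rightarrow> ennreal"
  assumes [measurable]: "\<phi> \<in> borel_measurable borel"
  shows "(\<integral>\<^sup>+v. \<phi> \<bar>v\<bar> \<partial>lborel) \<le> 2 * (\<integral>\<^sup>+v. \<phi> v \<partial>lborel)"
proof -
  have "(\<integral>\<^sup>+v. \<phi> \<bar>v\<bar> \<partial>lborel) \<le> (\<integral>\<^sup>+v. \<phi> v + \<phi> (- v) \<partial>lborel)"
    by (intro nn_integral_mono) (auto simp: abs_if)
  also have "\<dots> = 2 * (\<integral>\<^sup>+v. \<phi> v \<partial>lborel)"
    by (subst nn_integral_add) (auto simp: nn_integral_reflect mult_2)
  finally show ?thesis .
qed

lemma ennreal_mult_two: "0 \<le> a \<Longrightarrow> 0 \<le> b \<Longrightarrow> 0 \<le> c \<Longrightarrow> ennreal a * (2 * (ennreal b * ennreal c)) = ennreal (a * (2 * (b * c)))"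
  by (simp add: ennreal_mult)

lemma square_sum_le: "(p + q)\<^sup>2 \<le> 2 * p\<^sup>2 + 2 * (q::real)\<^sup>2"
  using zero_le_power2[of "p - q"] by (simp add: power2_sum power2_diff)

lemma square_diff_le: "(p - q)\<^sup>2 \<le> 2 * p\<^sup>2 + 2 * (q::real)\<^sup>2"
  using square_sum_le[of p "- q"] by simp

section \<open>Kernel estimates for the two-layer medium\<close>

locale layered_medium =
  fixes a1 a2 \<rho>1 \<rho>2 :: real
  assumes pos: "0 < a1" "0 < a2" "0 < \<rho>1" "0 < \<rho>2"
begin

abbreviation "f \<equiv> scale_f a1 a2"
abbreviation "\<beta> \<equiv> coeff_beta a1 a2 \<rho>1 \<rho>2"
abbreviation "G \<equiv> heat_kernel a1 a2 \<rho>1 \<rho>2"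

definition "amax = max a1 a2"
definition "amin = min a1 a2"
definition "\<kappa> = 1 / sqrt amax"

definition weight :: "real \<Rightarrow> real" where
  "weight y = (if y \<le> 0 then 1 / sqrt a1 else 1 / sqrt a2)"

lemma amax: "0 < amax" "a1 \<le> amax" "a2 \<le> amax" and amin: "0 < amin" "amin \<le> a1" "amin \<le> a2"
  and \<kappa>: "0 < \<kappa>"
  using pos by (auto simp: amax_def amin_def \<kappa>_def max_def)

lemma heat_kernel_gk: "G t x y = weight y * (gk t (f x - f y) + \<beta> * sgn y * gk t (\<bar>f x\<bar> + \<bar>f y\<bar>))"
  by (auto simp: heat_kernel_def weight_def gk_def indicator_def field_simps)

lemma scale_f_measurable [measurable]: "f \<in> borel_measurable borel"
  and weight_measurable [measurable]: "weight \<in> borel_measurable borel"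
  unfolding scale_f_def[abs_def] weight_def[abs_def] by measurable

lemma heat_kernel_measurable [measurable (raw)]:
  assumes [measurable]: "g \<in> borel_measurable N" "h \<in> borel_measurable N"
  shows "(\<lambda>z. G (g z) x (h z)) \<in> borel_measurable N"
  unfolding heat_kernel_gk by measurable

lemma weight_bounds: "0 < weight y" "(weight y)\<^sup>2 \<le> 1 / amin"
  using pos amin by (auto simp: weight_def power_divide frac_le)

text \<open>The substitution \<open>v = f y\<close> on each half-line; the Jacobians
  \<open>sqrt a1\<close> and \<open>sqrt a2\<close> are at most \<open>sqrt amax\<close>.\<close>

lemma nn_integral_scale_f:
  assumes [measurable]: "\<phi> \<in> borel_measurable borel"
  shows "(\<integral>\<^sup>+y. \<phi> (f y) \<partial>lborel) \<le> ennreal (sqrt amax) * (\<integral>\<^sup>+v. \<phi> v \<partial>lborel)"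
proof -
  have s: "0 < sqrt a1" "0 < sqrt a2" using pos by auto
  have "(\<integral>\<^sup>+y. \<phi> (f y) \<partial>lborel) = (\<integral>\<^sup>+y. (\<lambda>v. \<phi> v * indicator {..0} v) (0 + y / sqrt a1) + (\<lambda>v. \<phi> v * indicator {0<..} v) (0 + y / sqrt a2) \<partial>lborel)"
    using s by (intro nn_integral_cong) (auto simp: scale_f_def indicator_def divide_le_0_iff zero_less_divide_iff)
  also have "\<dots> = (\<integral>\<^sup>+y. (\<lambda>v. \<phi> v * indicator {..0} v) (0 + y / sqrt a1) \<partial>lborel) + (\<integral>\<^sup>+y. (\<lambda>v. \<phi> v * indicator {0<..} v) (0 + y / sqrt a2) \<partial>lborel)"
    by (rule nn_integral_add) auto
  also have "\<dots> = ennreal (sqrt a1) * (\<integral>\<^sup>+v. \<phi> v * indicator {..0} v \<partial>lborel) + ennreal (sqrt a2) * (\<integral>\<^sup>+v. \<phi> v * indicator {0<..} v \<partial>lborel)"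
    using s by (intro arg_cong2[where f="(+)"] nn_integral_scale) auto
  also have "\<dots> \<le> ennreal (sqrt amax) * (\<integral>\<^sup>+v. \<phi> v * indicator {..0} v \<partial>lborel) + ennreal (sqrt amax) * (\<integral>\<^sup>+v. \<phi> v * indicator {0<..} v \<partial>lborel)"
    using amax by (intro add_mono mult_right_mono ennreal_leI) auto
  also have "\<dots> = ennreal (sqrt amax) * (\<integral>\<^sup>+v. \<phi> v * indicator {..0} v + \<phi> v * indicator {0<..} v \<partial>lborel)"
    by (subst nn_integral_add) (auto simp: distrib_left)
  also have "(\<integral>\<^sup>+v. \<phi> v * indicator {..0} v + \<phi> v * indicator {0<..} v \<partial>lborel) = (\<integral>\<^sup>+v. \<phi> v \<partial>lborel)"
    by (intro nn_integral_cong) (auto simp: indicator_def)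
  finally show ?thesis .
qed

text \<open>The first factors come from the squared density weight and the two squares of direct and
  reflected part, \<open>sqrt amax\<close> from the substitution, and 3 is 1 for the direct part
  plus 2 for the reflected part, which is folded at 0.\<close>

definition "C_diff = 2 * (1 / amin) * (1 + \<beta>\<^sup>2) * sqrt amax * 3"

lemma C_diff_nonneg: "0 \<le> C_diff"
  unfolding C_diff_def using amin amax by simp

lemma heat_kernel_diff_pointwise:
  "(G t x y - G s x' y)\<^sup>2 \<le> 2 * (1 / amin) * (1 + \<beta>\<^sup>2) *
    ((gk t (f x - f y) - gk s (f x' - f y))\<^sup>2 + (gk t (\<bar>f x\<bar> + \<bar>f y\<bar>) - gk s (\<bar>f x'\<bar> + \<bar>f y\<bar>))\<^sup>2)"
proof -
  define A where "A = gk t (f x - f y) - gk s (f x' - f y)"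
  define B where "B = gk t (\<bar>f x\<bar> + \<bar>f y\<bar>) - gk s (\<bar>f x'\<bar> + \<bar>f y\<bar>)"
  have "(G t x y - G s x' y)\<^sup>2 = (weight y)\<^sup>2 * (A + \<beta> * sgn y * B)\<^sup>2"
    unfolding heat_kernel_gk A_def B_def power_mult_distrib[symmetric] by (simp add: algebra_simps)
  also have "\<dots> \<le> (1 / amin) * (2 * A\<^sup>2 + 2 * (\<beta> * sgn y * B)\<^sup>2)"
    using weight_bounds(2) amin by (intro mult_mono square_sum_le) auto
  also have "\<dots> \<le> (1 / amin) * (2 * ((1 + \<beta>\<^sup>2) * A\<^sup>2) + 2 * ((1 + \<beta>\<^sup>2) * B\<^sup>2))"
  proof (intro mult_left_mono add_mono)
    have "(\<beta> * sgn y * B)\<^sup>2 \<le> \<beta>\<^sup>2 * 1 * B\<^sup>2" unfolding power_mult_distrib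
      by (intro mult_right_mono mult_left_mono) (auto simp: sgn_if)
    then show "(\<beta> * sgn y * B)\<^sup>2 \<le> (1 + \<beta>\<^sup>2) * B\<^sup>2"
      using zero_le_power2[of B] unfolding distrib_right by linarith
    show "A\<^sup>2 \<le> (1 + \<beta>\<^sup>2) * A\<^sup>2" by (simp add: distrib_right)
  qed (use amin in auto)
  also have "\<dots> = 2 * (1 / amin) * (1 + \<beta>\<^sup>2) * (A\<^sup>2 + B\<^sup>2)" by (simp add: algebra_simps add_divide_distrib)
  finally show ?thesis unfolding A_def B_def .
qed

text \<open>Reduces increments of the layered kernel to increments of the free Gaussian kernel. The
  hypothesis ranges over all centres at distance at most \<open>\<bar>f x - f x'\<bar>\<close>
  because the reflected part has the centres \<open>\<bar>f x\<bar>\<close> and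
  \<open>\<bar>f x'\<bar>\<close>, whose distance is no larger.\<close>

lemma heat_kernel_diff_integral:
  assumes "\<And>c d. \<bar>c - d\<bar> \<le> \<bar>f x - f x'\<bar> \<Longrightarrow> (\<integral>\<^sup>+v. ennreal ((gk t (c - v) - gk s (d - v))\<^sup>2) \<partial>lborel) \<le> E"
  shows "(\<integral>\<^sup>+y. ennreal ((G t x y - G s x' y)\<^sup>2) \<partial>lborel) \<le> ennreal C_diff * E"
proof -
  define K where "K = 2 * (1 / amin) * (1 + \<beta>\<^sup>2)"
  have K: "0 \<le> K" unfolding K_def using amin by simp
  have "(\<integral>\<^sup>+y. ennreal ((G t x y - G s x' y)\<^sup>2) \<partial>lborel) \<le>
     (\<integral>\<^sup>+y. ennreal K * (ennreal ((gk t (f x - f y) - gk s (f x' - f y))\<^sup>2) + ennreal ((gk t (\<bar>f x\<bar> + \<bar>f y\<bar>) - gk s (\<bar>f x'\<bar> + \<bar>f y\<bar>))\<^sup>2)) \<partial>lborel)"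
  proof (rule nn_integral_mono)
    fix y
    show "ennreal ((G t x y - G s x' y)\<^sup>2) \<le>
      ennreal K * (ennreal ((gk t (f x - f y) - gk s (f x' - f y))\<^sup>2) + ennreal ((gk t (\<bar>f x\<bar> + \<bar>f y\<bar>) - gk s (\<bar>f x'\<bar> + \<bar>f y\<bar>))\<^sup>2))"
      using ennreal_leI[OF heat_kernel_diff_pointwise[of t x y s x', folded K_def]] K
      by (simp add: ennreal_mult ennreal_plus)
  qed
  also have "\<dots> = ennreal K * ((\<integral>\<^sup>+y. ennreal ((gk t (f x - f y) - gk s (f x' - f y))\<^sup>2) \<partial>lborel) +
     (\<integral>\<^sup>+y. ennreal ((gk t (\<bar>f x\<bar> + \<bar>f y\<bar>) - gk s (\<bar>f x'\<bar> + \<bar>f y\<bar>))\<^sup>2) \<partial>lborel))"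
    by (simp add: nn_integral_cmult nn_integral_add)
  also have "\<dots> \<le> ennreal K * (ennreal (sqrt amax) * E + ennreal (sqrt amax) * (2 * E))"
  proof (intro mult_left_mono add_mono)
    show "(\<integral>\<^sup>+y. ennreal ((gk t (f x - f y) - gk s (f x' - f y))\<^sup>2) \<partial>lborel) \<le> ennreal (sqrt amax) * E"
      by (rule order_trans[OF nn_integral_scale_f[of "\<lambda>v. ennreal ((gk t (f x - v) - gk s (f x' - v))\<^sup>2)"]])
         (auto intro!: mult_left_mono assms)
    have "(\<integral>\<^sup>+y. ennreal ((gk t (\<bar>f x\<bar> + \<bar>f y\<bar>) - gk s (\<bar>f x'\<bar> + \<bar>f y\<bar>))\<^sup>2) \<partial>lborel) \<le>
       ennreal (sqrt amax) * (\<integral>\<^sup>+v. ennreal ((gk t (\<bar>f x\<bar> + \<bar>v\<bar>) - gk s (\<bar>f x'\<bar> + \<bar>v\<bar>))\<^sup>2) \<partial>lborel)"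
      by (rule nn_integral_scale_f[of "\<lambda>v. ennreal ((gk t (\<bar>f x\<bar> + \<bar>v\<bar>) - gk s (\<bar>f x'\<bar> + \<bar>v\<bar>))\<^sup>2)"]) auto
    also have "(\<integral>\<^sup>+v. ennreal ((gk t (\<bar>f x\<bar> + \<bar>v\<bar>) - gk s (\<bar>f x'\<bar> + \<bar>v\<bar>))\<^sup>2) \<partial>lborel) \<le>
        2 * (\<integral>\<^sup>+v. ennreal ((gk t (\<bar>f x\<bar> + v) - gk s (\<bar>f x'\<bar> + v))\<^sup>2) \<partial>lborel)"
      by (rule nn_integral_abs_le[of "\<lambda>v. ennreal ((gk t (\<bar>f x\<bar> + v) - gk s (\<bar>f x'\<bar> + v))\<^sup>2)"]) auto
    also have "(\<integral>\<^sup>+v. ennreal ((gk t (\<bar>f x\<bar> + v) - gk s (\<bar>f x'\<bar> + v))\<^sup>2) \<partial>lborel) =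
        (\<integral>\<^sup>+v. ennreal ((gk t (\<bar>f x\<bar> - v) - gk s (\<bar>f x'\<bar> - v))\<^sup>2) \<partial>lborel)"
      using nn_integral_reflect[of "\<lambda>v. ennreal ((gk t (\<bar>f x\<bar> - v) - gk s (\<bar>f x'\<bar> - v))\<^sup>2)"] by simp
    also have "\<dots> \<le> E" by (rule assms) (rule abs_triangle_ineq3)
    finally show "(\<integral>\<^sup>+y. ennreal ((gk t (\<bar>f x\<bar> + \<bar>f y\<bar>) - gk s (\<bar>f x'\<bar> + \<bar>f y\<bar>))\<^sup>2) \<partial>lborel) \<le> ennreal (sqrt amax) * (2 * E)"
      by (simp add: mult_left_mono)
  qed auto
  also have "\<dots> = ennreal C_diff * E"
  proof -
    have "E + 2 * E = (1 + 2) * E" unfolding distrib_right by simp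
    then have "ennreal K * (ennreal (sqrt amax) * E + ennreal (sqrt amax) * (2 * E)) = (ennreal K * ennreal (sqrt amax) * 3) * E"
      by (simp add: distrib_left[symmetric] mult.assoc)
    also have "ennreal K * ennreal (sqrt amax) * 3 = ennreal (K * sqrt amax * 3)"
      using K amax by (simp add: ennreal_mult)
    finally show ?thesis by (simp add: C_diff_def K_def)
  qed
  finally show ?thesis .
qed

lemma heat_kernel_time_diff:
  assumes "0 < eps"
  shows "(\<integral>\<^sup>+y. ennreal ((G r x y - G (r - eps) x y)\<^sup>2) \<partial>lborel) \<le> ennreal (C_diff * gk_energy eps r)"
proof -
  have "(\<integral>\<^sup>+y. ennreal ((G r x y - G (r - eps) x y)\<^sup>2) \<partial>lborel) \<le> ennreal C_diff * ennreal (gk_energy eps r)"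
    by (rule heat_kernel_diff_integral) (use gk_energy(1)[OF assms] in auto)
  then show ?thesis using C_diff_nonneg gk_energy(2)[OF assms] by (simp add: ennreal_mult)
qed

lemma heat_kernel_time_diff_total:
  assumes "0 < eps"
  shows "(\<integral>\<^sup>+r\<in>{0..q}. (\<integral>\<^sup>+y. ennreal ((G r x y - G (r - eps) x y)\<^sup>2) \<partial>lborel) \<partial>lborel) \<le> ennreal (C_diff * sqrt eps)"
proof -
  have "(\<integral>\<^sup>+r\<in>{0..q}. (\<integral>\<^sup>+y. ennreal ((G r x y - G (r - eps) x y)\<^sup>2) \<partial>lborel) \<partial>lborel) \<le>
     (\<integral>\<^sup>+r. ennreal C_diff * (ennreal (gk_energy eps r) * indicator {0..q} r) \<partial>lborel)"
    using heat_kernel_time_diff[OF assms] C_diff_nonneg gk_energy(2)[OF assms]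
    by (intro nn_integral_mono) (auto simp: indicator_def ennreal_mult)
  also have "\<dots> = ennreal C_diff * (\<integral>\<^sup>+r\<in>{0..q}. ennreal (gk_energy eps r) \<partial>lborel)"
    by (rule nn_integral_cmult) auto
  also have "\<dots> \<le> ennreal C_diff * ennreal (sqrt eps)"
    by (intro mult_left_mono gk_energy_total assms) auto
  also have "\<dots> = ennreal (C_diff * sqrt eps)" using assms C_diff_nonneg by (simp add: ennreal_mult)
  finally show ?thesis .
qed

lemma scale_f_Lipschitz: "\<bar>f x - f y\<bar> \<le> \<bar>x - y\<bar> / sqrt amin"
proof -
  have "\<bar>f x - f y\<bar> \<le> \<bar>x - y\<bar> / sqrt amin" if xy: "x \<le> y" for x y
  proof -
    have s: "sqrt amin \<le> sqrt a1" "sqrt amin \<le> sqrt a2" "0 < sqrt amin" using amin by auto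
    have d: "z / sqrt a1 \<le> z / sqrt amin" "z / sqrt a2 \<le> z / sqrt amin" if "0 \<le> z" for z
      using s that by (auto intro!: divide_left_mono mult_pos_pos)
    consider "y \<le> 0" | "x \<le> 0" "0 < y" | "0 < x" by linarith
    then show ?thesis
    proof cases
      case 1
      then show ?thesis using d(1)[of "y - x"] xy pos by (simp add: scale_f_def diff_divide_distrib[symmetric])
    next
      case 2
      then have "x / sqrt a1 \<le> 0" "0 \<le> y / sqrt a2" using pos by (auto simp: divide_nonpos_pos)
      then show ?thesis using d(1)[of "- x"] d(2)[of y] 2 by (simp add: scale_f_def diff_divide_distrib)
    next
      case 3
      then show ?thesis using d(2)[of "y - x"] xy pos by (simp add: scale_f_def diff_divide_distrib[symmetric])
    qed
  qed
  from this[of x y] this[of y x] show ?thesis by (cases "x \<le> y") (auto simp: abs_minus_commute)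
qed

lemma heat_kernel_space_diff_total:
  assumes \<rho>: "0 < \<rho>" and T: "0 \<le> T"
  shows "(\<integral>\<^sup>+r\<in>{0..T}. (\<integral>\<^sup>+y. ennreal ((G r x y - G r x' y)\<^sup>2) \<partial>lborel) \<partial>lborel) \<le>
    ennreal (C_diff * (2 * \<rho> + (x - x')\<^sup>2 / amin * sqrt T / \<rho>\<^sup>2))"
proof -
  define d where "d = f x - f x'"
  \<comment> \<open>The integral depends on the centres only through
    \<open>gk (2 * r) (p - q)\<close> and grows with their distance, so the largest admissible
    distance \<open>d\<close> is the worst case.\<close>
  have E: "(\<integral>\<^sup>+v. ennreal ((gk r (p - v) - gk r (q - v))\<^sup>2) \<partial>lborel) \<le> (\<integral>\<^sup>+v. ennreal ((gk r (d - v) - gk r (0 - v))\<^sup>2) \<partial>lborel)"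
    if le: "\<bar>p - q\<bar> \<le> \<bar>f x - f x'\<bar>" for p q r
  proof (cases "0 < r")
    case True
    have "gk (r + r) d \<le> gk (r + r) (p - q)" using le by (intro gk_antimono) (simp add: d_def)
    then show ?thesis
      using gk_diff_sq_integral(1)[OF True True, of p q] gk_diff_sq_integral(1)[OF True True, of d 0] by (simp add: ennreal_leI)
  qed simp
  have m: "(\<lambda>r. \<integral>\<^sup>+v. ennreal ((gk r (d - v) - gk r (0 - v))\<^sup>2) \<partial>lborel) \<in> borel_measurable borel"
    by measurable
  have "(\<integral>\<^sup>+r\<in>{0..T}. (\<integral>\<^sup>+y. ennreal ((G r x y - G r x' y)\<^sup>2) \<partial>lborel) \<partial>lborel) \<le>
     (\<integral>\<^sup>+r. ennreal C_diff * ((\<integral>\<^sup>+v. ennreal ((gk r (d - v) - gk r (0 - v))\<^sup>2) \<partial>lborel) * indicator {0..T} r) \<partial>lborel)"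
    using heat_kernel_diff_integral[OF E] by (intro nn_integral_mono) (auto simp: indicator_def)
  also have "\<dots> = ennreal C_diff * (\<integral>\<^sup>+r\<in>{0..T}. (\<integral>\<^sup>+v. ennreal ((gk r (d - v) - gk r (0 - v))\<^sup>2) \<partial>lborel) \<partial>lborel)"
    using m by (intro nn_integral_cmult) auto
  also have "\<dots> \<le> ennreal C_diff * ennreal (2 * \<rho> + (d - 0)\<^sup>2 * sqrt T / \<rho>\<^sup>2)"
    by (intro mult_left_mono gk_space_increment \<rho> T) auto
  also have "\<dots> \<le> ennreal C_diff * ennreal (2 * \<rho> + (x - x')\<^sup>2 / amin * sqrt T / \<rho>\<^sup>2)"
  proof (intro mult_left_mono ennreal_leI add_left_mono divide_right_mono mult_right_mono)
    have "\<bar>d\<bar>\<^sup>2 \<le> (\<bar>x - x'\<bar> / sqrt amin)\<^sup>2" unfolding d_def by (intro power_mono scale_f_Lipschitz) auto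
    then show "(d - 0)\<^sup>2 \<le> (x - x')\<^sup>2 / amin" using amin by (simp add: power_divide)
  qed (use T in auto)
  also have "\<dots> = ennreal (C_diff * (2 * \<rho> + (x - x')\<^sup>2 / amin * sqrt T / \<rho>\<^sup>2))"
    using C_diff_nonneg \<rho> T amin by (intro ennreal_mult[symmetric]) auto
  finally show ?thesis .
qed

text \<open>The kernel of the homogeneous medium surrounding \<open>x\<close>.\<close>

definition near_kernel :: "real \<Rightarrow> real \<Rightarrow> real \<Rightarrow> real" where
  "near_kernel t x y = gk t ((x - y) / sqrt (coeff_A a1 a2 x)) / sqrt (coeff_A a1 a2 x)"

lemma coeff_A: "0 < coeff_A a1 a2 x" "amin \<le> coeff_A a1 a2 x" "coeff_A a1 a2 x \<le> amax"
  using pos amin amax by (auto simp: coeff_A_def)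

lemma near_kernel_measurable [measurable (raw)]:
  assumes [measurable]: "g \<in> borel_measurable N" "h \<in> borel_measurable N"
  shows "(\<lambda>z. near_kernel (g z) x (h z)) \<in> borel_measurable N"
  unfolding near_kernel_def by measurable

text \<open>\<open>\<bar>\<beta>\<bar>\<close> is the share of the reflected part; across the
  interface the direct part and the homogeneous kernel count 1 each.\<close>

definition "C_near = (2 + \<bar>\<beta>\<bar>) / sqrt amin"

text \<open>On the side of \<open>x\<close> the two kernels differ by the reflected part alone.
  Across the interface every part is small by itself: the way from \<open>x\<close> to
  \<open>y\<close> leads through 0, and since \<kappa> is the smallest slope of \<open>f\<close>,
  its scaled length is at least \<open>\<kappa> * (\<bar>x\<bar> + \<bar>y\<bar>)\<close>.\<close>

lemma heat_kernel_near:
  assumes x: "x \<noteq> 0"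
  shows "\<bar>G t x y - near_kernel t x y\<bar> \<le> C_near * gk t (\<kappa> * (\<bar>x\<bar> + \<bar>y\<bar>))"
proof -
  define g where "g = gk t (\<kappa> * (\<bar>x\<bar> + \<bar>y\<bar>))"
  have g0: "0 \<le> g" by (simp add: g_def)
  have fk: "\<kappa> * \<bar>z\<bar> \<le> \<bar>f z\<bar>" for z
  proof -
    have "\<bar>z\<bar> / sqrt amax \<le> \<bar>z\<bar> / sqrt a1" "\<bar>z\<bar> / sqrt amax \<le> \<bar>z\<bar> / sqrt a2"
      using amax pos by (auto intro!: divide_left_mono mult_pos_pos)
    then show ?thesis using pos by (auto simp: \<kappa>_def scale_f_def)
  qed
  have ff: "\<kappa> * (\<bar>x\<bar> + \<bar>y\<bar>) \<le> \<bar>f x\<bar> + \<bar>f y\<bar>" using fk[of x] fk[of y] by (simp add: distrib_left)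
  have gf: "gk t (\<bar>f x\<bar> + \<bar>f y\<bar>) \<le> g"
    unfolding g_def using ff \<kappa> by (intro gk_antimono) auto
  have w: "weight y \<le> 1 / sqrt amin"
    using amin by (auto simp: weight_def intro!: divide_left_mono mult_pos_pos)
  have w0: "0 \<le> weight y" using weight_bounds(1)[of y] by simp
  have refl: "\<bar>weight y * (\<beta> * sgn y * gk t (\<bar>f x\<bar> + \<bar>f y\<bar>))\<bar> \<le> (1 / sqrt amin) * (\<bar>\<beta>\<bar> * g)"
  proof -
    have "\<bar>\<beta> * sgn y * gk t (\<bar>f x\<bar> + \<bar>f y\<bar>)\<bar> \<le> \<bar>\<beta>\<bar> * 1 * g"
      unfolding abs_mult by (intro mult_mono) (use gf in \<open>auto simp: sgn_if\<close>)
    then show ?thesis unfolding abs_mult[of "weight y"] using w w0 amin by (intro mult_mono) auto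
  qed
  show ?thesis
  proof (cases "(x \<le> 0) = (y \<le> 0)")
    case True
    have "weight y = 1 / sqrt (coeff_A a1 a2 x)" "f x - f y = (x - y) / sqrt (coeff_A a1 a2 x)"
      using True by (auto simp: weight_def coeff_A_def scale_f_def diff_divide_distrib)
    then have "G t x y - near_kernel t x y = weight y * (\<beta> * sgn y * gk t (\<bar>f x\<bar> + \<bar>f y\<bar>))"
      by (simp add: heat_kernel_gk near_kernel_def distrib_left)
    then have "\<bar>G t x y - near_kernel t x y\<bar> \<le> (1 / sqrt amin) * (\<bar>\<beta>\<bar> * g)" using refl by simp
    also have "\<dots> \<le> (1 / sqrt amin) * ((2 + \<bar>\<beta>\<bar>) * g)" using g0 amin by (intro mult_left_mono mult_right_mono) auto
    finally show ?thesis by (simp add: C_near_def g_def)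
  next
    case False
    have o: "\<bar>f x - f y\<bar> = \<bar>f x\<bar> + \<bar>f y\<bar>"
    proof -
      have "(f x \<le> 0 \<and> 0 \<le> f y) \<or> (0 \<le> f x \<and> f y \<le> 0)"
        using False pos by (auto simp: scale_f_def divide_le_0_iff zero_le_divide_iff)
      then show ?thesis by auto
    qed
    have 1: "gk t (f x - f y) \<le> g" unfolding g_def using ff o \<kappa> by (intro gk_antimono) auto
    have 2: "gk t ((x - y) / sqrt (coeff_A a1 a2 x)) \<le> g"
    proof -
      have "\<bar>x - y\<bar> = \<bar>x\<bar> + \<bar>y\<bar>" using False by auto
      moreover have "(\<bar>x\<bar> + \<bar>y\<bar>) / sqrt amax \<le> (\<bar>x\<bar> + \<bar>y\<bar>) / sqrt (coeff_A a1 a2 x)"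
        using coeff_A amax by (intro divide_left_mono mult_pos_pos) auto
      ultimately show ?thesis
        unfolding g_def using coeff_A(1)[of x] \<kappa> by (intro gk_antimono) (auto simp: \<kappa>_def)
    qed
    have n: "\<bar>near_kernel t x y\<bar> \<le> (1 / sqrt amin) * g"
    proof -
      have "g / sqrt (coeff_A a1 a2 x) \<le> g / sqrt amin" using coeff_A amin g0 by (intro divide_left_mono mult_pos_pos) auto
      moreover have "near_kernel t x y \<le> g / sqrt (coeff_A a1 a2 x)" unfolding near_kernel_def using 2 coeff_A(1)[of x] by (intro divide_right_mono) auto
      moreover have "0 \<le> near_kernel t x y" using coeff_A(1)[of x] by (simp add: near_kernel_def)
      ultimately show ?thesis by simp
    qed
    have h: "\<bar>weight y * gk t (f x - f y)\<bar> \<le> (1 / sqrt amin) * g"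
      unfolding abs_mult using w w0 1 g0 amin by (intro mult_mono) auto
    have "\<bar>G t x y - near_kernel t x y\<bar> \<le> \<bar>weight y * gk t (f x - f y)\<bar> + \<bar>weight y * (\<beta> * sgn y * gk t (\<bar>f x\<bar> + \<bar>f y\<bar>))\<bar> + \<bar>near_kernel t x y\<bar>"
      unfolding heat_kernel_gk distrib_left by linarith
    also have "\<dots> \<le> (1 / sqrt amin) * g + (1 / sqrt amin) * (\<bar>\<beta>\<bar> * g) + (1 / sqrt amin) * g"
      using h refl n by linarith
    also have "\<dots> = C_near * g" by (simp add: C_near_def add_divide_distrib algebra_simps)
    finally show ?thesis by (simp add: g_def)
  qed
qed

definition "C_far x = 2 / \<kappa> / (\<kappa> * x)\<^sup>2"

text \<open>Every argument \<open>z\<close> has size at least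
  \<open>\<kappa> * \<bar>x\<bar>\<close>, so the factor
  \<open>z\<^sup>2 / (\<kappa> * x)\<^sup>2\<close> may be inserted and the second moment used. This
  gains a factor \<open>t\<close> over the norm of the full kernel. In \<open>C_far\<close>, 2 stems
  from folding at 0 and \<open>1 / \<kappa>\<close> from the substitution.\<close>

lemma gk_far_integral:
  assumes x: "x \<noteq> 0"
  shows "(\<integral>\<^sup>+y. ennreal ((gk t (\<kappa> * (\<bar>x\<bar> + \<bar>y\<bar>)))\<^sup>2) \<partial>lborel) \<le> ennreal (C_far x * sqrt t)"
proof (cases "t \<le> 0")
  case False
  have kx: "0 < (\<kappa> * x)\<^sup>2" using x \<kappa> by simp
  let ?\<phi> = "\<lambda>z. ennreal ((gk t z)\<^sup>2 * z\<^sup>2)"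
  have "(\<integral>\<^sup>+y. ennreal ((gk t (\<kappa> * (\<bar>x\<bar> + \<bar>y\<bar>)))\<^sup>2) \<partial>lborel) \<le> (\<integral>\<^sup>+y. ennreal (1 / (\<kappa> * x)\<^sup>2) * ?\<phi> (\<kappa> * (\<bar>x\<bar> + \<bar>y\<bar>)) \<partial>lborel)"
  proof (rule nn_integral_mono)
    fix y
    define z where "z = \<kappa> * (\<bar>x\<bar> + \<bar>y\<bar>)"
    have "\<bar>\<kappa> * x\<bar> \<le> \<bar>z\<bar>" using \<kappa> by (simp add: z_def abs_mult)
    then have "(\<kappa> * x)\<^sup>2 \<le> z\<^sup>2" by (simp add: abs_le_square_iff)
    then have "(gk t z)\<^sup>2 * (\<kappa> * x)\<^sup>2 \<le> (gk t z)\<^sup>2 * z\<^sup>2" by (intro mult_left_mono) auto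
    then have "(gk t z)\<^sup>2 \<le> 1 / (\<kappa> * x)\<^sup>2 * ((gk t z)\<^sup>2 * z\<^sup>2)" using kx by (simp add: field_simps)
    from ennreal_leI[OF this] show "ennreal ((gk t (\<kappa> * (\<bar>x\<bar> + \<bar>y\<bar>)))\<^sup>2) \<le> ennreal (1 / (\<kappa> * x)\<^sup>2) * ?\<phi> (\<kappa> * (\<bar>x\<bar> + \<bar>y\<bar>))"
      unfolding z_def by (subst ennreal_mult[symmetric]) auto
  qed
  also have "\<dots> = ennreal (1 / (\<kappa> * x)\<^sup>2) * (\<integral>\<^sup>+y. ?\<phi> (\<kappa> * (\<bar>x\<bar> + \<bar>y\<bar>)) \<partial>lborel)"
    by (rule nn_integral_cmult) auto
  also have "(\<integral>\<^sup>+y. ?\<phi> (\<kappa> * (\<bar>x\<bar> + \<bar>y\<bar>)) \<partial>lborel) \<le> 2 * (\<integral>\<^sup>+y. ?\<phi> (\<kappa> * \<bar>x\<bar> + y / (1 / \<kappa>)) \<partial>lborel)"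
    using nn_integral_abs_le[of "\<lambda>y. ?\<phi> (\<kappa> * (\<bar>x\<bar> + y))"] by (simp add: distrib_left mult.commute)
  also have "(\<integral>\<^sup>+y. ?\<phi> (\<kappa> * \<bar>x\<bar> + y / (1 / \<kappa>)) \<partial>lborel) = ennreal (1 / \<kappa>) * (\<integral>\<^sup>+z. ?\<phi> z \<partial>lborel)"
    using \<kappa> by (intro nn_integral_scale) auto
  also have "\<dots> \<le> ennreal (1 / \<kappa>) * ennreal (sqrt t)" by (intro mult_left_mono gk_second_moment) auto
  also have "ennreal (1 / (\<kappa> * x)\<^sup>2) * (2 * (ennreal (1 / \<kappa>) * ennreal (sqrt t))) = ennreal (1 / (\<kappa> * x)\<^sup>2 * (2 * (1 / \<kappa> * sqrt t)))"
    using \<kappa> False by (intro ennreal_mult_two) auto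
  also have "1 / (\<kappa> * x)\<^sup>2 * (2 * (1 / \<kappa> * sqrt t)) = C_far x * sqrt t" by (simp add: C_far_def)
  finally show ?thesis by (simp add: mult_left_mono)
qed simp

definition "C_err x = 4 * C_near\<^sup>2 * C_far x"

lemma C_nonneg: "0 \<le> C_near" "0 \<le> C_far x" "0 \<le> C_err x"
  using amin \<kappa> by (auto simp: C_near_def C_far_def C_err_def)

text \<open>No cancellation between the two times is needed: the interface error of each kernel
  already has squared norm of order \<open>sqrt r\<close>, far below the order
  \<open>1 / sqrt r\<close> of the kernel itself.\<close>

lemma heat_kernel_near_diff:
  assumes x: "x \<noteq> 0" and r: "0 < eps"
  shows "(\<integral>\<^sup>+y. ennreal (((G r x y - G (r - eps) x y) - (near_kernel r x y - near_kernel (r - eps) x y))\<^sup>2) \<partial>lborel) \<le>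
    ennreal (C_err x * sqrt r)"
proof (cases "r \<le> 0")
  case True
  then show ?thesis using r by (simp add: heat_kernel_gk near_kernel_def)
next
  case False
  have s: "ennreal (sqrt (r - eps)) \<le> ennreal (sqrt r)" using r by (intro ennreal_leI) auto
  let ?g = "\<lambda>t y. gk t (\<kappa> * (\<bar>x\<bar> + \<bar>y\<bar>))"
  have "(\<integral>\<^sup>+y. ennreal (((G r x y - G (r - eps) x y) - (near_kernel r x y - near_kernel (r - eps) x y))\<^sup>2) \<partial>lborel) \<le>
    (\<integral>\<^sup>+y. ennreal (2 * C_near\<^sup>2) * (ennreal ((?g r y)\<^sup>2) + ennreal ((?g (r - eps) y)\<^sup>2)) \<partial>lborel)"
  proof (rule nn_integral_mono)
    fix y
    define p where "p = G r x y - near_kernel r x y"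
    define q where "q = G (r - eps) x y - near_kernel (r - eps) x y"
    have "\<bar>p\<bar>\<^sup>2 \<le> (C_near * ?g r y)\<^sup>2" "\<bar>q\<bar>\<^sup>2 \<le> (C_near * ?g (r - eps) y)\<^sup>2"
      unfolding p_def q_def by (intro power_mono heat_kernel_near x abs_ge_zero)+
    then have "(p - q)\<^sup>2 \<le> 2 * C_near\<^sup>2 * ((?g r y)\<^sup>2 + (?g (r - eps) y)\<^sup>2)"
      using square_diff_le[of p q] by (simp add: power_mult_distrib algebra_simps)
    moreover have "(G r x y - G (r - eps) x y) - (near_kernel r x y - near_kernel (r - eps) x y) = p - q"
      by (simp add: p_def q_def)
    ultimately show "ennreal (((G r x y - G (r - eps) x y) - (near_kernel r x y - near_kernel (r - eps) x y))\<^sup>2) \<le>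
       ennreal (2 * C_near\<^sup>2) * (ennreal ((?g r y)\<^sup>2) + ennreal ((?g (r - eps) y)\<^sup>2))"
      by (simp add: ennreal_leI ennreal_mult[symmetric] ennreal_plus[symmetric] del: ennreal_plus)
  qed
  also have "\<dots> = ennreal (2 * C_near\<^sup>2) * ((\<integral>\<^sup>+y. ennreal ((?g r y)\<^sup>2) \<partial>lborel) + (\<integral>\<^sup>+y. ennreal ((?g (r - eps) y)\<^sup>2) \<partial>lborel))"
    by (simp add: nn_integral_cmult nn_integral_add)
  also have "\<dots> \<le> ennreal (2 * C_near\<^sup>2) * (ennreal (C_far x * sqrt r) + ennreal (C_far x * sqrt r))"
  proof (intro mult_left_mono add_mono order_trans[OF gk_far_integral[OF x]] order_refl)
    show "ennreal (C_far x * sqrt (r - eps)) \<le> ennreal (C_far x * sqrt r)"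
      using r C_nonneg(2)[of x] by (intro ennreal_leI mult_left_mono) auto
  qed auto
  also have "\<dots> = ennreal (2 * C_near\<^sup>2 * (C_far x * sqrt r + C_far x * sqrt r))"
    using False C_nonneg(2)[of x] by (simp add: ennreal_mult[symmetric] ennreal_plus[symmetric] del: ennreal_plus)
  also have "2 * C_near\<^sup>2 * (C_far x * sqrt r + C_far x * sqrt r) = C_err x * sqrt r" by (simp add: C_err_def)
  finally show ?thesis .
qed

text \<open>The weight \<phi> is the constant 1 for the energy and a multiple of the square for the
  second moment. The two kernels bring \<open>1 / A\<close>, the substitution brings
  \<open>sqrt A\<close>.\<close>

lemma near_kernel_sq_integral:
  fixes \<phi> :: "real \<Rightarrow> real"
  assumes [measurable]: "\<phi> \<in> borel_measurable borel" and nn: "\<And>z. 0 \<le> \<phi> z"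
  shows "(\<integral>\<^sup>+y. ennreal ((near_kernel r x y - near_kernel s x y)\<^sup>2 * \<phi> ((y - x) / sqrt (coeff_A a1 a2 x))) \<partial>lborel) =
    ennreal (1 / sqrt (coeff_A a1 a2 x)) * (\<integral>\<^sup>+z. ennreal ((gk r z - gk s z)\<^sup>2 * \<phi> z) \<partial>lborel)"
proof -
  define a where "a = sqrt (coeff_A a1 a2 x)"
  have a: "0 < a" using coeff_A(1)[of x] by (simp add: a_def)
  have m: "gk t ((x - y) / a) = gk t (- (x / a) + y / a)" for t y
    using gk_minus[of t "(x - y) / a"] by (simp add: diff_divide_distrib)
  have "(\<integral>\<^sup>+y. ennreal ((near_kernel r x y - near_kernel s x y)\<^sup>2 * \<phi> ((y - x) / a)) \<partial>lborel) =
     (\<integral>\<^sup>+y. ennreal (1 / a\<^sup>2) * (\<lambda>z. ennreal ((gk r z - gk s z)\<^sup>2 * \<phi> z)) (- (x / a) + y / a) \<partial>lborel)"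
    unfolding near_kernel_def a_def[symmetric] m diff_divide_distrib[symmetric] power_divide
    using nn by (intro nn_integral_cong) (subst ennreal_mult[symmetric], auto simp: diff_divide_distrib)
  also have "\<dots> = ennreal (1 / a\<^sup>2) * (\<integral>\<^sup>+y. (\<lambda>z. ennreal ((gk r z - gk s z)\<^sup>2 * \<phi> z)) (- (x / a) + y / a) \<partial>lborel)"
    by (rule nn_integral_cmult) auto
  also have "\<dots> = ennreal (1 / a\<^sup>2) * (ennreal a * (\<integral>\<^sup>+z. ennreal ((gk r z - gk s z)\<^sup>2 * \<phi> z) \<partial>lborel))"
    using a by (subst nn_integral_scale) auto
  also have "\<dots> = ennreal (1 / a) * (\<integral>\<^sup>+z. ennreal ((gk r z - gk s z)\<^sup>2 * \<phi> z) \<partial>lborel)"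
    using a by (simp add: mult.assoc[symmetric] ennreal_mult[symmetric] power2_eq_square)
  finally show ?thesis unfolding a_def .
qed

lemma near_kernel_energy:
  assumes "0 < eps"
  shows "(\<integral>\<^sup>+y. ennreal ((near_kernel r x y - near_kernel (r - eps) x y)\<^sup>2) \<partial>lborel) = ennreal (gk_energy eps r / sqrt (coeff_A a1 a2 x))"
  using near_kernel_sq_integral[of "\<lambda>_. 1" r x "r - eps"] gk_energy(1)[OF assms, of r 0] gk_energy(2)[OF assms, of r] coeff_A(1)[of x]
  by (simp add: ennreal_mult[symmetric])

text \<open>In contrast to the energy, the two kernels are estimated separately, because the weight
  \<open>(y - x)\<^sup>2\<close> already gains a factor \<open>r\<close>.\<close>

lemma near_kernel_second_moment:
  assumes "0 < eps"
  shows "(\<integral>\<^sup>+y. ennreal ((near_kernel r x y - near_kernel (r - eps) x y)\<^sup>2 * (y - x)\<^sup>2) \<partial>lborel) \<le> ennreal (4 * sqrt amax * sqrt r)"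
proof (cases "r \<le> 0")
  case True
  then show ?thesis using assms by (simp add: near_kernel_def)
next
  case False
  define a where "a = coeff_A a1 a2 x"
  have a: "0 < a" "a \<le> amax" using coeff_A[of x] by (auto simp: a_def)
  have e: "(y - x)\<^sup>2 = a * ((y - x) / sqrt a)\<^sup>2" for y using a by (simp add: power_divide)
  have "(\<integral>\<^sup>+y. ennreal ((near_kernel r x y - near_kernel (r - eps) x y)\<^sup>2 * (y - x)\<^sup>2) \<partial>lborel) =
     ennreal (1 / sqrt a) * (\<integral>\<^sup>+z. ennreal ((gk r z - gk (r - eps) z)\<^sup>2 * (a * z\<^sup>2)) \<partial>lborel)"
    unfolding e using a near_kernel_sq_integral[of "\<lambda>z. a * z\<^sup>2" r x "r - eps", folded a_def] by simp
  also have "\<dots> \<le> ennreal (1 / sqrt a) * (\<integral>\<^sup>+z. ennreal (2 * a) * (ennreal ((gk r z)\<^sup>2 * z\<^sup>2) + ennreal ((gk (r - eps) z)\<^sup>2 * z\<^sup>2)) \<partial>lborel)"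
  proof (intro mult_left_mono nn_integral_mono)
    fix z
    have "(gk r z - gk (r - eps) z)\<^sup>2 * (a * z\<^sup>2) \<le> (2 * (gk r z)\<^sup>2 + 2 * (gk (r - eps) z)\<^sup>2) * (a * z\<^sup>2)"
      using a by (intro mult_right_mono square_diff_le) auto
    also have "\<dots> = 2 * a * ((gk r z)\<^sup>2 * z\<^sup>2 + (gk (r - eps) z)\<^sup>2 * z\<^sup>2)" by (simp add: algebra_simps)
    finally show "ennreal ((gk r z - gk (r - eps) z)\<^sup>2 * (a * z\<^sup>2)) \<le> ennreal (2 * a) * (ennreal ((gk r z)\<^sup>2 * z\<^sup>2) + ennreal ((gk (r - eps) z)\<^sup>2 * z\<^sup>2))"
      using a by (simp add: ennreal_leI ennreal_mult[symmetric] ennreal_plus[symmetric] del: ennreal_plus)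
  qed auto
  also have "\<dots> = ennreal (1 / sqrt a) * (ennreal (2 * a) * ((\<integral>\<^sup>+z. ennreal ((gk r z)\<^sup>2 * z\<^sup>2) \<partial>lborel) + (\<integral>\<^sup>+z. ennreal ((gk (r - eps) z)\<^sup>2 * z\<^sup>2) \<partial>lborel)))"
    by (simp add: nn_integral_cmult nn_integral_add)
  also have "\<dots> \<le> ennreal (1 / sqrt a) * (ennreal (2 * a) * (ennreal (sqrt r) + ennreal (sqrt r)))"
    using assms by (intro mult_left_mono add_mono gk_second_moment order_trans[OF gk_second_moment]) (auto intro!: ennreal_leI)
  also have "\<dots> = ennreal (1 / sqrt a * (2 * a * (sqrt r + sqrt r)))"
    using a False by (simp add: ennreal_mult[symmetric] ennreal_plus[symmetric] del: ennreal_plus)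
  also have "1 / sqrt a * (2 * a * (sqrt r + sqrt r)) = 4 * sqrt a * sqrt r"
    using a by (simp add: field_simps real_div_sqrt)
  also have "ennreal (4 * sqrt a * sqrt r) \<le> ennreal (4 * sqrt amax * sqrt r)"
    using a False by (intro ennreal_leI mult_right_mono mult_left_mono) auto
  finally show ?thesis .
qed

end

section \<open>The mild solution\<close>

lemma nn_integral_time_reversal:
  fixes F :: "real \<Rightarrow> ennreal"
  assumes [measurable]: "F \<in> borel_measurable borel" and z: "\<And>r. r \<le> 0 \<Longrightarrow> F r = 0"
  shows "(\<integral>\<^sup>+s\<in>{0..}. F (t - s) \<partial>lborel) = (\<integral>\<^sup>+r\<in>{0..t}. F r \<partial>lborel)"
proof -
  have "(\<integral>\<^sup>+r\<in>{0..t}. F r \<partial>lborel) = (\<integral>\<^sup>+s. F (t + (-1) * s) * indicator {0..t} (t + (-1) * s) \<partial>lborel)"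
    by (subst nn_integral_real_affine[where c="-1" and t=t]) auto
  also have "\<dots> = (\<integral>\<^sup>+s\<in>{0..}. F (t - s) \<partial>lborel)"
    by (intro nn_integral_cong) (auto simp: indicator_def z)
  finally show ?thesis ..
qed

context white_noise
begin

lemma walsh_limit_cong:
  assumes X: "walsh_limit X I" and e: "\<And>s y w. 0 \<le> s \<Longrightarrow> X s y w = Y s y w"
  shows "walsh_limit Y I"
proof (rule walsh_limit_closure)
  have sp: "0 \<le> fst z" if "z \<in> space (field_measure M)" for z
    using that by (auto simp: field_measure_def space_pair_measure space_restrict_space)
  show "field_measurable Y"
    by (rule measurable_cong[THEN iffD1, OF _ walsh_limitD(1)[OF X]]) (use sp e in \<open>auto simp: case_prod_beta'\<close>)
  show "I \<in> borel_measurable M" by (rule walsh_limitD[OF X])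
  have "fsq (\<lambda>s y w. X s y w - Y s y w) = (\<integral>\<^sup>+z. 0 \<partial>field_measure M)"
    unfolding field_sq_norm_def by (rule nn_integral_cong) (use sp e in \<open>auto simp: case_prod_beta'\<close>)
  then show "\<exists>Z J. walsh_limit Z J \<and> fsq (\<lambda>s y w. Z s y w - Y s y w) \<le> ennreal d \<and> nnE (\<lambda>w. (J w - I w)\<^sup>2) \<le> ennreal d" for d
    using X by (intro exI[of _ X] exI[of _ I]) auto
qed

end

locale stochastic_heat = white_noise M W + layered_medium a1 a2 \<rho>1 \<rho>2
  for M :: "'a measure" and W :: "real \<Rightarrow> real set \<Rightarrow> 'a \<Rightarrow> real" and a1 a2 \<rho>1 \<rho>2 :: real +
  fixes K :: real and \<sigma> :: "real \<Rightarrow> real" and u :: "real \<Rightarrow> real \<Rightarrow> 'a \<Rightarrow> real"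
  assumes K: "0 < K" and Lip: "\<And>y z. \<bar>\<sigma> y - \<sigma> z\<bar> \<le> K * \<bar>y - z\<bar>"
    and mild: "mild_solution M W a1 a2 \<rho>1 \<rho>2 \<sigma> u"
begin

lemma \<sigma>_measurable [measurable]: "\<sigma> \<in> borel_measurable borel"
proof (rule borel_measurable_continuous_onI)
  have "K-lipschitz_on UNIV \<sigma>" using Lip K by (auto simp: lipschitz_on_def dist_real_def)
  then show "continuous_on UNIV \<sigma>" by (rule lipschitz_on_continuous_on)
qed

lemma u_adapted: "0 \<le> t \<Longrightarrow> u t x \<in> borel_measurable (\<F> t)"
  using mild by (auto simp: mild_solution_def)

lemma u_measurable: "0 \<le> t \<Longrightarrow> u t x \<in> borel_measurable M"
  using u_adapted filtration_measurable by blast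

lemma u_field_measurable: "field_measurable u"
  using mild by (auto simp: mild_solution_def)

lemma u_moment:
  assumes "0 < T" "2 \<le> p"
  shows "\<exists>C\<ge>0. \<forall>t x. 0 \<le> t \<longrightarrow> t \<le> T \<longrightarrow> nnE (\<lambda>w. \<bar>u t x w\<bar> powr p) \<le> ennreal C"
proof -
  define S where "S = (SUP (t, x)\<in>{0..T} \<times> UNIV. \<integral>\<^sup>+ w. ennreal (\<bar>u t x w\<bar> powr p) \<partial>M)"
  have "S < \<infinity>" using mild assms unfolding mild_solution_def S_def by blast
  then obtain C where C: "S = ennreal C" "0 \<le> C" by (cases S) auto
  have "nnE (\<lambda>w. \<bar>u t x w\<bar> powr p) \<le> S" if "0 \<le> t" "t \<le> T" for t x
    unfolding S_def by (rule SUP_upper2[of "(t, x)"]) (use that in auto)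
  then show ?thesis using C by auto
qed

lemma \<sigma>_power_bound: "\<bar>\<sigma> z\<bar> ^ n \<le> 2 ^ n * (\<bar>\<sigma> 0\<bar> ^ n + K ^ n * \<bar>z\<bar> ^ n)"
proof -
  have "\<bar>\<sigma> z\<bar> \<le> \<bar>\<sigma> 0\<bar> + K * \<bar>z\<bar>" using Lip[of z 0] by simp
  also have "\<dots> \<le> 2 * max \<bar>\<sigma> 0\<bar> (K * \<bar>z\<bar>)" by simp
  finally have "\<bar>\<sigma> z\<bar> ^ n \<le> (2 * max \<bar>\<sigma> 0\<bar> (K * \<bar>z\<bar>)) ^ n" by (intro power_mono) auto
  also have "\<dots> = 2 ^ n * (max \<bar>\<sigma> 0\<bar> (K * \<bar>z\<bar>)) ^ n" by (simp add: power_mult_distrib)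
  also have "(max \<bar>\<sigma> 0\<bar> (K * \<bar>z\<bar>)) ^ n \<le> \<bar>\<sigma> 0\<bar> ^ n + (K * \<bar>z\<bar>) ^ n"
    using K by (auto simp: max_def)
  finally show ?thesis by (simp add: power_mult_distrib)
qed

lemma \<sigma>_moment:
  assumes "0 < T" "2 \<le> n" "even n"
  shows "\<exists>C\<ge>0. \<forall>t x. 0 \<le> t \<longrightarrow> t \<le> T \<longrightarrow> nnE (\<lambda>w. \<sigma> (u t x w) ^ n) \<le> ennreal C"
proof -
  obtain C where C: "0 \<le> C" "\<And>t x. 0 \<le> t \<Longrightarrow> t \<le> T \<Longrightarrow> nnE (\<lambda>w. \<bar>u t x w\<bar> powr real n) \<le> ennreal C"
    using u_moment[of T "real n"] assms by auto
  have "nnE (\<lambda>w. \<sigma> (u t x w) ^ n) \<le> ennreal (2 ^ n * \<bar>\<sigma> 0\<bar> ^ n + 2 ^ n * K ^ n * C)" if t: "0 \<le> t" "t \<le> T" for t x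
  proof -
    note [measurable] = u_measurable[OF t(1), of x]
    have "nnE (\<lambda>w. \<sigma> (u t x w) ^ n) \<le> (\<integral>\<^sup>+w. ennreal (2 ^ n * \<bar>\<sigma> 0\<bar> ^ n) + ennreal (2 ^ n * K ^ n) * ennreal (\<bar>u t x w\<bar> powr real n) \<partial>M)"
    proof (rule nn_integral_mono)
      fix w
      have p: "\<bar>u t x w\<bar> powr real n = \<bar>u t x w\<bar> ^ n" using assms by (cases "u t x w = 0") (auto simp: powr_realpow)
      have "\<sigma> (u t x w) ^ n \<le> 2 ^ n * \<bar>\<sigma> 0\<bar> ^ n + 2 ^ n * K ^ n * \<bar>u t x w\<bar> powr real n"
        using \<sigma>_power_bound[of "u t x w" n] assms(3) unfolding p by (simp add: power_even_abs algebra_simps)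
      from ennreal_leI[OF this] show "ennreal (\<sigma> (u t x w) ^ n) \<le> ennreal (2 ^ n * \<bar>\<sigma> 0\<bar> ^ n) + ennreal (2 ^ n * K ^ n) * ennreal (\<bar>u t x w\<bar> powr real n)"
        using K by (simp add: ennreal_mult[symmetric] ennreal_plus[symmetric] del: ennreal_plus)
    qed
    also have "\<dots> = ennreal (2 ^ n * \<bar>\<sigma> 0\<bar> ^ n) + ennreal (2 ^ n * K ^ n) * nnE (\<lambda>w. \<bar>u t x w\<bar> powr real n)"
      by (simp add: nn_integral_add nn_integral_cmult emeasure_space_1)
    also have "\<dots> \<le> ennreal (2 ^ n * \<bar>\<sigma> 0\<bar> ^ n) + ennreal (2 ^ n * K ^ n) * ennreal C"
      by (intro add_left_mono mult_left_mono C t) auto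
    also have "\<dots> = ennreal (2 ^ n * \<bar>\<sigma> 0\<bar> ^ n + 2 ^ n * K ^ n * C)"
      using K C by (simp add: ennreal_mult[symmetric] ennreal_plus[symmetric] del: ennreal_plus)
    finally show ?thesis .
  qed
  then show ?thesis using K C by (intro exI[of _ "2 ^ n * \<bar>\<sigma> 0\<bar> ^ n + 2 ^ n * K ^ n * C"]) auto
qed

lemma nn_integral_imp_expectation:
  assumes [measurable]: "X \<in> borel_measurable M" and "\<And>w. 0 \<le> X w" and "nnE (\<lambda>w. X w) \<le> ennreal C" "0 \<le> C"
  shows "integrable M X" "expectation X \<le> C"
proof -
  show i: "integrable M X"
    using assms by (intro integrableI_nonneg) (auto intro: le_less_trans)
  have "ennreal (expectation X) \<le> ennreal C" using assms nn_integral_eq_integral[OF i] by simp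
  then show "expectation X \<le> C" using assms(4) by (subst (asm) ennreal_le_iff)
qed

text \<open>The indicator of \<open>{0..t}\<close> is redundant on nonnegative times since the
  kernel vanishes for \<open>t \<le> s\<close>. Without it, the formulas at two different times can
  be subtracted directly.\<close>

lemma u_walsh_limit:
  assumes "0 \<le> t"
  shows "walsh_limit (\<lambda>s y w. \<sigma> (u s y w) * G (t - s) x y) (u t x)"
proof -
  obtain I where I: "has_walsh_integral M W
          (\<lambda>s y w. indicator {0..t} s * (\<sigma> (u s y w) * G (t - s) x y)) I" "AE w in M. u t x w = I w"
    using mild assms unfolding mild_solution_def by blast
  have [measurable]: "(\<lambda>z. u (fst z) (fst (snd z)) (snd (snd z))) \<in> borel_measurable (field_measure M)"
    using u_field_measurable by (simp add: case_prod_beta')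
  have "field_measurable (\<lambda>s y w. indicator {0..t} s * (\<sigma> (u s y w) * G (t - s) x y))"
    unfolding case_prod_beta' by measurable
  then have "walsh_limit (\<lambda>s y w. indicator {0..t} s * (\<sigma> (u s y w) * G (t - s) x y)) (u t x)"
    by (intro walsh_limit_AE[OF has_walsh_integral_limit[OF I(1)] I(2)] u_measurable assms)
  then show ?thesis
    by (rule walsh_limit_cong) (auto simp: indicator_def heat_kernel_def)
qed

text \<open>The intermediate point is \<open>(\<tau>, x')\<close>: time changes at a fixed position,
  then the position at a fixed time. Reversing time turns both pieces into integrals over the age of
  the noise.\<close>

lemma heat_kernel_increment_integral:
  assumes \<tau>: "0 \<le> \<tau>" "\<tau> \<le> t" "t \<le> T" and \<rho>: "0 < \<rho>"
  shows "(\<integral>\<^sup>+s\<in>{0..}. (\<integral>\<^sup>+y. ennreal ((G (t - s) x' y - G (\<tau> - s) x y)\<^sup>2) \<partial>lborel) \<partial>lborel) \<le>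
    ennreal (2 * (C_diff * sqrt (t - \<tau>)) + 2 * (C_diff * (2 * \<rho> + (x' - x)\<^sup>2 / amin * sqrt T / \<rho>\<^sup>2)))"
proof -
  let ?A = "\<lambda>s. \<integral>\<^sup>+y. ennreal ((G (t - s) x' y - G (\<tau> - s) x' y)\<^sup>2) \<partial>lborel"
  let ?B = "\<lambda>s. \<integral>\<^sup>+y. ennreal ((G (\<tau> - s) x' y - G (\<tau> - s) x y)\<^sup>2) \<partial>lborel"
  have m: "?A \<in> borel_measurable borel" "?B \<in> borel_measurable borel" by measurable
  have A: "(\<integral>\<^sup>+s\<in>{0..}. ?A s \<partial>lborel) \<le> ennreal (C_diff * sqrt (t - \<tau>))"
  proof (cases "t = \<tau>")
    case False
    then have e: "0 < t - \<tau>" using \<tau> by simp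
    have "(\<integral>\<^sup>+s\<in>{0..}. (\<lambda>r. \<integral>\<^sup>+y. ennreal ((G r x' y - G (r - (t - \<tau>)) x' y)\<^sup>2) \<partial>lborel) (t - s) \<partial>lborel) =
       (\<integral>\<^sup>+r\<in>{0..t}. (\<integral>\<^sup>+y. ennreal ((G r x' y - G (r - (t - \<tau>)) x' y)\<^sup>2) \<partial>lborel) \<partial>lborel)"
      using e by (intro nn_integral_time_reversal) (measurable, auto simp: heat_kernel_def)
    also have "\<dots> \<le> ennreal (C_diff * sqrt (t - \<tau>))" by (rule heat_kernel_time_diff_total[OF e])
    finally show ?thesis by simp
  qed simp
  have B: "(\<integral>\<^sup>+s\<in>{0..}. ?B s \<partial>lborel) \<le> ennreal (C_diff * (2 * \<rho> + (x' - x)\<^sup>2 / amin * sqrt T / \<rho>\<^sup>2))"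
  proof -
    have "(\<integral>\<^sup>+s\<in>{0..}. (\<lambda>r. \<integral>\<^sup>+y. ennreal ((G r x' y - G r x y)\<^sup>2) \<partial>lborel) (\<tau> - s) \<partial>lborel) =
       (\<integral>\<^sup>+r\<in>{0..\<tau>}. (\<integral>\<^sup>+y. ennreal ((G r x' y - G r x y)\<^sup>2) \<partial>lborel) \<partial>lborel)"
      by (intro nn_integral_time_reversal) (measurable, auto simp: heat_kernel_def)
    also have "\<dots> \<le> ennreal (C_diff * (2 * \<rho> + (x' - x)\<^sup>2 / amin * sqrt \<tau> / \<rho>\<^sup>2))" by (rule heat_kernel_space_diff_total[OF \<rho> \<tau>(1)])
    also have "\<dots> \<le> ennreal (C_diff * (2 * \<rho> + (x' - x)\<^sup>2 / amin * sqrt T / \<rho>\<^sup>2))"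
      using C_diff_nonneg amin \<tau> by (intro ennreal_leI mult_left_mono add_left_mono divide_right_mono) auto
    finally show ?thesis by simp
  qed
  have "(\<integral>\<^sup>+s\<in>{0..}. (\<integral>\<^sup>+y. ennreal ((G (t - s) x' y - G (\<tau> - s) x y)\<^sup>2) \<partial>lborel) \<partial>lborel) \<le> (\<integral>\<^sup>+s. 2 * (?A s * indicator {0..} s) + 2 * (?B s * indicator {0..} s) \<partial>lborel)"
  proof (rule nn_integral_mono)
    fix s
    have "(\<integral>\<^sup>+y. ennreal ((G (t - s) x' y - G (\<tau> - s) x y)\<^sup>2) \<partial>lborel) \<le> 2 * ?A s + 2 * ?B s"
      using nn_integral_sq_add[of "\<lambda>y. G (t - s) x' y - G (\<tau> - s) x' y" lborel "\<lambda>y. G (\<tau> - s) x' y - G (\<tau> - s) x y"] by simp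
    then show "(\<integral>\<^sup>+y. ennreal ((G (t - s) x' y - G (\<tau> - s) x y)\<^sup>2) \<partial>lborel) * indicator {0..} s \<le> 2 * (?A s * indicator {0..} s) + 2 * (?B s * indicator {0..} s)"
      by (auto simp: indicator_def)
  qed
  also have "\<dots> = 2 * (\<integral>\<^sup>+s\<in>{0..}. ?A s \<partial>lborel) + 2 * (\<integral>\<^sup>+s\<in>{0..}. ?B s \<partial>lborel)"
    using m by (simp add: nn_integral_add nn_integral_cmult)
  also have "\<dots> \<le> 2 * ennreal (C_diff * sqrt (t - \<tau>)) + 2 * ennreal (C_diff * (2 * \<rho> + (x' - x)\<^sup>2 / amin * sqrt T / \<rho>\<^sup>2))"
    by (intro add_mono mult_left_mono A B) auto
  also have "\<dots> = ennreal (2 * (C_diff * sqrt (t - \<tau>)) + 2 * (C_diff * (2 * \<rho> + (x' - x)\<^sup>2 / amin * sqrt T / \<rho>\<^sup>2)))"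
    using C_diff_nonneg amin \<tau> \<rho> by (intro ennreal_two_sum) auto
  finally show ?thesis .
qed

text \<open>The difference of two mild formulas is one Walsh integral of
  \<open>\<sigma> (u s y)\<close> times a deterministic kernel increment. Fourth moments of the
  coefficient are bounded uniformly up to \<open>T\<close>, so \<open>sqrt C4\<close> times the
  squared increment dominates and the solution inherits the modulus of the kernel.\<close>

lemma u_modulus:
  assumes "0 < T"
  shows "\<exists>C\<ge>0. \<forall>\<tau> t x x' \<rho>. 0 \<le> \<tau> \<longrightarrow> \<tau> \<le> t \<longrightarrow> t \<le> T \<longrightarrow> 0 < \<rho> \<longrightarrow>
    nnE (\<lambda>w. (u t x' w - u \<tau> x w) ^ 4) \<le> ennreal (C * (sqrt (t - \<tau>) + \<rho> + (x' - x)\<^sup>2 / \<rho>\<^sup>2)\<^sup>2)"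
proof -
  obtain C4 where C4: "0 \<le> C4" "\<And>t x. 0 \<le> t \<Longrightarrow> t \<le> T \<Longrightarrow> nnE (\<lambda>w. \<sigma> (u t x w) ^ 4) \<le> ennreal C4"
    using \<sigma>_moment[OF assms, of 4] by auto
  \<comment> \<open>The 4 is the coefficient of \<rho> in the kernel estimate, the other summand
    that of the squared distance over \<open>\<rho>\<^sup>2\<close>; their sum serves for all three
    terms.\<close>
  define B where "B = C_diff * (4 + 2 / amin * sqrt T)"
  have B0: "0 \<le> B" unfolding B_def using C_diff_nonneg amin assms by (intro mult_nonneg_nonneg) auto
  have "nnE (\<lambda>w. (u t x' w - u \<tau> x w) ^ 4) \<le> ennreal (9 * C4 * B\<^sup>2 * (sqrt (t - \<tau>) + \<rho> + (x' - x)\<^sup>2 / \<rho>\<^sup>2)\<^sup>2)"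
    if \<tau>: "0 \<le> \<tau>" "\<tau> \<le> t" "t \<le> T" and \<rho>: "0 < \<rho>" for \<tau> t x x' \<rho>
  proof -
    let ?D = "\<lambda>s y. G (t - s) x' y - G (\<tau> - s) x y"
    define Q where "Q = sqrt (t - \<tau>) + \<rho> + (x' - x)\<^sup>2 / \<rho>\<^sup>2"
    have Q0: "0 \<le> Q" unfolding Q_def using \<tau> \<rho> by (intro add_nonneg_nonneg) auto
    have W: "walsh_limit (\<lambda>s y w. \<sigma> (u s y w) * ?D s y) (\<lambda>w. u t x' w - u \<tau> x w)"
      using walsh_limit_diff[OF u_walsh_limit[of t x'] u_walsh_limit[of \<tau> x]] \<tau> by (simp add: right_diff_distrib)
    have "nnE (\<lambda>w. (u t x' w - u \<tau> x w) ^ 4) \<le> ennreal (9 * (sqrt C4 * (B * Q))\<^sup>2)"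
    proof (rule walsh_fourth_moment[OF W, where h="\<lambda>s y. sqrt C4 * (?D s y)\<^sup>2"])
      show "(\<lambda>(s, y). sqrt C4 * (?D s y)\<^sup>2) \<in> borel_measurable (borel \<Otimes>\<^sub>M borel)" by measurable
      show "0 \<le> sqrt C4 * (?D s y)\<^sup>2" for s y using C4(1) by simp
      show "0 \<le> sqrt C4 * (B * Q)" using C4(1) B0 Q0 by simp
      fix s y :: real assume s: "0 \<le> s"
      show "nnE (\<lambda>w. (\<sigma> (u s y w) * ?D s y) ^ 4) \<le> ennreal ((sqrt C4 * (?D s y)\<^sup>2)\<^sup>2)"
      proof (cases "s \<le> T")
        case True
        note [measurable] = u_measurable[OF s, of y]
        have "nnE (\<lambda>w. (\<sigma> (u s y w) * ?D s y) ^ 4) = ennreal ((?D s y) ^ 4) * nnE (\<lambda>w. \<sigma> (u s y w) ^ 4)"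
          by (subst nn_integral_cmult[symmetric]) (auto simp: power_mult_distrib ennreal_mult[symmetric] mult.commute)
        also have "\<dots> \<le> ennreal ((?D s y) ^ 4) * ennreal C4" by (intro mult_left_mono C4 s True) auto
        also have "\<dots> = ennreal ((sqrt C4 * (?D s y)\<^sup>2)\<^sup>2)"
          using C4(1) by (subst ennreal_mult[symmetric]) (auto simp: power_mult_distrib mult.commute)
        finally show ?thesis .
      next
        case False
        then show ?thesis using \<tau> by (simp add: heat_kernel_def)
      qed
    next
      have "(\<integral>\<^sup>+s\<in>{0..}. (\<integral>\<^sup>+y. ennreal (sqrt C4 * (?D s y)\<^sup>2) \<partial>lborel) \<partial>lborel) =
         (\<integral>\<^sup>+s. ennreal (sqrt C4) * ((\<integral>\<^sup>+y. ennreal ((?D s y)\<^sup>2) \<partial>lborel) * indicator {0..} s) \<partial>lborel)"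
        using C4(1) by (intro nn_integral_cong) (simp add: ennreal_mult nn_integral_cmult indicator_def)
      also have "\<dots> = ennreal (sqrt C4) * (\<integral>\<^sup>+s\<in>{0..}. (\<integral>\<^sup>+y. ennreal ((?D s y)\<^sup>2) \<partial>lborel) \<partial>lborel)"
        by (rule nn_integral_cmult) measurable
      also have "\<dots> \<le> ennreal (sqrt C4) * ennreal (2 * (C_diff * sqrt (t - \<tau>)) + 2 * (C_diff * (2 * \<rho> + (x' - x)\<^sup>2 / amin * sqrt T / \<rho>\<^sup>2)))"
        by (intro mult_left_mono heat_kernel_increment_integral \<tau> \<rho>) auto
      also have "\<dots> \<le> ennreal (sqrt C4) * ennreal (B * Q)"
      proof (intro mult_left_mono ennreal_leI)
        define d where "d = (x' - x)\<^sup>2 / \<rho>\<^sup>2"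
        define m where "m = sqrt T / amin"
        have p: "0 \<le> d" "0 \<le> m" "0 \<le> sqrt (t - \<tau>)" using amin assms \<tau> by (auto simp: d_def m_def)
        have "2 * sqrt (t - \<tau>) + 2 * (2 * \<rho> + m * d) \<le> (4 + 2 * m) * (sqrt (t - \<tau>) + \<rho> + d)"
          using p \<rho> mult_nonneg_nonneg[of m "sqrt (t - \<tau>) + \<rho>"] by (simp add: algebra_simps)
        from mult_left_mono[OF this C_diff_nonneg]
        show "2 * (C_diff * sqrt (t - \<tau>)) + 2 * (C_diff * (2 * \<rho> + (x' - x)\<^sup>2 / amin * sqrt T / \<rho>\<^sup>2)) \<le> B * Q"
          by (simp add: B_def Q_def d_def m_def algebra_simps)
      qed auto
      also have "\<dots> = ennreal (sqrt C4 * (B * Q))" using B0 Q0 C4(1) by (intro ennreal_mult[symmetric]) auto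
      finally show "(\<integral>\<^sup>+s\<in>{0..}. (\<integral>\<^sup>+y. ennreal (sqrt C4 * (?D s y)\<^sup>2) \<partial>lborel) \<partial>lborel) \<le> ennreal (sqrt C4 * (B * Q))" .
    qed
    also have "9 * (sqrt C4 * (B * Q))\<^sup>2 = 9 * C4 * B\<^sup>2 * Q\<^sup>2" using C4(1) by (simp add: power_mult_distrib)
    finally show ?thesis unfolding Q_def .
  qed
  then show ?thesis using C4(1) by (intro exI[of _ "9 * C4 * B\<^sup>2"]) auto
qed

lemma \<sigma>_modulus:
  assumes "0 < T"
  shows "\<exists>C\<ge>0. \<forall>\<tau> t x x' \<rho>. 0 \<le> \<tau> \<longrightarrow> \<tau> \<le> t \<longrightarrow> t \<le> T \<longrightarrow> 0 < \<rho> \<longrightarrow>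
    nnE (\<lambda>w. (\<sigma> (u t x' w) - \<sigma> (u \<tau> x w)) ^ 4) \<le> ennreal ((C * (sqrt (t - \<tau>) + \<rho> + (x' - x)\<^sup>2 / \<rho>\<^sup>2))\<^sup>2)"
proof -
  obtain C where C: "0 \<le> C" and b: "\<And>\<tau> t x x' \<rho>. 0 \<le> \<tau> \<Longrightarrow> \<tau> \<le> t \<Longrightarrow> t \<le> T \<Longrightarrow> 0 < \<rho> \<Longrightarrow>
    nnE (\<lambda>w. (u t x' w - u \<tau> x w) ^ 4) \<le> ennreal (C * (sqrt (t - \<tau>) + \<rho> + (x' - x)\<^sup>2 / \<rho>\<^sup>2)\<^sup>2)"
    using u_modulus[OF assms] by auto
  have "nnE (\<lambda>w. (\<sigma> (u t x' w) - \<sigma> (u \<tau> x w)) ^ 4) \<le> ennreal ((K\<^sup>2 * sqrt C * (sqrt (t - \<tau>) + \<rho> + (x' - x)\<^sup>2 / \<rho>\<^sup>2))\<^sup>2)"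
    if \<tau>: "0 \<le> \<tau>" "\<tau> \<le> t" "t \<le> T" and \<rho>: "0 < \<rho>" for \<tau> t x x' \<rho>
  proof -
    have [measurable]: "u t x' \<in> borel_measurable M" "u \<tau> x \<in> borel_measurable M"
      using \<tau> by (auto intro: u_measurable)
    have "nnE (\<lambda>w. (\<sigma> (u t x' w) - \<sigma> (u \<tau> x w)) ^ 4) \<le> (\<integral>\<^sup>+w. ennreal (K ^ 4) * ennreal ((u t x' w - u \<tau> x w) ^ 4) \<partial>M)"
    proof (rule nn_integral_mono)
      fix w
      have "\<bar>\<sigma> (u t x' w) - \<sigma> (u \<tau> x w)\<bar> ^ 4 \<le> (K * \<bar>u t x' w - u \<tau> x w\<bar>) ^ 4" by (intro power_mono Lip) auto
      then have "(\<sigma> (u t x' w) - \<sigma> (u \<tau> x w)) ^ 4 \<le> K ^ 4 * (u t x' w - u \<tau> x w) ^ 4"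
        by (simp add: power_mult_distrib)
      then show "ennreal ((\<sigma> (u t x' w) - \<sigma> (u \<tau> x w)) ^ 4) \<le> ennreal (K ^ 4) * ennreal ((u t x' w - u \<tau> x w) ^ 4)"
        by (simp add: ennreal_mult[symmetric] ennreal_leI)
    qed
    also have "\<dots> = ennreal (K ^ 4) * nnE (\<lambda>w. (u t x' w - u \<tau> x w) ^ 4)"
      by (rule nn_integral_cmult) auto
    also have "\<dots> \<le> ennreal (K ^ 4) * ennreal (C * (sqrt (t - \<tau>) + \<rho> + (x' - x)\<^sup>2 / \<rho>\<^sup>2)\<^sup>2)"
      by (intro mult_left_mono b \<tau> \<rho>) auto
    also have "\<dots> = ennreal ((K\<^sup>2 * sqrt C * (sqrt (t - \<tau>) + \<rho> + (x' - x)\<^sup>2 / \<rho>\<^sup>2))\<^sup>2)"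
      using C by (subst ennreal_mult[symmetric]) (auto simp: power_mult_distrib)
    finally show ?thesis .
  qed
  then show ?thesis using C by (intro exI[of _ "K\<^sup>2 * sqrt C"]) auto
qed

end

section \<open>Gaussian approximation of a single time increment\<close>

definition lag_defect :: "real \<Rightarrow> real" where
  "lag_defect L = 2 * sqrt (L - 1 / 2) - sqrt L - sqrt (L - 1)"

text \<open>Scaling: the energy of ages beyond \<open>L * eps\<close> is \<open>sqrt eps\<close>
  times a function of \<open>L\<close> alone, so the relative loss caused by a finite window does
  not depend on the time step.\<close>

lemma energy_primitive_lag:
  assumes "0 < eps" "1 \<le> L"
  shows "energy_primitive eps (L * eps) = - (sqrt eps / sqrt pi * lag_defect L)"
proof -
  have e: "L * eps - eps = (L - 1) * eps" "L * eps - eps / 2 = (L - 1 / 2) * eps" by (simp_all add: algebra_simps)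
  have r: "sqrt (L * eps) = sqrt L * sqrt eps" "sqrt (L * eps - eps) = sqrt (L - 1) * sqrt eps" "sqrt (L * eps - eps / 2) = sqrt (L - 1 / 2) * sqrt eps"
    unfolding e by (simp_all add: real_sqrt_mult)
  show ?thesis
    unfolding energy_primitive_def lag_defect_def r by (simp add: field_simps)
qed

lemma lag_defect_nonneg:
  assumes "1 \<le> L"
  shows "0 \<le> lag_defect L"
proof -
  have "- (1 / sqrt pi * lag_defect L) \<le> 0"
    using energy_primitive_lag[of 1 L] energy_primitive_nonpos[of 1 L] assms by simp
  then show ?thesis using pi_gt_zero by (simp add: zero_le_divide_iff del: pi_gt_zero)
qed

lemma lag_defect_tendsto: "(lag_defect \<longlongrightarrow> 0) at_top"
  unfolding lag_defect_def by real_asymp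

lemma nn_integral_time_window:
  fixes F :: "real \<Rightarrow> ennreal"
  assumes [measurable]: "F \<in> borel_measurable borel" and z: "\<And>r. r \<le> 0 \<Longrightarrow> F r = 0"
  shows "(\<integral>\<^sup>+s. F (t - s) * indicator {\<tau><..} s \<partial>lborel) = (\<integral>\<^sup>+r\<in>{0..t - \<tau>}. F r \<partial>lborel)"
proof -
  \<comment> \<open>The age \<open>t - \<tau>\<close> belongs to the time \<open>\<tau>\<close>,
    which the half-open window omits.\<close>
  have "AE r in lborel. r \<noteq> t - \<tau>" by (rule AE_lborel_singleton)
  then have "AE r in lborel. F r * indicator {0..t - \<tau>} r = F r * indicator {..<t - \<tau>} r"
    by eventually_elim (auto simp: indicator_def z)
  then have "(\<integral>\<^sup>+r\<in>{0..t - \<tau>}. F r \<partial>lborel) = (\<integral>\<^sup>+r\<in>{..<t - \<tau>}. F r \<partial>lborel)"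
    by (rule nn_integral_cong_AE)
  also have "\<dots> = (\<integral>\<^sup>+s. F (t + (-1) * s) * indicator {..<t - \<tau>} (t + (-1) * s) \<partial>lborel)"
    by (subst nn_integral_real_affine[where c="-1" and t=t]) auto
  also have "\<dots> = (\<integral>\<^sup>+s. F (t - s) * indicator {\<tau><..} s \<partial>lborel)"
    by (intro nn_integral_cong) (auto simp: indicator_def)
  finally show ?thesis ..
qed

lemma nn_integral_sqrt_window:
  assumes "0 \<le> c" "0 \<le> q"
  shows "(\<integral>\<^sup>+r\<in>{0..q}. ennreal (c * sqrt r) \<partial>lborel) \<le> ennreal (c * (q * sqrt q))"
proof -
  have "(\<integral>\<^sup>+r\<in>{0..q}. ennreal (c * sqrt r) \<partial>lborel) \<le> (\<integral>\<^sup>+r. ennreal (c * sqrt q) * indicator {0..q} r \<partial>lborel)"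
    using assms by (intro nn_integral_mono) (auto simp: indicator_def intro!: ennreal_leI mult_left_mono)
  also have "\<dots> = ennreal (c * sqrt q) * ennreal q" using assms by (simp add: nn_integral_cmult_indicator)
  also have "\<dots> = ennreal (c * (q * sqrt q))" using assms by (simp add: ennreal_mult[symmetric] mult_ac)
  finally show ?thesis .
qed

text \<open>The parameter \<eta> allows norms of two nearby functions to be compared with a relative
  error; the factor 2 of the plain inequality would destroy the limiting constant.\<close>

lemma nn_integral_sq_weighted:
  fixes f g :: "'b \<Rightarrow> real"
  assumes [measurable]: "f \<in> borel_measurable N" "g \<in> borel_measurable N" and \<eta>: "0 < \<eta>"
  shows "(\<integral>\<^sup>+x. ennreal ((f x + g x)\<^sup>2) \<partial>N) \<le>
    ennreal (1 + \<eta>) * (\<integral>\<^sup>+x. ennreal ((f x)\<^sup>2) \<partial>N) + ennreal (1 + 1 / \<eta>) * (\<integral>\<^sup>+x. ennreal ((g x)\<^sup>2) \<partial>N)"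
proof -
  have conv: "(x + y)\<^sup>2 \<le> (1 + \<eta>) * x\<^sup>2 + (1 + 1 / \<eta>) * y\<^sup>2" for x y :: real
  proof -
    have "0 \<le> (\<eta> * x - y)\<^sup>2 / \<eta>" using \<eta> by simp
    also have "\<dots> = \<eta> * x\<^sup>2 + y\<^sup>2 / \<eta> - 2 * x * y"
      using \<eta> by (simp add: field_simps power2_eq_square)
    finally show ?thesis by (simp add: power2_sum algebra_simps)
  qed
  have "(\<integral>\<^sup>+x. ennreal ((f x + g x)\<^sup>2) \<partial>N) \<le> (\<integral>\<^sup>+x. ennreal (1 + \<eta>) * ennreal ((f x)\<^sup>2) + ennreal (1 + 1 / \<eta>) * ennreal ((g x)\<^sup>2) \<partial>N)"
  proof (rule nn_integral_mono)
    fix x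
    show "ennreal ((f x + g x)\<^sup>2) \<le> ennreal (1 + \<eta>) * ennreal ((f x)\<^sup>2) + ennreal (1 + 1 / \<eta>) * ennreal ((g x)\<^sup>2)"
      using ennreal_leI[OF conv[of "f x" "g x"]] \<eta> by (subst ennreal_linear) auto
  qed
  then show ?thesis by (simp add: nn_integral_add nn_integral_cmult)
qed

lemma fourth_power_sum3: "(a + b + c) ^ 4 \<le> 27 * (a ^ 4 + b ^ 4 + (c::real) ^ 4)"
proof -
  have s: "(a + b + c)\<^sup>2 \<le> 3 * (a\<^sup>2 + b\<^sup>2 + c\<^sup>2)" for a b c :: real
    using zero_le_power2[of "a - b"] zero_le_power2[of "b - c"] zero_le_power2[of "a - c"]
    by (simp add: power2_eq_square algebra_simps)
  have "(a + b + c) ^ 4 = ((a + b + c)\<^sup>2)\<^sup>2" by (simp flip: power_mult)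
  also have "\<dots> \<le> (3 * (a\<^sup>2 + b\<^sup>2 + c\<^sup>2))\<^sup>2" by (intro power_mono s) auto
  also have "\<dots> = 9 * (a\<^sup>2 + b\<^sup>2 + c\<^sup>2)\<^sup>2" unfolding power_mult_distrib by simp
  also have "\<dots> \<le> 9 * (3 * ((a\<^sup>2)\<^sup>2 + (b\<^sup>2)\<^sup>2 + (c\<^sup>2)\<^sup>2))" by (intro mult_left_mono s) auto
  finally show ?thesis by (simp flip: power_mult)
qed

lemma plane_iterated:
  fixes f :: "real \<times> real \<Rightarrow> ennreal"
  assumes "f \<in> borel_measurable (borel \<Otimes>\<^sub>M borel)"
  shows "(\<integral>\<^sup>+z. f z \<partial>plane) = (\<integral>\<^sup>+s. (\<integral>\<^sup>+y. f (s, y) \<partial>lborel) \<partial>lborel)"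
proof -
  have "f \<in> borel_measurable plane" using assms by (simp cong: measurable_cong_sets)
  then show ?thesis by (rule lborel.nn_integral_fst[symmetric])
qed

context layered_medium
begin

text \<open>\<open>\<kappa>0 x * sqrt eps\<close> is the variance of an increment over time \<open>eps\<close> of the linear equation in the
  homogeneous medium, started in the infinite past; the part of it that stems from noise older than
  \<open>L * eps\<close> is proportional to \<open>lag_defect L\<close>.\<close>

definition "\<kappa>0 x = sqrt 2 / (sqrt pi * sqrt (coeff_A a1 a2 x))"

definition near_increment :: "real \<Rightarrow> real \<Rightarrow> real \<Rightarrow> real \<Rightarrow> real \<times> real \<Rightarrow> real" where
  "near_increment t \<tau> eps x = (\<lambda>(s, y). (near_kernel (t - s) x y - near_kernel (t - eps - s) x y) * indicator {\<tau><..} s)"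

lemma \<kappa>0_pos: "0 < \<kappa>0 x"
  using coeff_A(1)[of x] by (simp add: \<kappa>0_def)

lemma near_increment_measurable [measurable]: "near_increment t \<tau> eps x \<in> borel_measurable (borel \<Otimes>\<^sub>M borel)"
  unfolding near_increment_def case_prod_beta' by measurable

lemma near_increment_sq:
  assumes "0 < eps" "1 \<le> L"
  shows "(\<integral>\<^sup>+z. ennreal ((near_increment t (t - L * eps) eps x z)\<^sup>2) \<partial>plane) =
    ennreal (\<kappa>0 x * sqrt eps - sqrt eps * lag_defect L / (sqrt pi * sqrt (coeff_A a1 a2 x)))" (is "?S1")
    and "0 \<le> \<kappa>0 x * sqrt eps - sqrt eps * lag_defect L / (sqrt pi * sqrt (coeff_A a1 a2 x))" (is "?S2")
proof -
  define a where "a = sqrt (coeff_A a1 a2 x)"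
  have a: "0 < a" using coeff_A(1)[of x] by (simp add: a_def)
  have Le: "eps \<le> L * eps" using assms by simp
  have e: "sqrt 2 * sqrt eps / sqrt pi + energy_primitive eps (L * eps) = a * (\<kappa>0 x * sqrt eps - sqrt eps * lag_defect L / (sqrt pi * a))"
    unfolding energy_primitive_lag[OF assms] \<kappa>0_def a_def[symmetric] using a by (simp add: field_simps)
  have "0 \<le> a * (\<kappa>0 x * sqrt eps - sqrt eps * lag_defect L / (sqrt pi * a))"
    using gk_energy_integral(2)[OF assms(1) Le] unfolding e .
  then show n: ?S2
    using a by (simp add: zero_le_mult_iff a_def)
  have ar: "t - eps - s = t - s - eps" for s by simp
  have "(\<integral>\<^sup>+z. ennreal ((near_increment t (t - L * eps) eps x z)\<^sup>2) \<partial>plane) =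
     (\<integral>\<^sup>+s. (\<integral>\<^sup>+y. ennreal ((near_kernel (t - s) x y - near_kernel (t - eps - s) x y)\<^sup>2) \<partial>lborel) * indicator {t - L * eps<..} s \<partial>lborel)"
    by (subst plane_iterated) (measurable, auto intro!: nn_integral_cong simp: near_increment_def indicator_def)
  also have "\<dots> = (\<integral>\<^sup>+s. (\<lambda>r. ennreal (gk_energy eps r / a)) (t - s) * indicator {t - L * eps<..} s \<partial>lborel)"
    unfolding ar near_kernel_energy[OF assms(1)] a_def ..
  also have "\<dots> = (\<integral>\<^sup>+r\<in>{0..t - (t - L * eps)}. ennreal (gk_energy eps r / a) \<partial>lborel)"
    by (rule nn_integral_time_window) (measurable, simp add: gk_energy_def)
  also have "\<dots> = (\<integral>\<^sup>+r. ennreal (1 / a) * (ennreal (gk_energy eps r) * indicator {0..L * eps} r) \<partial>lborel)"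
    using a gk_energy(2)[OF assms(1)] by (intro nn_integral_cong) (auto simp: indicator_def ennreal_mult[symmetric])
  also have "\<dots> = ennreal (1 / a) * (\<integral>\<^sup>+r\<in>{0..L * eps}. ennreal (gk_energy eps r) \<partial>lborel)"
    by (rule nn_integral_cmult) measurable
  also have "\<dots> = ennreal (1 / a * (a * (\<kappa>0 x * sqrt eps - sqrt eps * lag_defect L / (sqrt pi * a))))"
    unfolding gk_energy_integral(1)[OF assms(1) Le] e using a by (intro ennreal_mult'[symmetric]) auto
  finally show ?S1
    using a by (simp add: a_def)
qed

lemma near_increment_second_moment:
  assumes "0 < eps" "1 \<le> L"
  shows "(\<integral>\<^sup>+z. ennreal ((near_increment t (t - L * eps) eps x z)\<^sup>2 * (snd z - x)\<^sup>2) \<partial>plane) \<le> ennreal (4 * sqrt amax * (L * eps * sqrt (L * eps)))"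
proof -
  have ar: "t - eps - s = t - s - eps" for s by simp
  have "(\<integral>\<^sup>+z. ennreal ((near_increment t (t - L * eps) eps x z)\<^sup>2 * (snd z - x)\<^sup>2) \<partial>plane) =
     (\<integral>\<^sup>+s. (\<integral>\<^sup>+y. ennreal ((near_kernel (t - s) x y - near_kernel (t - eps - s) x y)\<^sup>2 * (y - x)\<^sup>2) \<partial>lborel) * indicator {t - L * eps<..} s \<partial>lborel)"
    by (subst plane_iterated) (measurable, auto intro!: nn_integral_cong simp: near_increment_def indicator_def)
  also have "\<dots> \<le> (\<integral>\<^sup>+s. (\<lambda>r. ennreal (4 * sqrt amax * sqrt r)) (t - s) * indicator {t - L * eps<..} s \<partial>lborel)"
    unfolding ar by (intro nn_integral_mono mult_right_mono near_kernel_second_moment assms) auto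
  also have "\<dots> = (\<integral>\<^sup>+r\<in>{0..t - (t - L * eps)}. ennreal (4 * sqrt amax * sqrt r) \<partial>lborel)"
    using amax by (intro nn_integral_time_window) (measurable, auto simp: ennreal_neg mult_nonneg_nonpos)
  also have "\<dots> \<le> ennreal (4 * sqrt amax * (L * eps * sqrt (L * eps)))"
    using nn_integral_sqrt_window[of "4 * sqrt amax" "L * eps"] assms amax by simp
  finally show ?thesis .
qed

text \<open>For fixed \<open>L\<close> the bound is of order \<open>eps * sqrt eps\<close>,
  negligible against the order \<open>sqrt eps\<close> of the variance of an increment.\<close>

lemma near_increment_error:
  assumes "0 < eps" "1 \<le> L" "x \<noteq> 0"
  shows "(\<integral>\<^sup>+z. ennreal ((G (t - fst z) x (snd z) - G (t - eps - fst z) x (snd z) - near_increment t (t - L * eps) eps x z)\<^sup>2 * indicator {t - L * eps<..} (fst z)) \<partial>plane)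
    \<le> ennreal (C_err x * (L * eps * sqrt (L * eps)))"
proof -
  have ar: "t - eps - s = t - s - eps" for s by simp
  have "(\<integral>\<^sup>+z. ennreal ((G (t - fst z) x (snd z) - G (t - eps - fst z) x (snd z) - near_increment t (t - L * eps) eps x z)\<^sup>2 * indicator {t - L * eps<..} (fst z)) \<partial>plane) =
     (\<integral>\<^sup>+s. (\<integral>\<^sup>+y. ennreal (((G (t - s) x y - G (t - eps - s) x y) - (near_kernel (t - s) x y - near_kernel (t - eps - s) x y))\<^sup>2) \<partial>lborel) * indicator {t - L * eps<..} s \<partial>lborel)"
    by (subst plane_iterated) (measurable, auto intro!: nn_integral_cong simp: near_increment_def indicator_def)
  also have "\<dots> \<le> (\<integral>\<^sup>+s. (\<lambda>r. ennreal (C_err x * sqrt r)) (t - s) * indicator {t - L * eps<..} s \<partial>lborel)"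
    unfolding ar by (intro nn_integral_mono mult_right_mono heat_kernel_near_diff assms) auto
  also have "\<dots> = (\<integral>\<^sup>+r\<in>{0..t - (t - L * eps)}. ennreal (C_err x * sqrt r) \<partial>lborel)"
    using C_nonneg(3)[of x] by (intro nn_integral_time_window) (measurable, auto simp: ennreal_neg mult_nonneg_nonpos)
  also have "\<dots> \<le> ennreal (C_err x * (L * eps * sqrt (L * eps)))"
    using nn_integral_sqrt_window[of "C_err x" "L * eps"] assms C_nonneg(3)[of x] by simp
  finally show ?thesis .
qed

text \<open>The ages between \<open>L * eps\<close> and \<open>t\<close> give a difference of the
  primitive. Its value at \<open>t\<close> has a favourable sign and is dropped, which leaves the
  defect; the factor \<open>1 / sqrt pi\<close> is given away.\<close>

lemma remote_increment:
  assumes "0 < eps" "1 \<le> L" "L * eps \<le> t"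
  shows "(\<integral>\<^sup>+z. ennreal ((G (t - fst z) x (snd z) - G (t - eps - fst z) x (snd z))\<^sup>2 * indicator {0..t - L * eps} (fst z)) \<partial>plane)
    \<le> ennreal (C_diff * (sqrt eps * lag_defect L))"
proof -
  have ar: "t - eps - s = t - s - eps" for s by simp
  have Le: "eps \<le> L * eps" using assms by simp
  have "(\<integral>\<^sup>+z. ennreal ((G (t - fst z) x (snd z) - G (t - eps - fst z) x (snd z))\<^sup>2 * indicator {0..t - L * eps} (fst z)) \<partial>plane) =
     (\<integral>\<^sup>+s. (\<integral>\<^sup>+y. ennreal ((G (t - s) x y - G (t - eps - s) x y)\<^sup>2) \<partial>lborel) * indicator {0..t - L * eps} s \<partial>lborel)"
    by (subst plane_iterated) (measurable, auto intro!: nn_integral_cong simp: indicator_def)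
  also have "\<dots> \<le> (\<integral>\<^sup>+s. ennreal (C_diff * gk_energy eps (t - s)) * indicator {0..t - L * eps} s \<partial>lborel)"
    unfolding ar by (intro nn_integral_mono mult_right_mono heat_kernel_time_diff assms) auto
  also have "\<dots> = (\<integral>\<^sup>+r. ennreal C_diff * (ennreal (gk_energy eps r) * indicator {L * eps..t} r) \<partial>lborel)"
    using C_diff_nonneg gk_energy(2)[OF assms(1)]
    by (subst (2) nn_integral_real_affine[where c="-1" and t=t]) (auto intro!: nn_integral_cong simp: indicator_def ennreal_mult)
  also have "\<dots> = ennreal C_diff * (\<integral>\<^sup>+r\<in>{L * eps..t}. ennreal (gk_energy eps r) \<partial>lborel)"
    by (rule nn_integral_cmult) measurable
  also have "\<dots> = ennreal C_diff * ennreal (energy_primitive eps t - energy_primitive eps (L * eps))"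
    unfolding gk_energy_integral_late[OF assms(1) Le assms(3)] ..
  also have "\<dots> \<le> ennreal C_diff * ennreal (sqrt eps * lag_defect L)"
  proof (intro mult_left_mono ennreal_leI)
    have "energy_primitive eps t \<le> 0" using energy_primitive_nonpos[OF assms(1) order_trans[OF Le assms(3)]] .
    moreover have "sqrt eps / sqrt pi * lag_defect L \<le> sqrt eps * lag_defect L"
    proof (intro mult_right_mono lag_defect_nonneg assms)
      show "sqrt eps / sqrt pi \<le> sqrt eps" using pi_ge_two assms by (simp add: pos_divide_le_eq)
    qed
    ultimately show "energy_primitive eps t - energy_primitive eps (L * eps) \<le> sqrt eps * lag_defect L"
      unfolding energy_primitive_lag[OF assms(1,2)] by linarith
  qed auto
  also have "\<dots> = ennreal (C_diff * (sqrt eps * lag_defect L))"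
    using C_diff_nonneg assms lag_defect_nonneg by (intro ennreal_mult[symmetric]) auto
  finally show ?thesis .
qed

end

context stochastic_heat
begin

text \<open>The weighted inequality with parameter \<delta> is applied in both directions. An
  approximation error of \<open>\<delta>\<^sup>2 * sqrt eps\<close> then costs a multiple
  \<open>(1 + 1 / \<delta>) * \<delta>\<^sup>2 \<le> 2 * \<delta>\<close> of
  \<open>sqrt eps\<close>, and the finite window costs the defect.\<close>

lemma increment_variance:
  assumes eps: "0 < eps" and L: "1 \<le> L" and t: "L * eps \<le> t" and \<delta>: "0 < \<delta>" "\<delta> \<le> 1"
    and P: "rect_within (t - L * eps) t P"
    and ap: "(\<integral>\<^sup>+z. ennreal ((rect_value P z - near_increment t (t - L * eps) eps x z)\<^sup>2) \<partial>plane) \<le> ennreal (\<delta>\<^sup>2 * sqrt eps)"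
  shows "\<bar>expectation (\<lambda>w. (rect_integral P w)\<^sup>2) - \<kappa>0 x * sqrt eps\<bar> \<le> sqrt eps * (\<delta> * (2 * \<kappa>0 x + 4) + \<kappa>0 x * lag_defect L)"
proof -
  define F where "F = near_increment t (t - L * eps) eps x"
  define v where "v = expectation (\<lambda>w. (rect_integral P w)\<^sup>2)"
  define k where "k = \<kappa>0 x"
  define wt where "wt = k * sqrt eps - sqrt eps * lag_defect L / (sqrt pi * sqrt (coeff_A a1 a2 x))"
  have k: "0 < k" unfolding k_def by (rule \<kappa>0_pos)
  have l: "0 \<le> lag_defect L" using lag_defect_nonneg[OF L] .
  have v: "(\<integral>\<^sup>+z. ennreal ((rect_value P z)\<^sup>2) \<partial>plane) = ennreal v" "0 \<le> v"
    using rect_integral_sq[OF P] t by (simp_all add: v_def)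
  have wt: "(\<integral>\<^sup>+z. ennreal ((F z)\<^sup>2) \<partial>plane) = ennreal wt" "0 \<le> wt"
    using near_increment_sq[OF eps L] unfolding wt_def F_def k_def by auto
  have [measurable]: "F \<in> borel_measurable plane" "rect_value P \<in> borel_measurable plane"
    unfolding F_def using rect_value_plane[OF P] by (simp_all cong: measurable_cong_sets)
  have d: "(\<integral>\<^sup>+z. ennreal ((rect_value P z - F z)\<^sup>2) \<partial>plane) \<le> ennreal (\<delta>\<^sup>2 * sqrt eps)" using ap unfolding F_def .
  have b: "p \<le> q + \<delta> * q + 2 * \<delta> * sqrt eps"
    if "ennreal p \<le> ennreal (1 + \<delta>) * ennreal q + ennreal (1 + 1 / \<delta>) * ennreal (\<delta>\<^sup>2 * sqrt eps)" "0 \<le> q" for p q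
  proof -
    have "ennreal p \<le> ennreal ((1 + \<delta>) * q + (1 + 1 / \<delta>) * (\<delta>\<^sup>2 * sqrt eps))"
      using that \<delta> eps by (subst (asm) ennreal_linear) auto
    then have "p \<le> (1 + \<delta>) * q + (1 + 1 / \<delta>) * (\<delta>\<^sup>2 * sqrt eps)"
      using that \<delta> eps by (subst (asm) ennreal_le_iff) auto
    also have "(1 + 1 / \<delta>) * (\<delta>\<^sup>2 * sqrt eps) = (\<delta> + 1) * \<delta> * sqrt eps" using \<delta> by (simp add: field_simps power2_eq_square)
    also have "\<dots> \<le> 2 * \<delta> * sqrt eps" using \<delta> eps by (intro mult_right_mono) auto
    finally show ?thesis by (simp add: algebra_simps)
  qed
  have 1: "v \<le> wt + \<delta> * wt + 2 * \<delta> * sqrt eps"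
  proof (rule b)
    have "ennreal v \<le> ennreal (1 + \<delta>) * ennreal wt + ennreal (1 + 1 / \<delta>) * (\<integral>\<^sup>+z. ennreal ((rect_value P z - F z)\<^sup>2) \<partial>plane)"
      using nn_integral_sq_weighted[of F plane "\<lambda>z. rect_value P z - F z" \<delta>] \<delta> by (simp add: v wt)
    also have "\<dots> \<le> ennreal (1 + \<delta>) * ennreal wt + ennreal (1 + 1 / \<delta>) * ennreal (\<delta>\<^sup>2 * sqrt eps)"
      by (intro add_left_mono mult_left_mono d) auto
    finally show "ennreal v \<le> ennreal (1 + \<delta>) * ennreal wt + ennreal (1 + 1 / \<delta>) * ennreal (\<delta>\<^sup>2 * sqrt eps)" .
  qed (rule wt)
  have 2: "wt \<le> v + \<delta> * v + 2 * \<delta> * sqrt eps"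
  proof (rule b)
    have "(\<integral>\<^sup>+z. ennreal ((F z - rect_value P z)\<^sup>2) \<partial>plane) \<le> ennreal (\<delta>\<^sup>2 * sqrt eps)"
      using d by (simp add: power2_commute)
    moreover have "ennreal wt \<le> ennreal (1 + \<delta>) * ennreal v + ennreal (1 + 1 / \<delta>) * (\<integral>\<^sup>+z. ennreal ((F z - rect_value P z)\<^sup>2) \<partial>plane)"
      using nn_integral_sq_weighted[of "rect_value P" plane "\<lambda>z. F z - rect_value P z" \<delta>] \<delta> by (simp add: v wt)
    ultimately show "ennreal wt \<le> ennreal (1 + \<delta>) * ennreal v + ennreal (1 + 1 / \<delta>) * ennreal (\<delta>\<^sup>2 * sqrt eps)"
      by (meson add_left_mono mult_left_mono order_trans zero_le)
  qed (rule v)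
  have wk: "wt \<le> k * sqrt eps" unfolding wt_def using eps l coeff_A(1)[of x] by simp
  have kw: "k * sqrt eps \<le> wt + k * lag_defect L * sqrt eps"
  proof -
    have "1 / (sqrt pi * sqrt (coeff_A a1 a2 x)) \<le> k"
      unfolding k_def \<kappa>0_def using coeff_A(1)[of x] by (intro divide_right_mono) auto
    then have "1 / (sqrt pi * sqrt (coeff_A a1 a2 x)) * (sqrt eps * lag_defect L) \<le> k * (sqrt eps * lag_defect L)"
      using eps l by (intro mult_right_mono) auto
    then show ?thesis unfolding wt_def by (simp add: mult_ac)
  qed
  have dw: "\<delta> * wt \<le> \<delta> * (k * sqrt eps)" using wk \<delta> by (intro mult_left_mono) auto
  have "\<delta> * (k * sqrt eps) \<le> 1 * (k * sqrt eps)" "\<delta> * sqrt eps \<le> 1 * sqrt eps" using \<delta> k eps by (intro mult_right_mono; simp)+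
  \<comment> \<open>This crude bound, which uses \<open>\<delta> \<le> 1\<close>, accounts for
    \<open>2 * k + 2\<close> in the factor \<open>2 * k + 4\<close>; the other 2 is the
    approximation error.\<close>
  then have "v \<le> 2 * (k * sqrt eps) + 2 * sqrt eps" using 1 wk dw by linarith
  then have dv: "\<delta> * v \<le> \<delta> * (2 * (k * sqrt eps) + 2 * sqrt eps)" using \<delta> by (intro mult_left_mono) auto
  have e: "sqrt eps * (\<delta> * (2 * k + 4) + k * lag_defect L) = 2 * (\<delta> * (k * sqrt eps)) + 4 * (\<delta> * sqrt eps) + k * lag_defect L * sqrt eps"
    by (simp add: algebra_simps)
  have nn: "0 \<le> \<delta> * (k * sqrt eps)" "0 \<le> \<delta> * sqrt eps" "0 \<le> k * lag_defect L * sqrt eps" using \<delta> k eps l by auto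
  have "v - k * sqrt eps \<le> sqrt eps * (\<delta> * (2 * k + 4) + k * lag_defect L)" using 1 wk dw nn unfolding e by linarith
  moreover have "k * sqrt eps - v \<le> sqrt eps * (\<delta> * (2 * k + 4) + k * lag_defect L)"
    using 2 kw dv nn unfolding e by (simp add: algebra_simps)
  ultimately show ?thesis unfolding v_def[symmetric] k_def[symmetric] by linarith
qed

text \<open>Before the window the integrand is \<sigma>(u) times the remote increment. Inside the
  window it is split as \<sigma>(u) \<open>(H - F)\<close> plus (\<sigma>(u) - \<xi>)
  \<open>F\<close> plus \<xi> times the difference of \<open>F\<close> and its step function: the
  effect of the interface, the modulus of the coefficient, and the discretisation. In the middle
  part the squared distance in the modulus meets the second moment of \<open>F\<close>, the
  remaining terms meet its norm.\<close>

lemma increment_approx: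
  assumes T: "0 < T" and x: "x \<noteq> 0"
  shows "\<exists>D\<ge>0. \<forall>eps L t \<delta> \<rho>. 0 < eps \<longrightarrow> 1 \<le> L \<longrightarrow> L * eps \<le> t \<longrightarrow> t \<le> T \<longrightarrow> 0 < \<delta> \<longrightarrow> \<delta> \<le> 1 \<longrightarrow> 0 < \<rho> \<longrightarrow>
    (\<exists>P. rect_within (t - L * eps) t P \<and>
      \<bar>expectation (\<lambda>w. (rect_integral P w)\<^sup>2) - \<kappa>0 x * sqrt eps\<bar> \<le> sqrt eps * (\<delta> * (2 * \<kappa>0 x + 4) + \<kappa>0 x * lag_defect L) \<and>
      nnE (\<lambda>w. (u t x w - u (t - eps) x w - \<sigma> (u (t - L * eps) x w) * rect_integral P w) ^ 4) \<le>
        ennreal (9 * (sqrt eps * (D * (lag_defect L + (sqrt (L * eps) + \<rho>) + L * sqrt L * eps / \<rho>\<^sup>2 + L * sqrt L * eps + \<delta>)))\<^sup>2))"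
proof -
  obtain C4 where C4: "0 \<le> C4" "\<And>t x. 0 \<le> t \<Longrightarrow> t \<le> T \<Longrightarrow> nnE (\<lambda>w. \<sigma> (u t x w) ^ 4) \<le> ennreal C4"
    using \<sigma>_moment[OF T, of 4] by auto
  obtain Cm where Cm: "0 \<le> Cm" "\<And>\<tau> t x x' \<rho>. 0 \<le> \<tau> \<Longrightarrow> \<tau> \<le> t \<Longrightarrow> t \<le> T \<Longrightarrow> 0 < \<rho> \<Longrightarrow>
    nnE (\<lambda>w. (\<sigma> (u t x' w) - \<sigma> (u \<tau> x w)) ^ 4) \<le> ennreal ((Cm * (sqrt (t - \<tau>) + \<rho> + (x' - x)\<^sup>2 / \<rho>\<^sup>2))\<^sup>2)"
    using \<sigma>_modulus[OF T] by auto
  define C where "C = sqrt C4"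
  have C: "0 \<le> C" "C\<^sup>2 = C4" using C4(1) by (auto simp: C_def)
  \<comment> \<open>One summand for each of the error parts \<open>A1\<close>, \<open>A3\<close>,
    \<open>A4\<close> and two for \<open>A2\<close>; the 8 is the factor in
    \<open>h\<close>.\<close>
  define D where "D = 8 * (C * C_diff + Cm * \<kappa>0 x + 4 * Cm * sqrt amax + C * C_err x + C)"
  have D: "0 \<le> D" unfolding D_def using C Cm(1) C_diff_nonneg \<kappa>0_pos[of x] amax C_nonneg by (intro mult_nonneg_nonneg add_nonneg_nonneg) (auto simp: less_imp_le)
  have "\<exists>P. rect_within (t - L * eps) t P \<and>
      \<bar>expectation (\<lambda>w. (rect_integral P w)\<^sup>2) - \<kappa>0 x * sqrt eps\<bar> \<le> sqrt eps * (\<delta> * (2 * \<kappa>0 x + 4) + \<kappa>0 x * lag_defect L) \<and>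
      nnE (\<lambda>w. (u t x w - u (t - eps) x w - \<sigma> (u (t - L * eps) x w) * rect_integral P w) ^ 4) \<le>
        ennreal (9 * (sqrt eps * (D * (lag_defect L + (sqrt (L * eps) + \<rho>) + L * sqrt L * eps / \<rho>\<^sup>2 + L * sqrt L * eps + \<delta>)))\<^sup>2)"
    if eps: "0 < eps" and L: "1 \<le> L" and t: "L * eps \<le> t" "t \<le> T" and \<delta>: "0 < \<delta>" "\<delta> \<le> 1" and \<rho>: "0 < \<rho>" for eps L t \<delta> \<rho>
  proof -
    define \<tau> where "\<tau> = t - L * eps"
    have Le: "eps \<le> L * eps" using L eps by simp
    have \<tau>: "0 \<le> \<tau>" "\<tau> \<le> t" "0 \<le> t - eps" unfolding \<tau>_def using t Le eps by linarith+
    define F where "F = near_increment t \<tau> eps x"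
    define H where "H z = G (t - fst z) x (snd z) - G (t - eps - fst z) x (snd z)" for z
    have Fm[measurable]: "F \<in> borel_measurable (borel \<Otimes>\<^sub>M borel)" unfolding F_def by measurable
    have Hm[measurable]: "H \<in> borel_measurable (borel \<Otimes>\<^sub>M borel)" unfolding H_def by measurable
    have Fsq: "(\<integral>\<^sup>+z. ennreal ((F z)\<^sup>2) \<partial>plane) \<le> ennreal (\<kappa>0 x * sqrt eps)"
      unfolding F_def \<tau>_def near_increment_sq(1)[OF eps L]
      using lag_defect_nonneg[OF L] coeff_A(1)[of x] eps by (intro ennreal_leI) simp
    have "rect_approx \<tau> t F"
    proof (rule rect_dense[OF \<tau>(2)])
      show "F \<in> borel_measurable plane" using Fm by (simp cong: measurable_cong_sets)
      show "(\<integral>\<^sup>+z. ennreal ((F z)\<^sup>2) \<partial>plane) < \<infinity>" using Fsq by (rule le_less_trans) simp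
      show "F (s, y) = 0" if "s \<notin> {\<tau><..t}" for s y
        using that eps by (auto simp: F_def near_increment_def indicator_def near_kernel_def)
    qed
    from rect_approxD(2)[OF this, of "\<delta>\<^sup>2 * sqrt eps"] \<delta> eps
    obtain P where P: "rect_within \<tau> t P" and ap: "(\<integral>\<^sup>+z. ennreal ((rect_value P z - F z)\<^sup>2) \<partial>plane) \<le> ennreal (\<delta>\<^sup>2 * sqrt eps)"
      by auto
    have var: "\<bar>expectation (\<lambda>w. (rect_integral P w)\<^sup>2) - \<kappa>0 x * sqrt eps\<bar> \<le> sqrt eps * (\<delta> * (2 * \<kappa>0 x + 4) + \<kappa>0 x * lag_defect L)"
      using increment_variance[OF eps L t(1) \<delta>] P ap unfolding F_def \<tau>_def by blast
    have Pm[measurable]: "rect_value P \<in> borel_measurable (borel \<Otimes>\<^sub>M borel)" by (rule rect_value_measurable[OF P])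
    define \<xi> where "\<xi> w = \<sigma> (u \<tau> x w)" for w
    have \<xi>F: "\<xi> \<in> borel_measurable (\<F> \<tau>)" unfolding \<xi>_def[abs_def] using u_adapted[OF \<tau>(1), of x] by simp
    have \<xi>m[measurable]: "\<xi> \<in> borel_measurable M" using filtration_measurable[OF \<xi>F] .
    have \<xi>4: "nnE (\<lambda>w. \<xi> w ^ 4) \<le> ennreal C4" unfolding \<xi>_def using C4(2) \<tau> t by simp
    have i4: "integrable M (\<lambda>w. \<xi> w ^ 4)" using nn_integral_imp_expectation(1)[OF _ _ \<xi>4 C4(1)] by simp
    have "integrable M (\<lambda>w. ((\<xi> w)\<^sup>2)\<^sup>2)" using i4 by (simp flip: power_mult)
    then have i2: "integrable M (\<lambda>w. (\<xi> w)\<^sup>2)" by (rule square_integrable_imp_integrable[rotated]) measurable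
    have W0: "walsh_limit (\<lambda>s y w. (\<sigma> (u s y w) * G (t - s) x y - \<sigma> (u s y w) * G (t - eps - s) x y) - \<xi> w * rect_value P (s, y))
       (\<lambda>w. (u t x w - u (t - eps) x w) - \<xi> w * rect_integral P w)"
      using t \<tau> by (intro walsh_limit_diff u_walsh_limit walsh_limit_rect[OF P \<tau>(1) \<xi>F i2]) auto
    define X where "X s y w = \<sigma> (u s y w) * H (s, y) - \<xi> w * rect_value P (s, y)" for s y w
    have WX: "walsh_limit X (\<lambda>w. (u t x w - u (t - eps) x w) - \<xi> w * rect_integral P w)"
      using W0 by (rule walsh_limit_cong) (simp add: X_def H_def right_diff_distrib)
    define q where "q = sqrt (L * eps) + \<rho>"
    have q0: "0 \<le> q" using L eps \<rho> by (simp add: q_def)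
    define A1 where "A1 z = C * ((H z)\<^sup>2 * indicator {0..\<tau>} (fst z))" for z
    define A2 where "A2 z = Cm * (q * (F z)\<^sup>2 + (1 / \<rho>\<^sup>2) * ((F z)\<^sup>2 * (snd z - x)\<^sup>2))" for z
    define A3 where "A3 z = C * ((H z - F z)\<^sup>2 * indicator {\<tau><..} (fst z))" for z
    define A4 where "A4 z = C * (rect_value P z - F z)\<^sup>2" for z
    have A0: "0 \<le> A1 z" "0 \<le> A2 z" "0 \<le> A3 z" "0 \<le> A4 z" for z
      unfolding A1_def A2_def A3_def A4_def using C Cm q0 by auto
    have Am[measurable]: "A1 \<in> borel_measurable (borel \<Otimes>\<^sub>M borel)" "A2 \<in> borel_measurable (borel \<Otimes>\<^sub>M borel)"
      "A3 \<in> borel_measurable (borel \<Otimes>\<^sub>M borel)" "A4 \<in> borel_measurable (borel \<Otimes>\<^sub>M borel)"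
      unfolding A1_def A2_def A3_def A4_def by measurable
    \<comment> \<open>The factor 8 absorbs the 27 from the fourth power of a sum of three terms,
      since \<open>27 \<le> 64\<close>.\<close>
    define h where "h z = 8 * (A1 z + A2 z + A3 z + A4 z)" for z
    \<comment> \<open>Each error part is proportional to one summand of \<open>R\<close>; bounding
      them all by \<open>R\<close> leaves a single constant \<open>D\<close>.\<close>
    define R where "R = lag_defect L + q + L * sqrt L * eps / \<rho>\<^sup>2 + L * sqrt L * eps + \<delta>"
    have parts: "0 \<le> lag_defect L" "0 \<le> L * sqrt L * eps / \<rho>\<^sup>2" "0 \<le> L * sqrt L * eps"
      using lag_defect_nonneg[OF L] L eps by auto
    then have R: "lag_defect L \<le> R" "q \<le> R" "L * sqrt L * eps / \<rho>\<^sup>2 \<le> R" "L * sqrt L * eps \<le> R" "\<delta> \<le> R" "0 \<le> R"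
      unfolding R_def using q0 \<delta> by auto
    have LL: "L * eps * sqrt (L * eps) = sqrt eps * (L * sqrt L * eps)" by (simp add: real_sqrt_mult mult_ac)
    have "nnE (\<lambda>w. ((u t x w - u (t - eps) x w) - \<xi> w * rect_integral P w) ^ 4) \<le> ennreal (9 * (sqrt eps * (D * R))\<^sup>2)"
    proof (rule walsh_fourth_moment[OF WX, where h="\<lambda>s y. h (s, y)"])
      show "(\<lambda>(s, y). h (s, y)) \<in> borel_measurable (borel \<Otimes>\<^sub>M borel)" unfolding h_def by measurable
      show "0 \<le> h (s, y)" for s y using A0 by (simp add: h_def)
      show "0 \<le> sqrt eps * (D * R)" using D R eps by simp
      fix s y :: real assume s: "0 \<le> s"
      consider "s \<le> \<tau>" | "\<tau> < s" "s \<le> t" | "t < s" by linarith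
      then show "nnE (\<lambda>w. X s y w ^ 4) \<le> ennreal ((h (s, y))\<^sup>2)"
      proof cases
        case 1
        note [measurable] = u_measurable[OF s, of y]
        have P0: "rect_value P (s, y) = 0" using rect_value_outside[OF P] 1 by auto
        have "nnE (\<lambda>w. X s y w ^ 4) = ennreal (H (s, y) ^ 4) * nnE (\<lambda>w. \<sigma> (u s y w) ^ 4)"
          by (subst nn_integral_cmult[symmetric]) (auto simp: X_def P0 power_mult_distrib ennreal_mult[symmetric] mult.commute)
        also have "\<dots> \<le> ennreal (H (s, y) ^ 4) * ennreal C4" using C4(2)[OF s] 1 \<tau> t by (intro mult_left_mono) auto
        also have "\<dots> = ennreal ((A1 (s, y))\<^sup>2)"
          using 1 s C4(1) C(2) by (subst ennreal_mult[symmetric]) (auto simp: A1_def power_mult_distrib mult.commute)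
        also have "\<dots> \<le> ennreal ((h (s, y))\<^sup>2)"
          using A0[of "(s, y)"] by (intro ennreal_leI power_mono) (auto simp: h_def)
        finally show ?thesis .
      next
        case 2
        note [measurable] = u_measurable[OF s, of y]
        define Q where "Q = q + (y - x)\<^sup>2 / \<rho>\<^sup>2"
        have Q0: "0 \<le> Q" using q0 by (simp add: Q_def)
        let ?e = "H (s, y) - F (s, y)" and ?f = "F (s, y)" and ?g = "F (s, y) - rect_value P (s, y)"
        have m: "nnE (\<lambda>w. (\<sigma> (u s y w) - \<xi> w) ^ 4) \<le> ennreal ((Cm * Q)\<^sup>2)"
        proof -
          have "sqrt (s - \<tau>) \<le> sqrt (L * eps)" using 2 by (simp add: \<tau>_def)
          then have "Cm * (sqrt (s - \<tau>) + \<rho> + (y - x)\<^sup>2 / \<rho>\<^sup>2) \<le> Cm * Q" using Cm(1) by (intro mult_left_mono) (auto simp: Q_def q_def)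
          moreover have "0 \<le> Cm * (sqrt (s - \<tau>) + \<rho> + (y - x)\<^sup>2 / \<rho>\<^sup>2)" using Cm(1) \<rho> 2 by (intro mult_nonneg_nonneg add_nonneg_nonneg) auto
          ultimately have "ennreal ((Cm * (sqrt (s - \<tau>) + \<rho> + (y - x)\<^sup>2 / \<rho>\<^sup>2))\<^sup>2) \<le> ennreal ((Cm * Q)\<^sup>2)"
            by (intro ennreal_leI power_mono)
          moreover have "nnE (\<lambda>w. (\<sigma> (u s y w) - \<xi> w) ^ 4) \<le> ennreal ((Cm * (sqrt (s - \<tau>) + \<rho> + (y - x)\<^sup>2 / \<rho>\<^sup>2))\<^sup>2)"
            unfolding \<xi>_def using 2 \<tau> t \<rho> by (intro Cm(2)) auto
          ultimately show ?thesis by (rule order_trans[rotated])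
        qed
        have "nnE (\<lambda>w. X s y w ^ 4) \<le> (\<integral>\<^sup>+w. ennreal (27 * ?e ^ 4) * ennreal (\<sigma> (u s y w) ^ 4) +
           (ennreal (27 * ?f ^ 4) * ennreal ((\<sigma> (u s y w) - \<xi> w) ^ 4) + ennreal (27 * ?g ^ 4) * ennreal (\<xi> w ^ 4)) \<partial>M)"
        proof (rule nn_integral_mono)
          fix w
          have "X s y w = \<sigma> (u s y w) * ?e + (\<sigma> (u s y w) - \<xi> w) * ?f + \<xi> w * ?g"
            by (simp add: X_def algebra_simps)
          then have "X s y w ^ 4 \<le> 27 * ?e ^ 4 * \<sigma> (u s y w) ^ 4 + (27 * ?f ^ 4 * (\<sigma> (u s y w) - \<xi> w) ^ 4 + 27 * ?g ^ 4 * \<xi> w ^ 4)"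
            using fourth_power_sum3[of "\<sigma> (u s y w) * ?e" "(\<sigma> (u s y w) - \<xi> w) * ?f" "\<xi> w * ?g"]
            by (simp add: power_mult_distrib mult_ac)
          then have "ennreal (X s y w ^ 4) \<le> ennreal (27 * ?e ^ 4 * \<sigma> (u s y w) ^ 4 + (27 * ?f ^ 4 * (\<sigma> (u s y w) - \<xi> w) ^ 4 + 27 * ?g ^ 4 * \<xi> w ^ 4))"
            by (rule ennreal_leI)
          also have "\<dots> = ennreal (27 * ?e ^ 4) * ennreal (\<sigma> (u s y w) ^ 4) +
           (ennreal (27 * ?f ^ 4) * ennreal ((\<sigma> (u s y w) - \<xi> w) ^ 4) + ennreal (27 * ?g ^ 4) * ennreal (\<xi> w ^ 4))"
            by (simp only: ennreal_mult[symmetric] ennreal_plus[symmetric] mult_nonneg_nonneg add_nonneg_nonneg zero_le_numeral zero_le_even_power even_numeral)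
          finally show "ennreal (X s y w ^ 4) \<le> ennreal (27 * ?e ^ 4) * ennreal (\<sigma> (u s y w) ^ 4) +
           (ennreal (27 * ?f ^ 4) * ennreal ((\<sigma> (u s y w) - \<xi> w) ^ 4) + ennreal (27 * ?g ^ 4) * ennreal (\<xi> w ^ 4))" .
        qed
        also have "\<dots> = ennreal (27 * ?e ^ 4) * nnE (\<lambda>w. \<sigma> (u s y w) ^ 4) +
           (ennreal (27 * ?f ^ 4) * nnE (\<lambda>w. (\<sigma> (u s y w) - \<xi> w) ^ 4) + ennreal (27 * ?g ^ 4) * nnE (\<lambda>w. \<xi> w ^ 4))"
          by (simp add: nn_integral_add nn_integral_cmult)
        also have "\<dots> \<le> ennreal (27 * ?e ^ 4) * ennreal C4 + (ennreal (27 * ?f ^ 4) * ennreal ((Cm * Q)\<^sup>2) + ennreal (27 * ?g ^ 4) * ennreal C4)"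
          using C4(2)[OF s, of y] 2 t by (intro add_mono mult_left_mono m \<xi>4) auto
        also have "\<dots> = ennreal (27 * ?e ^ 4 * C4 + (27 * ?f ^ 4 * (Cm * Q)\<^sup>2 + 27 * ?g ^ 4 * C4))"
          using C4(1) by (simp only: ennreal_mult[symmetric] ennreal_plus[symmetric] mult_nonneg_nonneg add_nonneg_nonneg zero_le_numeral zero_le_even_power even_numeral zero_le_power2)
        also have "\<dots> \<le> ennreal ((h (s, y))\<^sup>2)"
        proof (rule ennreal_leI)
          have e: "A3 (s, y) = C * ?e\<^sup>2" "A2 (s, y) = Cm * Q * ?f\<^sup>2" "A4 (s, y) = C * ?g\<^sup>2"
            using 2 by (auto simp: A3_def A2_def A4_def Q_def algebra_simps power2_commute)
          have "27 * ?e ^ 4 * C4 + (27 * ?f ^ 4 * (Cm * Q)\<^sup>2 + 27 * ?g ^ 4 * C4) = 27 * ((A3 (s, y))\<^sup>2 + (A2 (s, y))\<^sup>2 + (A4 (s, y))\<^sup>2)"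
            unfolding e C(2)[symmetric] by (simp add: power_mult_distrib algebra_simps)
          also have "\<dots> \<le> 64 * (A2 (s, y) + A3 (s, y) + A4 (s, y))\<^sup>2"
          proof -
            have "p\<^sup>2 + r\<^sup>2 + v\<^sup>2 \<le> (r + p + v)\<^sup>2" if "0 \<le> p" "0 \<le> r" "0 \<le> v" for p r v :: real
              using mult_nonneg_nonneg[OF that(1,2)] mult_nonneg_nonneg[OF that(1,3)] mult_nonneg_nonneg[OF that(2,3)]
              by (simp add: power2_eq_square algebra_simps)
            from this[OF A0(3)[of "(s,y)"] A0(2)[of "(s,y)"] A0(4)[of "(s,y)"]] show ?thesis using zero_le_power2[of "A2 (s, y) + A3 (s, y) + A4 (s, y)"] by (simp only: distrib_left)
          qed
          also have "\<dots> = (8 * (A2 (s, y) + A3 (s, y) + A4 (s, y)))\<^sup>2" unfolding power_mult_distrib by simp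
          also have "\<dots> \<le> (h (s, y))\<^sup>2" using A0[of "(s, y)"] by (intro power_mono) (auto simp: h_def)
          finally show "27 * ?e ^ 4 * C4 + (27 * ?f ^ 4 * (Cm * Q)\<^sup>2 + 27 * ?g ^ 4 * C4) \<le> (h (s, y))\<^sup>2" .
        qed
        finally show ?thesis .
      next
        case 3
        have "rect_value P (s, y) = 0" using rect_value_outside[OF P] 3 by auto
        moreover have "H (s, y) = 0" using 3 eps by (simp add: H_def heat_kernel_def)
        ultimately show ?thesis by (simp add: X_def)
      qed
    next
      have pm: "f \<in> borel_measurable plane" if "f \<in> borel_measurable (borel \<Otimes>\<^sub>M borel)" for f :: "real \<times> real \<Rightarrow> real"
        using that by (simp cong: measurable_cong_sets)
      note [measurable] = Am[THEN pm] pm[OF Fm] pm[OF Hm] pm[OF Pm]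
      have I1: "(\<integral>\<^sup>+z. ennreal (A1 z) \<partial>plane) \<le> ennreal (sqrt eps * (C * C_diff * R))"
      proof -
        have "(\<integral>\<^sup>+z. ennreal (A1 z) \<partial>plane) = ennreal C * (\<integral>\<^sup>+z. ennreal ((H z)\<^sup>2 * indicator {0..\<tau>} (fst z)) \<partial>plane)"
          unfolding A1_def using C(1) by (subst nn_integral_cmult[symmetric]) (auto simp: ennreal_mult)
        also have "\<dots> \<le> ennreal C * ennreal (C_diff * (sqrt eps * lag_defect L))"
          unfolding H_def \<tau>_def by (intro mult_left_mono remote_increment eps L t) auto
        also have "\<dots> \<le> ennreal C * ennreal (C_diff * (sqrt eps * R))"
          using R C_diff_nonneg eps by (intro mult_left_mono ennreal_leI) auto
        also have "\<dots> = ennreal (sqrt eps * (C * C_diff * R))"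
          using C(1) C_diff_nonneg eps R(6) by (subst ennreal_mult[symmetric]) (auto simp: mult_ac)
        finally show ?thesis .
      qed
      have I2: "(\<integral>\<^sup>+z. ennreal (A2 z) \<partial>plane) \<le> ennreal (sqrt eps * (Cm * \<kappa>0 x * R + 4 * Cm * sqrt amax * R))"
      proof -
        have "(\<integral>\<^sup>+z. ennreal (A2 z) \<partial>plane) = (\<integral>\<^sup>+z. ennreal Cm * (ennreal q * ennreal ((F z)\<^sup>2) + ennreal (1 / \<rho>\<^sup>2) * ennreal ((F z)\<^sup>2 * (snd z - x)\<^sup>2)) \<partial>plane)"
          unfolding A2_def using Cm(1) q0 by (intro nn_integral_cong) (subst ennreal_linear, simp_all del: ennreal_plus add: ennreal_mult[symmetric])
        also have "\<dots> = ennreal Cm * (ennreal q * (\<integral>\<^sup>+z. ennreal ((F z)\<^sup>2) \<partial>plane) + ennreal (1 / \<rho>\<^sup>2) * (\<integral>\<^sup>+z. ennreal ((F z)\<^sup>2 * (snd z - x)\<^sup>2) \<partial>plane))"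
          by (simp add: nn_integral_cmult nn_integral_add)
        also have "\<dots> \<le> ennreal Cm * (ennreal q * ennreal (\<kappa>0 x * sqrt eps) + ennreal (1 / \<rho>\<^sup>2) * ennreal (4 * sqrt amax * (L * eps * sqrt (L * eps))))"
          using near_increment_second_moment[OF eps L, of t x] by (intro mult_left_mono add_mono Fsq) (auto simp: F_def \<tau>_def)
        also have "\<dots> = ennreal (Cm * (q * (\<kappa>0 x * sqrt eps) + (1 / \<rho>\<^sup>2) * (4 * sqrt amax * (L * eps * sqrt (L * eps)))))"
          using Cm(1) q0 \<kappa>0_pos[of x] eps L amax by (subst ennreal_linear) (auto simp: ennreal_mult)
        also have "\<dots> \<le> ennreal (sqrt eps * (Cm * \<kappa>0 x * R + 4 * Cm * sqrt amax * R))"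
        proof (rule ennreal_leI)
          have "Cm * \<kappa>0 x * q \<le> Cm * \<kappa>0 x * R" using Cm(1) \<kappa>0_pos[of x] R by (intro mult_left_mono) auto
          moreover have "4 * Cm * sqrt amax * (L * sqrt L * eps / \<rho>\<^sup>2) \<le> 4 * Cm * sqrt amax * R" using Cm(1) amax R by (intro mult_left_mono) auto
          ultimately have "sqrt eps * (Cm * \<kappa>0 x * q + 4 * Cm * sqrt amax * (L * sqrt L * eps / \<rho>\<^sup>2)) \<le> sqrt eps * (Cm * \<kappa>0 x * R + 4 * Cm * sqrt amax * R)"
            by (rule mult_left_mono[OF add_mono]) (use eps in simp)
          then show "Cm * (q * (\<kappa>0 x * sqrt eps) + (1 / \<rho>\<^sup>2) * (4 * sqrt amax * (L * eps * sqrt (L * eps)))) \<le> sqrt eps * (Cm * \<kappa>0 x * R + 4 * Cm * sqrt amax * R)"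
            unfolding LL by (simp add: algebra_simps)
        qed
        finally show ?thesis .
      qed
      have I3: "(\<integral>\<^sup>+z. ennreal (A3 z) \<partial>plane) \<le> ennreal (sqrt eps * (C * C_err x * R))"
      proof -
        have "(\<integral>\<^sup>+z. ennreal (A3 z) \<partial>plane) = ennreal C * (\<integral>\<^sup>+z. ennreal ((H z - F z)\<^sup>2 * indicator {\<tau><..} (fst z)) \<partial>plane)"
          unfolding A3_def using C(1) by (subst nn_integral_cmult[symmetric]) (auto simp: ennreal_mult)
        also have "\<dots> \<le> ennreal C * ennreal (C_err x * (L * eps * sqrt (L * eps)))"
          unfolding H_def F_def \<tau>_def by (intro mult_left_mono near_increment_error eps L x) auto
        also have "\<dots> \<le> ennreal C * ennreal (C_err x * (sqrt eps * R))"
          unfolding LL using R C_nonneg(3)[of x] eps by (intro mult_left_mono ennreal_leI) auto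
        also have "\<dots> = ennreal (sqrt eps * (C * C_err x * R))"
          using C(1) C_nonneg(3)[of x] eps R(6) by (subst ennreal_mult[symmetric]) (auto simp: mult_ac)
        finally show ?thesis .
      qed
      have I4: "(\<integral>\<^sup>+z. ennreal (A4 z) \<partial>plane) \<le> ennreal (sqrt eps * (C * R))"
      proof -
        have "(\<integral>\<^sup>+z. ennreal (A4 z) \<partial>plane) = ennreal C * (\<integral>\<^sup>+z. ennreal ((rect_value P z - F z)\<^sup>2) \<partial>plane)"
          unfolding A4_def using C(1) by (subst nn_integral_cmult[symmetric]) (auto simp: ennreal_mult)
        also have "\<dots> \<le> ennreal C * ennreal (\<delta>\<^sup>2 * sqrt eps)" by (intro mult_left_mono ap) auto
        also have "\<dots> \<le> ennreal C * ennreal (R * sqrt eps)"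
        proof (intro mult_left_mono ennreal_leI mult_right_mono)
          have "\<delta> * \<delta> \<le> 1 * \<delta>" using \<delta> by (intro mult_right_mono) auto
          then show "\<delta>\<^sup>2 \<le> R" using R(5) by (simp add: power2_eq_square)
        qed (use eps in auto)
        also have "\<dots> = ennreal (sqrt eps * (C * R))"
          using C(1) eps R(6) by (subst ennreal_mult[symmetric]) (auto simp: mult_ac)
        finally show ?thesis .
      qed
      have "(\<integral>\<^sup>+s\<in>{0..}. (\<integral>\<^sup>+y. ennreal (h (s, y)) \<partial>lborel) \<partial>lborel) \<le> (\<integral>\<^sup>+s. (\<integral>\<^sup>+y. ennreal (h (s, y)) \<partial>lborel) \<partial>lborel)"
        by (intro nn_integral_mono) (auto simp: indicator_def)
      also have "\<dots> = (\<integral>\<^sup>+z. ennreal (h z) \<partial>plane)"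
        by (rule plane_iterated[symmetric]) (simp add: h_def)
      also have "\<dots> = (\<integral>\<^sup>+z. 8 * (ennreal (A1 z) + ennreal (A2 z) + ennreal (A3 z) + ennreal (A4 z)) \<partial>plane)"
        unfolding h_def using A0 by (intro nn_integral_cong) (simp add: ennreal_mult)
      also have "\<dots> = 8 * ((\<integral>\<^sup>+z. ennreal (A1 z) \<partial>plane) + (\<integral>\<^sup>+z. ennreal (A2 z) \<partial>plane) + (\<integral>\<^sup>+z. ennreal (A3 z) \<partial>plane) + (\<integral>\<^sup>+z. ennreal (A4 z) \<partial>plane))"
        by (simp add: nn_integral_cmult nn_integral_add)
      also have "\<dots> \<le> 8 * (ennreal (sqrt eps * (C * C_diff * R)) + ennreal (sqrt eps * (Cm * \<kappa>0 x * R + 4 * Cm * sqrt amax * R)) +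
          ennreal (sqrt eps * (C * C_err x * R)) + ennreal (sqrt eps * (C * R)))"
        by (intro mult_left_mono add_mono I1 I2 I3 I4) auto
      also have "\<dots> = ennreal (sqrt eps * (D * R))"
      proof -
        have n: "0 \<le> sqrt eps * (C * C_diff * R)" "0 \<le> sqrt eps * (Cm * \<kappa>0 x * R + 4 * Cm * sqrt amax * R)"
          "0 \<le> sqrt eps * (C * C_err x * R)" "0 \<le> sqrt eps * (C * R)"
          using eps C(1) C_diff_nonneg R(6) Cm(1) \<kappa>0_pos[of x] amax C_nonneg(3)[of x] by (auto simp: less_imp_le)
        have "sqrt eps * (D * R) = 8 * (sqrt eps * (C * C_diff * R) + sqrt eps * (Cm * \<kappa>0 x * R + 4 * Cm * sqrt amax * R) +
          sqrt eps * (C * C_err x * R) + sqrt eps * (C * R))"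
          unfolding D_def by (simp add: algebra_simps)
        then show ?thesis using n by (simp only: ennreal_mult ennreal_plus[symmetric] add_nonneg_nonneg zero_le_numeral ennreal_numeral)
      qed
      finally show "(\<integral>\<^sup>+s\<in>{0..}. (\<integral>\<^sup>+y. ennreal (h (s, y)) \<partial>lborel) \<partial>lborel) \<le> ennreal (sqrt eps * (D * R))" .
    qed
    then show ?thesis
      using P var unfolding \<tau>_def \<xi>_def R_def q_def by (intro exI[of _ P]) auto
  qed
  then show ?thesis using D by (intro exI[of _ D]) blast
qed

end

section \<open>Quartic variation\<close>

context prob_space
begin

lemma L1_imp_in_probability:
  assumes b: "\<And>r. 0 < r \<Longrightarrow> \<forall>\<^sub>F n in sequentially. integrable M (X n) \<and> expectation (\<lambda>w. \<bar>X n w\<bar>) \<le> r"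
  shows "converges_in_probability M X 0"
  unfolding converges_in_probability_def
proof (intro allI impI tendstoI)
  fix e r :: real assume e: "0 < e" and r: "0 < r"
  have "\<forall>\<^sub>F n in sequentially. integrable M (X n) \<and> expectation (\<lambda>w. \<bar>X n w\<bar>) \<le> e * r / 2"
    using e r by (intro b) simp
  then show "\<forall>\<^sub>F n in sequentially. dist (prob {w \<in> space M. e < \<bar>X n w - 0\<bar>}) 0 < r"
  proof eventually_elim
    case (elim n)
    then have [measurable]: "X n \<in> borel_measurable M" by auto
    have "prob {w \<in> space M. e < \<bar>X n w - 0\<bar>} \<le> prob {w \<in> space M. \<bar>X n w\<bar> \<ge> e}"
      by (intro finite_measure_mono) auto
    also have "\<dots> \<le> expectation (\<lambda>w. \<bar>X n w\<bar>) / e"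
      using elim e by (intro integral_Markov_inequality_measure[where A="{}"]) auto
    also have "\<dots> \<le> r / 2" using elim e by (simp add: pos_divide_le_eq mult_ac)
    also have "\<dots> < r" using r by simp
    finally show ?case by (simp add: dist_real_def)
  qed
qed

text \<open>The limit \<open>R\<close> is positive but may be arbitrarily small, so first a level
  \<eta> is chosen with \<open>R \<le> 2 * \<eta>\<close> improbable. Off this event and two
  deviation events \<open>V\<close> stays above \<open>c * \<eta> / 2\<close>, so the quotient is
  taken, and its distance from \<open>k / c\<close> is
  \<open>k * \<bar>V - c * Q\<bar> / (c * V)\<close>.\<close>

lemma ratio_in_probability:
  fixes V Q :: "nat \<Rightarrow> 'a \<Rightarrow> real"
  assumes m: "\<And>n. V n \<in> borel_measurable M" "\<And>n. Q n \<in> borel_measurable M"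
    and [measurable]: "R \<in> borel_measurable M" and R: "AE w in M. 0 < R w" and c: "0 < c" and k: "0 < k"
    and V: "converges_in_probability M (\<lambda>n w. V n w - c * Q n w) 0"
    and Q: "converges_in_probability M (\<lambda>n w. Q n w - R w) 0"
  shows "converges_in_probability M (\<lambda>n w. if 0 < V n w then k * Q n w / V n w else 0) (k / c)"
  unfolding converges_in_probability_def
proof (intro allI impI tendstoI)
  fix e r :: real assume e: "0 < e" and r: "0 < r"
  note [measurable] = m
  have "(\<lambda>j. prob {w \<in> space M. R w \<le> 2 / real (Suc j)}) \<longlonglongrightarrow> prob (\<Inter>j. {w \<in> space M. R w \<le> 2 / real (Suc j)})"
  proof (rule finite_Lim_measure_decseq)
    show "decseq (\<lambda>j. {w \<in> space M. R w \<le> 2 / real (Suc j)})"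
      by (rule decseq_SucI) (auto elim!: order_trans intro!: divide_left_mono)
  qed auto
  moreover have "prob (\<Inter>j. {w \<in> space M. R w \<le> 2 / real (Suc j)}) = prob {}"
  proof (rule finite_measure_eq_AE)
    show "AE w in M. w \<in> (\<Inter>j. {w \<in> space M. R w \<le> 2 / real (Suc j)}) \<longleftrightarrow> w \<in> {}"
      using R
    proof eventually_elim
      case (elim w)
      obtain j where "inverse (real (Suc j)) < R w / 2" using reals_Archimedean[of "R w / 2"] elim by auto
      then have "\<not> R w \<le> 2 / real (Suc j)" by (simp add: field_simps)
      then show ?case by blast
    qed
  qed auto
  ultimately have "(\<lambda>j. prob {w \<in> space M. R w \<le> 2 / real (Suc j)}) \<longlonglongrightarrow> 0" by simp
  then have "\<forall>\<^sub>F j in sequentially. prob {w \<in> space M. R w \<le> 2 / real (Suc j)} < r / 3"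
    using r by (intro order_tendstoD) auto
  then obtain j where j: "prob {w \<in> space M. R w \<le> 2 / real (Suc j)} < r / 3"
    by (auto simp: eventually_sequentially)
  define \<eta> where "\<eta> = 1 / real (Suc j)"
  have \<eta>: "0 < \<eta>" "prob {w \<in> space M. R w \<le> 2 * \<eta>} < r / 3" using j by (simp_all add: \<eta>_def)
  \<comment> \<open>The first bound keeps \<open>V\<close> above \<open>c * \<eta> / 2\<close>, the
    second makes the error of the quotient at most \<open>e\<close>.\<close>
  define \<theta> where "\<theta> = min (c * \<eta> / 2) (e * (c * (c * \<eta> / 2)) / k)"
  have \<theta>: "0 < \<theta>" "\<theta> \<le> c * \<eta> / 2" "\<theta> \<le> e * (c * (c * \<eta> / 2)) / k" using c k e \<eta> by (auto simp: \<theta>_def)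
  have "\<forall>\<^sub>F n in sequentially. prob {w \<in> space M. \<theta> < \<bar>V n w - c * Q n w - 0\<bar>} < r / 3"
    using V \<theta>(1) r unfolding converges_in_probability_def by (intro order_tendstoD(2)[where y=0]) auto
  moreover have "\<forall>\<^sub>F n in sequentially. prob {w \<in> space M. \<eta> < \<bar>Q n w - R w - 0\<bar>} < r / 3"
    using Q \<eta>(1) r unfolding converges_in_probability_def by (intro order_tendstoD(2)[where y=0]) auto
  ultimately show "\<forall>\<^sub>F n in sequentially. dist (prob {w \<in> space M. e < \<bar>(if 0 < V n w then k * Q n w / V n w else 0) - k / c\<bar>}) 0 < r"
  proof eventually_elim
    case (elim n)
    let ?A = "{w \<in> space M. R w \<le> 2 * \<eta>}" and ?B = "{w \<in> space M. \<theta> < \<bar>V n w - c * Q n w - 0\<bar>}"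
      and ?C = "{w \<in> space M. \<eta> < \<bar>Q n w - R w - 0\<bar>}"
    have "\<bar>(if 0 < V n w then k * Q n w / V n w else 0) - k / c\<bar> \<le> e"
      if g: "2 * \<eta> < R w" "\<bar>V n w - c * Q n w\<bar> \<le> \<theta>" "\<bar>Q n w - R w\<bar> \<le> \<eta>" for w
    proof -
      have "\<eta> < Q n w" using g by linarith
      then have "c * \<eta> < c * Q n w" using c by simp
      then have v: "c * \<eta> / 2 < V n w" using g(2) \<theta>(2) by linarith
      have cn: "0 < c * \<eta> / 2" using c \<eta> by simp
      with v have v0: "0 < V n w" by linarith
      have "k * Q n w / V n w - k / c = - (k * (V n w - c * Q n w) / (c * V n w))" using v0 c by (simp add: field_simps)
      then have "\<bar>k * Q n w / V n w - k / c\<bar> = k * \<bar>V n w - c * Q n w\<bar> / (c * V n w)" using v0 c k by (simp add: abs_mult)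
      also have "\<dots> \<le> k * (e * (c * (c * \<eta> / 2)) / k) / (c * (c * \<eta> / 2))"
        using g(2) \<theta> v cn c k e by (intro frac_le mult_left_mono) auto
      also have "\<dots> = e" using \<eta>(1) c k by simp
      finally show ?thesis using v0 by simp
    qed
    then have "{w \<in> space M. e < \<bar>(if 0 < V n w then k * Q n w / V n w else 0) - k / c\<bar>} \<subseteq> (?A \<union> ?B) \<union> ?C"
      by (simp only: subset_iff mem_Collect_eq Un_iff diff_zero) (meson linorder_not_le)
    then have "prob {w \<in> space M. e < \<bar>(if 0 < V n w then k * Q n w / V n w else 0) - k / c\<bar>} \<le> prob ((?A \<union> ?B) \<union> ?C)"
      by (intro finite_measure_mono) auto
    also have "\<dots> \<le> prob (?A \<union> ?B) + prob ?C" by (intro measure_Un_le) auto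
    also have "prob (?A \<union> ?B) \<le> prob ?A + prob ?B" by (intro measure_Un_le) auto
    finally show ?case using \<eta>(2) elim by (simp add: dist_real_def)
  qed
qed

end

text \<open>The splitting inequality in both directions. The relative error must refer to
  \<open>a\<close>; when \<open>b ^ 4\<close> is the smaller of the two powers it can be replaced by
  \<open>a ^ 4\<close> in the error term.\<close>

lemma fourth_power_diff:
  fixes \<eta> :: real
  assumes "0 < \<eta>"
  shows "\<exists>C\<ge>0. \<forall>a b. \<bar>b ^ 4 - a ^ 4\<bar> \<le> \<eta> * a ^ 4 + C * (b - a) ^ 4"
proof -
  define h where "h = min 1 (\<eta> / 2)"
  have h: "0 < h" "h \<le> 1" "2 * h \<le> \<eta>" using assms by (auto simp: h_def)
  obtain C where C: "1 \<le> C" "\<And>a b. (a + b) ^ 4 \<le> (1 + h) * a ^ 4 + C * b ^ 4"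
    using fourth_power_split[OF h(1)] by blast
  have "\<bar>b ^ 4 - a ^ 4\<bar> \<le> \<eta> * a ^ 4 + 2 * C * (b - a) ^ 4" for a b :: real
  proof -
    define A B E where "A = a ^ 4" and "B = b ^ 4" and "E = C * (b - a) ^ 4"
    have n: "0 \<le> A" "0 \<le> B" "0 \<le> E" using C by (auto simp: A_def B_def E_def)
    have 1: "B \<le> A + h * A + E" using C(2)[of a "b - a"] by (simp add: A_def B_def E_def algebra_simps)
    have "(a - b) ^ 4 = (b - a) ^ 4" by (metis minus_diff_eq power_minus_even even_numeral)
    then have 2: "A \<le> B + h * B + E" using C(2)[of b "a - b"] by (simp add: A_def B_def E_def algebra_simps)
    have "h * A \<le> 1 * A" "h * A \<ge> 0" using h n by (intro mult_right_mono mult_nonneg_nonneg; simp)+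
    moreover have "2 * h * A \<le> \<eta> * A" using h n by (intro mult_right_mono) auto
    moreover have "h * (A + h * A + E) = h * A + h * (h * A) + h * E" by (simp add: algebra_simps)
    moreover have "A - B \<le> 2 * (h * A) + 2 * E"
    proof (cases "A \<le> B")
      case True
      then show ?thesis using n \<open>h * A \<ge> 0\<close> by linarith
    next
      case False
      then have "h * B \<le> h * A" using h by (intro mult_left_mono) auto
      then show ?thesis using 2 n \<open>h * A \<ge> 0\<close> by linarith
    qed
    ultimately have "\<bar>B - A\<bar> \<le> \<eta> * A + 2 * E" using 1 n by linarith
    then show ?thesis by (simp add: A_def B_def E_def)
  qed
  then show ?thesis using C(1) by (intro exI[of _ "2 * C"]) auto
qed

text \<open>In the expanded second moment each index meets at most \<open>2 * l\<close> indices with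
  a nonzero covariance, and Cauchy-Schwarz bounds each of these by \<open>B\<close>.\<close>

lemma (in white_noise) expectation_abs_sum_lag_uncorrelated:
  fixes \<zeta> :: "nat \<Rightarrow> 'a \<Rightarrow> real"
  assumes m: "\<And>i. i \<in> {1..n} \<Longrightarrow> \<zeta> i \<in> borel_measurable M"
    and i: "\<And>i. i \<in> {1..n} \<Longrightarrow> integrable M (\<lambda>w. (\<zeta> i w)\<^sup>2)"
    and b: "\<And>i. i \<in> {1..n} \<Longrightarrow> expectation (\<lambda>w. (\<zeta> i w)\<^sup>2) \<le> B"
    and z: "\<And>i j. i \<in> {1..n} \<Longrightarrow> j \<in> {1..n} \<Longrightarrow> i + l \<le> j \<Longrightarrow> expectation (\<lambda>w. \<zeta> i w * \<zeta> j w) = 0"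
  shows "integrable M (\<lambda>w. \<Sum>i=1..n. \<zeta> i w)"
    and "expectation (\<lambda>w. \<bar>\<Sum>i=1..n. \<zeta> i w\<bar>) \<le> sqrt (real n * (2 * real l * B))" (is "?S1")
proof -
  have ij: "integrable M (\<lambda>w. \<zeta> i w * \<zeta> j w)" if "i \<in> {1..n}" "j \<in> {1..n}" for i j
    using that by (intro expectation_Cauchy_Schwarz m i)
  have sq: "(\<Sum>i=1..n. \<zeta> i w)\<^sup>2 = (\<Sum>i=1..n. \<Sum>j=1..n. \<zeta> i w * \<zeta> j w)" for w
    by (simp add: power2_eq_square sum_product)
  have iS: "integrable M (\<lambda>w. (\<Sum>i=1..n. \<zeta> i w)\<^sup>2)" unfolding sq by (intro Bochner_Integration.integrable_sum ij)
  have mS: "(\<lambda>w. \<Sum>i=1..n. \<zeta> i w) \<in> borel_measurable M" using m by (intro borel_measurable_sum) auto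
  \<comment> \<open>The interval holds the indices at distance less than \<open>l\<close> from
    \<open>i\<close>; for \<open>i < l\<close> the truncated subtraction merely shortens it.\<close>
  have p: "expectation (\<lambda>w. \<zeta> i w * \<zeta> j w) \<le> B * indicator {i + 1 - l..<i + l} j" if "i \<in> {1..n}" "j \<in> {1..n}" for i j
  proof (cases "i + l \<le> j \<or> j + l \<le> i")
    case True
    then have "expectation (\<lambda>w. \<zeta> i w * \<zeta> j w) = 0" using z[OF that] z[OF that(2,1)] by (auto simp: mult.commute)
    moreover have "0 \<le> B" using b[OF that(1)] by (rule order_trans[rotated]) simp
    ultimately show ?thesis by simp
  next
    case False
    have B: "0 \<le> B" using b[OF that(1)] by (rule order_trans[rotated]) simp
    have "expectation (\<lambda>w. \<zeta> i w * \<zeta> j w) \<le> sqrt (expectation (\<lambda>w. (\<zeta> i w)\<^sup>2)) * sqrt (expectation (\<lambda>w. (\<zeta> j w)\<^sup>2))"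
      using that by (intro expectation_Cauchy_Schwarz m i)
    also have "\<dots> \<le> sqrt B * sqrt B" using that B by (intro mult_mono real_sqrt_le_mono b) auto
    also have "\<dots> = B * indicator {i + 1 - l..<i + l} j" using False B by (auto simp: indicator_def)
    finally show ?thesis .
  qed
  have "expectation (\<lambda>w. (\<Sum>i=1..n. \<zeta> i w)\<^sup>2) = (\<Sum>i=1..n. \<Sum>j=1..n. expectation (\<lambda>w. \<zeta> i w * \<zeta> j w))"
    unfolding sq by (subst Bochner_Integration.integral_sum, (intro Bochner_Integration.integrable_sum ij; assumption)) (intro sum.cong refl Bochner_Integration.integral_sum ij)
  also have "\<dots> \<le> (\<Sum>i=1..n. 2 * real l * B)"
  proof (rule sum_mono)
    fix i assume i: "i \<in> {1..n}"
    have B: "0 \<le> B" using b[OF i] by (rule order_trans[rotated]) simp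
    have "(\<Sum>j=1..n. expectation (\<lambda>w. \<zeta> i w * \<zeta> j w)) \<le> (\<Sum>j=1..n. B * indicator {i + 1 - l..<i + l} j)"
      using i by (intro sum_mono p)
    also have "\<dots> = B * real (card ({1..n} \<inter> {i + 1 - l..<i + l}))"
      by (simp add: sum_distrib_left[symmetric] indicator_def sum.If_cases Int_def)
    also have "\<dots> \<le> B * (2 * real l)"
    proof (rule mult_left_mono[OF _ B])
      have "card ({1..n} \<inter> {i + 1 - l..<i + l}) \<le> card {i + 1 - l..<i + l}" by (intro card_mono) auto
      then show "real (card ({1..n} \<inter> {i + 1 - l..<i + l})) \<le> 2 * real l" by simp
    qed
    finally show "(\<Sum>j=1..n. expectation (\<lambda>w. \<zeta> i w * \<zeta> j w)) \<le> 2 * real l * B" by (simp only: mult_ac)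
  qed
  finally have "expectation (\<lambda>w. (\<Sum>i=1..n. \<zeta> i w)\<^sup>2) \<le> real n * (2 * real l * B)" by simp
  then show ?S1
    using expectation_abs_le_sqrt(2)[OF mS iS] by (meson order_trans real_sqrt_le_mono)
  show "integrable M (\<lambda>w. \<Sum>i=1..n. \<zeta> i w)" by (rule expectation_abs_le_sqrt(1)[OF mS iS])
qed

text \<open>For a Gaussian variable of variance \<open>v\<close> the bracket is centred and has
  second moment \<open>(105 - 18 + 9) * v ^ 4\<close>, hence 96. The coefficient is known at the
  start of the window and factors off. If \<open>j\<close> is at least \<open>l\<close> steps later,
  all of \<open>\<zeta> i\<close> is known when the window of \<open>j\<close> opens, so the centred
  bracket of \<open>\<zeta> j\<close> averages to zero.\<close>

lemma (in white_noise) quartic_fluctuation: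
  fixes s Z :: "nat \<Rightarrow> 'a \<Rightarrow> real" and \<tau> t :: "nat \<Rightarrow> real"
  assumes \<tau>: "\<And>i. i \<in> {1..n} \<Longrightarrow> 0 \<le> \<tau> i" "\<And>i. i \<in> {1..n} \<Longrightarrow> \<tau> i \<le> t i"
    and gap: "\<And>i j. i \<in> {1..n} \<Longrightarrow> j \<in> {1..n} \<Longrightarrow> i + l \<le> j \<Longrightarrow> t i \<le> \<tau> j"
    and Z: "\<And>i. i \<in> {1..n} \<Longrightarrow> Z i \<in> future (\<tau> i)" "\<And>i. i \<in> {1..n} \<Longrightarrow> Z i \<in> borel_measurable (\<F> (t i))"
    and s: "\<And>i. i \<in> {1..n} \<Longrightarrow> s i \<in> borel_measurable (\<F> (\<tau> i))"
    and s8: "\<And>i. i \<in> {1..n} \<Longrightarrow> integrable M (\<lambda>w. s i w ^ 8)" "\<And>i. i \<in> {1..n} \<Longrightarrow> expectation (\<lambda>w. s i w ^ 8) \<le> C"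
    and wt: "\<And>i. i \<in> {1..n} \<Longrightarrow> expectation (\<lambda>w. (Z i w)\<^sup>2) \<le> wt"
  defines "\<zeta> i w \<equiv> s i w ^ 4 * (Z i w ^ 4 - 3 * (expectation (\<lambda>w. (Z i w)\<^sup>2))\<^sup>2)"
  shows "integrable M (\<lambda>w. \<Sum>i=1..n. \<zeta> i w)"
    and "expectation (\<lambda>w. \<bar>\<Sum>i=1..n. \<zeta> i w\<bar>) \<le> sqrt (real n * (2 * real l * (96 * C * wt ^ 4)))" (is "?S1")
proof -
  define v where "v i = expectation (\<lambda>w. (Z i w)\<^sup>2)" for i
  have \<zeta>: "\<zeta> i w = s i w ^ 4 * (Z i w ^ 4 - 3 * (v i)\<^sup>2)" for i w by (simp add: \<zeta>_def v_def)
  have g: "centered_gaussian M (Z i)" if "i \<in> {1..n}" for i using future_gaussian[OF Z(1)[OF that]] .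
  note gi = centered_gaussian_even_moment(1)[OF g]
  have m4: "integrable M (\<lambda>w. Z i w ^ 4 - 3 * (v i)\<^sup>2)" "expectation (\<lambda>w. Z i w ^ 4 - 3 * (v i)\<^sup>2) = 0" if "i \<in> {1..n}" for i
    using gi[OF that, of 4] centered_gaussian_moments(3)[OF g[OF that]] by (simp_all add: v_def prob_space)
  have m8: "integrable M (\<lambda>w. (Z i w ^ 4 - 3 * (v i)\<^sup>2)\<^sup>2)" "expectation (\<lambda>w. (Z i w ^ 4 - 3 * (v i)\<^sup>2)\<^sup>2) = 96 * v i ^ 4" if "i \<in> {1..n}" for i
  proof -
    have e: "(Z i w ^ 4 - 3 * (v i)\<^sup>2)\<^sup>2 = Z i w ^ 8 - 6 * (v i)\<^sup>2 * Z i w ^ 4 + 9 * v i ^ 4" for w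
      by (simp add: power2_diff flip: power_mult)
    show "integrable M (\<lambda>w. (Z i w ^ 4 - 3 * (v i)\<^sup>2)\<^sup>2)" unfolding e using gi[OF that] by simp
    show "expectation (\<lambda>w. (Z i w ^ 4 - 3 * (v i)\<^sup>2)\<^sup>2) = 96 * v i ^ 4"
      unfolding e using gi[OF that] centered_gaussian_moments(3,4)[OF g[OF that]] by (simp add: prob_space v_def[symmetric] flip: power_mult)
  qed
  have \<zeta>F: "\<zeta> i \<in> borel_measurable (\<F> (t i))" if "i \<in> {1..n}" for i
    unfolding \<zeta>[abs_def] using Z(2)[OF that] filtration_measurable_mono[OF s[OF that] \<tau>(2)[OF that]] by measurable
  have sP: "s i \<in> borel_measurable (past_and_uncorrelated (\<tau> i) (Z i))" if "i \<in> {1..n}" for i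
    by (rule measurable_past_and_uncorrelated_past[OF s[OF that]])
  have \<zeta>2: "integrable M (\<lambda>w. (\<zeta> i w)\<^sup>2)" "expectation (\<lambda>w. (\<zeta> i w)\<^sup>2) \<le> 96 * C * wt ^ 4" if i: "i \<in> {1..n}" for i
  proof -
    note [measurable] = sP[OF i]
    have e: "(\<zeta> i w)\<^sup>2 = s i w ^ 8 * (Z i w ^ 4 - 3 * (v i)\<^sup>2)\<^sup>2" for w
      by (simp add: \<zeta> power_mult_distrib flip: power_mult)
    have f: "integrable M (\<lambda>w. s i w ^ 8 * (Z i w ^ 4 - 3 * (v i)\<^sup>2)\<^sup>2)"
      "expectation (\<lambda>w. s i w ^ 8 * (Z i w ^ 4 - 3 * (v i)\<^sup>2)\<^sup>2) = expectation (\<lambda>w. s i w ^ 8) * expectation (\<lambda>w. (Z i w ^ 4 - 3 * (v i)\<^sup>2)\<^sup>2)"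
      using future_expectation_mult[OF Z(1)[OF i] \<tau>(1)[OF i], of "\<lambda>w. s i w ^ 8" "\<lambda>z. (z ^ 4 - 3 * (v i)\<^sup>2)\<^sup>2"] s8(1)[OF i] m8(1)[OF i] by auto
    show "integrable M (\<lambda>w. (\<zeta> i w)\<^sup>2)" unfolding e by (rule f)
    have v: "0 \<le> v i" "v i \<le> wt" using wt[OF i] by (auto simp: v_def)
    have "0 \<le> C" using s8(2)[OF i] by (rule order_trans[rotated]) simp
    then have "expectation (\<lambda>w. s i w ^ 8) * (96 * v i ^ 4) \<le> C * (96 * wt ^ 4)"
      using v s8(2)[OF i] by (intro mult_mono power_mono) auto
    then show "expectation (\<lambda>w. (\<zeta> i w)\<^sup>2) \<le> 96 * C * wt ^ 4" unfolding e f(2) m8(2)[OF i] by (simp add: mult_ac)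
  qed
  have z: "expectation (\<lambda>w. \<zeta> i w * \<zeta> j w) = 0" if i: "i \<in> {1..n}" and j: "j \<in> {1..n}" and l: "i + l \<le> j" for i j
  proof -
    note [measurable] = sP[OF j] measurable_past_and_uncorrelated_past[OF filtration_measurable_mono[OF \<zeta>F[OF i] gap[OF i j l]], of "Z j"]
    note sj[measurable] = filtration_measurable[OF s[OF j]]
    have "integrable M (\<lambda>w. (s j w ^ 4)\<^sup>2)" using s8(1)[OF j] by (simp flip: power_mult)
    then have "integrable M (\<lambda>w. \<zeta> i w * s j w ^ 4)"
      by (intro expectation_Cauchy_Schwarz \<zeta>2 i filtration_measurable[OF \<zeta>F]) measurable
    then have "expectation (\<lambda>w. (\<zeta> i w * s j w ^ 4) * (Z j w ^ 4 - 3 * (v j)\<^sup>2)) =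
       expectation (\<lambda>w. \<zeta> i w * s j w ^ 4) * expectation (\<lambda>w. Z j w ^ 4 - 3 * (v j)\<^sup>2)"
      using m4(1)[OF j] by (intro future_expectation_mult(2)[OF Z(1)[OF j] \<tau>(1)[OF j], of _ "\<lambda>z. z ^ 4 - 3 * (v j)\<^sup>2"]) auto
    then show ?thesis unfolding m4(2)[OF j] by (simp add: \<zeta>[of j] mult_ac)
  qed
  show "integrable M (\<lambda>w. \<Sum>i=1..n. \<zeta> i w)"
    ?S1
    by (rule expectation_abs_sum_lag_uncorrelated[OF filtration_measurable[OF \<zeta>F] \<zeta>2 z]; assumption)+
qed

text \<open>The bracket in the bound of \<open>increment_approx\<close>, named so that all its
  parameters can be sent to their limits together.\<close>

definition lag_error :: "real \<Rightarrow> real \<Rightarrow> real \<Rightarrow> real \<Rightarrow> real" where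
  "lag_error L eps \<delta> \<rho> = lag_defect L + (sqrt (L * eps) + \<rho>) + L * sqrt L * eps / \<rho>\<^sup>2 + L * sqrt L * eps + \<delta>"

lemma lag_error_bounds:
  assumes "0 < eps" "1 \<le> L" "0 < \<delta>" "0 < \<rho>"
  shows "lag_defect L + \<delta> \<le> lag_error L eps \<delta> \<rho>" (is "?S1") "sqrt (L * eps) + \<rho> \<le> lag_error L eps \<delta> \<rho>" (is "?S2") "\<delta> \<le> lag_error L eps \<delta> \<rho>" "0 \<le> lag_error L eps \<delta> \<rho>"
proof -
  have p: "0 \<le> lag_defect L" "0 \<le> L * sqrt L * eps / \<rho>\<^sup>2" "0 \<le> L * sqrt L * eps" "0 \<le> sqrt (L * eps)"
    using lag_defect_nonneg[of L] assms by auto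
  then show ?S1 ?S2 "\<delta> \<le> lag_error L eps \<delta> \<rho>" "0 \<le> lag_error L eps \<delta> \<rho>"
    unfolding lag_error_def using assms by linarith+
qed

text \<open>\<open>L\<close> must tend to infinity for the defect, while the window and the modulus
  need \<open>L * eps\<close> and \<rho> to vanish. The competing term is
  \<open>L * sqrt L * eps / \<rho>\<^sup>2\<close>; with exponents 1/4, -1 and -1/8 for
  \<open>L\<close>, \<open>eps\<close> and \<rho> it is of order
  \<open>n powr (- 3 / 8)\<close>.\<close>

lemma lag_error_tendsto:
  assumes "0 < \<theta>"
  shows "(\<lambda>n. lag_error (real n powr (1 / 4)) (\<theta> / real n) (1 / real n) (real n powr (- 1 / 8))) \<longlonglongrightarrow> 0"
proof -
  have "(\<lambda>n. lag_defect (real n powr (1 / 4))) \<longlonglongrightarrow> 0"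
    by (rule filterlim_compose[OF lag_defect_tendsto]) real_asymp
  moreover have "(\<lambda>n. (sqrt (real n powr (1 / 4) * (\<theta> / real n)) + real n powr (- 1 / 8)) +
      real n powr (1 / 4) * sqrt (real n powr (1 / 4)) * (\<theta> / real n) / (real n powr (- 1 / 8))\<^sup>2 +
      real n powr (1 / 4) * sqrt (real n powr (1 / 4)) * (\<theta> / real n) + 1 / real n) \<longlonglongrightarrow> 0"
    using assms by real_asymp
  ultimately have "(\<lambda>n. lag_defect (real n powr (1 / 4)) + ((sqrt (real n powr (1 / 4) * (\<theta> / real n)) + real n powr (- 1 / 8)) +
      real n powr (1 / 4) * sqrt (real n powr (1 / 4)) * (\<theta> / real n) / (real n powr (- 1 / 8))\<^sup>2 +
      real n powr (1 / 4) * sqrt (real n powr (1 / 4)) * (\<theta> / real n) + 1 / real n)) \<longlonglongrightarrow> 0 + 0"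
    by (rule tendsto_add)
  then show ?thesis by (simp add: lag_error_def add.assoc)
qed

text \<open>Three replacements are accounted for: \<Delta> by \<open>s * Z\<close>, the Gaussian
  moment \<open>3 * v\<^sup>2\<close> by \<open>c\<close>, and the coefficient \<open>S\<close> by
  its earlier value \<open>s\<close>. The centred fluctuation, which is small only after summation,
  is left on the other side.\<close>

lemma quartic_decomposition:
  fixes \<Delta> s S Z :: real
  assumes C: "\<And>a b. \<bar>b ^ 4 - a ^ 4\<bar> \<le> \<eta> * a ^ 4 + C * (b - a) ^ 4" and v: "\<bar>3 * v\<^sup>2 - c\<bar> \<le> m" and c: "0 \<le> c"
  shows "\<bar>(\<Delta> ^ 4 - c * S ^ 4) - s ^ 4 * (Z ^ 4 - 3 * v\<^sup>2)\<bar> \<le>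
    \<eta> * (s ^ 4 * Z ^ 4) + C * (\<Delta> - s * Z) ^ 4 + m * s ^ 4 + c * (\<eta> * s ^ 4 + C * (S - s) ^ 4)"
proof -
  have e: "(\<Delta> ^ 4 - c * S ^ 4) - s ^ 4 * (Z ^ 4 - 3 * v\<^sup>2) =
      (\<Delta> ^ 4 - (s * Z) ^ 4) + (3 * v\<^sup>2 - c) * s ^ 4 - c * (S ^ 4 - s ^ 4)"
    by (simp add: algebra_simps power_mult_distrib)
  have "\<bar>\<Delta> ^ 4 - (s * Z) ^ 4\<bar> \<le> \<eta> * (s ^ 4 * Z ^ 4) + C * (\<Delta> - s * Z) ^ 4"
    using C[of "\<Delta>" "s * Z"] by (simp add: power_mult_distrib)
  moreover have "\<bar>(3 * v\<^sup>2 - c) * s ^ 4\<bar> \<le> m * s ^ 4" using v by (simp add: abs_mult mult_right_mono)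
  moreover have "\<bar>c * (S ^ 4 - s ^ 4)\<bar> \<le> c * (\<eta> * s ^ 4 + C * (S - s) ^ 4)"
    using C[of S s] c by (simp add: abs_mult mult_left_mono)
  ultimately show ?thesis unfolding e by linarith
qed

context stochastic_heat
begin

text \<open>The order of quantifiers matters: comparing fourth powers loses a relative error \<eta>,
  and the constant \<open>C\<close> of that comparison enters \<open>B\<close> but not
  \<open>A\<close>. So \<eta> can be made small first, and the lag error is sent to zero
  afterwards.\<close>

lemma quartic_variation_error:
  assumes T: "0 < T1" "T1 < T2" and x: "x \<noteq> 0"
  defines "Q n w \<equiv> (T2 - T1) / real n * (\<Sum>i=1..n. \<sigma> (u (grid_point T1 T2 n i) x w) ^ 4)"
  shows "\<exists>A\<ge>0. \<forall>\<eta>>0. \<exists>B\<ge>0. \<forall>n L \<delta> \<rho>. 1 \<le> n \<longrightarrow> 1 \<le> L \<longrightarrow> L * ((T2 - T1) / real n) \<le> T1 \<longrightarrow> 0 < \<delta> \<longrightarrow> 0 < \<rho> \<longrightarrow>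
     lag_error L ((T2 - T1) / real n) \<delta> \<rho> \<le> 1 \<longrightarrow>
     integrable M (\<lambda>w. quartic_variation T1 T2 u n x w - 3 * (\<kappa>0 x)\<^sup>2 * Q n w) \<and>
     expectation (\<lambda>w. \<bar>quartic_variation T1 T2 u n x w - 3 * (\<kappa>0 x)\<^sup>2 * Q n w\<bar>) \<le> \<eta> * A + B * lag_error L ((T2 - T1) / real n) \<delta> \<rho>"
proof -
  define k where "k = \<kappa>0 x"
  define \<theta> where "\<theta> = T2 - T1"
  have k: "0 < k" and \<theta>: "0 < \<theta>" and T2: "0 < T2" using \<kappa>0_pos[of x] T by (auto simp: k_def \<theta>_def)
  obtain C4 where C4: "0 \<le> C4" "\<And>t x. 0 \<le> t \<Longrightarrow> t \<le> T2 \<Longrightarrow> nnE (\<lambda>w. \<sigma> (u t x w) ^ 4) \<le> ennreal C4"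
    using \<sigma>_moment[OF T2, of 4] by auto
  obtain C8 where C8: "0 \<le> C8" "\<And>t x. 0 \<le> t \<Longrightarrow> t \<le> T2 \<Longrightarrow> nnE (\<lambda>w. \<sigma> (u t x w) ^ 8) \<le> ennreal C8"
    using \<sigma>_moment[OF T2, of 8] by auto
  obtain Cm where Cm: "0 \<le> Cm" "\<And>\<tau> t x x' \<rho>. 0 \<le> \<tau> \<Longrightarrow> \<tau> \<le> t \<Longrightarrow> t \<le> T2 \<Longrightarrow> 0 < \<rho> \<Longrightarrow>
    nnE (\<lambda>w. (\<sigma> (u t x' w) - \<sigma> (u \<tau> x w)) ^ 4) \<le> ennreal ((Cm * (sqrt (t - \<tau>) + \<rho> + (x' - x)\<^sup>2 / \<rho>\<^sup>2))\<^sup>2)"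
    using \<sigma>_modulus[OF T2] by auto
  obtain D where D: "0 \<le> D" and approx: "\<And>eps L t \<delta> \<rho>. 0 < eps \<Longrightarrow> 1 \<le> L \<Longrightarrow> L * eps \<le> t \<Longrightarrow> t \<le> T2 \<Longrightarrow> 0 < \<delta> \<Longrightarrow> \<delta> \<le> 1 \<Longrightarrow> 0 < \<rho> \<Longrightarrow>
    (\<exists>P. rect_within (t - L * eps) t P \<and>
      \<bar>expectation (\<lambda>w. (rect_integral P w)\<^sup>2) - k * sqrt eps\<bar> \<le> sqrt eps * (\<delta> * (2 * k + 4) + k * lag_defect L) \<and>
      nnE (\<lambda>w. (u t x w - u (t - eps) x w - \<sigma> (u (t - L * eps) x w) * rect_integral P w) ^ 4) \<le>
        ennreal (9 * (sqrt eps * (D * lag_error L eps \<delta> \<rho>))\<^sup>2))"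
    using increment_approx[OF T2 x] unfolding k_def lag_error_def by blast
  \<comment> \<open>Contributions proportional to \<eta>: the fourth moment of \<open>s * Z\<close>,
    at most \<open>C4 * (3 * wt\<^sup>2)\<close>, and \<open>3 * k\<^sup>2 * eps * C4\<close>;
    summing \<open>n\<close> steps turns \<open>eps\<close> into \<theta>.\<close>
  define A where "A = \<theta> * (C4 * (3 * (3 * k + 4)\<^sup>2 + 3 * k\<^sup>2))"
  have A: "0 \<le> A" using \<theta> C4 by (simp add: A_def)
  have "\<exists>B\<ge>0. \<forall>n L \<delta> \<rho>. 1 \<le> n \<longrightarrow> 1 \<le> L \<longrightarrow> L * (\<theta> / real n) \<le> T1 \<longrightarrow> 0 < \<delta> \<longrightarrow> 0 < \<rho> \<longrightarrow>
     lag_error L (\<theta> / real n) \<delta> \<rho> \<le> 1 \<longrightarrow>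
     integrable M (\<lambda>w. quartic_variation T1 T2 u n x w - 3 * k\<^sup>2 * Q n w) \<and>
     expectation (\<lambda>w. \<bar>quartic_variation T1 T2 u n x w - 3 * k\<^sup>2 * Q n w\<bar>) \<le> \<eta> * A + B * lag_error L (\<theta> / real n) \<delta> \<rho>"
    if \<eta>: "0 < \<eta>" for \<eta>
  proof -
    obtain C where C: "0 \<le> C" "\<And>a b. \<bar>b ^ 4 - a ^ 4\<bar> \<le> \<eta> * a ^ 4 + C * (b - a) ^ 4"
      using fourth_power_diff[OF \<eta>] by blast
    \<comment> \<open>The three summands come from replacing the increment, the variance and the
      coefficient, in this order.\<close>
    define B1 where "B1 = \<theta> * (9 * C * D\<^sup>2 + 3 * (2 * k + 4) * (4 * k + 4) * C4 + 3 * k\<^sup>2 * C * Cm\<^sup>2)"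
    \<comment> \<open>From the fluctuation bound
      \<open>sqrt (n * (2 * l * (96 * C8 * wt ^ 4)))\<close> with \<open>l \<le> 2 * L\<close> and
      \<open>n * eps = \<theta>\<close>, so that \<open>384 = 2 * 2 * 96\<close>.\<close>
    define B2 where "B2 = sqrt (384 * C8 * \<theta> * (3 * k + 4) ^ 4)"
    have B: "0 \<le> B1" "0 \<le> B2" using \<theta> C C4 C8 k by (auto simp: B1_def B2_def)
    have "integrable M (\<lambda>w. quartic_variation T1 T2 u n x w - 3 * k\<^sup>2 * Q n w) \<and>
     expectation (\<lambda>w. \<bar>quartic_variation T1 T2 u n x w - 3 * k\<^sup>2 * Q n w\<bar>) \<le> \<eta> * A + (B1 + B2) * lag_error L (\<theta> / real n) \<delta> \<rho>"
      if n: "1 \<le> n" and L: "1 \<le> L" and LT: "L * (\<theta> / real n) \<le> T1" and \<delta>: "0 < \<delta>" and \<rho>: "0 < \<rho>" and small: "lag_error L (\<theta> / real n) \<delta> \<rho> \<le> 1"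
      for n L \<delta> \<rho>
    proof -
      define eps where "eps = \<theta> / real n"
      define \<beta> where "\<beta> = lag_error L eps \<delta> \<rho>"
      define t where "t i = grid_point T1 T2 n i" for i
      define \<tau> where "\<tau> i = t i - L * eps" for i
      have eps: "0 < eps" "real n * eps = \<theta>" using \<theta> n by (auto simp: eps_def)
      have t_eq: "t i = T1 + real i * eps" for i by (simp add: t_def grid_point_def eps_def \<theta>_def)
      have t_prev: "grid_point T1 T2 n (i - 1) = t i - eps" if "i \<in> {1..n}" for i
        using that by (simp add: t_eq grid_point_def eps_def[symmetric] \<theta>_def[symmetric] of_nat_diff algebra_simps)
      have \<beta>: "lag_defect L + \<delta> \<le> \<beta>" "sqrt (L * eps) + \<rho> \<le> \<beta>" "\<delta> \<le> \<beta>" "0 \<le> \<beta>" "\<beta> \<le> 1"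
        using lag_error_bounds[OF eps(1) L \<delta> \<rho>] small unfolding \<beta>_def eps_def by auto
      have Le: "0 \<le> L * eps" using L eps by simp
      have tb: "t i \<le> T2" "L * eps \<le> t i" "0 \<le> \<tau> i" "\<tau> i \<le> t i" "0 \<le> t i" "0 \<le> t i - eps" "\<tau> i \<le> T2" if "i \<in> {1..n}" for i
      proof -
        have "real i * eps \<le> real n * eps" "eps \<le> L * eps" "0 \<le> real i * eps" using that eps L by (auto intro: mult_right_mono)
        then show "t i \<le> T2" "L * eps \<le> t i" "0 \<le> \<tau> i" "\<tau> i \<le> t i" "0 \<le> t i" "0 \<le> t i - eps" "\<tau> i \<le> T2"
          unfolding \<tau>_def t_eq using eps(2) LT[folded eps_def] T Le by (auto simp: \<theta>_def)
      qed
      \<comment> \<open>The three properties are collected in one predicate so that a single choice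
        provides the step functions for all grid intervals.\<close>
      define good where "good i P \<longleftrightarrow> rect_within (\<tau> i) (t i) P \<and>
        \<bar>expectation (\<lambda>w. (rect_integral P w)\<^sup>2) - k * sqrt eps\<bar> \<le> sqrt eps * (\<delta> * (2 * k + 4) + k * lag_defect L) \<and>
        nnE (\<lambda>w. (u (t i) x w - u (t i - eps) x w - \<sigma> (u (\<tau> i) x w) * rect_integral P w) ^ 4) \<le> ennreal (9 * (sqrt eps * (D * \<beta>))\<^sup>2)"
        for i P
      have "\<forall>i\<in>{1..n}. \<exists>P. good i P"
        unfolding good_def \<tau>_def \<beta>_def using tb \<beta> \<delta> by (intro ballI approx eps L \<rho>) auto
      then obtain P where good: "\<forall>i\<in>{1..n}. good i (P i)" by (rule bchoice[THEN exE])
      have P: "rect_within (\<tau> i) (t i) (P i)"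
        and var: "\<bar>expectation (\<lambda>w. (rect_integral (P i) w)\<^sup>2) - k * sqrt eps\<bar> \<le> sqrt eps * (\<delta> * (2 * k + 4) + k * lag_defect L)"
        and err: "nnE (\<lambda>w. (u (t i) x w - u (t i - eps) x w - \<sigma> (u (\<tau> i) x w) * rect_integral (P i) w) ^ 4) \<le> ennreal (9 * (sqrt eps * (D * \<beta>))\<^sup>2)"
        if "i \<in> {1..n}" for i
        using bspec[OF good that] unfolding good_def by blast+
      define Z where "Z i = rect_integral (P i)" for i
      define s where "s i w = \<sigma> (u (\<tau> i) x w)" for i w
      define S where "S i w = \<sigma> (u (t i) x w)" for i w
      define \<Delta> where "\<Delta> i w = u (t i) x w - u (t i - eps) x w" for i w
      define v where "v i = expectation (\<lambda>w. (Z i w)\<^sup>2)" for i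
      \<comment> \<open>Upper bound for all variances: \<open>k * sqrt eps\<close> plus the variance
        error, in which \<open>\<beta> \<le> 1\<close> is used.\<close>
      define wt where "wt = (3 * k + 4) * sqrt eps"
      \<comment> \<open>Error of \<open>3 * (v i)\<^sup>2\<close>, factored as a difference of
        squares: \<open>2 * k + 4\<close> belongs to the difference and \<open>4 * k + 4\<close> to
        the sum of \<open>v i\<close> and \<open>k * sqrt eps\<close>.\<close>
      define \<mu> where "\<mu> = 3 * eps * ((2 * k + 4) * \<beta> * (4 * k + 4))"
      have Zf: "Z i \<in> future (\<tau> i)" "Z i \<in> borel_measurable (\<F> (t i))" if "i \<in> {1..n}" for i
        unfolding Z_def using rect_integral_future[OF P[OF that] tb(3)[OF that]] rect_integral_adapted[OF P[OF that] tb(3)[OF that]] by auto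
      have sF: "s i \<in> borel_measurable (\<F> (\<tau> i))" if "i \<in> {1..n}" for i
        unfolding s_def[abs_def] using u_adapted[OF tb(3)[OF that], of x] by simp
      have m: "Z i \<in> borel_measurable M" "s i \<in> borel_measurable M" "S i \<in> borel_measurable M" "\<Delta> i \<in> borel_measurable M" if "i \<in> {1..n}" for i
        using filtration_measurable[OF Zf(2)[OF that]] filtration_measurable[OF sF[OF that]] u_measurable[OF tb(5)[OF that], of x] u_measurable[OF tb(6)[OF that], of x]
        unfolding S_def[abs_def] \<Delta>_def[abs_def] by auto
      have dv: "\<bar>v i - k * sqrt eps\<bar> \<le> sqrt eps * ((2 * k + 4) * \<beta>)" if "i \<in> {1..n}" for i
      proof -
        have "\<delta> * (2 * k + 4) + k * lag_defect L \<le> (2 * k + 4) * (lag_defect L + \<delta>)"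
          using lag_defect_nonneg[OF L] k by (simp add: algebra_simps)
        also have "\<dots> \<le> (2 * k + 4) * \<beta>" using \<beta> k by (intro mult_left_mono) auto
        finally have "sqrt eps * (\<delta> * (2 * k + 4) + k * lag_defect L) \<le> sqrt eps * ((2 * k + 4) * \<beta>)" using eps by (intro mult_left_mono) auto
        then show ?thesis using var[OF that] unfolding v_def Z_def by linarith
      qed
      have v: "0 \<le> v i" "v i \<le> wt" "\<bar>3 * (v i)\<^sup>2 - 3 * k\<^sup>2 * eps\<bar> \<le> \<mu>" if "i \<in> {1..n}" for i
      proof -
        show v0: "0 \<le> v i" by (simp add: v_def)
        have "sqrt eps * ((2 * k + 4) * \<beta>) \<le> sqrt eps * ((2 * k + 4) * 1)" using \<beta> k eps by (intro mult_left_mono) auto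
        then show vw: "v i \<le> wt" using dv[OF that] by (simp add: wt_def algebra_simps)
        have "3 * (v i)\<^sup>2 - 3 * k\<^sup>2 * eps = 3 * ((v i - k * sqrt eps) * (v i + k * sqrt eps))"
          using eps by (simp add: algebra_simps power2_eq_square)
        then have "\<bar>3 * (v i)\<^sup>2 - 3 * k\<^sup>2 * eps\<bar> = 3 * (\<bar>v i - k * sqrt eps\<bar> * (v i + k * sqrt eps))"
          using v0 k eps by (simp add: abs_mult)
        also have "\<dots> \<le> 3 * ((sqrt eps * ((2 * k + 4) * \<beta>)) * (sqrt eps * (4 * k + 4)))"
          using dv[OF that] vw v0 k eps \<beta> by (intro mult_left_mono mult_mono) (auto simp: wt_def algebra_simps)
        also have "\<dots> = \<mu>" using eps by (simp add: \<mu>_def)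
        finally show "\<bar>3 * (v i)\<^sup>2 - 3 * k\<^sup>2 * eps\<bar> \<le> \<mu>" .
      qed
      have \<mu>: "0 \<le> \<mu>" using eps k \<beta> by (simp add: \<mu>_def)
      have e: "integrable M (\<lambda>w. s i w ^ 4)" "expectation (\<lambda>w. s i w ^ 4) \<le> C4"
        "integrable M (\<lambda>w. s i w ^ 8)" "expectation (\<lambda>w. s i w ^ 8) \<le> C8"
        "integrable M (\<lambda>w. (\<Delta> i w - s i w * Z i w) ^ 4)" "expectation (\<lambda>w. (\<Delta> i w - s i w * Z i w) ^ 4) \<le> 9 * (sqrt eps * (D * \<beta>))\<^sup>2"
        "integrable M (\<lambda>w. (S i w - s i w) ^ 4)" "expectation (\<lambda>w. (S i w - s i w) ^ 4) \<le> (Cm * (sqrt (L * eps) + \<rho>))\<^sup>2" if "i \<in> {1..n}" for i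
      proof -
        note [measurable] = m[OF that]
        have 4: "nnE (\<lambda>w. s i w ^ 4) \<le> ennreal C4" and 8: "nnE (\<lambda>w. s i w ^ 8) \<le> ennreal C8"
          unfolding s_def using C4(2) C8(2) tb[OF that] by auto
        have 1: "nnE (\<lambda>w. (\<Delta> i w - s i w * Z i w) ^ 4) \<le> ennreal (9 * (sqrt eps * (D * \<beta>))\<^sup>2)"
          unfolding s_def \<Delta>_def Z_def by (rule err[OF that])
        have 2: "nnE (\<lambda>w. (S i w - s i w) ^ 4) \<le> ennreal ((Cm * (sqrt (L * eps) + \<rho>))\<^sup>2)"
          using Cm(2)[OF tb(3,4,1)[OF that] \<rho>, of x x] unfolding s_def S_def by (simp add: \<tau>_def)
        show "integrable M (\<lambda>w. s i w ^ 4)" "expectation (\<lambda>w. s i w ^ 4) \<le> C4"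
          by (rule nn_integral_imp_expectation[OF _ _ 4 C4(1)]; simp)+
        show "integrable M (\<lambda>w. s i w ^ 8)" "expectation (\<lambda>w. s i w ^ 8) \<le> C8"
          by (rule nn_integral_imp_expectation[OF _ _ 8 C8(1)]; simp)+
        show "integrable M (\<lambda>w. (\<Delta> i w - s i w * Z i w) ^ 4)" "expectation (\<lambda>w. (\<Delta> i w - s i w * Z i w) ^ 4) \<le> 9 * (sqrt eps * (D * \<beta>))\<^sup>2"
          by (rule nn_integral_imp_expectation[OF _ _ 1]; simp)+
        show "integrable M (\<lambda>w. (S i w - s i w) ^ 4)" "expectation (\<lambda>w. (S i w - s i w) ^ 4) \<le> (Cm * (sqrt (L * eps) + \<rho>))\<^sup>2"
          by (rule nn_integral_imp_expectation[OF _ _ 2]; simp)+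
      qed
      have sZ: "integrable M (\<lambda>w. s i w ^ 4 * Z i w ^ 4)" "expectation (\<lambda>w. s i w ^ 4 * Z i w ^ 4) \<le> C4 * (3 * wt\<^sup>2)" if i: "i \<in> {1..n}" for i
      proof -
        note [measurable] = measurable_past_and_uncorrelated_past[OF sF[OF i], of "Z i"]
        note g = future_gaussian[OF Zf(1)[OF i]]
        have f: "integrable M (\<lambda>w. s i w ^ 4 * Z i w ^ 4)"
          "expectation (\<lambda>w. s i w ^ 4 * Z i w ^ 4) = expectation (\<lambda>w. s i w ^ 4) * expectation (\<lambda>w. Z i w ^ 4)"
          using future_expectation_mult[OF Zf(1)[OF i] tb(3)[OF i], of "\<lambda>w. s i w ^ 4" "\<lambda>z. z ^ 4"] e(1)[OF i] centered_gaussian_even_moment(1)[OF g] by auto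
        show "integrable M (\<lambda>w. s i w ^ 4 * Z i w ^ 4)" by (rule f)
        show "expectation (\<lambda>w. s i w ^ 4 * Z i w ^ 4) \<le> C4 * (3 * wt\<^sup>2)"
          unfolding f centered_gaussian_moments(3)[OF g] v_def[symmetric]
          using v[OF i] e(2)[OF i] C4(1) by (intro mult_mono power_mono) auto
      qed
      define \<zeta> where "\<zeta> i w = s i w ^ 4 * (Z i w ^ 4 - 3 * (v i)\<^sup>2)" for i w
      \<comment> \<open>The lag in grid steps: after \<open>l \<ge> L\<close> steps the window of
        the later increment starts no earlier than the earlier increment ends. The bound
        \<open>2 * L\<close> holds because \<open>L \<ge> 1\<close>.\<close>
      define l where "l = nat \<lceil>L\<rceil>"
      have l: "L \<le> real l" "real l \<le> 2 * L" using L by (auto simp: l_def) linarith+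
      have gap: "t i \<le> \<tau> j" if "i + l \<le> j" for i j
      proof -
        have "L \<le> real j - real i" using that l(1) by linarith
        then have "L * eps \<le> (real j - real i) * eps" using eps by (intro mult_right_mono) auto
        then show ?thesis by (simp add: t_eq \<tau>_def algebra_simps)
      qed
      note fluct = quartic_fluctuation[of n \<tau> t l Z s C8 wt, OF tb(3,4) gap Zf sF e(3,4) v(2)[unfolded v_def], folded v_def, folded \<zeta>_def]
      define Y where "Y i w = \<eta> * (s i w ^ 4 * Z i w ^ 4) + C * (\<Delta> i w - s i w * Z i w) ^ 4 + \<mu> * s i w ^ 4 + 3 * k\<^sup>2 * eps * (\<eta> * s i w ^ 4 + C * (S i w - s i w) ^ 4)" for i w
      have Yi: "integrable M (Y i)" if "i \<in> {1..n}" for i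
        unfolding Y_def[abs_def] using e[OF that] sZ[OF that] by (intro Bochner_Integration.integrable_add integrable_mult_right)
      have Yb: "expectation (Y i) \<le> eps * (\<eta> * (C4 * (3 * (3 * k + 4)\<^sup>2 + 3 * k\<^sup>2)) + (9 * C * D\<^sup>2 + 3 * (2 * k + 4) * (4 * k + 4) * C4 + 3 * k\<^sup>2 * C * Cm\<^sup>2) * \<beta>)"
        if i: "i \<in> {1..n}" for i
      proof -
        have w2: "wt\<^sup>2 = (3 * k + 4)\<^sup>2 * eps" unfolding wt_def power_mult_distrib using eps(1) by simp
        \<comment> \<open>The moment errors are quadratic in \<beta>; with
          \<open>\<beta> \<le> 1\<close> all of them become linear and can be added to the
          rest.\<close>
        have b2: "\<beta>\<^sup>2 \<le> \<beta>" using \<beta> by (simp add: power2_eq_square mult_left_le)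
        have "expectation (Y i) = \<eta> * expectation (\<lambda>w. s i w ^ 4 * Z i w ^ 4) + C * expectation (\<lambda>w. (\<Delta> i w - s i w * Z i w) ^ 4) + \<mu> * expectation (\<lambda>w. s i w ^ 4)
            + 3 * k\<^sup>2 * eps * (\<eta> * expectation (\<lambda>w. s i w ^ 4) + C * expectation (\<lambda>w. (S i w - s i w) ^ 4))"
          unfolding Y_def using e[OF i] sZ[OF i] by simp
        also have "\<dots> \<le> \<eta> * (C4 * (3 * wt\<^sup>2)) + C * (9 * (sqrt eps * (D * \<beta>))\<^sup>2) + \<mu> * C4 + 3 * k\<^sup>2 * eps * (\<eta> * C4 + C * (Cm * (sqrt (L * eps) + \<rho>))\<^sup>2)"
          using e[OF i] sZ[OF i] \<eta> C(1) \<mu> eps by (intro add_mono mult_left_mono) auto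
        also have "\<dots> \<le> \<eta> * (C4 * (3 * wt\<^sup>2)) + C * (9 * (eps * (D\<^sup>2 * \<beta>))) + \<mu> * C4 + 3 * k\<^sup>2 * eps * (\<eta> * C4 + C * (Cm\<^sup>2 * \<beta>))"
        proof (intro add_mono mult_left_mono order_refl)
          show "(sqrt eps * (D * \<beta>))\<^sup>2 \<le> eps * (D\<^sup>2 * \<beta>)"
            using eps b2 by (simp add: power_mult_distrib mult_left_mono)
          have "(sqrt (L * eps) + \<rho>)\<^sup>2 \<le> \<beta>\<^sup>2" using \<beta> Le \<rho> by (intro power_mono) auto
          then show "(Cm * (sqrt (L * eps) + \<rho>))\<^sup>2 \<le> Cm\<^sup>2 * \<beta>" using b2 by (simp add: power_mult_distrib mult_left_mono)
        qed (use C(1) C4(1) \<mu> \<eta> eps(1) in auto)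
        also have "\<dots> = eps * (\<eta> * (C4 * (3 * (3 * k + 4)\<^sup>2 + 3 * k\<^sup>2)) + (9 * C * D\<^sup>2 + 3 * (2 * k + 4) * (4 * k + 4) * C4 + 3 * k\<^sup>2 * C * Cm\<^sup>2) * \<beta>)"
          unfolding w2 \<mu>_def by (simp add: algebra_simps)
        finally show ?thesis .
      qed
      have sum_eq: "quartic_variation T1 T2 u n x w - 3 * k\<^sup>2 * Q n w = (\<Sum>i=1..n. \<Delta> i w ^ 4 - 3 * k\<^sup>2 * eps * S i w ^ 4)" for w
      proof -
        have "quartic_variation T1 T2 u n x w = (\<Sum>i=1..n. \<Delta> i w ^ 4)"
          unfolding quartic_variation_def by (intro sum.cong refl) (simp only: t_prev \<Delta>_def t_def)
        then show ?thesis
          by (simp add: Q_def S_def t_def \<theta>_def[symmetric] eps_def[symmetric] sum_subtractf sum_distrib_left mult_ac)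
      qed
      have pw: "\<bar>quartic_variation T1 T2 u n x w - 3 * k\<^sup>2 * Q n w\<bar> \<le> (\<Sum>i=1..n. Y i w) + \<bar>\<Sum>i=1..n. \<zeta> i w\<bar>" for w
      proof -
        have "\<bar>(\<Sum>i=1..n. \<Delta> i w ^ 4 - 3 * k\<^sup>2 * eps * S i w ^ 4) - (\<Sum>i=1..n. \<zeta> i w)\<bar> \<le> (\<Sum>i=1..n. Y i w)"
          unfolding sum_subtractf[symmetric]
        proof (rule order_trans[OF sum_abs sum_mono])
          fix i assume i: "i \<in> {1..n}"
          show "\<bar>\<Delta> i w ^ 4 - 3 * k\<^sup>2 * eps * S i w ^ 4 - \<zeta> i w\<bar> \<le> Y i w"
            unfolding \<zeta>_def Y_def using eps by (intro quartic_decomposition C(2) v(3)[OF i]) auto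
        qed
        then show ?thesis unfolding sum_eq by linarith
      qed
      have mV: "(\<lambda>w. quartic_variation T1 T2 u n x w - 3 * k\<^sup>2 * Q n w) \<in> borel_measurable M"
        unfolding sum_eq using m by (intro borel_measurable_sum) simp
      have iY: "integrable M (\<lambda>w. (\<Sum>i=1..n. Y i w) + \<bar>\<Sum>i=1..n. \<zeta> i w\<bar>)"
        by (rule Bochner_Integration.integrable_add[OF Bochner_Integration.integrable_sum[OF Yi] integrable_abs[OF fluct(1)]])
      have iV: "integrable M (\<lambda>w. quartic_variation T1 T2 u n x w - 3 * k\<^sup>2 * Q n w)"
        by (rule Bochner_Integration.integrable_bound[OF iY mV]) (use order_trans[OF pw abs_ge_self] in simp)
      have "expectation (\<lambda>w. \<bar>quartic_variation T1 T2 u n x w - 3 * k\<^sup>2 * Q n w\<bar>) \<le> expectation (\<lambda>w. (\<Sum>i=1..n. Y i w) + \<bar>\<Sum>i=1..n. \<zeta> i w\<bar>)"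
        using iV by (intro integral_mono iY pw) auto
      also have "\<dots> = (\<Sum>i=1..n. expectation (Y i)) + expectation (\<lambda>w. \<bar>\<Sum>i=1..n. \<zeta> i w\<bar>)"
        by (simp only: Bochner_Integration.integral_add[OF Bochner_Integration.integrable_sum[OF Yi] integrable_abs[OF fluct(1)]] Bochner_Integration.integral_sum[OF Yi])
      also have "\<dots> \<le> real n * (eps * (\<eta> * (C4 * (3 * (3 * k + 4)\<^sup>2 + 3 * k\<^sup>2)) + (9 * C * D\<^sup>2 + 3 * (2 * k + 4) * (4 * k + 4) * C4 + 3 * k\<^sup>2 * C * Cm\<^sup>2) * \<beta>))
          + sqrt (real n * (2 * real l * (96 * C8 * wt ^ 4)))"
        using sum_bounded_above[of "{1..n}" "\<lambda>i. expectation (Y i)", OF Yb] by (intro add_mono fluct(2)) simp_all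
      also have "real n * (eps * (\<eta> * (C4 * (3 * (3 * k + 4)\<^sup>2 + 3 * k\<^sup>2)) + (9 * C * D\<^sup>2 + 3 * (2 * k + 4) * (4 * k + 4) * C4 + 3 * k\<^sup>2 * C * Cm\<^sup>2) * \<beta>)) = \<eta> * A + B1 * \<beta>"
        unfolding A_def B1_def eps(2)[symmetric] by (simp only: distrib_left mult_ac)
      also have "sqrt (real n * (2 * real l * (96 * C8 * wt ^ 4))) \<le> B2 * \<beta>"
      proof -
        have "wt ^ 4 = (3 * k + 4) ^ 4 * eps\<^sup>2"
          using eps by (simp add: wt_def power_mult_distrib real_sqrt_power_even)
        then have "real n * (2 * real l * (96 * C8 * wt ^ 4)) = (192 * C8 * (3 * k + 4) ^ 4 * (real n * eps) * eps) * real l"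
          by (simp add: power2_eq_square)
        also have "\<dots> \<le> (192 * C8 * (3 * k + 4) ^ 4 * (real n * eps) * eps) * (2 * L)"
          using l(2) C8(1) k eps by (intro mult_left_mono) auto
        also have "\<dots> = (384 * C8 * \<theta> * (3 * k + 4) ^ 4) * (L * eps)" unfolding eps(2) by simp
        finally have "sqrt (real n * (2 * real l * (96 * C8 * wt ^ 4))) \<le> B2 * sqrt (L * eps)"
          unfolding B2_def real_sqrt_mult[symmetric] by (rule real_sqrt_le_mono)
        also have "\<dots> \<le> B2 * \<beta>" using B \<beta>(2) \<rho> by (intro mult_left_mono) auto
        finally show ?thesis .
      qed
      finally show ?thesis using iV unfolding \<beta>_def eps_def by (simp add: algebra_simps)
    qed
    then show ?thesis using B by (intro exI[of _ "B1 + B2"]) auto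
  qed
  then show ?thesis using A unfolding k_def[symmetric] \<theta>_def[symmetric] by (intro exI[of _ A]) blast
qed

lemma quartic_variation_in_probability:
  assumes T: "0 < T1" "T1 < T2" and x: "x \<noteq> 0"
  shows "converges_in_probability M (\<lambda>n w. quartic_variation T1 T2 u n x w -
    3 * (\<kappa>0 x)\<^sup>2 * ((T2 - T1) / real n * (\<Sum>i=1..n. \<sigma> (u (grid_point T1 T2 n i) x w) ^ 4))) 0"
proof (rule L1_imp_in_probability)
  fix r :: real assume r: "0 < r"
  define \<theta> where "\<theta> = T2 - T1"
  have \<theta>: "0 < \<theta>" using T by (simp add: \<theta>_def)
  let ?X = "\<lambda>n w. quartic_variation T1 T2 u n x w - 3 * (\<kappa>0 x)\<^sup>2 * (\<theta> / real n * (\<Sum>i=1..n. \<sigma> (u (grid_point T1 T2 n i) x w) ^ 4))"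
  let ?\<beta> = "\<lambda>n. lag_error (real n powr (1 / 4)) (\<theta> / real n) (1 / real n) (real n powr (- 1 / 8))"
  obtain A where A: "0 \<le> A" and ex: "\<And>\<eta>. 0 < \<eta> \<Longrightarrow> \<exists>B\<ge>0. \<forall>n L \<delta> \<rho>. 1 \<le> n \<longrightarrow> 1 \<le> L \<longrightarrow> L * (\<theta> / real n) \<le> T1 \<longrightarrow> 0 < \<delta> \<longrightarrow> 0 < \<rho> \<longrightarrow>
     lag_error L (\<theta> / real n) \<delta> \<rho> \<le> 1 \<longrightarrow> integrable M (?X n) \<and> expectation (\<lambda>w. \<bar>?X n w\<bar>) \<le> \<eta> * A + B * lag_error L (\<theta> / real n) \<delta> \<rho>"
    using quartic_variation_error[OF T x] unfolding \<theta>_def by blast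
  \<comment> \<open>Half of \<open>r\<close> is spent on the relative error, the other half on the
    lag error once \<open>n\<close> is large; the \<open>+ 1\<close> covers
    \<open>A = 0\<close>.\<close>
  define \<eta> where "\<eta> = r / (2 * (A + 1))"
  have \<eta>: "0 < \<eta>" "\<eta> * A \<le> r / 2" using r A by (auto simp: \<eta>_def field_simps)
  obtain B where B: "0 \<le> B" "\<And>n L \<delta> \<rho>. 1 \<le> n \<Longrightarrow> 1 \<le> L \<Longrightarrow> L * (\<theta> / real n) \<le> T1 \<Longrightarrow> 0 < \<delta> \<Longrightarrow> 0 < \<rho> \<Longrightarrow>
     lag_error L (\<theta> / real n) \<delta> \<rho> \<le> 1 \<Longrightarrow> integrable M (?X n) \<and> expectation (\<lambda>w. \<bar>?X n w\<bar>) \<le> \<eta> * A + B * lag_error L (\<theta> / real n) \<delta> \<rho>"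
    using ex[OF \<eta>(1)] by blast
  have "\<forall>\<^sub>F n in sequentially. ?\<beta> n < min 1 (r / (2 * (B + 1)))"
    using r B(1) by (intro order_tendstoD(2)[OF lag_error_tendsto[OF \<theta>]]) auto
  moreover have "\<forall>\<^sub>F n in sequentially. real n powr (1 / 4) * (\<theta> / real n) < T1"
    by (rule order_tendstoD(2)[where y=0]) (use T \<theta> in \<open>real_asymp | simp\<close>)+
  moreover have "\<forall>\<^sub>F n in sequentially. 1 \<le> (n::nat)" by (rule eventually_ge_at_top)
  ultimately show "\<forall>\<^sub>F n in sequentially. integrable M (\<lambda>w. quartic_variation T1 T2 u n x w -
      3 * (\<kappa>0 x)\<^sup>2 * ((T2 - T1) / real n * (\<Sum>i=1..n. \<sigma> (u (grid_point T1 T2 n i) x w) ^ 4))) \<and>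
    expectation (\<lambda>w. \<bar>quartic_variation T1 T2 u n x w -
      3 * (\<kappa>0 x)\<^sup>2 * ((T2 - T1) / real n * (\<Sum>i=1..n. \<sigma> (u (grid_point T1 T2 n i) x w) ^ 4))\<bar>) \<le> r"
    unfolding \<theta>_def[symmetric]
  proof eventually_elim
    case (elim n)
    have b: "integrable M (?X n) \<and> expectation (\<lambda>w. \<bar>?X n w\<bar>) \<le> \<eta> * A + B * ?\<beta> n"
      using elim by (intro B(2)) (auto intro: ge_one_powr_ge_zero)
    have "B * ?\<beta> n \<le> B * (r / (2 * (B + 1)))" using elim B(1) by (intro mult_left_mono) auto
    also have "\<dots> \<le> r / 2" using B(1) r by (simp add: field_simps)
    finally have "\<eta> * A + B * ?\<beta> n \<le> r" using \<eta>(2) by linarith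
    then show ?case using b by auto
  qed
qed

end

section \<open>Riemann sums of the fourth power of the coefficient\<close>

lemma ennreal_abs_diff_le:
  assumes "ennreal a \<le> ennreal b + e" "ennreal b \<le> ennreal a + e" "0 \<le> a" "0 \<le> b"
  shows "ennreal \<bar>a - b\<bar> \<le> e"
proof (cases e)
  case (real r)
  then have "a \<le> b + r" "b \<le> a + r" using assms by (simp_all flip: ennreal_plus)
  then show ?thesis using real by (auto intro!: ennreal_leI)
qed auto

lemma nn_integral_grid:
  fixes f :: "real \<Rightarrow> ennreal"
  assumes [measurable]: "f \<in> borel_measurable borel" and eps: "0 \<le> eps"
  shows "(\<integral>\<^sup>+r\<in>{T..T + real n * eps}. f r \<partial>lborel) = (\<Sum>i=1..n. \<integral>\<^sup>+r\<in>{T + real (i - 1) * eps<..T + real i * eps}. f r \<partial>lborel)"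
proof -
  have i: "(indicator {T<..T + real n * eps} r :: ennreal) = (\<Sum>i=1..n. indicator {T + real (i - 1) * eps<..T + real i * eps} r)" for r n
  proof (induction n)
    case (Suc n)
    have "T + real n * eps \<le> T + real (Suc n) * eps" "T \<le> T + real n * eps" using eps by (auto intro: mult_right_mono)
    then have "(indicator {T<..T + real (Suc n) * eps} r :: ennreal) = indicator {T<..T + real n * eps} r + indicator {T + real n * eps<..T + real (Suc n) * eps} r"
      by (auto simp: indicator_def)
    then show ?case using Suc by simp
  qed simp
  have "AE r in lborel. r \<noteq> T" by (rule AE_lborel_singleton)
  then have "(\<integral>\<^sup>+r\<in>{T..T + real n * eps}. f r \<partial>lborel) = (\<integral>\<^sup>+r\<in>{T<..T + real n * eps}. f r \<partial>lborel)"
    by (intro nn_integral_cong_AE) (auto simp: indicator_def)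
  then show ?thesis unfolding i sum_distrib_left by (subst (asm) nn_integral_sum) auto
qed

context stochastic_heat
begin

text \<open>The field is jointly measurable only over nonnegative times; \<open>max 0 r\<close>
  extends its path to the whole line, as Fubini with \<open>lborel\<close> requires, without
  changing it at the times that occur.\<close>

lemma \<sigma>_path_measurable:
  "(\<lambda>(r, w). \<sigma> (u (max 0 r) x w)) \<in> borel_measurable (lborel \<Otimes>\<^sub>M M)"
proof -
  have "(\<lambda>(r, w). (max 0 r, x, w)) \<in> measurable (lborel \<Otimes>\<^sub>M M) (field_measure M)"
    unfolding field_measure_def case_prod_beta'
    by (intro measurable_Pair measurable_restrict_space2) (auto intro: measurable_compose[OF measurable_fst])
  from measurable_compose[OF measurable_compose[OF this u_field_measurable] \<sigma>_measurable]
  show ?thesis by (simp add: case_prod_beta')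
qed

text \<open>No path continuity is used. The fourth moment modulus compares the values in a grid cell
  with the value at its right endpoint on average, and Fubini sums these errors to a bound in
  \<open>L\<^sup>1\<close>.\<close>

lemma quartic_riemann_sum_in_probability:
  fixes T1 T2 x :: real
  assumes T: "0 < T1" "T1 < T2"
  defines "R w \<equiv> \<integral>\<^sup>+r\<in>{T1..T2}. ennreal (\<sigma> (u r x w) ^ 4) \<partial>lborel"
  shows "R \<in> borel_measurable M" and "AE w in M. R w < \<infinity>"
    and "converges_in_probability M (\<lambda>n w. (T2 - T1) / real n * (\<Sum>i=1..n. \<sigma> (u (grid_point T1 T2 n i) x w) ^ 4) - enn2real (R w)) 0" (is "?S1")
proof -
  define \<theta> where "\<theta> = T2 - T1"
  have \<theta>: "0 < \<theta>" and T2: "0 < T2" using T by (auto simp: \<theta>_def)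
  obtain C4 where C4: "0 \<le> C4" "\<And>t x. 0 \<le> t \<Longrightarrow> t \<le> T2 \<Longrightarrow> nnE (\<lambda>w. \<sigma> (u t x w) ^ 4) \<le> ennreal C4"
    using \<sigma>_moment[OF T2, of 4] by auto
  obtain Cm where Cm: "0 \<le> Cm" "\<And>\<tau> t x x' \<rho>. 0 \<le> \<tau> \<Longrightarrow> \<tau> \<le> t \<Longrightarrow> t \<le> T2 \<Longrightarrow> 0 < \<rho> \<Longrightarrow>
    nnE (\<lambda>w. (\<sigma> (u t x' w) - \<sigma> (u \<tau> x w)) ^ 4) \<le> ennreal ((Cm * (sqrt (t - \<tau>) + \<rho> + (x' - x)\<^sup>2 / \<rho>\<^sup>2))\<^sup>2)"
    using \<sigma>_modulus[OF T2] by auto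
  define g where "g r w = \<sigma> (u (max 0 r) x w)" for r w
  have gm[measurable]: "(\<lambda>(r, w). g r w) \<in> borel_measurable (lborel \<Otimes>\<^sub>M M)"
    unfolding g_def by (rule \<sigma>_path_measurable)
  have g1[measurable]: "(\<lambda>r. g r w) \<in> borel_measurable borel" if "w \<in> space M" for w
    using measurable_compose[OF measurable_Pair2'[OF that] gm] by simp
  have g2[measurable]: "g r \<in> borel_measurable M" for r
    unfolding g_def[abs_def] using u_measurable[of "max 0 r" x] by simp
  have gR: "R w = (\<integral>\<^sup>+r\<in>{T1..T2}. ennreal (g r w ^ 4) \<partial>lborel)" for w
    unfolding R_def using T by (intro nn_integral_cong) (auto simp: g_def indicator_def)
  have g4: "nnE (\<lambda>w. g r w ^ 4) \<le> ennreal C4" if "r \<le> T2" for r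
    unfolding g_def using C4(2)[of "max 0 r" x] that T2 by simp
  interpret P: pair_sigma_finite lborel M ..
  show Rm: "R \<in> borel_measurable M"
    unfolding gR[abs_def] by measurable
  have fub: "(\<integral>\<^sup>+w. (\<integral>\<^sup>+r\<in>I. F r w \<partial>lborel) \<partial>M) \<le> ennreal c * emeasure lborel I"
    if [measurable]: "(\<lambda>(r, w). F r w) \<in> borel_measurable (lborel \<Otimes>\<^sub>M M)" "I \<in> sets borel"
      and b: "\<And>r. r \<in> I \<Longrightarrow> (\<integral>\<^sup>+w. F r w \<partial>M) \<le> ennreal c" for F I c
  proof -
    have "(\<integral>\<^sup>+w. (\<integral>\<^sup>+r\<in>I. F r w \<partial>lborel) \<partial>M) = (\<integral>\<^sup>+r. (\<integral>\<^sup>+w. F r w * indicator I r \<partial>M) \<partial>lborel)"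
      by (rule P.Fubini') measurable
    also have "\<dots> \<le> (\<integral>\<^sup>+r. ennreal c * indicator I r \<partial>lborel)"
      using b by (intro nn_integral_mono) (auto simp: indicator_def)
    also have "\<dots> = ennreal c * emeasure lborel I" by (simp add: nn_integral_cmult)
    finally show ?thesis .
  qed
  have "(\<integral>\<^sup>+w. R w \<partial>M) \<le> ennreal C4 * emeasure lborel {T1..T2}"
    unfolding gR by (rule fub) (use g4 in auto)
  also have "\<dots> < \<infinity>" using T by (simp add: ennreal_mult_less_top)
  finally show Rf: "AE w in M. R w < \<infinity>"
    using nn_integral_PInf_AE[OF Rm] by (auto simp: less_top)
  define Q where "Q n w = \<theta> / real n * (\<Sum>i=1..n. g (grid_point T1 T2 n i) w ^ 4)" for n w
  have tpos: "0 \<le> grid_point T1 T2 n i" for n i using T by (simp add: grid_point_def)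
  have Qeq: "(T2 - T1) / real n * (\<Sum>i=1..n. \<sigma> (u (grid_point T1 T2 n i) x w) ^ 4) = Q n w" for n w
    using tpos by (simp add: Q_def g_def \<theta>_def max_absorb2)
  have Qm[measurable]: "Q n \<in> borel_measurable M" for n unfolding Q_def[abs_def] by measurable
  have bound: "integrable M (\<lambda>w. Q n w - enn2real (R w)) \<and> expectation (\<lambda>w. \<bar>Q n w - enn2real (R w)\<bar>) \<le> \<theta> * (\<eta> * C4 + C * (4 * Cm\<^sup>2 * (\<theta> / real n)))"
    if n: "1 \<le> n" and \<eta>: "0 < \<eta>" and C: "0 \<le> C" "\<And>a b. \<bar>b ^ 4 - a ^ 4\<bar> \<le> \<eta> * a ^ 4 + C * (b - a) ^ 4" for n \<eta> C
  proof -
    define eps where "eps = \<theta> / real n"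
    have eps: "0 < eps" "real n * eps = \<theta>" using \<theta> n by (auto simp: eps_def)
    define t where "t i = T1 + real i * eps" for i
    define I where "I i = {T1 + real (i - 1) * eps<..T1 + real i * eps}" for i
    have t: "grid_point T1 T2 n i = t i" for i by (simp add: t_def grid_point_def eps_def \<theta>_def)
    have tT: "T1 + real n * eps = T2" by (simp add: eps(2) \<theta>_def)
    have lI: "emeasure lborel (I i) = ennreal eps" if "i \<in> {1..n}" for i
    proof -
      have "T1 + real i * eps - (T1 + real (i - 1) * eps) = eps" using that by (simp add: of_nat_diff algebra_simps)
      then show ?thesis using eps unfolding I_def by (subst emeasure_lborel_Ioc) (auto simp: mult_right_mono)
    qed
    \<comment> \<open>\<open>E\<close> dominates the distance of Riemann sum and integral almost
      surely, namely where the integral is finite, and its mean is controlled cell by cell.\<close>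
    define E where "E w = (\<Sum>i=1..n. \<integral>\<^sup>+r\<in>I i. ennreal \<bar>g (t i) w ^ 4 - g r w ^ 4\<bar> \<partial>lborel)" for w
    define c where "c = \<eta> * C4 + C * (4 * Cm\<^sup>2 * eps)"
    have c: "0 \<le> c" using \<eta> C C4 eps by (simp add: c_def)
    have Ig: "(\<integral>\<^sup>+w. ennreal \<bar>g (t i) w ^ 4 - g r w ^ 4\<bar> \<partial>M) \<le> ennreal c" if i: "i \<in> {1..n}" and r: "r \<in> I i" for i r
    proof -
      have "real i * eps \<le> real n * eps" "0 \<le> real (i - 1) * eps" "t i - eps = T1 + real (i - 1) * eps"
        using i eps by (auto simp: t_def of_nat_diff algebra_simps intro: mult_left_mono)
      moreover have "T1 + real (i - 1) * eps < r" "r \<le> t i" using r by (auto simp: I_def t_def)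
      ultimately have b: "0 \<le> r" "r \<le> t i" "t i \<le> T2" "t i - r \<le> eps" "0 \<le> t i" using T tT unfolding t_def by linarith+
      \<comment> \<open>Both values are taken at the same position, so the spatial term of the
        modulus is zero and \<open>\<rho> = sqrt eps\<close> matches the order of the time
        term.\<close>
      have "nnE (\<lambda>w. (g (t i) w - g r w) ^ 4) \<le> ennreal ((Cm * (sqrt (t i - r) + sqrt eps + (x - x)\<^sup>2 / (sqrt eps)\<^sup>2))\<^sup>2)"
        using Cm(2)[OF b(1-3), of "sqrt eps" x x] eps(1) b(1,5) by (simp add: g_def max_absorb2)
      also have "\<dots> \<le> ennreal ((Cm * (2 * sqrt eps))\<^sup>2)"
        using b Cm(1) eps(1) by (intro ennreal_leI power_mono mult_left_mono mult_nonneg_nonneg) auto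
      also have "(Cm * (2 * sqrt eps))\<^sup>2 = 4 * Cm\<^sup>2 * eps" unfolding power_mult_distrib using eps(1) by simp
      finally have d: "nnE (\<lambda>w. (g (t i) w - g r w) ^ 4) \<le> ennreal (4 * Cm\<^sup>2 * eps)" .
      have "(\<integral>\<^sup>+w. ennreal \<bar>g (t i) w ^ 4 - g r w ^ 4\<bar> \<partial>M) \<le> (\<integral>\<^sup>+w. ennreal \<eta> * ennreal (g r w ^ 4) + ennreal C * ennreal ((g (t i) w - g r w) ^ 4) \<partial>M)"
        using C \<eta> by (intro nn_integral_mono) (subst ennreal_linear, auto intro!: ennreal_leI simp del: ennreal_plus)
      also have "\<dots> = ennreal \<eta> * nnE (\<lambda>w. g r w ^ 4) + ennreal C * nnE (\<lambda>w. (g (t i) w - g r w) ^ 4)"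
        by (simp add: nn_integral_add nn_integral_cmult)
      also have "\<dots> \<le> ennreal \<eta> * ennreal C4 + ennreal C * ennreal (4 * Cm\<^sup>2 * eps)"
        using b by (intro add_mono mult_left_mono d g4) auto
      also have "\<dots> = ennreal c" unfolding c_def using \<eta> C C4 eps by (intro ennreal_linear) auto
      finally show ?thesis .
    qed
    have Em: "(\<lambda>(r, w). ennreal \<bar>g (t i) w ^ 4 - g r w ^ 4\<bar>) \<in> borel_measurable (lborel \<Otimes>\<^sub>M M)" for i by measurable
    have Ep: "(\<lambda>w. \<integral>\<^sup>+r\<in>I i. ennreal \<bar>g (t i) w ^ 4 - g r w ^ 4\<bar> \<partial>lborel) \<in> borel_measurable M" for i
      unfolding I_def by measurable
    have "(\<integral>\<^sup>+w. E w \<partial>M) = (\<Sum>i=1..n. \<integral>\<^sup>+w. (\<integral>\<^sup>+r\<in>I i. ennreal \<bar>g (t i) w ^ 4 - g r w ^ 4\<bar> \<partial>lborel) \<partial>M)"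
      unfolding E_def by (rule nn_integral_sum[OF Ep])
    also have "\<dots> \<le> (\<Sum>i=1..n. ennreal c * ennreal eps)"
    proof (rule sum_mono)
      fix i assume i: "i \<in> {1..n}"
      show "(\<integral>\<^sup>+w. (\<integral>\<^sup>+r\<in>I i. ennreal \<bar>g (t i) w ^ 4 - g r w ^ 4\<bar> \<partial>lborel) \<partial>M) \<le> ennreal c * ennreal eps"
        using fub[OF Em _ Ig[OF i], of "I i"] unfolding lI[OF i] by (simp add: I_def)
    qed
    also have "\<dots> = ennreal (\<theta> * c)"
      using c eps(1) by (simp add: eps(2)[symmetric] ennreal_mult ennreal_of_nat_eq_real_of_nat mult_ac)
    finally have EE: "(\<integral>\<^sup>+w. E w \<partial>M) \<le> ennreal (\<theta> * c)" .
    have pw: "AE w in M. ennreal \<bar>Q n w - enn2real (R w)\<bar> \<le> E w"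
      using Rf AE_space
    proof eventually_elim
      case (elim w)
      note [measurable] = g1[OF elim(2)]
      have R: "ennreal (enn2real (R w)) = (\<Sum>i=1..n. \<integral>\<^sup>+r\<in>I i. ennreal (g r w ^ 4) \<partial>lborel)"
        using elim(1) nn_integral_grid[of "\<lambda>r. ennreal (g r w ^ 4)" eps T1 n] eps unfolding gR I_def tT by simp
      have Q: "ennreal (Q n w) = (\<Sum>i=1..n. \<integral>\<^sup>+r\<in>I i. ennreal (g (t i) w ^ 4) \<partial>lborel)"
      proof -
        have "(\<integral>\<^sup>+r\<in>I i. ennreal (g (t i) w ^ 4) \<partial>lborel) = ennreal (eps * g (t i) w ^ 4)" if "i \<in> {1..n}" for i
          using lI[OF that] eps by (subst nn_integral_cmult_indicator) (auto simp: I_def ennreal_mult mult.commute)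
        then have "(\<Sum>i=1..n. \<integral>\<^sup>+r\<in>I i. ennreal (g (t i) w ^ 4) \<partial>lborel) = (\<Sum>i=1..n. ennreal (eps * g (t i) w ^ 4))" by simp
        also have "\<dots> = ennreal (\<Sum>i=1..n. eps * g (t i) w ^ 4)" using eps by (intro sum_ennreal) auto
        finally show ?thesis by (simp add: Q_def t eps_def sum_distrib_left)
      qed
      have le: "(\<integral>\<^sup>+r\<in>I i. ennreal (f r) \<partial>lborel) \<le> (\<integral>\<^sup>+r\<in>I i. ennreal (h r) \<partial>lborel) + (\<integral>\<^sup>+r\<in>I i. ennreal \<bar>g (t i) w ^ 4 - g r w ^ 4\<bar> \<partial>lborel)"
        if [measurable]: "f \<in> borel_measurable borel" "h \<in> borel_measurable borel"
          and f: "\<And>r. f r \<le> h r + \<bar>g (t i) w ^ 4 - g r w ^ 4\<bar>" and h: "\<And>r. 0 \<le> h r" for f h :: "real \<Rightarrow> real" and i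
      proof -
        have "(\<integral>\<^sup>+r\<in>I i. ennreal (f r) \<partial>lborel) \<le> (\<integral>\<^sup>+r. ennreal (h r) * indicator (I i) r + ennreal \<bar>g (t i) w ^ 4 - g r w ^ 4\<bar> * indicator (I i) r \<partial>lborel)"
          using f h by (intro nn_integral_mono) (auto simp: indicator_def ennreal_plus[symmetric] intro!: ennreal_leI simp del: ennreal_plus)
        then show ?thesis by (subst (asm) nn_integral_add) (auto simp: I_def)
      qed
      show ?case
      proof (rule ennreal_abs_diff_le)
        show "ennreal (Q n w) \<le> ennreal (enn2real (R w)) + E w"
          unfolding Q R E_def sum.distrib[symmetric] by (intro sum_mono le) auto
        show "ennreal (enn2real (R w)) \<le> ennreal (Q n w) + E w"
          unfolding Q R E_def sum.distrib[symmetric] by (intro sum_mono le) auto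
        show "0 \<le> Q n w" unfolding Q_def using \<theta> by (intro mult_nonneg_nonneg sum_nonneg) auto
      qed simp
    qed
    have nb: "(\<integral>\<^sup>+w. ennreal \<bar>Q n w - enn2real (R w)\<bar> \<partial>M) \<le> ennreal (\<theta> * c)"
      using nn_integral_mono_AE[OF pw] EE by (rule order_trans)
    note [measurable] = Rm
    have "integrable M (\<lambda>w. \<bar>Q n w - enn2real (R w)\<bar>)" "expectation (\<lambda>w. \<bar>Q n w - enn2real (R w)\<bar>) \<le> \<theta> * c"
      using nn_integral_imp_expectation[OF _ _ nb] \<theta> c by auto
    then show ?thesis unfolding c_def eps_def by (simp add: integrable_abs_iff)
  qed
  show ?S1
    unfolding Qeq
  proof (rule L1_imp_in_probability)
    fix r :: real assume r: "0 < r"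
    \<comment> \<open>Again the relative error takes half of \<open>r\<close>, before
      \<open>n\<close> is chosen according to the constant \<open>C\<close> that belongs to
      \<eta>.\<close>
    define \<eta> where "\<eta> = r / (2 * (\<theta> * C4 + 1))"
    have tC: "0 \<le> \<theta> * C4" using \<theta> C4 by simp
    have \<eta>: "0 < \<eta>" "\<theta> * (\<eta> * C4) \<le> r / 2" using r tC by (auto simp: \<eta>_def field_simps)
    obtain C where C: "0 \<le> C" "\<And>a b. \<bar>b ^ 4 - a ^ 4\<bar> \<le> \<eta> * a ^ 4 + C * (b - a) ^ 4"
      using fourth_power_diff[OF \<eta>(1)] by blast
    have "(\<lambda>n. \<theta> * (C * (4 * Cm\<^sup>2 * (\<theta> / real n)))) \<longlonglongrightarrow> \<theta> * (C * (4 * Cm\<^sup>2 * 0))"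
      by (intro tendsto_intros lim_const_over_n)
    then have "\<forall>\<^sub>F n in sequentially. \<theta> * (C * (4 * Cm\<^sup>2 * (\<theta> / real n))) < r / 2"
      using r by (intro order_tendstoD(2)) auto
    moreover have "\<forall>\<^sub>F n in sequentially. 1 \<le> (n::nat)" by (rule eventually_ge_at_top)
    ultimately show "\<forall>\<^sub>F n in sequentially. integrable M (\<lambda>w. Q n w - enn2real (R w)) \<and> expectation (\<lambda>w. \<bar>Q n w - enn2real (R w)\<bar>) \<le> r"
    proof eventually_elim
      case (elim n)
      have "\<theta> * (\<eta> * C4 + C * (4 * Cm\<^sup>2 * (\<theta> / real n))) \<le> r" using elim(1) \<eta>(2) by (simp only: distrib_left)
      then show ?case using bound[OF elim(2) \<eta>(1) C] by linarith
    qed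
  qed
qed

text \<open>The quartic variation is asymptotically \<open>c * Q\<close> with
  \<open>c = 3 * (\<kappa>0 x)\<^sup>2\<close>, and the estimator is \<open>6 / pi\<close> times
  \<open>Q\<close> over the quartic variation, so its limit is \<open>6 / pi / c\<close>. Positivity
  of the integral has probability 1 by hypothesis; with its almost sure finiteness this gives a
  positive real limit.\<close>

lemma estimator_consistent:
  assumes T: "0 < T1" "T1 < T2" and x: "x \<noteq> 0"
    and pos: "measure M {w \<in> space M. (\<integral>\<^sup>+r\<in>{T1..T2}. ennreal (\<sigma> (u r x w) ^ 4) \<partial>lborel) > 0} = 1"
  shows "converges_in_probability M (\<lambda>n. A_estimator \<sigma> T1 T2 u n x) (coeff_A a1 a2 x)"
proof -
  define R where "R w = (\<integral>\<^sup>+r\<in>{T1..T2}. ennreal (\<sigma> (u r x w) ^ 4) \<partial>lborel)" for w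
  note Rs = quartic_riemann_sum_in_probability[OF T, of x, folded R_def]
  note [measurable] = Rs(1)
  define Q where "Q n w = (T2 - T1) / real n * (\<Sum>i=1..n. \<sigma> (u (grid_point T1 T2 n i) x w) ^ 4)" for n w
  have g: "0 \<le> grid_point T1 T2 n i" for n i using T by (simp add: grid_point_def)
  note um[measurable] = u_measurable[OF g]
  have "AE w in M. 0 < R w"
    using pos unfolding R_def[symmetric] by (subst (asm) prob_Collect_eq_1) auto
  then have Rpos: "AE w in M. 0 < enn2real (R w)"
    using Rs(2) by eventually_elim (simp add: enn2real_positive_iff)
  have \<kappa>: "3 * (\<kappa>0 x)\<^sup>2 = 6 / (pi * coeff_A a1 a2 x)"
    using coeff_A(1)[of x] by (simp add: \<kappa>0_def power_divide power_mult_distrib)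
  have "converges_in_probability M (\<lambda>n w. if 0 < quartic_variation T1 T2 u n x w then 6 / pi * Q n w / quartic_variation T1 T2 u n x w else 0) (6 / pi / (6 / (pi * coeff_A a1 a2 x)))"
  proof (rule ratio_in_probability[OF _ _ _ Rpos])
    show "quartic_variation T1 T2 u n x \<in> borel_measurable M" for n
      unfolding quartic_variation_def[abs_def] by measurable
    show "Q n \<in> borel_measurable M" for n unfolding Q_def[abs_def] by measurable
    show "0 < 6 / (pi * coeff_A a1 a2 x)" using coeff_A(1)[of x] by simp
    show "converges_in_probability M (\<lambda>n w. quartic_variation T1 T2 u n x w - 6 / (pi * coeff_A a1 a2 x) * Q n w) 0"
      using quartic_variation_in_probability[OF T x] unfolding \<kappa> Q_def .
    show "converges_in_probability M (\<lambda>n w. Q n w - enn2real (R w)) 0"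
      using Rs(3) unfolding Q_def .
  qed auto
  moreover have "6 / pi / (6 / (pi * coeff_A a1 a2 x)) = coeff_A a1 a2 x" by simp
  moreover have "A_estimator \<sigma> T1 T2 u n x = (\<lambda>w. if 0 < quartic_variation T1 T2 u n x w then 6 / pi * Q n w / quartic_variation T1 T2 u n x w else 0)" for n
    by (rule ext) (simp only: A_estimator_def Q_def times_divide_times_eq times_divide_eq_left times_divide_eq_right divide_divide_eq_left mult_ac)
  ultimately show ?thesis by (simp only:)
qed

end

theorem mainTheorem3:
  fixes M :: "'a measure"
    and W :: "real \<Rightarrow> real set \<Rightarrow> 'a \<Rightarrow> real"
    and a1 a2 \<rho>1 \<rho>2 K T1 T2 x :: real
    and \<sigma> :: "real \<Rightarrow> real"
    and u :: "real \<Rightarrow> real \<Rightarrow> 'a \<Rightarrow> real"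
  assumes "prob_space M"
    and "space_time_white_noise M W"
    and "a1 > 0" and "a2 > 0" and "\<rho>1 > 0" and "\<rho>2 > 0"
    and "K > 0" and "\<And>y z. \<bar>\<sigma> y - \<sigma> z\<bar> \<le> K * \<bar>y - z\<bar>"
    and "mild_solution M W a1 a2 \<rho>1 \<rho>2 \<sigma> u"
    and "0 < T1" and "T1 < T2" and "x \<noteq> 0"
    and "measure M {\<omega> \<in> space M.
           (\<integral>\<^sup>+ r\<in>{T1..T2}. ennreal (\<sigma> (u r x \<omega>) ^ 4) \<partial>lborel) > 0} = 1"
  shows "converges_in_probability M (\<lambda>n. A_estimator \<sigma> T1 T2 u n x) (coeff_A a1 a2 x) \<and>
    (x < 0 \<longrightarrow> converges_in_probability M (\<lambda>n. A_estimator \<sigma> T1 T2 u n x) a1) \<and>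
    (x > 0 \<longrightarrow> converges_in_probability M (\<lambda>n. A_estimator \<sigma> T1 T2 u n x) a2)"
proof -
  interpret prob_space M by fact
  interpret stochastic_heat M W a1 a2 \<rho>1 \<rho>2 K \<sigma> u
    by unfold_locales (use assms in auto)
  have "converges_in_probability M (\<lambda>n. A_estimator \<sigma> T1 T2 u n x) (coeff_A a1 a2 x)"
    using estimator_consistent assms by blast
  then show ?thesis by (auto simp: coeff_A_def split: if_splits)
qed

end
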